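(* For $\eta\in(0,+\infty)$ let $F_{\rm SU}(x)=\mathrm{Pf}\big(J-K^{\rm SU}\big)_{\mathbb{L}^2(x,\infty)}$ be the cumulative distribution function of the largest eigenvalue of the symplectic-unitary transition ensemble with parameter $\eta$, where $K^{\rm SU}(x,y)$ is the matrix kernel depending on $\eta$ defined in the context. Then for all $x\in\mathbb{R}$, $$F_{\rm SU}(x)\xrightarrow[\eta\to0]{}F_{\rm GSE}(x)\qquad\text{and}\qquad F_{\rm SU}(x)\xrightarrow[\eta\to+\infty]{}F_{\rm GUE}(x).$$
   Context: Contours: $\mathcal{C}_a^\varphi$ is the union of the two rays departing from $a$ with angles $\pm\varphi$, oriented from $a+\infty e^{-i\varphi}$ to $a+\infty e^{i\varphi}$; $\mathbf{d}z:=\frac{1}{2\pi i}\mathrm{d}z$. Fredholm Pfaffian: $\mathrm{Pf}(J-K)_{\mathbb{L}^2(x,\infty)}=1+\sum_{k\geq1}\frac{(-1)^k}{k!}\int_{(x,\infty)^k}\mathrm{Pf}(K(x_i,x_j))_{i,j=1}^k\mathrm{d}x_1\cdots\mathrm{d}x_k$ (matrix made of $k^2$ blocks of size $2\times2$). Kernel (one-point case): $K^{\rm SU}_{21}(x,y)=-K^{\rm SU}_{12}(y,x)$ and $$K^{\rm SU}_{11}(x,y)=\int_{\mathcal{C}_1^{\pi/3}}\mathbf{d}z\int_{\mathcal{C}_1^{\pi/3}}\mathbf{d}w\frac{(z-w)\,e^{z^3/3+w^3/3-xz-yw}}{4(z+\eta)(w+\eta)(z+w+2\eta)},$$ $$K^{\rm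 SU}_{12}(x,y)=\int_{\mathcal{C}_{a_z}^{\pi/3}}\mathbf{d}z\int_{\mathcal{C}_{a_w}^{\pi/3}}\mathbf{d}w\frac{(z-w+2\eta)\,e^{z^3/3+w^3/3-xz-yw}}{2(z+\eta)(z+w)},\quad a_z>-\eta,\ a_z+a_w>0,$$ $$K^{\rm SU}_{22}(x,y)=\int_{\mathcal{C}_{b_z}^{\pi/3}}\mathbf{d}z\int_{\mathcal{C}_{b_w}^{\pi/3}}\mathbf{d}w\frac{z-w}{z+w-2\eta}e^{z^3/3+w^3/3-xz-yw}+R^{\rm SU}_{22}(x,y),\quad b_z,b_w>\eta,$$ where $R_{22}^{\rm SU}$ is antisymmetric and for $x>y$ $$R_{22}^{\rm SU}(x,y)=-2\int_{\mathcal{C}_0^{\pi/3}}\mathbf{d}z\;z\,e^{(z+\eta)^3/3+(-z+\eta)^3/3-x(z+\eta)-y(-z+\eta)}.$$ $F_{\rm GUE}(x)=\det(I-K_{\rm Ai})_{\mathbb{L}^2(x,\infty)}$ with $K_{\rm Ai}(u,v)=\int_{\mathcal{C}_{-1}^{2\pi/3}}\mathbf{d}w\int_{\mathcal{C}_1^{\pi/3}}\mathbf{d}z\frac{e^{z^3/3-zu}}{e^{w^3/3-wv}}\frac1{z-w}$. $F_{\rm GSE}(x)=\mathrm{Pf}(J-K^{\rm GSE})_{\mathbb{L}^2(x,\infty)}$, where $K^{\rm GSE}_{11}$, $K^{\rm GSE}_{12}$, $K^{\rm GSE}_{22}$ are the double integrals $\int_{\mathcal{C}_1^{\pi/3}}\mathbf{d}z\int_{\mathcal{C}_1^{\pi/3}}\mathbf{d}w\,(\cdot)\,e^{z^3/3+w^3/3-xz-yw}$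 with $(\cdot)$ equal respectively to $\frac{z-w}{4zw(z+w)}$, $\frac{z-w}{4z(z+w)}$, $\frac{z-w}{4(z+w)}$, and $K^{\rm GSE}_{21}(x,y)=-K^{\rm GSE}_{12}(y,x)$. *)

theory Defs
  imports "HOL-Analysis.Analysis" "Jordan_Normal_Form.Determinant"
begin

text \<open>The integral of \<open>f\<close> with respect to \<open>1/(2 \<pi> \<i>) dz\<close> over the union of the two rays departing
  from \<open>a\<close> with angles \<open>\<phi>\<close> and \<open>-\<phi>\<close>, oriented from the lower end to the upper end; hence the
  minus sign in front of the lower ray, which is parametrised away from \<open>a\<close>.\<close>

definition wedge_integral :: "real \<Rightarrow> real \<Rightarrow> (complex \<Rightarrow> complex) \<Rightarrow> complex" where
  "wedge_integral a \<phi> f =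
     1 / (2 * of_real pi * \<i>) *
       ((LBINT t:{0..}. f (of_real a + of_real t * cis \<phi>) * cis \<phi>)
        - (LBINT t:{0..}. f (of_real a + of_real t * cis (- \<phi>)) * cis (- \<phi>)))"

definition airy_exp :: "real \<Rightarrow> real \<Rightarrow> complex \<Rightarrow> complex \<Rightarrow> complex" where
  "airy_exp x y z w = exp (z ^ 3 / 3 + w ^ 3 / 3 - of_real x * z - of_real y * w)"

definition double_airy_integral ::
  "real \<Rightarrow> real \<Rightarrow> (complex \<Rightarrow> complex \<Rightarrow> complex) \<Rightarrow> real \<Rightarrow> real \<Rightarrow> complex" where
  "double_airy_integral a b g x y =
     wedge_integral a (pi / 3) (\<lambda>z. wedge_integral b (pi / 3) (\<lambda>w. g z w * airy_exp x y z w))"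

text \<open>Only meaningful for skew-symmetric matrices of even size.\<close>

definition pfaffian :: "'a::field_char_0 mat \<Rightarrow> 'a" where
  "pfaffian A = (let n = dim_row A div 2 in
     1 / (2 ^ n * fact n) *
       (\<Sum>p | p permutes {0..<2 * n}.
          of_int (sign p) * (\<Prod>i = 0..<n. A $$ (p (2 * i), p (2 * i + 1)))))"

text \<open>A \<open>2 \<times> 2\<close> matrix kernel is a function \<open>K i j x y\<close> with \<open>i, j \<in> {1, 2}\<close>.\<close>

type_synonym matrix_kernel = "nat \<Rightarrow> nat \<Rightarrow> real \<Rightarrow> real \<Rightarrow> complex"

definition skew_kernel ::
  "(real \<Rightarrow> real \<Rightarrow> complex) \<Rightarrow> (real \<Rightarrow> real \<Rightarrow> complex) \<Rightarrow> (real \<Rightarrow> real \<Rightarrow> complex) \<Rightarrow> matrix_kernel" where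
  "skew_kernel K11 K12 K22 i j x y =
     (if i = 1 then (if j = 1 then K11 x y else K12 x y)
      else (if j = 1 then - K12 y x else K22 x y))"

definition block_matrix :: "matrix_kernel \<Rightarrow> nat \<Rightarrow> (nat \<Rightarrow> real) \<Rightarrow> complex mat" where
  "block_matrix K k xs =
     mat (2 * k) (2 * k)
       (\<lambda>(m, n). K (m mod 2 + 1) (n mod 2 + 1) (xs (m div 2)) (xs (n div 2)))"

definition integral_over_cube :: "nat \<Rightarrow> real \<Rightarrow> ((nat \<Rightarrow> real) \<Rightarrow> complex) \<Rightarrow> complex" where
  "integral_over_cube k x f =
     (LINT xs : (\<Pi>\<^sub>E i\<in>{0..<k}. {x<..}) | (\<Pi>\<^sub>M i\<in>{0..<k}. lborel). f xs)"

text \<open>\<open>fredholm_pf K x\<close> is the Fredholm Pfaffian of \<open>J - K\<close>, and \<open>fredholm_det K x\<close> the Fredholm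
  determinant of \<open>I - K\<close>, on \<open>L\<^sup>2(x, \<infinity>)\<close>.\<close>

definition fredholm_pf :: "matrix_kernel \<Rightarrow> real \<Rightarrow> complex" where
  "fredholm_pf K x =
     1 + (\<Sum>k. (- 1) ^ Suc k / fact (Suc k) *
            integral_over_cube (Suc k) x (\<lambda>xs. pfaffian (block_matrix K (Suc k) xs)))"

definition fredholm_det :: "(real \<Rightarrow> real \<Rightarrow> complex) \<Rightarrow> real \<Rightarrow> complex" where
  "fredholm_det K x =
     1 + (\<Sum>k. (- 1) ^ Suc k / fact (Suc k) *
            integral_over_cube (Suc k) x
              (\<lambda>xs. Determinant.det (mat (Suc k) (Suc k) (\<lambda>(i, j). K (xs i) (xs j)))))"

definition KSU11 :: "real \<Rightarrow> real \<Rightarrow> real \<Rightarrow> complex" where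
  "KSU11 \<eta> = double_airy_integral 1 1
     (\<lambda>z w. (z - w) / (4 * (z + of_real \<eta>) * (w + of_real \<eta>) * (z + w + 2 * of_real \<eta>)))"

text \<open>The base points \<open>a\<^sub>z, a\<^sub>w\<close> are constrained by \<open>a\<^sub>z > -\<eta>\<close> and \<open>a\<^sub>z + a\<^sub>w > 0\<close>.\<close>

definition KSU12 :: "real \<Rightarrow> real \<Rightarrow> real \<Rightarrow> real \<Rightarrow> real \<Rightarrow> complex" where
  "KSU12 az aw \<eta> = double_airy_integral az aw
     (\<lambda>z w. (z - w + 2 * of_real \<eta>) / (2 * (z + of_real \<eta>) * (z + w)))"

definition RSU22_upper :: "real \<Rightarrow> real \<Rightarrow> real \<Rightarrow> complex" where
  "RSU22_upper \<eta> x y =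
     - 2 * wedge_integral 0 (pi / 3)
             (\<lambda>z. z * exp ((z + of_real \<eta>) ^ 3 / 3 + (- z + of_real \<eta>) ^ 3 / 3
                           - of_real x * (z + of_real \<eta>) - of_real y * (- z + of_real \<eta>)))"

definition RSU22 :: "real \<Rightarrow> real \<Rightarrow> real \<Rightarrow> complex" where
  "RSU22 \<eta> x y =
     (if x > y then RSU22_upper \<eta> x y
      else if x < y then - RSU22_upper \<eta> y x
      else 0)"

text \<open>The base points \<open>b\<^sub>z, b\<^sub>w\<close> are constrained by \<open>b\<^sub>z, b\<^sub>w > \<eta>\<close>.\<close>

definition KSU22 :: "real \<Rightarrow> real \<Rightarrow> real \<Rightarrow> real \<Rightarrow> real \<Rightarrow> complex" where
  "KSU22 bz bw \<eta> x y =
     double_airy_integral bz bw (\<lambda>z w. (z - w) / (z + w - 2 * of_real \<eta>)) x y + RSU22 \<eta> x y"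

definition F_SU :: "real \<Rightarrow> real \<Rightarrow> real \<Rightarrow> real \<Rightarrow> real \<Rightarrow> real \<Rightarrow> complex" where
  "F_SU az aw bz bw \<eta> x =
     fredholm_pf (skew_kernel (KSU11 \<eta>) (KSU12 az aw \<eta>) (KSU22 bz bw \<eta>)) x"

definition K_Ai :: "real \<Rightarrow> real \<Rightarrow> complex" where
  "K_Ai u v =
     wedge_integral (- 1) (2 * pi / 3) (\<lambda>w. wedge_integral 1 (pi / 3) (\<lambda>z.
       exp (z ^ 3 / 3 - z * of_real u) / exp (w ^ 3 / 3 - w * of_real v) * (1 / (z - w))))"

definition F_GUE :: "real \<Rightarrow> complex" where
  "F_GUE = fredholm_det K_Ai"

definition F_GSE :: "real \<Rightarrow> complex" where
  "F_GSE = fredholm_pf (skew_kernel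
     (double_airy_integral 1 1 (\<lambda>z w. (z - w) / (4 * z * w * (z + w))))
     (double_airy_integral 1 1 (\<lambda>z w. (z - w) / (4 * z * (z + w))))
     (double_airy_integral 1 1 (\<lambda>z w. (z - w) / (4 * (z + w)))))"

end

theory Submission
  imports Defs "HOL-Combinatorics.Combinatorics" "HOL-Probability.Probability"
    "HOL-Complex_Analysis.Complex_Analysis" "HOL-Real_Asymp.Real_Asymp"
begin

text \<open>
  As \<open>\<eta> \<longrightarrow> \<infinity>\<close> the first and the last entry of the kernel vanish, and a Pfaffian with zero diagonal
  blocks is a determinant, so the limit is the Fredholm determinant of the Airy kernel. The last entry
  is not small term by term: its Gaussian part is cancelled by the integral over the whole line of a
  Wronskian of Airy functions, because \<open>\<integral> exp (p l) Ai(l) dl = exp (p^3 / 3)\<close>.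

  As \<open>\<eta> \<longrightarrow> 0\<close> the Gaussian part \<open>R\<close> of the last entry concentrates on the diagonal and converges only as a
  distribution. Expanding each Pfaffian in the number \<open>m\<close> of factors \<open>R\<close>, and integrating one of the
  two variables of each factor, replaces a row of the kernel by its convolution with \<open>R / 2\<close>, corrected by a
  multiple of the row itself that does not change the Pfaffian. The corrected convolution
  converges to minus the derivative of the row, which is minus one half of the second row. After
  reordering the absolutely convergent double series by \<open>n = k - m\<close>, the sum over \<open>m\<close> is a
  binomial sum \<open>(1 - 1 / 2)^n\<close>, and dominated convergence applies. The bounds come from Hadamard's inequality.\<close>

section \<open>Pfaffians as sums over permutations\<close>

text \<open>Near the endpoint \<open>x\<close> the half line y > x cuts the Gaussian R(s, y), whose
  leading part is odd in y - s, and its integral grows like 1 / sqrt \<eta>. Domination thus fails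
  at the boundary and not only on the diagonal. Subtracting the row at \<open>s\<close> leaves a
  difference of order |y - s|, which cancels the singular factor uniformly up to \<open>x\<close>;
  the first row of the same point is still in the matrix, so the Pfaffian does not notice.

  Each factor R uses up the second rows of two points and one of these points is integrated out, so
  \<open>k\<close> points with \<open>m\<close> factors leave a Pfaffian on n = k - m points. Only
  these have bounds uniform in \<eta>, and those with a common \<open>n\<close> come from different
  \<open>k\<close>.

  The base points may vary with \<eta>. The entries that contain them are rewritten as half-line
  integrals of Airy functions, where no base point occurs and no contour has to follow \<eta> to
  infinity.

  Counting the terms of a Pfaffian would leave a geometric series of uncontrolled ratio; Hadamard's
  inequality gains a further factor \<open>1 / sqrt (fact n)\<close>.\<close>

definition pf :: "nat \<Rightarrow> (nat \<Rightarrow> nat \<Rightarrow> complex) \<Rightarrow> complex" where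
  "pf n A = 1 / (2 ^ n * fact n) *
     (\<Sum>p | p permutes {0..<2 * n}. of_int (sign p) * (\<Prod>i = 0..<n. A (p (2 * i)) (p (2 * i + 1))))"

lemma permutes_less: "p permutes {0..<n} \<Longrightarrow> p a < n \<longleftrightarrow> a < (n::nat)"
  using permutes_in_image[of p "{0..<n}" a] by auto

lemma pfaffian_mat: "pfaffian (mat (2 * n) (2 * n) (\<lambda>(i, j). A i j)) = pf n A"
proof -
  have "(\<Prod>i = 0..<n. mat (2 * n) (2 * n) (\<lambda>(i, j). A i j) $$ (p (2 * i), p (2 * i + 1)))
      = (\<Prod>i = 0..<n. A (p (2 * i)) (p (2 * i + 1)))" if "p permutes {0..<2 * n}" for p
    by (rule prod.cong) (auto simp: permutes_less[OF that])
  then show ?thesis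
    unfolding pfaffian_def pf_def Let_def by (auto intro!: sum.cong)
qed

lemma pf_cong:
  assumes "\<And>a b. a < 2 * n \<Longrightarrow> b < 2 * n \<Longrightarrow> A a b = B a b"
  shows "pf n A = pf n B"
proof -
  have "(\<Prod>i = 0..<n. A (p (2 * i)) (p (2 * i + 1))) = (\<Prod>i = 0..<n. B (p (2 * i)) (p (2 * i + 1)))"
    if "p permutes {0..<2 * n}" for p
    by (rule prod.cong) (auto intro!: assms simp: permutes_less[OF that])
  then show ?thesis unfolding pf_def by (auto intro!: sum.cong)
qed

lemma prod_pairs: "(\<Prod>a<2 * n. f a) = (\<Prod>i = 0..<n. f (2 * i) * f (2 * i + 1 :: nat) :: 'a :: comm_monoid_mult)"
  by (induction n) (auto simp: mult.assoc)

lemma prod_pairs_permutes: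
  assumes "p permutes {0..<2 * n :: nat}"
  shows "(\<Prod>i = 0..<n. d (p (2 * i)) * d (p (2 * i + 1))) = (\<Prod>a<2 * n. d a :: 'a :: comm_monoid_mult)"
  using prod.permute[of p "{..<2 * n}" d] assms
  by (simp only: prod_pairs[of "\<lambda>a. d (p a)", symmetric] lessThan_atLeast0 o_def)

text \<open>Every position occurs exactly once among the pairs of a permutation, so each factor
  \<open>d a\<close> comes out once.\<close>

lemma pf_scale: "pf n (\<lambda>a b. d a * d b * A a b) = (\<Prod>a<2 * n. d a) * pf n A"
proof -
  have "(\<Prod>i = 0..<n. d (p (2 * i)) * d (p (2 * i + 1)) * A (p (2 * i)) (p (2 * i + 1)))
      = (\<Prod>a<2 * n. d a) * (\<Prod>i = 0..<n. A (p (2 * i)) (p (2 * i + 1)))"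
    if "p permutes {0..<2 * n}" for p
    by (simp only: prod.distrib[of "\<lambda>i. d (p (2 * i)) * d (p (2 * i + 1))"] prod_pairs_permutes[OF that])
  then show ?thesis
    unfolding pf_def sum_distrib_left by (auto intro!: sum.cong)
qed

text \<open>Row and column change together, since a Pfaffian is linear in such a pair and not in a
  single row.\<close>

definition set_row :: "nat \<Rightarrow> (nat \<Rightarrow> complex) \<Rightarrow> (nat \<Rightarrow> nat \<Rightarrow> complex) \<Rightarrow> nat \<Rightarrow> nat \<Rightarrow> complex" where
  "set_row b r A a c = (if a = b then (if c = b then 0 else r c) else if c = b then - r a else A a c)"

text \<open>In each permutation the position \<open>b\<close> lies in exactly one pair, so each
  summand contains exactly one entry of the new row. Weights and columns are found before
  \<open>r\<close> is chosen; this lets an integral over \<open>r\<close> pass through the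
  Pfaffian.\<close>

lemma pf_set_row:
  assumes b: "b < 2 * n"
  shows "\<exists>P w c. finite (P :: (nat \<Rightarrow> nat) set) \<and> (\<forall>p\<in>P. c p < 2 * n \<and> c p \<noteq> b) \<and>
    (\<forall>r. pf n (set_row b r A) = (\<Sum>p\<in>P. w p * r (c p)))"
proof -
  let ?P = "{p. p permutes {0..<2 * n}}"
  \<comment> \<open>\<open>wc\<close> holds what a summand contains besides \<open>r\<close>: the
    signed product of the other entries, and the partner of \<open>b\<close> in its pair. One such
    pair must serve all rows at once, hence the quantifier over \<open>r\<close> inside.\<close>
  define Q where "Q p wc \<longleftrightarrow> snd wc < 2 * n \<and> snd wc \<noteq> b \<and> (\<forall>r. 1 / (2 ^ n * fact n) * (of_int (sign p) *
      (\<Prod>i = 0..<n. set_row b r A (p (2 * i)) (p (2 * i + 1)))) = fst wc * r (snd wc))"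
    for p and wc :: "complex \<times> nat"
  have "\<exists>wc. Q p wc"
    if p: "p permutes {0..<2 * n}" for p
  proof -
    have inj: "p x = p y \<longleftrightarrow> x = y" for x y using permutes_inj[OF p] by (simp add: inj_eq)
    obtain a where a: "p a = b" "a < 2 * n"
      using b permutes_less[OF p] permutes_surj[OF p] by (metis surjD)
    define j where "j = a div 2"
    have j: "j < n" using a by (simp add: j_def)
    let ?F = "\<lambda>r i. set_row b r A (p (2 * i)) (p (2 * i + 1))"
    have rest: "?F r i = A (p (2 * i)) (p (2 * i + 1))" if "i \<noteq> j" for r i
    proof -
      have "a \<noteq> 2 * i" "a \<noteq> 2 * i + 1" using that by (auto simp: j_def)
      then have "p (2 * i) \<noteq> b" "p (2 * i + 1) \<noteq> b" using inj a by metis+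
      then show ?thesis by (simp add: set_row_def)
    qed
    have split: "(\<Prod>i = 0..<n. ?F r i) = ?F r j * (\<Prod>i\<in>{0..<n} - {j}. A (p (2 * i)) (p (2 * i + 1)))" for r
    proof -
      have "(\<Prod>i\<in>{0..<n} - {j}. ?F r i) = (\<Prod>i\<in>{0..<n} - {j}. A (p (2 * i)) (p (2 * i + 1)))"
        by (rule prod.cong) (use rest in auto)
      then show ?thesis using j prod.remove[of "{0..<n}" j "?F r"] by (simp only: finite_atLeastLessThan atLeastLessThan_iff) simp
    qed
    show ?thesis
    proof (cases "even a")
      case True
      then have e: "a = 2 * j" by (simp add: j_def)
      have "p (2 * j + 1) \<noteq> b" using inj a e by (metis n_not_Suc_n Suc_eq_plus1)
      then have "?F r j = r (p (2 * j + 1))" for r using e a by (simp add: set_row_def)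
      then show ?thesis using \<open>p (2 * j + 1) \<noteq> b\<close> j
        by (intro exI[of _ "(1 / (2 ^ n * fact n) * (of_int (sign p) * (\<Prod>i\<in>{0..<n} - {j}. A (p (2 * i)) (p (2 * i + 1)))),
            p (2 * j + 1))"]) (auto simp: Q_def split[simplified] permutes_less[OF p])
    next
      case False
      then have e: "a = 2 * j + 1" by (simp add: j_def) 
      have "p (2 * j) \<noteq> b" using inj a e by (metis n_not_Suc_n Suc_eq_plus1)
      then have "?F r j = - r (p (2 * j))" for r using e a by (simp add: set_row_def)
      then show ?thesis using \<open>p (2 * j) \<noteq> b\<close> j
        by (intro exI[of _ "(- (1 / (2 ^ n * fact n) * (of_int (sign p) * (\<Prod>i\<in>{0..<n} - {j}. A (p (2 * i)) (p (2 * i + 1))))),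
            p (2 * j))"]) (auto simp: Q_def split[simplified] permutes_less[OF p])
    qed
  qed
  then obtain f where f: "\<And>p. p \<in> ?P \<Longrightarrow> Q p (f p)" using bchoice[of ?P Q] by auto
  have eq: "pf n (set_row b r A) = (\<Sum>p\<in>?P. fst (f p) * r (snd (f p)))" for r
    unfolding pf_def sum_distrib_left 
  proof (intro sum.cong refl)
    fix p assume "p \<in> ?P"
    from f[OF this] show "1 / (2 ^ n * fact n) * (of_int (sign p) *
      (\<Prod>i = 0..<n. set_row b r A (p (2 * i)) (p (2 * i + 1)))) = fst (f p) * r (snd (f p))"
      unfolding Q_def by blast
  qed
  have fin: "finite ?P" by (intro finite_permutations) simp
  have c: "\<forall>p\<in>?P. snd (f p) < 2 * n \<and> snd (f p) \<noteq> b"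
    using f unfolding Q_def by blast
  show ?thesis
    by (rule exI[of _ ?P], rule exI[of _ "\<lambda>p. fst (f p)"], rule exI[of _ "\<lambda>p. snd (f p)"])
       (intro conjI fin c allI eq)
qed

lemma set_row_self: "(\<And>a. A a b = - A b a) \<Longrightarrow> A b b = 0 \<Longrightarrow> set_row b (A b) A = A"
  unfolding set_row_def fun_eq_iff by metis

lemma sum_sign_transpose_zero:
  fixes f :: "(nat \<Rightarrow> nat) \<Rightarrow> complex"
  assumes "a < N" "b < N" "a \<noteq> b" "\<And>p. p permutes {0..<N} \<Longrightarrow> f (Transposition.transpose a b \<circ> p) = f p"
  shows "(\<Sum>p | p permutes {0..<N}. of_int (sign p) * f p) = 0"
proof -
  have t: "Transposition.transpose a b permutes {0..<N}" using assms by (intro permutes_swap_id) auto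
  have "(\<Sum>p | p permutes {0..<N}. of_int (sign p) * f p)
      = (\<Sum>p | p permutes {0..<N}. of_int (sign (Transposition.transpose a b \<circ> p)) * f (Transposition.transpose a b \<circ> p))"
    by (rule setum_permutations_compose_left[OF t])
  also have "\<dots> = (\<Sum>p | p permutes {0..<N}. - (of_int (sign p) * f p))"
    using assms t
    by (intro sum.cong) (auto simp: sign_compose permutes_imp_permutation[OF finite_atLeastLessThan] sign_swap_id)
  finally show ?thesis by (simp add: sum_negf)
qed

text \<open>Equality of the rows \<open>a\<close> and \<open>b\<close>, columns included, is
  expressed as invariance under their transposition. Composing a permutation with it keeps the
  product and flips the sign.\<close>

lemma pf_equal_rows:
  assumes "a < 2 * n" "b < 2 * n" "a \<noteq> b"
    and "\<And>c d. A (Transposition.transpose a b c) (Transposition.transpose a b d) = A c d"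
  shows "pf n A = 0"
  unfolding pf_def
  using sum_sign_transpose_zero[of a "2 * n" b "\<lambda>p. \<Prod>i = 0..<n. A (p (2 * i)) (p (2 * i + 1))"] assms
  by simp

text \<open>By linearity in the row the added multiple contributes the Pfaffian of a matrix with two
  equal rows. The value of \<open>r\<close> at \<open>b\<close> itself is left open, as
  \<open>set_row\<close> puts 0 there.\<close>

lemma pf_add_multiple_row:
  assumes ab: "a < 2 * n" "b < 2 * n" "a \<noteq> b"
    and skew: "\<And>c d. A c d = - A d c"
    and r: "\<And>c. c < 2 * n \<Longrightarrow> c \<noteq> b \<Longrightarrow> r c = A b c + \<alpha> * A a c"
  shows "pf n (set_row b r A) = pf n A"
proof -
  have diag: "A c c = 0" for c using skew[of c c] by (simp add: eq_neg_iff_add_eq_0)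
  obtain P :: "(nat \<Rightarrow> nat) set" and w c where
    P: "finite P" "\<And>p. p \<in> P \<Longrightarrow> c p < 2 * n \<and> c p \<noteq> b"
      "\<And>r. pf n (set_row b r A) = (\<Sum>p\<in>P. w p * r (c p))"
    using pf_set_row[OF ab(2), of A] by blast
  have "pf n (set_row b r A) = (\<Sum>p\<in>P. w p * A b (c p)) + \<alpha> * (\<Sum>p\<in>P. w p * A a (c p))"
    using P(2) by (simp add: P(3) r sum_distrib_left algebra_simps flip: sum.distrib cong: sum.cong)
  also have "(\<Sum>p\<in>P. w p * A b (c p)) = pf n (set_row b (A b) A)"
    by (simp add: P(3))
  also have "set_row b (A b) A = A" by (intro set_row_self skew diag)
  also have "(\<Sum>p\<in>P. w p * A a (c p)) = pf n (set_row b (A a) A)"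
    by (simp add: P(3))
  also have "\<dots> = 0"
  proof -
    have "A c a = - A a c" if "c \<noteq> a" for c by (rule skew)
    then show ?thesis
      using ab diag by (intro pf_equal_rows[of a _ b]) (auto simp: set_row_def Transposition.transpose_def)
  qed
  finally show ?thesis by simp
qed

section \<open>Permutations of positions induced by permutations of points, and determinants as
  Pfaffians\<close>

definition lift :: "nat \<Rightarrow> (nat \<Rightarrow> nat) \<Rightarrow> nat \<Rightarrow> nat" where
  "lift r q a = (if a mod 2 = r then 2 * q (a div 2) + r else a)"

lemma even_lift: "r < 2 \<Longrightarrow> even (lift r q a) \<longleftrightarrow> even a"
  by (cases "r = 0") (auto simp: lift_def mod_2_eq_odd)

lemma lift_compose: "r < 2 \<Longrightarrow> lift r (p \<circ> q) = lift r p \<circ> lift r q"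
  by (auto simp: lift_def fun_eq_iff)

lemma lift_transpose: "r < 2 \<Longrightarrow> lift r (Transposition.transpose a b) = Transposition.transpose (2 * a + r) (2 * b + r)"
proof (rule ext)
  fix c assume r: "r < (2::nat)"
  show "lift r (Transposition.transpose a b) c = Transposition.transpose (2 * a + r) (2 * b + r) c"
  proof (cases "c mod 2 = r")
    case True
    then have "c = 2 * (c div 2) + r" by (metis mult_div_mod_eq)
    then obtain d where "c = 2 * d + r" by blast
    then show ?thesis using r by (auto simp: lift_def Transposition.transpose_def)
  next
    case False
    then show ?thesis using r by (auto simp: lift_def Transposition.transpose_def)
  qed
qed

lemma sign_compose_less:
  "p permutes {0..<n::nat} \<Longrightarrow> q permutes {0..<n'::nat} \<Longrightarrow> sign (p \<circ> q) = sign p * sign q"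
  by (intro sign_compose permutes_imp_permutation[OF finite_atLeastLessThan])

text \<open>Lifting to one parity class turns a transposition of points into a transposition of
  positions, so the sign is carried over step by step.\<close>

lemma lift_permutes_sign:
  assumes "q permutes {0..<k}" "r < 2"
  shows "lift r q permutes {0..<2 * k} \<and> sign (lift r q) = sign q"
  using assms(1) finite_atLeastLessThan
proof (induction rule: permutes_induct)
  case id
  have "lift r id = id" by (auto simp: lift_def fun_eq_iff)
  then show ?case using permutes_id sign_id by metis
next
  case (swap a b p)
  have t: "Transposition.transpose (2 * a + r) (2 * b + r) permutes {0..<2 * k}" "Transposition.transpose a b permutes {0..<k}"
    using swap assms by (auto intro!: permutes_swap_id)
  have e: "lift r (Transposition.transpose a b \<circ> p) = Transposition.transpose (2 * a + r) (2 * b + r) \<circ> lift r p"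
    using assms(2) by (simp only: lift_compose lift_transpose)
  have "sign (Transposition.transpose (2 * a + r) (2 * b + r) \<circ> lift r p) = sign (Transposition.transpose a b \<circ> p)"
    unfolding sign_compose_less[OF t(1) conjunct1[OF swap.IH]] sign_compose_less[OF t(2) swap.hyps(4)]
    using swap by (simp add: sign_swap_id)
  then show ?case
    unfolding e using permutes_compose[OF conjunct1[OF swap.IH] t(1)] by blast
qed

definition lift2 :: "(nat \<Rightarrow> nat) \<Rightarrow> nat \<Rightarrow> nat" where
  "lift2 q a = 2 * q (a div 2) + a mod 2"

lemma lift2_eq: "lift2 q = lift 0 q \<circ> lift 1 q"
  by (auto simp: lift2_def lift_def fun_eq_iff mod_2_eq_odd)

lemma lift2_permutes: "q permutes {0..<k} \<Longrightarrow> lift2 q permutes {0..<2 * k}"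
  unfolding lift2_eq using lift_permutes_sign[of q k] by (auto intro: permutes_compose)

text \<open>The even and the odd positions each contribute the sign of \<open>q\<close>. This is why
  the points of a Pfaffian can be relabelled freely.\<close>

lemma sign_lift2: "q permutes {0..<k} \<Longrightarrow> sign (lift2 q) = 1"
  unfolding lift2_eq using lift_permutes_sign[of q k 0] lift_permutes_sign[of q k 1]
  by (subst sign_compose_less) (auto simp: sign_idempotent)

lemma extend_to_permutation:
  assumes "finite S" "X \<subseteq> S" "g ` X \<subseteq> S" "inj_on g X"
  obtains q where "q permutes S" "\<And>x. x \<in> X \<Longrightarrow> q x = g x"
proof -
  have "card (S - X) = card (S - g ` X)"
    using assms by (simp add: card_Diff_subset finite_subset card_image)
  then obtain h where h: "bij_betw h (S - X) (S - g ` X)"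
    using assms by (meson finite_Diff finite_same_card_bij)
  define q where "q x = (if x \<in> X then g x else if x \<in> S then h x else x)" for x
  have "bij_betw q (X \<union> (S - X)) (g ` X \<union> (S - g ` X))"
  proof (rule bij_betw_combine)
    show "bij_betw q X (g ` X)" using assms by (auto simp: bij_betw_def q_def inj_on_def)
    show "bij_betw q (S - X) (S - g ` X)"
      using h by (subst bij_betw_cong[of _ _ h]) (auto simp: q_def)
  qed auto
  moreover have "X \<union> (S - X) = S" "g ` X \<union> (S - g ` X) = S" using assms by auto
  ultimately have "bij_betw q S S" by simp
  then have "q permutes S" using assms(2) by (intro bij_imp_permutes) (auto simp: q_def)
  then show ?thesis by (rule that) (simp add: q_def)
qed

definition flip :: "nat set \<Rightarrow> nat \<Rightarrow> nat" where
  "flip Y a = (if a div 2 \<in> Y then (if even a then a + 1 else a - 1) else a)"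

lemma flip_permutes_sign:
  assumes "finite Y" "Y \<subseteq> {0..<k}"
  shows "flip Y permutes {0..<2 * k} \<and> sign (flip Y) = (- 1) ^ card Y"
  using assms
proof (induction Y)
  case empty
  have "flip {} = id" by (auto simp: flip_def fun_eq_iff)
  then show ?case using permutes_id sign_id by (metis card.empty power_0)
next
  case (insert y Y)
  have e: "flip (insert y Y) = Transposition.transpose (2 * y) (2 * y + 1) \<circ> flip Y"
  proof
    fix a show "flip (insert y Y) a = (Transposition.transpose (2 * y) (2 * y + 1) \<circ> flip Y) a"
      using insert(2) by (cases "even a"; cases "a div 2 = y")
        (auto simp: flip_def Transposition.transpose_def elim!: evenE oddE)
  qed
  have t: "Transposition.transpose (2 * y) (2 * y + 1) permutes {0..<2 * k}"
    using insert by (auto intro!: permutes_swap_id)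
  have i: "flip Y permutes {0..<2 * k} \<and> sign (flip Y) = (- 1) ^ card Y" using insert by auto
  then show ?case
    unfolding e sign_compose_less[OF t conjunct1[OF i]]
    using permutes_compose[OF conjunct1[OF i] t] insert(1,2) by (simp add: sign_swap_id del: o_apply)
qed

text \<open>The product is expanded over the set \<open>X\<close> of factors in which the first term
  is taken. A substitution in \<open>p\<close> flips the other pairs back, and its sign cancels the
  minus signs. All \<open>2 ^ k\<close> subsets give the same sum.\<close>

lemma sum_antisymmetrize:
  fixes M :: "nat \<Rightarrow> nat \<Rightarrow> complex"
  shows "(\<Sum>p | p permutes {0..<2 * k}. of_int (sign p) *
            (\<Prod>i = 0..<k. M (p (2 * i)) (p (2 * i + 1)) - M (p (2 * i + 1)) (p (2 * i))))
       = 2 ^ k * (\<Sum>p | p permutes {0..<2 * k}. of_int (sign p) * (\<Prod>i = 0..<k. M (p (2 * i)) (p (2 * i + 1))))"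
    (is "?L = _ * ?R")
proof -
  let ?I = "{0..<k}" and ?f = "\<lambda>p i. M (p (2 * i)) (p (2 * i + 1))" and ?g = "\<lambda>p i. M (p (2 * i + 1)) (p (2 * i))"
  have one: "(\<Sum>p | p permutes {0..<2 * k}. of_int (sign p) * ((\<Prod>i\<in>X. ?f p i) * (\<Prod>i\<in>?I - X. - ?g p i))) = ?R"
    if X: "X \<subseteq> ?I" for X
  proof -
    let ?Y = "?I - X"
    have F: "flip ?Y permutes {0..<2 * k}" "sign (flip ?Y) = (- 1) ^ card ?Y"
      using flip_permutes_sign[of ?Y k] by auto
    have "?R = (\<Sum>p | p permutes {0..<2 * k}. of_int (sign (p \<circ> flip ?Y)) * (\<Prod>i = 0..<k. ?f (p \<circ> flip ?Y) i))"
      by (rule sum_permutations_compose_right[OF F(1)])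
    also have "\<dots> = (\<Sum>p | p permutes {0..<2 * k}. of_int (sign p) * ((\<Prod>i\<in>X. ?f p i) * (\<Prod>i\<in>?I - X. - ?g p i)))"
    proof (rule sum.cong[OF refl])
      fix p assume "p \<in> {p. p permutes {0..<2 * k}}"
      then have p: "permutation p" by (auto intro: permutes_imp_permutation[OF finite_atLeastLessThan])
      have s: "sign (p \<circ> flip ?Y) = sign p * (- 1) ^ card ?Y"
        using sign_compose[OF p permutes_imp_permutation[OF finite_atLeastLessThan F(1)]] F(2) by simp
      have "(\<Prod>i\<in>?I. ?f (p \<circ> flip ?Y) i) = (\<Prod>i\<in>X. ?f (p \<circ> flip ?Y) i) * (\<Prod>i\<in>?Y. ?f (p \<circ> flip ?Y) i)"
        using X by (subst prod.subset_diff[OF X]) (auto simp: mult.commute)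
      also have "(\<Prod>i\<in>X. ?f (p \<circ> flip ?Y) i) = (\<Prod>i\<in>X. ?f p i)"
        by (rule prod.cong) (auto simp: flip_def)
      also have "(\<Prod>i\<in>?Y. ?f (p \<circ> flip ?Y) i) = (\<Prod>i\<in>?Y. ?g p i)"
        by (rule prod.cong) (auto simp: flip_def)
      finally show "of_int (sign (p \<circ> flip ?Y)) * (\<Prod>i = 0..<k. ?f (p \<circ> flip ?Y) i)
          = of_int (sign p) * ((\<Prod>i\<in>X. ?f p i) * (\<Prod>i\<in>?I - X. - ?g p i))"
        by (simp add: s prod_uminus)
    qed
    finally show ?thesis by simp
  qed
  have "?L = (\<Sum>p | p permutes {0..<2 * k}. \<Sum>X\<in>Pow ?I. of_int (sign p) * ((\<Prod>i\<in>X. ?f p i) * (\<Prod>i\<in>?I - X. - ?g p i)))"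
    by (simp only: diff_conv_add_uminus prod_add[OF finite_atLeastLessThan] sum_distrib_left)
  also have "\<dots> = (\<Sum>X\<in>Pow ?I. ?R)"
    by (rule trans[OF sum.swap]) (rule sum.cong[OF refl one], simp)
  also have "\<dots> = 2 ^ k * ?R" by (simp add: card_Pow)
  finally show ?thesis .
qed

text \<open>Once the order inside a pair is discarded, only permutations that preserve parity
  survive. Such a permutation is a pair of permutations of the points, one for the even and one for
  the odd positions, and only their quotient matters.\<close>

lemma pf_off_diagonal:
  assumes skew: "\<And>a b. A a b = - A b a" and zero: "\<And>a b. even (a + b) \<Longrightarrow> A a b = 0"
  shows "pf k A = Determinant.det (mat k k (\<lambda>(i, j). A (2 * i) (2 * j + 1)))"
proof -
  let ?S = "{p. p permutes {0..<k}}"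
  \<comment> \<open>\<open>M\<close> keeps the entries with even row and odd column; the given
    matrix is \<open>M\<close> minus its transpose, which is the shape treated by
    \<open>sum_antisymmetrize\<close>.\<close>
  define M where "M a b = (if even a \<and> odd b then A a b else 0)" for a b
  have AM: "A a b = M a b - M b a" for a b
    using skew[of a b] zero[of a b] by (auto simp: M_def)
  let ?f = "\<lambda>p. of_int (sign p) * (\<Prod>i = 0..<k. M (p (2 * i)) (p (2 * i + 1)))"
  let ?g = "\<lambda>q. of_int (sign q) * (\<Prod>i = 0..<k. A (2 * i) (2 * q i + 1))"
  let ?P = "{p. p permutes {0..<2 * k} \<and> (\<forall>a. even (p a) \<longleftrightarrow> even a)}"
  have "(\<Sum>p | p permutes {0..<2 * k}. ?f p) = (\<Sum>p\<in>?P. ?f p)"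
  proof (rule sum.mono_neutral_right)
    show "\<forall>p\<in>{p. p permutes {0..<2 * k}} - ?P. ?f p = 0"
    proof
      fix p assume "p \<in> {p. p permutes {0..<2 * k}} - ?P"
      then obtain a where p: "p permutes {0..<2 * k}" and a: "even (p a) \<noteq> even a" by auto
      have "a < 2 * k"
      proof (rule ccontr)
        assume "\<not> a < 2 * k"
        then have "p a = a" using p by (auto simp: permutes_def)
        then show False using a by auto
      qed
      then have "a div 2 \<in> {0..<k}" by auto
      moreover have "M (p (2 * (a div 2))) (p (2 * (a div 2) + 1)) = 0"
        using a by (cases "even a") (auto simp: M_def)
      ultimately show "?f p = 0" by (auto intro!: prod_zero)
    qed
  qed (auto simp: finite_permutations)
  also have "\<dots> = (\<Sum>(q, r)\<in>?S \<times> ?S. ?f (lift 0 q \<circ> lift 1 r))"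
  proof (rule sum.reindex_bij_witness[of _ "\<lambda>(q, r). lift 0 q \<circ> lift 1 r"
        "\<lambda>p. (\<lambda>i. p (2 * i) div 2, \<lambda>i. p (2 * i + 1) div 2)"], goal_cases)
    case (1 p)
    then have "even (p a) = even a" for a by simp
    then show ?case by (auto simp: lift_def fun_eq_iff mod_2_eq_odd)
  next
    case (2 p)
    then have p: "p permutes {0..<2 * k}" and ev: "\<And>a. even (p a) = even a" by auto
    have inj: "p x = p y \<longleftrightarrow> x = y" for x y using permutes_inj[OF p] by (simp add: inj_eq)
    have fin: "(\<lambda>i. p (2 * i + s) div 2) permutes {0..<k}" if s: "s < 2" for s
    proof (rule bij_imp_permutes)
      have mod: "p (2 * i + s) mod 2 = s" for i using ev[of "2 * i + s"] s by (cases "s = 0") (auto simp: mod_2_eq_odd)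
      have eq: "p (2 * i + s) = 2 * (p (2 * i + s) div 2) + s" for i
        using mod[of i] by (metis mult_div_mod_eq)
      have "inj_on (\<lambda>i. p (2 * i + s) div 2) {0..<k}"
        by (rule inj_onI) (metis eq inj add_right_cancel mult_cancel1 zero_neq_numeral)
      moreover have "(\<lambda>i. p (2 * i + s) div 2) ` {0..<k} \<subseteq> {0..<k}"
      proof safe
        fix i assume "i \<in> {0..<k}"
        then have "2 * i + s < 2 * k" using s by auto
        then have "p (2 * i + s) < 2 * k" using permutes_less[OF p] by blast
        then show "p (2 * i + s) div 2 \<in> {0..<k}" by auto
      qed
      ultimately show "bij_betw (\<lambda>i. p (2 * i + s) div 2) {0..<k} {0..<k}"
        by (simp add: bij_betw_def endo_inj_surj)
      show "p (2 * i + s) div 2 = i" if "i \<notin> {0..<k}" for i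
      proof -
        have "2 * i + s \<notin> {0..<2 * k}" using that by auto
        then have "p (2 * i + s) = 2 * i + s" using p by (auto simp: permutes_def)
        then show ?thesis using s by simp
      qed
    qed
    from fin[of 0] fin[of 1] show ?case by simp
  next
    case (3 qr)
    then obtain q r where "qr = (q, r)" by (cases qr)
    then show ?case by (simp add: lift_def fun_eq_iff)
  next
    case (4 qr)
    then obtain q r where qr: "qr = (q, r)" "q permutes {0..<k}" "r permutes {0..<k}" by auto
    have "lift 0 q \<circ> lift 1 r permutes {0..<2 * k}"
      using lift_permutes_sign[OF qr(2), of 0] lift_permutes_sign[OF qr(3), of 1]
      by (intro permutes_compose) auto
    moreover have "even ((lift 0 q \<circ> lift 1 r) a) = even a" for a
      by (simp add: even_lift)
    ultimately show ?case by (simp add: qr(1))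
  next
    case (5 p)
    then have "even (p a) = even a" for a by simp
    then have "lift 0 (\<lambda>i. p (2 * i) div 2) \<circ> lift 1 (\<lambda>i. p (2 * i + 1) div 2) = p"
      by (auto simp: lift_def fun_eq_iff mod_2_eq_odd)
    then show ?case by (simp only: prod.case)
  qed
  also have "\<dots> = (\<Sum>q\<in>?S. \<Sum>r\<in>?S. ?f (lift 0 q \<circ> lift 1 r))"
    by (simp add: sum.cartesian_product)
  also have "\<dots> = (\<Sum>q\<in>?S. \<Sum>r\<in>?S. ?g r)"
  proof (rule sum.cong[OF refl])
    fix q assume "q \<in> ?S"
    then have q: "q permutes {0..<k}" by simp
    \<comment> \<open>Substituting \<open>r \<circ> q\<close> for \<open>r\<close> removes
      \<open>q\<close>: its two signs cancel and the product is merely reindexed. Every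
      \<open>q\<close> thus yields the same sum, \<open>fact k\<close> times in all.\<close>
    have "(\<Sum>r\<in>?S. ?f (lift 0 q \<circ> lift 1 r)) = (\<Sum>r\<in>?S. ?f (lift 0 q \<circ> lift 1 (r \<circ> q)))"
      by (rule sum_permutations_compose_right[OF q])
    also have "\<dots> = (\<Sum>r\<in>?S. ?g r)"
    proof (rule sum.cong[OF refl])
      fix r assume "r \<in> ?S"
      then have r: "r permutes {0..<k}" by simp
      have rq: "r \<circ> q permutes {0..<k}" using q r by (rule permutes_compose)
      note perm = permutes_imp_permutation[OF finite_atLeastLessThan]
      have "sign (lift 0 q \<circ> lift 1 (r \<circ> q)) = sign q * (sign r * sign q)"
        using lift_permutes_sign[OF q, of 0] lift_permutes_sign[OF rq, of 1]
          sign_compose_less[of "lift 0 q" "2 * k" "lift 1 (r \<circ> q)" "2 * k"] sign_compose_less[OF r q]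
        by (metis One_nat_def less_2_cases_iff)
      also have "\<dots> = sign r" using sign_idempotent[of q] by (simp add: mult_ac)
      finally have s: "sign (lift 0 q \<circ> lift 1 (r \<circ> q)) = sign r" .
      have "(\<Prod>i = 0..<k. M ((lift 0 q \<circ> lift 1 (r \<circ> q)) (2 * i)) ((lift 0 q \<circ> lift 1 (r \<circ> q)) (2 * i + 1)))
          = (\<Prod>i = 0..<k. A (2 * q i) (2 * r (q i) + 1))"
        by (rule prod.cong) (auto simp: lift_def M_def)
      also have "\<dots> = (\<Prod>i = 0..<k. A (2 * i) (2 * r i + 1))"
        using prod.permute[OF q, of "\<lambda>i. A (2 * i) (2 * r i + 1)"] by (simp add: o_def)
      finally show "?f (lift 0 q \<circ> lift 1 (r \<circ> q)) = ?g r" using s by simp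
    qed
    finally show "(\<Sum>r\<in>?S. ?f (lift 0 q \<circ> lift 1 r)) = (\<Sum>r\<in>?S. ?g r)" .
  qed
  also have "\<dots> = fact k * (\<Sum>r\<in>?S. ?g r)"
    by (simp add: card_permutations)
  finally have eq: "(\<Sum>p | p permutes {0..<2 * k}. ?f p) = fact k * (\<Sum>r\<in>?S. ?g r)" .
  have "pf k A = 1 / (2 ^ k * fact k) * (2 ^ k * (\<Sum>p | p permutes {0..<2 * k}. ?f p))"
    unfolding pf_def by (simp only: AM sum_antisymmetrize)
  also have "\<dots> = (\<Sum>r\<in>?S. ?g r)"
    unfolding eq by simp
  also have "\<dots> = Determinant.det (mat k k (\<lambda>(i, j). A (2 * i) (2 * j + 1)))"
    by (subst det_def'[of _ k]) (auto intro!: sum.cong prod.cong simp: permutes_less)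
  finally show ?thesis .
qed

section \<open>Bounds for Pfaffians and their integrals over cubes\<close>

text \<open>One step of elimination: the unit lower triangular \<open>L\<close> clears the first
  column below the pivot and leaves a block triangular matrix.\<close>

lemma det_schur_complement:
  fixes g :: "nat \<Rightarrow> nat \<Rightarrow> complex"
  assumes g: "g 0 0 \<noteq> 0"
  shows "Determinant.det (mat (Suc k) (Suc k) (\<lambda>(i, j). g i j)) = g 0 0 *
    Determinant.det (mat k k (\<lambda>(i, j). g (Suc i) (Suc j) - g (Suc i) 0 * g 0 (Suc j) / g 0 0))"
proof -
  let ?A = "mat (Suc k) (Suc k) (\<lambda>(i, j). g i j)"
  let ?S = "mat k k (\<lambda>(i, j). g (Suc i) (Suc j) - g (Suc i) 0 * g 0 (Suc j) / g 0 0)"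
  define L where "L = mat (Suc k) (Suc k) (\<lambda>(i, j). if i = j then 1 else if j = 0 then - g i 0 / g 0 0 else 0)"
  have L: "L \<in> carrier_mat (Suc k) (Suc k)" by (simp add: L_def)
  have "Determinant.det L = prod_list (diag_mat L)"
    by (rule det_lower_triangular[OF _ L]) (auto simp: L_def)
  also have "diag_mat L = map (\<lambda>_. 1) [0..<Suc k]"
    unfolding diag_mat_def by (rule map_cong) (auto simp: L_def)
  also have "prod_list (map (\<lambda>_. 1 :: complex) [0..<Suc k]) = 1"
    by (induction k) auto
  finally have "Determinant.det L = 1" .
  then have "Determinant.det ?A = Determinant.det (L * ?A)"
    using det_mult[OF L, of ?A] by simp
  also have "L * ?A = four_block_mat (mat 1 1 (\<lambda>_. g 0 0)) (mat 1 k (\<lambda>(i, j). g 0 (Suc j))) (0\<^sub>m k 1) ?S"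
    (is "_ = ?B")
  proof (rule eq_matI)
    fix i j assume "i < dim_row ?B" "j < dim_col ?B"
    then have ij: "i < Suc k" "j < Suc k" by auto
    have "(L * ?A) $$ (i, j) = (\<Sum>l\<in>{0..<Suc k}. L $$ (i, l) * g l j)"
    proof -
      have "(L * ?A) $$ (i, j) = (\<Sum>l\<in>{0..<Suc k}. Matrix.row L i $ l * Matrix.col ?A j $ l)"
        using ij L by (subst index_mult_mat) (auto simp: scalar_prod_def)
      also have "\<dots> = (\<Sum>l\<in>{0..<Suc k}. L $$ (i, l) * g l j)"
        using ij L by (intro sum.cong) auto
      finally show ?thesis .
    qed
    also have "\<dots> = (\<Sum>l\<in>{0, i}. L $$ (i, l) * g l j)"
      using ij by (intro sum.mono_neutral_right) (auto simp: L_def)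
    also have "\<dots> = ?B $$ (i, j)"
      using ij g by (cases i; cases j) (auto simp: L_def)
    finally show "(L * ?A) $$ (i, j) = ?B $$ (i, j)" .
  qed (use L in auto)
  also have "Determinant.det ?B = Determinant.det (mat 1 1 (\<lambda>_. g 0 0)) * Determinant.det ?S"
    by (rule det_four_block_mat_lower_left_zero_col) auto
  also have "Determinant.det (mat 1 1 (\<lambda>_. g 0 0)) = g 0 0"
    by (subst det_single) auto
  finally show ?thesis .
qed

section \<open>Gram determinants and Hadamard's inequality\<close>

definition gram :: "nat \<Rightarrow> (nat \<Rightarrow> nat \<Rightarrow> complex) \<Rightarrow> nat \<Rightarrow> nat \<Rightarrow> complex" where
  "gram N v i j = (\<Sum>a<N. v i a * cnj (v j a))"

lemma gram_diag: "gram N v i i = of_real (\<Sum>a<N. (cmod (v i a))\<^sup>2)"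
  by (simp only: gram_def of_real_sum complex_norm_square)

lemma gram_cnj: "cnj (gram N v i j) = gram N v j i"
  by (simp add: gram_def mult.commute)

text \<open>Subtracting from the other vectors their projection onto the first one turns the Gram
  matrix into its Schur complement and decreases the norms.\<close>

lemma gram_det_bound:
  "cmod (Determinant.det (mat k k (\<lambda>(i, j). gram N v i j))) \<le> (\<Prod>i<k. \<Sum>a<N. (cmod (v i a))\<^sup>2)"
proof (induction k arbitrary: v)
  case 0
  then show ?case by simp
next
  case (Suc k)
  let ?n = "\<lambda>v i. \<Sum>a<N. (cmod (v i a))\<^sup>2"
  have n0: "0 \<le> ?n v i" for v :: "nat \<Rightarrow> nat \<Rightarrow> complex" and i by (simp add: sum_nonneg)
  show ?case
  proof (cases "gram N v 0 0 = 0")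
    \<comment> \<open>A zero pivot means that the first vector vanishes, and with it the first row
      of the Gram matrix.\<close>
    case True
    then have "?n v 0 = 0" by (simp only: gram_diag of_real_eq_0_iff)
    then have "v 0 a = 0" if "a < N" for a
      using that by (subst (asm) sum_nonneg_eq_0_iff) auto
    then have "gram N v 0 j = 0" for j by (simp add: gram_def)
    then have "(\<Prod>i = 0..<Suc k. mat (Suc k) (Suc k) (\<lambda>(i, j). gram N v i j) $$ (i, p i)) = 0"
      if "p permutes {0..<Suc k}" for p
      using permutes_in_image[OF that, of 0] by (intro prod_zero) (auto intro!: bexI[of _ 0])
    then have "Determinant.det (mat (Suc k) (Suc k) (\<lambda>(i, j). gram N v i j)) = 0"
      by (subst det_def'[of _ "Suc k"]) (auto intro!: sum.neutral simp del: prod.op_ivl_Suc)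
    then show ?thesis using n0 by (simp add: prod_nonneg)
  next
    case False
    define c where "c i = gram N v (Suc i) 0 / gram N v 0 0" for i
    define v' where "v' i a = v (Suc i) a - c i * v 0 a" for i a
    have cc: "cnj (c j) = gram N v 0 (Suc j) / gram N v 0 0" for j
      by (simp add: c_def gram_cnj)
    have g': "gram N v' i j = gram N v (Suc i) (Suc j) - gram N v (Suc i) 0 * gram N v 0 (Suc j) / gram N v 0 0" for i j
    proof -
      have "gram N v' i j = gram N v (Suc i) (Suc j) - c i * gram N v 0 (Suc j) - cnj (c j) * gram N v (Suc i) 0
          + c i * cnj (c j) * gram N v 0 0"
        by (simp add: gram_def v'_def sum_distrib_left algebra_simps flip: sum.distrib sum_subtractf)
      also have "\<dots> = gram N v (Suc i) (Suc j) - gram N v (Suc i) 0 * gram N v 0 (Suc j) / gram N v 0 0"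
        using False unfolding cc by (simp add: c_def field_simps)
      finally show ?thesis .
    qed
    have n': "?n v' i \<le> ?n v (Suc i)" for i
    proof -
      have "gram N v (Suc i) 0 * gram N v 0 (Suc i) = of_real ((cmod (gram N v (Suc i) 0))\<^sup>2)"
        by (subst complex_norm_square) (simp add: gram_cnj)
      then have "of_real (?n v' i) = (of_real (?n v (Suc i) - (cmod (gram N v (Suc i) 0))\<^sup>2 / ?n v 0) :: complex)"
        using g'[of i i] unfolding gram_diag by simp
      then have "?n v' i = ?n v (Suc i) - (cmod (gram N v (Suc i) 0))\<^sup>2 / ?n v 0"
        by (simp only: of_real_eq_iff)
      then show ?thesis using n0[of v 0] by simp
    qed
    have "cmod (Determinant.det (mat (Suc k) (Suc k) (\<lambda>(i, j). gram N v i j)))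
        = ?n v 0 * cmod (Determinant.det (mat k k (\<lambda>(i, j). gram N v' i j)))"
    proof -
      have "cmod (gram N v 0 0) = ?n v 0" unfolding gram_diag norm_of_real using n0[of v 0] by simp
      then show ?thesis by (simp only: det_schur_complement[of "gram N v", OF False] g' norm_mult)
    qed
    also have "\<dots> \<le> ?n v 0 * (\<Prod>i<k. ?n v (Suc i))"
      by (intro mult_left_mono n0 order.trans[OF Suc.IH] prod_mono conjI n')
    also have "\<dots> = (\<Prod>i<Suc k. ?n v i)"
      by (simp only: prod.lessThan_Suc_shift)
    finally show ?thesis .
  qed
qed

text \<open>The Gram matrix of the rows is the matrix times its conjugate transpose, so its
  determinant is the squared modulus on the left.\<close>

lemma hadamard_inequality:
  fixes b :: "nat \<Rightarrow> nat \<Rightarrow> complex"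
  shows "(cmod (Determinant.det (mat N N (\<lambda>(i, j). b i j))))\<^sup>2 \<le> (\<Prod>i<N. \<Sum>j<N. (cmod (b i j))\<^sup>2)"
proof -
  let ?B = "mat N N (\<lambda>(i, j). b i j)" and ?C = "mat N N (\<lambda>(i, j). cnj (b j i))"
  have "Determinant.det (transpose_mat ?C) = cnj (Determinant.det ?B)"
    by (subst (1 2) det_def'[of _ N]) (auto intro!: sum.cong prod.cong dest: permutes_in_image)
  then have C: "Determinant.det ?C = cnj (Determinant.det ?B)"
    by (subst (asm) det_transpose[of _ N]) auto
  have "?B * ?C = mat N N (\<lambda>(i, j). gram N b i j)"
    by (rule eq_matI) (auto simp: scalar_prod_def gram_def lessThan_atLeast0)
  moreover have "Determinant.det (?B * ?C) = Determinant.det ?B * Determinant.det ?C"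
    by (rule det_mult) auto
  ultimately have "cmod (Determinant.det (mat N N (\<lambda>(i, j). gram N b i j))) = (cmod (Determinant.det ?B))\<^sup>2"
    by (simp add: C norm_mult power2_eq_square)
  then show ?thesis using gram_det_bound[of N N b] by simp
qed

text \<open>There are \<open>(2 * n) ^ n\<close> choices of the first members of the pairs. Each
  leaves a determinant bounded by \<open>sqrt (real (2 * n) ^ n)\<close>, half of whose rows are
  unit vectors. The denominator is the normalisation of \<open>pf\<close>.\<close>

definition pf_const :: "nat \<Rightarrow> real" where
  "pf_const n = real (2 * n) ^ n * sqrt (real (2 * n) ^ n) / (2 ^ n * fact n)"

lemma pf_const_nonneg: "0 \<le> pf_const n"
  by (simp add: pf_const_def)

text \<open>The rows of \<open>A\<close> are expanded at the even positions only, which turns the Pfaffian into a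
  sum of determinants to which Hadamard's inequality applies.\<close>

lemma pf_bound_one:
  assumes A: "\<And>a b. a < 2 * n \<Longrightarrow> b < 2 * n \<Longrightarrow> cmod (A a b) \<le> 1"
  shows "cmod (pf n A) \<le> pf_const n"
proof -
  let ?P = "{p. p permutes {0..<2 * n}}" and ?C = "PiE {0..<n} (\<lambda>_. {0..<2 * n})"
  \<comment> \<open>Row \<open>2 * i\<close> is a unit vector that forces the first member of pair
    \<open>i\<close> to be \<open>c i\<close>; row \<open>2 * i + 1\<close> is then row
    \<open>c i\<close> of \<open>A\<close>. Unit rows cost only a factor 1 in Hadamard's
    inequality.\<close>
  define B :: "(nat \<Rightarrow> nat) \<Rightarrow> nat \<Rightarrow> nat \<Rightarrow> complex" where
    "B c r a = (if even r then (if a = c (r div 2) then 1 else 0) else A (c (r div 2)) a)" for c r a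
  let ?D = "\<lambda>c. Determinant.det (mat (2 * n) (2 * n) (\<lambda>(r, a). B c r a))"
  let ?F = "\<lambda>p i a. (if p (2 * i) = a then 1 else 0) * A a (p (2 * i + 1))"
  have D: "?D c = (\<Sum>p\<in>?P. of_int (sign p) * (\<Prod>i\<in>{0..<n}. ?F p i (c i)))" for c
  proof -
    have "?D c = (\<Sum>p\<in>?P. of_int (sign p) * (\<Prod>r<2 * n. B c r (p r)))"
      by (subst det_def'[of _ "2 * n"]) (auto intro!: sum.cong prod.cong simp: permutes_less lessThan_atLeast0)
    also have "\<dots> = (\<Sum>p\<in>?P. of_int (sign p) * (\<Prod>i\<in>{0..<n}. ?F p i (c i)))"
      unfolding prod_pairs by (intro sum.cong refl arg_cong2[of _ _ _ _ "(*)"] prod.cong) (auto simp: B_def)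
    finally show ?thesis .
  qed
  have sumF: "(\<Sum>a\<in>{0..<2 * n}. ?F p i a) = A (p (2 * i)) (p (2 * i + 1))"
    if p: "p \<in> ?P" and i: "i \<in> {0..<n}" for p i
  proof -
    have "p (2 * i) \<in> {0..<2 * n}" using p i permutes_less[of p "2 * n" "2 * i"] by auto
    moreover have "(\<Sum>a\<in>{0..<2 * n}. ?F p i a) = (\<Sum>a\<in>{0..<2 * n}. if p (2 * i) = a then A a (p (2 * i + 1)) else 0)"
      by (intro sum.cong) auto
    ultimately show ?thesis by (simp only: sum.delta' finite_atLeastLessThan if_True)
  qed
  have "(\<Sum>p\<in>?P. of_int (sign p) * (\<Prod>i = 0..<n. A (p (2 * i)) (p (2 * i + 1))))
      = (\<Sum>p\<in>?P. of_int (sign p) * (\<Prod>i\<in>{0..<n}. \<Sum>a\<in>{0..<2 * n}. ?F p i a))"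
    by (intro sum.cong refl arg_cong2[of _ _ _ _ "(*)"] prod.cong) (simp only: sumF)
  also have "\<dots> = (\<Sum>p\<in>?P. \<Sum>c\<in>?C. of_int (sign p) * (\<Prod>i\<in>{0..<n}. ?F p i (c i)))"
    by (simp only: prod_sum_PiE finite_atLeastLessThan sum_distrib_left)
  also have "\<dots> = (\<Sum>c\<in>?C. ?D c)"
    unfolding D by (rule sum.swap)
  finally have eq: "(\<Sum>p\<in>?P. of_int (sign p) * (\<Prod>i = 0..<n. A (p (2 * i)) (p (2 * i + 1)))) = (\<Sum>c\<in>?C. ?D c)" .
  have Dbound: "cmod (?D c) \<le> sqrt (real (2 * n) ^ n)" if c: "c \<in> ?C" for c
  proof -
    have cl: "c i < 2 * n" if "i < n" for i using c that by (auto simp: PiE_def Pi_def)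
    have "(cmod (?D c))\<^sup>2 \<le> (\<Prod>r<2 * n. \<Sum>a<2 * n. (cmod (B c r a))\<^sup>2)"
      by (rule hadamard_inequality)
    also have "\<dots> = (\<Prod>i = 0..<n. (\<Sum>a<2 * n. (cmod (B c (2 * i) a))\<^sup>2) * (\<Sum>a<2 * n. (cmod (B c (2 * i + 1) a))\<^sup>2))"
      by (rule prod_pairs)
    also have "\<dots> \<le> (\<Prod>i = 0..<n. real (2 * n))"
    proof (intro prod_mono conjI mult_nonneg_nonneg sum_nonneg zero_le_power2)
      fix i assume "i \<in> {0..<n}"
      then have i: "c i < 2 * n" using cl by auto
      have "(\<Sum>a<2 * n. (cmod (B c (2 * i) a))\<^sup>2) = (\<Sum>a<2 * n. if c i = a then 1 else 0)"
        by (intro sum.cong) (auto simp: B_def)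
      also have "\<dots> = 1" using i by (simp only: sum.delta' finite_lessThan) simp
      finally have 1: "(\<Sum>a<2 * n. (cmod (B c (2 * i) a))\<^sup>2) = 1" .
      have "(\<Sum>a<2 * n. (cmod (B c (2 * i + 1) a))\<^sup>2) \<le> (\<Sum>a<2 * n. 1)"
        using i A by (intro sum_mono power_le_one) (auto simp: B_def)
      with 1 show "(\<Sum>a<2 * n. (cmod (B c (2 * i) a))\<^sup>2) * (\<Sum>a<2 * n. (cmod (B c (2 * i + 1) a))\<^sup>2) \<le> real (2 * n)"
        by simp
    qed
    finally show ?thesis by (intro real_le_rsqrt) simp
  qed
  have "cmod (\<Sum>c\<in>?C. ?D c) \<le> (\<Sum>c\<in>?C. sqrt (real (2 * n) ^ n))"
    by (intro sum_norm_le Dbound)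
  also have "\<dots> = real (2 * n) ^ n * sqrt (real (2 * n) ^ n)"
    by (simp add: card_PiE)
  finally have "cmod (\<Sum>c\<in>?C. ?D c) \<le> real (2 * n) ^ n * sqrt (real (2 * n) ^ n)" .
  then have "cmod (\<Sum>c\<in>?C. ?D c) / (2 ^ n * fact n) \<le> pf_const n"
    unfolding pf_const_def by (rule divide_right_mono) simp
  then show ?thesis
    unfolding pf_def eq by (simp add: norm_divide norm_mult norm_power)
qed

text \<open>Dividing row and column \<open>a\<close> by \<open>\<rho> a\<close> reduces the claim to
  entries of modulus at most 1.\<close>

lemma pf_bound:
  assumes "\<And>a. a < 2 * n \<Longrightarrow> 0 < \<rho> a"
    and "\<And>a b. a < 2 * n \<Longrightarrow> b < 2 * n \<Longrightarrow> cmod (A a b) \<le> \<rho> a * \<rho> b"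
  shows "cmod (pf n A) \<le> pf_const n * (\<Prod>a<2 * n. \<rho> a)"
proof -
  let ?r = "\<lambda>a. complex_of_real (\<rho> a)"
  have "pf n A = pf n (\<lambda>a b. ?r a * ?r b * (A a b / (?r a * ?r b)))"
  proof (rule pf_cong)
    fix a b assume "a < 2 * n" "b < 2 * n"
    then have "\<rho> a \<noteq> 0" "\<rho> b \<noteq> 0" using assms(1)[of a] assms(1)[of b] by auto
    then show "A a b = ?r a * ?r b * (A a b / (?r a * ?r b))" by simp
  qed
  also have "\<dots> = (\<Prod>a<2 * n. ?r a) * pf n (\<lambda>a b. A a b / (?r a * ?r b))"
    by (rule pf_scale)
  finally have eq: "pf n A = (\<Prod>a<2 * n. ?r a) * pf n (\<lambda>a b. A a b / (?r a * ?r b))" .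
  have le: "cmod (pf n (\<lambda>a b. A a b / (?r a * ?r b))) \<le> pf_const n"
  proof (rule pf_bound_one)
    fix a b assume ab: "a < 2 * n" "b < 2 * n"
    then have "0 < \<rho> a * \<rho> b" "cmod (A a b) \<le> \<rho> a * \<rho> b" using assms by auto
    then have "cmod (A a b) / (\<rho> a * \<rho> b) \<le> 1" by (subst divide_le_eq_1_pos)
    then show "cmod (A a b / (?r a * ?r b)) \<le> 1"
      using assms(1)[OF ab(1)] assms(1)[OF ab(2)] by (simp add: norm_divide norm_mult)
  qed
  have pr: "cmod (\<Prod>a<2 * n. ?r a) = (\<Prod>a<2 * n. \<rho> a)"
  proof -
    have "cmod (\<Prod>a<2 * n. ?r a) = (\<Prod>a<2 * n. cmod (?r a))" by (rule prod_norm[symmetric])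
    also have "\<dots> = (\<Prod>a<2 * n. \<rho> a)"
    proof (rule prod.cong[OF refl])
      fix a assume "a \<in> {..<2 * n}"
      then show "cmod (?r a) = \<rho> a" using assms(1)[of a] by simp
    qed
    finally show ?thesis .
  qed
  have "0 \<le> (\<Prod>a<2 * n. \<rho> a)" unfolding pr[symmetric] by (rule norm_ge_zero)
  then show ?thesis unfolding eq norm_mult pr mult.commute[of "pf_const n"]
    by (rule mult_left_mono[OF le])
qed

section \<open>Growth of the Pfaffian bound\<close>

lemma summable_power_over_sqrt_fact: "summable (\<lambda>n. K ^ n / sqrt (fact n))" for K :: real
proof -
  obtain N :: nat where N: "4 * K\<^sup>2 < real N" using reals_Archimedean2 by blast
  show ?thesis
  proof (rule summable_ratio_test[of "1/2" N])
    fix n assume n: "N \<le> n"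
    have "\<bar>K\<bar> / sqrt (real (Suc n)) \<le> 1 / 2"
    proof -
      have "(2 * \<bar>K\<bar>)\<^sup>2 \<le> real (Suc n)" using N n by (simp add: power_mult_distrib)
      then have "2 * \<bar>K\<bar> \<le> sqrt (real (Suc n))" by (rule real_le_rsqrt)
      then show ?thesis by (simp add: field_simps)
    qed
    then have "(\<bar>K\<bar> / sqrt (real (Suc n))) * (\<bar>K\<bar> ^ n / sqrt (fact n)) \<le> 1 / 2 * (\<bar>K\<bar> ^ n / sqrt (fact n))"
      by (intro mult_right_mono) auto
    then show "norm (K ^ Suc n / sqrt (fact (Suc n))) \<le> 1 / 2 * norm (K ^ n / sqrt (fact n))"
      by (simp add: power_abs real_sqrt_mult abs_mult mult_ac)
  qed simp
qed

lemma power_self_le_exp_fact: "real n ^ n \<le> exp (real n) * fact n"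
proof -
  have "real n ^ n / fact n \<le> exp (real n)"
    using summable_exp[of "real n"] 
    by (subst exp_def) (rule order.trans[OF _ sum_le_suminf[of _ "{n}"]],
        auto simp: divide_inverse scaleR_conv_of_real mult.commute)
  then show ?thesis by (simp add: field_simps)
qed

text \<open>Since \<open>n ^ n\<close> is at most \<open>exp n * fact n\<close>, the Pfaffian bound
  grows like \<open>sqrt (fact n)\<close> up to a geometric factor. The factorial of the Fredholm
  series then beats every power \<open>C ^ n\<close>.\<close>

lemma pf_const_le: "pf_const n / fact n \<le> (exp 1 * sqrt (2 * exp 1)) ^ n / sqrt (fact n)"
proof -
  have e: "exp (real n) = exp 1 ^ n" by (simp add: exp_of_nat_mult[symmetric])
  have 1: "real n ^ n \<le> exp 1 ^ n * fact n" using power_self_le_exp_fact[of n] e by simp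
  have "pf_const n / fact n = real n ^ n / fact n * sqrt (2 ^ n * real n ^ n) / fact n"
    by (simp add: pf_const_def power_mult_distrib)
  also have "\<dots> \<le> exp 1 ^ n * sqrt (2 ^ n * (exp 1 ^ n * fact n)) / fact n"
    using 1 by (intro divide_right_mono mult_mono real_sqrt_le_mono mult_left_mono) (auto simp: field_simps)
  also have "\<dots> = exp 1 ^ n * (sqrt (2 * exp 1)) ^ n * (sqrt (fact n) / fact n)"
    by (simp add: real_sqrt_mult real_sqrt_power power_mult_distrib)
  also have "sqrt (fact n) / fact n = 1 / sqrt (fact n :: real)"
    by (simp add: field_simps real_sqrt_mult_self)
  finally show ?thesis by (simp add: power_mult_distrib)
qed

lemma summable_pf_const: "summable (\<lambda>n. pf_const n * C ^ n / fact n)" if "0 \<le> C" for C :: real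
proof (rule summable_comparison_test'[where N = 0])
  show "summable (\<lambda>n. (exp 1 * sqrt (2 * exp 1) * C) ^ n / sqrt (fact n))"
    by (rule summable_power_over_sqrt_fact)
  show "norm (pf_const n * C ^ n / fact n) \<le> (exp 1 * sqrt (2 * exp 1) * C) ^ n / sqrt (fact n)" for n
    using mult_right_mono[OF pf_const_le[of n], of "C ^ n"] that pf_const_nonneg[of n]
    by (simp add: power_mult_distrib)
qed

section \<open>Rearranging sums over permutations\<close>

lemma card_permutations_prescribed:
  assumes S: "finite S" "T \<subseteq> S" "g ` T \<subseteq> S" "inj_on g T"
  shows "card {q. q permutes S \<and> (\<forall>t\<in>T. q t = g t)} = fact (card S - card T)"
proof -
  obtain q0 where q0: "q0 permutes S" "\<And>t. t \<in> T \<Longrightarrow> q0 t = g t"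
    using extend_to_permutation[OF S] by blast
  \<comment> \<open>The solutions form a coset: any of them differs from the chosen extension
    \<open>q0\<close> by a permutation of the complement of \<open>T\<close>.\<close>
  have "bij_betw (\<lambda>r. q0 \<circ> r) {r. r permutes (S - T)} {q. q permutes S \<and> (\<forall>t\<in>T. q t = g t)}"
  proof (rule bij_betw_byWitness[of _ "\<lambda>q. inv_into UNIV q0 \<circ> q"])
    show "\<forall>r\<in>{r. r permutes S - T}. inv_into UNIV q0 \<circ> (q0 \<circ> r) = r"
      using permutes_inv_o(2)[OF q0(1)] by (auto simp: o_assoc)
    show "\<forall>q\<in>{q. q permutes S \<and> (\<forall>t\<in>T. q t = g t)}. q0 \<circ> (inv_into UNIV q0 \<circ> q) = q"
      using permutes_inv_o(1)[OF q0(1)] by (auto simp: o_assoc)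
    show "(\<lambda>r. q0 \<circ> r) ` {r. r permutes S - T} \<subseteq> {q. q permutes S \<and> (\<forall>t\<in>T. q t = g t)}"
    proof (rule image_subsetI)
      fix r assume "r \<in> {r. r permutes S - T}"
      then have r: "r permutes S - T" by simp
      have "r t = t" if "t \<in> T" for t using r that by (auto simp: permutes_def)
      moreover have "r permutes S" using permutes_subset[OF r] by auto
      ultimately show "q0 \<circ> r \<in> {q. q permutes S \<and> (\<forall>t\<in>T. q t = g t)}"
        using permutes_compose[of r S q0] q0 by (auto simp: o_def)
    qed
    show "(\<lambda>q. inv_into UNIV q0 \<circ> q) ` {q. q permutes S \<and> (\<forall>t\<in>T. q t = g t)} \<subseteq> {r. r permutes S - T}"
    proof (rule image_subsetI)
      fix q assume "q \<in> {q. q permutes S \<and> (\<forall>t\<in>T. q t = g t)}"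
      then have q: "q permutes S" "\<And>t. t \<in> T \<Longrightarrow> q t = q0 t" using q0(2) by auto
      have "inv_into UNIV q0 \<circ> q permutes S" using permutes_compose[OF q(1) permutes_inv[OF q0(1)]] .
      then have "inv_into UNIV q0 \<circ> q permutes S - T"
        by (rule permutes_superset) (use q(2) permutes_inverses(2)[OF q0(1)] in auto)
      then show "inv_into UNIV q0 \<circ> q \<in> {r. r permutes S - T}" by simp
    qed
  qed
  then have "card {q. q permutes S \<and> (\<forall>t\<in>T. q t = g t)} = card {r. r permutes (S - T)}"
    by (simp add: bij_betw_same_card)
  also have "\<dots> = fact (card S - card T)"
    using S by (intro card_permutations) (auto simp: card_Diff_subset finite_subset)
  finally show ?thesis .
qed

text \<open>The product is expanded over the set \<open>X\<close> of pairs that receive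
  \<open>A\<close>. Moving whole pairs by \<open>lift2\<close> is an even permutation, so
  \<open>X\<close> can be carried to an initial segment without a sign and only its size
  counts.\<close>

lemma sum_prod_add_permutations:
  fixes A B :: "nat \<Rightarrow> nat \<Rightarrow> complex"
  shows "(\<Sum>p | p permutes {0..<2 * k}. of_int (sign p) *
      (\<Prod>i = 0..<k. A (p (2 * i)) (p (2 * i + 1)) + B (p (2 * i)) (p (2 * i + 1))))
    = (\<Sum>n\<in>{0..k}. of_nat (k choose n) * (\<Sum>p | p permutes {0..<2 * k}. of_int (sign p) *
        ((\<Prod>i = 0..<n. A (p (2 * i)) (p (2 * i + 1))) * (\<Prod>i = n..<k. B (p (2 * i)) (p (2 * i + 1))))))"
proof -
  let ?P = "{p. p permutes {0..<2 * k}}" and ?I = "{0..<k}"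
  let ?f = "\<lambda>p i. A (p (2 * i)) (p (2 * i + 1))" and ?g = "\<lambda>p i. B (p (2 * i)) (p (2 * i + 1))"
  let ?h = "\<lambda>n. \<Sum>p\<in>?P. of_int (sign p) * ((\<Prod>i = 0..<n. ?f p i) * (\<Prod>i = n..<k. ?g p i))"
  have one: "(\<Sum>p\<in>?P. of_int (sign p) * ((\<Prod>i\<in>X. ?f p i) * (\<Prod>i\<in>?I - X. ?g p i))) = ?h (card X)"
    if X: "X \<subseteq> ?I" for X
  proof -
    have "finite X" using X finite_subset by blast
    then obtain g where g: "bij_betw g X {0..<card X}" using ex_bij_betw_finite_nat by blast
    have "card X \<le> k" using card_mono[OF _ X] by simp
    then have gI: "g ` X \<subseteq> ?I" using g by (auto simp: bij_betw_def)
    obtain q where q: "q permutes ?I" "\<And>x. x \<in> X \<Longrightarrow> q x = g x"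
      using extend_to_permutation[of ?I X g] X gI g by (auto simp: bij_betw_def)
    have qX: "q ` X = {0..<card X}" using q(2) g by (force simp: bij_betw_def)
    have qIX: "q ` (?I - X) = {card X..<k}"
    proof -
      have "q ` (?I - X) = q ` ?I - q ` X" using permutes_inj[OF q(1)] by (simp add: image_set_diff)
      also have "\<dots> = {card X..<k}" unfolding qX permutes_image[OF q(1)] using \<open>card X \<le> k\<close> by auto
      finally show ?thesis .
    qed
    have "(\<Sum>p\<in>?P. of_int (sign p) * ((\<Prod>i\<in>X. ?f p i) * (\<Prod>i\<in>?I - X. ?g p i)))
       = (\<Sum>p\<in>?P. of_int (sign (p \<circ> lift2 q)) * ((\<Prod>i\<in>X. ?f (p \<circ> lift2 q) i) * (\<Prod>i\<in>?I - X. ?g (p \<circ> lift2 q) i)))"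
      by (rule sum_permutations_compose_right[OF lift2_permutes[OF q(1)]])
    also have "\<dots> = ?h (card X)"
    proof (rule sum.cong[OF refl])
      fix p assume "p \<in> ?P"
      then have p: "p permutes {0..<2 * k}" by simp
      have "sign (p \<circ> lift2 q) = sign p"
        using sign_compose_less[OF p lift2_permutes[OF q(1)]] sign_lift2[OF q(1)] by simp
      moreover have "(\<Prod>i\<in>X. ?f (p \<circ> lift2 q) i) = (\<Prod>i\<in>q ` X. ?f p i)"
        by (subst prod.reindex) (use permutes_inj[OF q(1)] in \<open>auto simp: inj_on_def inj_def lift2_def\<close>)
      moreover have "(\<Prod>i\<in>?I - X. ?g (p \<circ> lift2 q) i) = (\<Prod>i\<in>q ` (?I - X). ?g p i)"
        by (subst prod.reindex) (use permutes_inj[OF q(1)] in \<open>auto simp: inj_on_def inj_def lift2_def\<close>)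
      ultimately show "of_int (sign (p \<circ> lift2 q)) * ((\<Prod>i\<in>X. ?f (p \<circ> lift2 q) i) * (\<Prod>i\<in>?I - X. ?g (p \<circ> lift2 q) i))
         = of_int (sign p) * ((\<Prod>i = 0..<card X. ?f p i) * (\<Prod>i = card X..<k. ?g p i))"
        unfolding qX qIX by simp
    qed
    finally show ?thesis .
  qed
  have "(\<Sum>p\<in>?P. of_int (sign p) * (\<Prod>i = 0..<k. ?f p i + ?g p i))
     = (\<Sum>p\<in>?P. \<Sum>X\<in>Pow ?I. of_int (sign p) * ((\<Prod>i\<in>X. ?f p i) * (\<Prod>i\<in>?I - X. ?g p i)))"
    by (simp only: prod_add[OF finite_atLeastLessThan] sum_distrib_left)
  also have "\<dots> = (\<Sum>X\<in>Pow ?I. ?h (card X))"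
    by (rule trans[OF sum.swap]) (rule sum.cong[OF refl one], simp)
  also have "\<dots> = (\<Sum>n\<in>{0..k}. \<Sum>X\<in>{X \<in> Pow ?I. card X = n}. ?h (card X))"
    by (rule sum.group[symmetric]) (use card_mono[of ?I] in auto)
  also have "\<dots> = (\<Sum>n\<in>{0..k}. of_nat (k choose n) * ?h n)"
  proof (rule sum.cong[OF refl])
    fix n
    have "(\<Sum>X\<in>{X \<in> Pow ?I. card X = n}. ?h (card X)) = (\<Sum>X\<in>{X \<in> Pow ?I. card X = n}. ?h n)"
      by (rule sum.cong) auto
    also have "\<dots> = of_nat (card {X. X \<subseteq> ?I \<and> card X = n}) * ?h n"
      by (simp only: sum_constant Pow_iff mem_Collect_eq)
    also have "card {X. X \<subseteq> ?I \<and> card X = n} = k choose n"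
      using n_subsets[of ?I n] by simp
    finally show "(\<Sum>X\<in>{X \<in> Pow ?I. card X = n}. ?h (card X)) = of_nat (k choose n) * ?h n" .
  qed
  finally show ?thesis .
qed

text \<open>\<open>cross n m\<close> exchanges the odd position \<open>2 i + 1\<close> with the even position \<open>2 (n + i)\<close>, for \<open>i < m\<close>.\<close>

definition cross :: "nat \<Rightarrow> nat \<Rightarrow> nat \<Rightarrow> nat" where
  "cross n m a = (if odd a \<and> a < 2 * m then 2 * (n + a div 2)
     else if even a \<and> 2 * n \<le> a \<and> a < 2 * (n + m) then 2 * (a div 2 - n) + 1 else a)"

lemma cross_even: "cross n m (2 * c) = (if n \<le> c \<and> c < n + m then 2 * (c - n) + 1 else 2 * c)"
  by (simp add: cross_def)

lemma cross_odd: "cross n m (2 * c + 1) = (if c < m then 2 * (n + c) else 2 * c + 1)"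
  by (simp add: cross_def)

lemma transpose_odd_even:
  "Transposition.transpose (2 * b + 1) (2 * e) (2 * c) = (if c = e then 2 * b + 1 else 2 * c :: nat)"
  "Transposition.transpose (2 * b + 1) (2 * e) (2 * c + 1) = (if c = b then 2 * e else 2 * c + 1 :: nat)"
  by (auto simp: Transposition.transpose_def Suc_double_not_eq_double double_not_eq_Suc_double)

lemma cross_involution:
  assumes "m \<le> n"
  shows "cross n m (cross n m a) = a"
proof (cases "even a")
  case True
  then obtain c where "a = 2 * c" by blast
  then show ?thesis using assms by (simp only: cross_even cross_odd split: if_split) auto
next
  case False
  then obtain c where "a = 2 * c + 1" by (blast elim: oddE)
  then show ?thesis using assms by (simp only: cross_even cross_odd split: if_split) auto
qed

lemma cross_permutes_sign:
  "m \<le> n \<Longrightarrow> m \<le> l \<Longrightarrow> cross n m permutes {0..<2 * (n + l)} \<and> sign (cross n m) = (- 1) ^ m"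
proof (induction m)
  case 0
  have "cross n 0 = id" by (auto simp: cross_def fun_eq_iff)
  then show ?case using permutes_id sign_id by (metis power_0)
next
  case (Suc m)
  have e: "cross n (Suc m) = Transposition.transpose (2 * m + 1) (2 * (n + m)) \<circ> cross n m"
  proof
    fix a
    show "cross n (Suc m) a = (Transposition.transpose (2 * m + 1) (2 * (n + m)) \<circ> cross n m) a"
    proof (cases "even a")
      case True
      then obtain c where c: "a = 2 * c" by blast
      have "c - n = m \<longleftrightarrow> c = n + m" if "n \<le> c" using that by auto
      then show ?thesis using Suc.prems
        by (simp only: c o_apply cross_even transpose_odd_even if_distrib[of "Transposition.transpose (2 * m + 1) (2 * (n + m))"]) auto
    next
      case False
      then obtain c where c: "a = 2 * c + 1" by (blast elim: oddE)
      then show ?thesis using Suc.prems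
        by (simp only: c o_apply cross_odd transpose_odd_even if_distrib[of "Transposition.transpose (2 * m + 1) (2 * (n + m))"]) auto
    qed
  qed
  have t: "Transposition.transpose (2 * m + 1) (2 * (n + m)) permutes {0..<2 * (n + l)}"
    using Suc.prems by (intro permutes_swap_id) auto
  have ne: "2 * m + 1 \<noteq> 2 * (n + m)" by (simp add: Suc_double_not_eq_double)
  have i: "cross n m permutes {0..<2 * (n + l)}" "sign (cross n m) = (- 1) ^ m" using Suc by auto
  have "sign (Transposition.transpose (2 * m + 1) (2 * (n + m)) \<circ> cross n m) = (- 1) ^ Suc m"
    unfolding sign_compose_less[OF t i(1)] i(2) sign_swap_id using ne by simp
  then show ?case unfolding e using permutes_compose[OF i(1) t] by blast
qed

text \<open>The position whose image under \<open>cross n m\<close> is the odd position of the point \<open>t\<close>.\<close>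

definition slot :: "nat \<Rightarrow> nat \<Rightarrow> nat \<Rightarrow> nat" where
  "slot n m t = (if t < m then 2 * (n + t) else 2 * t + 1)"

lemma slot_image:
  assumes "m \<le> n"
  shows "slot n m ` ({0..<m} \<union> {n..<n + m}) = {2 * n..<2 * (n + m)}"
proof (intro equalityI subsetI)
  fix a assume "a \<in> {2 * n..<2 * (n + m)}"
  then show "a \<in> slot n m ` ({0..<m} \<union> {n..<n + m})"
  proof (cases "even a")
    case True
    then obtain c where c: "a = 2 * c" by blast
    then have "c - n \<in> {0..<m} \<union> {n..<n + m}" "slot n m (c - n) = a"
      using \<open>a \<in> _\<close> by (auto simp: slot_def)
    then show ?thesis by blast
  next
    case False
    then obtain c where c: "a = 2 * c + 1" by (blast elim: oddE)
    then have "c \<in> {0..<m} \<union> {n..<n + m}" "slot n m c = a"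
      using \<open>a \<in> _\<close> assms by (auto simp: slot_def)
    then show ?thesis by blast
  qed
qed (use assms in \<open>auto simp: slot_def split: if_splits\<close>)

text \<open>A sum over all permutations which is carried by those sending the last \<open>2 m\<close> positions to odd
  positions, and which does not depend on the labelling of the points, reduces to the permutations
  extending a fixed choice on these positions.\<close>

lemma sum_permutations_odd_tail:
  fixes F :: "(nat \<Rightarrow> nat) \<Rightarrow> complex"
  assumes inv: "\<And>q p. q permutes {0..<n + m} \<Longrightarrow> p permutes {0..<2 * (n + m)} \<Longrightarrow> F (lift2 q \<circ> p) = F p"
    and odd: "\<And>p a. p permutes {0..<2 * (n + m)} \<Longrightarrow> 2 * n \<le> a \<Longrightarrow> a < 2 * (n + m) \<Longrightarrow> even (p a) \<Longrightarrow> F p = 0"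
  shows "(\<Sum>p | p permutes {0..<2 * (n + m)}. of_int (sign p) * F p) =
    (if m \<le> n then fact (n + m) / fact (n - m) * (- 1) ^ m *
      (\<Sum>\<sigma> | \<sigma> permutes {0..<2 * n}. of_int (sign \<sigma>) * F (cross n m \<circ> \<sigma>)) else 0)"
proof -
  define k where "k = n + m"
  let ?P = "{p. p permutes {0..<2 * k}}"
  let ?Podd = "{p \<in> ?P. \<forall>a\<in>{2 * n..<2 * k}. odd (p a)}"
  let ?f = "\<lambda>p. of_int (sign p) * F p"
  note inv = inv[folded k_def] and odd = odd[folded k_def]
  have red: "(\<Sum>p\<in>?P. ?f p) = (\<Sum>p\<in>?Podd. ?f p)"
    by (rule sum.mono_neutral_right) (auto simp: finite_permutations intro: odd)
  show ?thesis
  proof (cases "m \<le> n")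
    case False
    \<comment> \<open>The tail has \<open>2 * m\<close> positions, more than the
      \<open>n + m\<close> odd positions available when \<open>m > n\<close>.\<close>
    have "?Podd = {}"
    proof (rule ccontr)
      assume "?Podd \<noteq> {}"
      then obtain p where p: "p permutes {0..<2 * k}" "\<forall>a\<in>{2 * n..<2 * k}. odd (p a)" by blast
      have "(\<lambda>a. p a div 2) ` {2 * n..<2 * k} \<subseteq> {0..<k}"
      proof (rule image_subsetI)
        fix a assume "a \<in> {2 * n..<2 * k}"
        then have "p a < 2 * k" using permutes_less[OF p(1), of a] by auto
        then show "p a div 2 \<in> {0..<k}" by auto
      qed
      moreover have "inj_on (\<lambda>a. p a div 2) {2 * n..<2 * k}"
      proof (rule inj_onI)
        fix a b assume "a \<in> {2 * n..<2 * k}" "b \<in> {2 * n..<2 * k}" "p a div 2 = p b div 2"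
        then have "p a = p b" using p(2) by (metis odd_two_times_div_two_succ)
        then show "a = b" using permutes_inj[OF p(1)] by (simp add: inj_eq)
      qed
      ultimately have "card {2 * n..<2 * k} \<le> card {0..<k}"
        by (metis card_image card_mono finite_atLeastLessThan)
      then show False using False by (simp add: k_def)
    qed
    then show ?thesis using red False by (simp only: k_def[symmetric] if_False sum.empty)
  next
    case True
    let ?S = "{q. q permutes {0..<k}}" and ?T = "{0..<m} \<union> {n..<k}"
    let ?s = "slot n m"
    \<comment> \<open>Normal form: the slot of the point \<open>t\<close> is sent to the odd
      position of \<open>t\<close> itself.\<close>
    let ?Pc = "{p \<in> ?P. \<forall>t\<in>?T. p (?s t) = 2 * t + 1}"
    let ?Q = "\<lambda>p. {q. q permutes {0..<k} \<and> (\<forall>t\<in>?T. q t = p (?s t) div 2)}"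
    have sT: "?s ` ?T = {2 * n..<2 * k}" using slot_image[OF True] by (simp add: k_def)
    have sinj: "inj_on ?s ?T"
      using True by (intro inj_onI, auto simp: slot_def split: if_splits) presburger+
    have Podd: "p \<in> ?Podd \<longleftrightarrow> p permutes {0..<2 * k} \<and> (\<forall>t\<in>?T. odd (p (?s t)))" for p
      unfolding sT[symmetric] by auto
    have cardQ: "card (?Q p) = fact (n - m)" if p: "p \<in> ?Podd" for p
    proof -
      have p': "p permutes {0..<2 * k}" "\<And>t. t \<in> ?T \<Longrightarrow> odd (p (?s t))" using p Podd by auto
      have "card (?Q p) = fact (card {0..<k} - card ?T)"
      proof (rule card_permutations_prescribed)
        show "(\<lambda>t. p (?s t) div 2) ` ?T \<subseteq> {0..<k}"
        proof (rule image_subsetI)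
          fix t assume "t \<in> ?T"
          then have "?s t < 2 * k" using sT by (metis atLeastLessThan_iff imageI)
          then have "p (?s t) < 2 * k" using permutes_less[OF p'(1)] by simp
          then show "p (?s t) div 2 \<in> {0..<k}" by auto
        qed
        show "inj_on (\<lambda>t. p (?s t) div 2) ?T"
        proof (rule inj_onI)
          fix t u assume tu: "t \<in> ?T" "u \<in> ?T" "p (?s t) div 2 = p (?s u) div 2"
          then have "p (?s t) = p (?s u)" using p'(2) by (metis odd_two_times_div_two_succ)
          then have "?s t = ?s u" using permutes_inj[OF p'(1)] by (simp add: inj_eq)
          then show "t = u" using sinj tu by (auto dest: inj_onD)
        qed
      qed (auto simp: k_def)
      moreover have "card ?T = m + m" using True by (subst card_Un_disjoint) (auto simp: k_def)
      ultimately show ?thesis using True by (simp add: k_def)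
    qed
    have finP: "finite ?P" and finS: "finite ?S" by (auto intro: finite_permutations)
    have cS: "card ?S = fact k" by (rule card_permutations) auto
    \<comment> \<open>Double counting of pairs of a relabelling and a permutation in normal form. A
      surviving permutation fixes the relabelling on the \<open>2 * m\<close> points of
      \<open>?T\<close>, so it arises from \<open>fact (n - m)\<close> of them.\<close>
    have "fact k * (\<Sum>p\<in>?Pc. ?f p) = (\<Sum>q\<in>?S. \<Sum>p\<in>?Pc. ?f p)"
      by (simp only: sum_constant cS of_nat_fact)
    also have "\<dots> = (\<Sum>(q, p)\<in>?S \<times> ?Pc. ?f p)"
      by (rule sum.cartesian_product)
    also have "\<dots> = (\<Sum>(p, q)\<in>Sigma ?Podd ?Q. ?f p)"
    proof (rule sum.reindex_bij_witness[of _ "\<lambda>(p, q). (q, lift2 (inv_into UNIV q) \<circ> p)" "\<lambda>(q, p). (lift2 q \<circ> p, q)"], goal_cases)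
      case (1 x)
      obtain q p where xe: "x = (q, p)" by (cases x)
      then have x: "x = (q, p)" "q permutes {0..<k}" using 1 by (auto simp only: mem_Sigma_iff mem_Collect_eq)
      have "lift2 (inv_into UNIV q) (lift2 q a) = a" for a
        using permutes_inverses(2)[OF x(2)] by (simp add: lift2_def)
      then show ?case by (simp add: x(1) o_def)
    next
      case (2 x)
      obtain q p where xe: "x = (q, p)" by (cases x)
      have "q permutes {0..<k} \<and> p \<in> ?Pc" using 2 unfolding xe by (auto simp only: mem_Sigma_iff mem_Collect_eq)
      then have x: "x = (q, p)" "q permutes {0..<k}" "p permutes {0..<2 * k}"
        "\<And>t. t \<in> ?T \<Longrightarrow> p (?s t) = 2 * t + 1" using xe by blast+
      have l: "lift2 q (p (?s t)) = 2 * q t + 1" if "t \<in> ?T" for t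
        by (simp only: x(4)[OF that]) (simp add: lift2_def)
      have "lift2 q \<circ> p \<in> ?Podd"
        unfolding Podd using permutes_compose[OF x(3) lift2_permutes[OF x(2)]] l by simp
      moreover have "q \<in> ?Q (lift2 q \<circ> p)" using x(2) l by simp
      ultimately show ?case by (simp only: x(1) prod.case mem_Sigma_iff)
    next
      case (3 x)
      obtain p q where xe: "x = (p, q)" by (cases x)
      then have x: "x = (p, q)" "q permutes {0..<k}" using 3 by (auto simp only: mem_Sigma_iff mem_Collect_eq)
      have "lift2 q (lift2 (inv_into UNIV q) a) = a" for a
        using permutes_inverses(1)[OF x(2)] by (simp add: lift2_def)
      then show ?case by (simp add: x(1) o_def)
    next
      case (4 x)
      obtain p q where xe: "x = (p, q)" by (cases x)
      then have x: "x = (p, q)" "p \<in> ?Podd" "q \<in> ?Q p" using 4 by (auto simp only: mem_Sigma_iff)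
      then have q: "q permutes {0..<k}" "\<And>t. t \<in> ?T \<Longrightarrow> q t = p (?s t) div 2" by blast+
      have p: "p permutes {0..<2 * k}" "\<And>t. t \<in> ?T \<Longrightarrow> odd (p (?s t))" using x(2) Podd by blast+
      have "lift2 (inv_into UNIV q) (p (?s t)) = 2 * t + 1" if t: "t \<in> ?T" for t
      proof -
        have "inv_into UNIV q (p (?s t) div 2) = t" using q(2)[OF t] permutes_inverses(2)[OF q(1)] by metis
        then show ?thesis using p(2)[OF t] by (simp add: lift2_def mod_2_eq_odd)
      qed
      then have "lift2 (inv_into UNIV q) \<circ> p \<in> ?Pc"
        using permutes_compose[OF p(1) lift2_permutes[OF permutes_inv[OF q(1)]]] by simp
      then show ?case using q(1) unfolding x(1) by (auto simp only: prod.case mem_Sigma_iff mem_Collect_eq)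
    next
      case (5 x)
      obtain q p where xe: "x = (q, p)" by (cases x)
      have "q permutes {0..<k} \<and> p \<in> ?Pc" using 5 unfolding xe by (auto simp only: mem_Sigma_iff mem_Collect_eq)
      then have x: "x = (q, p)" "q permutes {0..<k}" "p permutes {0..<2 * k}" using xe by blast+
      have "sign (lift2 q \<circ> p) = sign p"
        using sign_compose_less[OF lift2_permutes[OF x(2)] x(3)] sign_lift2[OF x(2)] by simp
      then show ?case using inv[OF x(2,3)] by (simp only: x(1) prod.case)
    qed
    also have "\<dots> = (\<Sum>p\<in>?Podd. \<Sum>q\<in>?Q p. ?f p)"
    proof (rule sum.Sigma[symmetric])
      show "finite ?Podd" by (rule finite_subset[OF _ finP]) blast
      show "\<forall>p\<in>?Podd. finite (?Q p)" by (intro ballI, rule finite_subset[OF _ finS]) blast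
    qed
    also have "\<dots> = (\<Sum>p\<in>?Podd. fact (n - m) * ?f p)"
      by (rule sum.cong[OF refl]) (simp only: sum_constant cardQ of_nat_fact)
    also have "\<dots> = fact (n - m) * (\<Sum>p\<in>?P. ?f p)"
      unfolding red by (simp only: sum_distrib_left)
    finally have main: "fact k * (\<Sum>p\<in>?Pc. ?f p) = fact (n - m) * (\<Sum>p\<in>?P. ?f p)" .
    have c: "cross n m permutes {0..<2 * k}" "sign (cross n m) = (- 1) ^ m"
      using cross_permutes_sign[OF True, of m] by (auto simp: k_def)
    have cs: "cross n m (?s t) = 2 * t + 1" "cross n m (2 * t + 1) = ?s t" if "t \<in> ?T" for t
    proof (atomize (full), cases "t < m")
      case True
      then show "cross n m (?s t) = 2 * t + 1 \<and> cross n m (2 * t + 1) = ?s t"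
        using cross_even[of n m "n + t"] cross_odd[of n m t] by (simp add: slot_def)
    next
      case False
      then show "cross n m (?s t) = 2 * t + 1 \<and> cross n m (2 * t + 1) = ?s t"
        using cross_odd[of n m t] by (simp add: slot_def)
    qed
    have cc: "cross n m (cross n m a) = a" for a by (rule cross_involution[OF True])
    \<comment> \<open>Composition with the involution \<open>cross n m\<close> makes a permutation
      in normal form fix the whole tail, that is, a permutation of the first \<open>2 * n\<close>
      positions.\<close>
    have "(\<Sum>p\<in>?Pc. ?f p) = (\<Sum>\<sigma> | \<sigma> permutes {0..<2 * n}. (- 1) ^ m * (of_int (sign \<sigma>) * F (cross n m \<circ> \<sigma>)))"
    proof (rule sum.reindex_bij_witness[of _ "\<lambda>\<sigma>. cross n m \<circ> \<sigma>" "\<lambda>p. cross n m \<circ> p"], goal_cases)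
      case (1 p) show ?case by (simp add: o_def cc)
    next
      case (2 p)
      then have p: "p permutes {0..<2 * k}" "\<And>t. t \<in> ?T \<Longrightarrow> p (?s t) = 2 * t + 1" by blast+
      have "cross n m \<circ> p permutes {0..<2 * n}"
      proof (rule permutes_superset[OF permutes_compose[OF p(1) c(1)]])
        fix a assume "a \<in> {0..<2 * k} - {0..<2 * n}"
        then have "a \<in> ?s ` ?T" unfolding sT by auto
        then obtain t where t: "t \<in> ?T" "a = ?s t" by blast
        show "(cross n m \<circ> p) a = a" by (simp only: o_apply t(2) p(2)[OF t(1)] cs(2)[OF t(1)])
      qed
      then show ?case by simp
    next
      case (3 \<sigma>) show ?case by (simp add: o_def cc)
    next
      case (4 \<sigma>)
      then have s: "\<sigma> permutes {0..<2 * n}" by simp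
      have "\<sigma> permutes {0..<2 * k}" by (rule permutes_subset[OF s]) (auto simp: k_def)
      then have "cross n m \<circ> \<sigma> permutes {0..<2 * k}" using c(1) by (rule permutes_compose)
      moreover have "(cross n m \<circ> \<sigma>) (?s t) = 2 * t + 1" if t: "t \<in> ?T" for t
      proof -
        have "?s t \<in> {2 * n..<2 * k}" using t sT by blast
        then have "\<sigma> (?s t) = ?s t" using s by (auto simp: permutes_def)
        then show ?thesis by (simp only: o_apply cs(1)[OF t])
      qed
      ultimately show ?case by blast
    next
      case (5 p)
      then have p: "p permutes {0..<2 * k}" by blast
      have "sign (cross n m \<circ> p) = (- 1) ^ m * sign p"
        using sign_compose_less[OF c(1) p] c(2) by simp
      moreover have "(- 1 :: complex) ^ m * (- 1) ^ m = 1" by (simp flip: power_add mult_2)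
      moreover have "cross n m \<circ> (cross n m \<circ> p) = p" by (simp add: o_def cc fun_eq_iff)
      ultimately show ?case by (simp add: mult.assoc[symmetric] del: o_apply)
    qed
    then have "fact k * ((- 1) ^ m * (\<Sum>\<sigma> | \<sigma> permutes {0..<2 * n}. of_int (sign \<sigma>) * F (cross n m \<circ> \<sigma>)))
        = fact (n - m) * (\<Sum>p\<in>?P. ?f p)"
      using main by (simp only: sum_distrib_left)
    then show ?thesis using True by (simp only: k_def[symmetric] if_True) (simp add: field_simps)
  qed
qed

section \<open>Integrals over cubes: bounds, symmetry and dominated convergence\<close>

abbreviation cubeM :: "nat \<Rightarrow> (nat \<Rightarrow> real) measure" where
  "cubeM k \<equiv> \<Pi>\<^sub>M i\<in>{0..<k}. lborel"

abbreviation cube :: "nat \<Rightarrow> real \<Rightarrow> (nat \<Rightarrow> real) set" where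
  "cube k x \<equiv> \<Pi>\<^sub>E i\<in>{0..<k}. {x<..}"

lemma product_sigma_finite_lborel: "product_sigma_finite (\<lambda>i :: nat. lborel :: real measure)"
  by unfold_locales

lemma cube_sets [measurable]: "cube k x \<in> sets (cubeM k)"
  by (rule sets_PiM_I_finite) auto

lemma cube_less: "xs \<in> cube k x \<Longrightarrow> i < k \<Longrightarrow> x < xs i"
  by (auto simp: PiE_def Pi_def)

lemma indicator_cube: "xs \<in> space (cubeM k) \<Longrightarrow> indicator (cube k x) xs = (\<Prod>i\<in>{0..<k}. indicator {x<..} (xs i) :: real)"
  by (auto simp: space_PiM PiE_def Pi_def indicator_def prod.If_cases split: if_splits)

lemma nn_integral_exp_tail:
  assumes "0 < c"
  shows "(\<integral>\<^sup>+ t. ennreal (exp (- c * t)) * indicator {x..} t \<partial>lborel) = ennreal (exp (- c * x) / c)"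
proof -
  have "(\<integral>\<^sup>+ t. ennreal (exp (- c * t)) * indicator {x..} t \<partial>lborel) = ennreal (0 - (- exp (- c * x) / c))"
  proof (rule nn_integral_FTC_atLeast[where F = "\<lambda>t. - exp (- c * t) / c"])
    show "((\<lambda>t. - exp (- c * t) / c) has_real_derivative exp (- c * t)) (at t)" for t
      using assms by (auto intro!: derivative_eq_intros)
    show "((\<lambda>t. - exp (- c * t) / c) \<longlongrightarrow> 0) at_top"
      using assms by real_asymp
  qed auto
  then show ?thesis by simp
qed

lemma exp_tail:
  assumes "0 < c"
  shows "integrable lborel (\<lambda>t :: real. indicator {x<..} t * exp (- c * t))"
    and "(\<integral>t. indicator {x<..} t * exp (- c * t) \<partial>lborel) = exp (- c * x) / c"
proof -
  have "(\<integral>\<^sup>+ t. ennreal (indicator {x<..} t * exp (- c * t)) \<partial>lborel)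
      = (\<integral>\<^sup>+ t. ennreal (exp (- c * t)) * indicator {x..} t \<partial>lborel)"
    by (rule nn_integral_cong_AE) (use AE_lborel_singleton[of x] in \<open>eventually_elim, auto simp: indicator_def\<close>)
  then have "has_bochner_integral lborel (\<lambda>t. indicator {x<..} t * exp (- c * t)) (exp (- c * x) / c)"
    using assms nn_integral_exp_tail[OF assms, of x] by (intro has_bochner_integral_nn_integral) auto
  then show "integrable lborel (\<lambda>t. indicator {x<..} t * exp (- c * t))"
    "(\<integral>t. indicator {x<..} t * exp (- c * t) \<partial>lborel) = exp (- c * x) / c"
    by (auto simp: has_bochner_integral_iff)
qed

lemma cube_exp:
  assumes "0 < c"
  shows "set_integrable (cubeM k) (cube k x) (\<lambda>xs. \<Prod>i<k. exp (- c * xs i))"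
    and "(LINT xs:cube k x|cubeM k. \<Prod>i<k. exp (- c * xs i)) = (exp (- c * x) / c) ^ k"
proof -
  interpret product_sigma_finite "\<lambda>i :: nat. lborel :: real measure"
    by (rule product_sigma_finite_lborel)
  have eq: "indicator (cube k x) xs *\<^sub>R (\<Prod>i<k. exp (- c * xs i))
      = (\<Prod>i\<in>{0..<k}. indicator {x<..} (xs i) * exp (- c * xs i))" if "xs \<in> space (cubeM k)" for xs
    using indicator_cube[OF that] by (simp add: prod.distrib lessThan_atLeast0)
  show "set_integrable (cubeM k) (cube k x) (\<lambda>xs. \<Prod>i<k. exp (- c * xs i))"
    unfolding set_integrable_def
    by (subst Bochner_Integration.integrable_cong[OF refl eq], assumption,
        rule product_integrable_prod) (use exp_tail[OF assms] in auto)
  show "(LINT xs:cube k x|cubeM k. \<Prod>i<k. exp (- c * xs i)) = (exp (- c * x) / c) ^ k"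
    unfolding set_lebesgue_integral_def
    by (subst Bochner_Integration.integral_cong[OF refl eq], assumption,
        subst product_integral_prod) (use exp_tail[OF assms] in auto)
qed

lemma set_integrable_cube_bound:
  fixes f :: "(nat \<Rightarrow> real) \<Rightarrow> complex"
  assumes "f \<in> borel_measurable (cubeM k)" "0 < c"
    and "\<And>xs. xs \<in> cube k x \<Longrightarrow> cmod (f xs) \<le> D * (\<Prod>i<k. exp (- c * xs i))"
  shows "set_integrable (cubeM k) (cube k x) f"
proof (rule set_integrable_bound)
  show "set_integrable (cubeM k) (cube k x) (\<lambda>xs. D * (\<Prod>i<k. exp (- c * xs i)))"
    using cube_exp(1)[OF assms(2)] by (rule set_integrable_mult_right)
  show "set_borel_measurable (cubeM k) (cube k x) f"
    unfolding set_borel_measurable_def using assms(1) by measurable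
  show "AE xs in cubeM k. xs \<in> cube k x \<longrightarrow> norm (f xs) \<le> norm (D * (\<Prod>i<k. exp (- c * xs i)))"
    using assms(3) by (intro AE_I2 impI) (metis order.trans abs_ge_self real_norm_def)
qed

lemma cube_cong: "(\<And>xs. xs \<in> cube k x \<Longrightarrow> f xs = g xs) \<Longrightarrow> integral_over_cube k x f = integral_over_cube k x g"
  unfolding integral_over_cube_def set_lebesgue_integral_def
  by (rule Bochner_Integration.integral_cong) (auto simp: indicator_def)

lemma cube_norm_le:
  assumes "f \<in> borel_measurable (cubeM k)" "0 < c"
    and "\<And>xs. xs \<in> cube k x \<Longrightarrow> cmod (f xs) \<le> D * (\<Prod>i<k. exp (- c * xs i))"
  shows "cmod (integral_over_cube k x f) \<le> D * (exp (- c * x) / c) ^ k"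
proof -
  have "cmod (integral_over_cube k x f) \<le> (LINT xs:cube k x|cubeM k. D * (\<Prod>i<k. exp (- c * xs i)))"
    unfolding integral_over_cube_def set_lebesgue_integral_def
    using set_integrable_cube_bound[OF assms] cube_exp(1)[OF assms(2), of k x, THEN set_integrable_mult_right, of D] assms(3)
    by (intro order.trans[OF integral_norm_bound] integral_mono integrable_norm)
       (auto simp: set_integrable_def indicator_def)
  then show ?thesis unfolding cube_exp(2)[OF assms(2), symmetric] by simp
qed

lemma measurable_permute_coordinates:
  assumes "q permutes {0..<k}"
  shows "(\<lambda>xs. xs \<circ> q) \<in> measurable (cubeM k) (cubeM k)"
proof -
  have "(\<lambda>xs i. xs (q i)) \<in> measurable (cubeM k) (cubeM k)"
  proof (rule measurable_PiM_single'[where f = "\<lambda>i xs. xs (q i)"])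
    show "(\<lambda>xs. xs (q i)) \<in> measurable (cubeM k) lborel" if "i \<in> {0..<k}" for i
      using that permutes_in_image[OF assms, of i] by auto
    show "(\<lambda>xs i. xs (q i)) \<in> space (cubeM k) \<rightarrow> (\<Pi>\<^sub>E i\<in>{0..<k}. space lborel)"
      using assms by (auto simp: space_PiM PiE_def extensional_def permutes_def)
  qed
  then show ?thesis by (simp add: o_def)
qed

lemma distr_permute_coordinates:
  assumes q: "q permutes {0..<k}"
  shows "distr (cubeM k) (cubeM k) (\<lambda>xs. xs \<circ> q) = cubeM k"
proof -
  interpret product_sigma_finite "\<lambda>i :: nat. lborel :: real measure"
    by (rule product_sigma_finite_lborel)
  let ?r = "inv_into UNIV q"
  have r: "?r permutes {0..<k}" using q by (rule permutes_inv)
  show ?thesis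
  proof (rule PiM_eqI)
    fix A :: "nat \<Rightarrow> real set" assume A: "\<And>i. i \<in> {0..<k} \<Longrightarrow> A i \<in> sets lborel"
    have "(\<lambda>xs. xs \<circ> q) -` Pi\<^sub>E {0..<k} A \<inter> space (cubeM k) = Pi\<^sub>E {0..<k} (\<lambda>i. A (?r i))"
    proof (rule Set.set_eqI)
      fix xs :: "nat \<Rightarrow> real"
      have "(\<forall>i\<in>{0..<k}. xs (q i) \<in> A i) \<longleftrightarrow> (\<forall>i\<in>{0..<k}. xs i \<in> A (?r i))"
        using permutes_inverses[OF q] permutes_in_image[OF q] permutes_in_image[OF r] by metis
      moreover have "xs \<in> extensional {0..<k} \<Longrightarrow> xs \<circ> q \<in> extensional {0..<k}"
        using q by (auto simp: extensional_def permutes_def)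
      ultimately show "xs \<in> (\<lambda>xs. xs \<circ> q) -` Pi\<^sub>E {0..<k} A \<inter> space (cubeM k) \<longleftrightarrow> xs \<in> Pi\<^sub>E {0..<k} (\<lambda>i. A (?r i))"
        by (auto simp: space_PiM PiE_iff)
    qed
    then have "emeasure (distr (cubeM k) (cubeM k) (\<lambda>xs. xs \<circ> q)) (Pi\<^sub>E {0..<k} A) = emeasure (cubeM k) (Pi\<^sub>E {0..<k} (\<lambda>i. A (?r i)))"
      using A by (subst emeasure_distr[OF measurable_permute_coordinates[OF q]]) (auto intro!: sets_PiM_I_finite)
    also have "\<dots> = (\<Prod>i\<in>{0..<k}. emeasure lborel (A (?r i)))"
      using A permutes_in_image[OF r] by (intro emeasure_PiM) auto
    also have "\<dots> = (\<Prod>i\<in>{0..<k}. emeasure lborel (A i))"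
      using prod.permute[OF r, of "\<lambda>i. emeasure lborel (A i)"] by (simp add: o_def)
    finally show "emeasure (distr (cubeM k) (cubeM k) (\<lambda>xs. xs \<circ> q)) (Pi\<^sub>E {0..<k} A) = (\<Prod>i\<in>{0..<k}. emeasure lborel (A i))" .
  qed auto
qed

lemma cube_permute:
  assumes q: "q permutes {0..<k}" and f: "f \<in> borel_measurable (cubeM k)"
  shows "integral_over_cube k x (\<lambda>xs. f (xs \<circ> q)) = integral_over_cube k x f"
proof -
  have ind: "indicator (cube k x) xs = (indicator (cube k x) (xs \<circ> q) :: real)" if "xs \<in> space (cubeM k)" for xs
  proof -
    have "(\<forall>i\<in>{0..<k}. x < xs (q i)) \<longleftrightarrow> (\<forall>i\<in>{0..<k}. x < xs i)"
      using permutes_inverses[OF q] permutes_in_image[OF q] permutes_in_image[OF permutes_inv[OF q]] by metis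
    moreover have "xs \<circ> q \<in> extensional {0..<k}"
      using that q by (auto simp: extensional_def permutes_def space_PiM PiE_def)
    ultimately show ?thesis using that by (auto simp: indicator_def space_PiM PiE_iff)
  qed
  have "integral_over_cube k x (\<lambda>xs. f (xs \<circ> q)) = (\<integral>xs. (\<lambda>xs. indicator (cube k x) xs *\<^sub>R f xs) (xs \<circ> q) \<partial>cubeM k)"
    unfolding integral_over_cube_def set_lebesgue_integral_def
    by (rule Bochner_Integration.integral_cong[OF refl]) (simp add: ind)
  also have "\<dots> = (\<integral>xs. indicator (cube k x) xs *\<^sub>R f xs \<partial>distr (cubeM k) (cubeM k) (\<lambda>xs. xs \<circ> q))"
    by (rule integral_distr[symmetric, OF measurable_permute_coordinates[OF q]]) (use f in measurable)
  finally show ?thesis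
    unfolding distr_permute_coordinates[OF q] integral_over_cube_def set_lebesgue_integral_def .
qed

lemma pf_measurable:
  assumes "\<And>a b. a < 2 * n \<Longrightarrow> b < 2 * n \<Longrightarrow> (\<lambda>xs. A xs a b) \<in> borel_measurable M"
  shows "(\<lambda>xs. pf n (A xs)) \<in> borel_measurable M"
  unfolding pf_def
proof (intro borel_measurable_times borel_measurable_const borel_measurable_sum borel_measurable_prod)
  fix p i assume "p \<in> {p. p permutes {0..<2 * n}}" "i \<in> {0..<n}"
  then show "(\<lambda>xs. A xs (p (2 * i)) (p (2 * i + 1))) \<in> borel_measurable M"
    by (intro assms) (auto simp: permutes_less)
qed

text \<open>\<open>C\<close> is split into \<open>sqrt C\<close> per position; the two positions of
  a point together give the factor \<open>exp (- 2 * xs i)\<close>, which is integrable over the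
  cube.\<close>

lemma pf_cube_bound:
  assumes C: "0 < C"
    and bound: "\<And>a b. a < 2 * n \<Longrightarrow> b < 2 * n \<Longrightarrow> cmod (A a b) \<le> C * exp (- xs (a div 2)) * exp (- xs (b div 2))"
  shows "cmod (pf n A) \<le> pf_const n * C ^ n * (\<Prod>i<n. exp (- 2 * xs i))"
proof -
  have "cmod (pf n A) \<le> pf_const n * (\<Prod>a<2 * n. sqrt C * exp (- xs (a div 2)))"
  proof (rule pf_bound)
    fix a b assume "a < 2 * n" "b < 2 * n"
    then have "cmod (A a b) \<le> C * exp (- xs (a div 2)) * exp (- xs (b div 2))" by (rule bound)
    also have "\<dots> = sqrt C * exp (- xs (a div 2)) * (sqrt C * exp (- xs (b div 2)))"
      using C by (simp add: mult_ac flip: real_sqrt_mult)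
    finally show "cmod (A a b) \<le> sqrt C * exp (- xs (a div 2)) * (sqrt C * exp (- xs (b div 2)))" .
  qed (use C in auto)
  also have "(\<Prod>a<2 * n. sqrt C * exp (- xs (a div 2))) = (\<Prod>i = 0..<n. C * exp (- 2 * xs i))"
    unfolding prod_pairs
  proof (rule prod.cong[OF refl])
    fix i :: nat
    have d: "2 * i div 2 = i" "(2 * i + 1) div 2 = i" by auto
    have "sqrt C * exp (- xs i) * (sqrt C * exp (- xs i)) = (sqrt C * sqrt C) * (exp (- xs i) * exp (- xs i))"
      by (simp only: mult_ac)
    also have "sqrt C * sqrt C = C" using C by simp
    also have "exp (- xs i) * exp (- xs i) = exp (- 2 * xs i)" by (simp flip: exp_add)
    finally show "sqrt C * exp (- xs (2 * i div 2)) * (sqrt C * exp (- xs ((2 * i + 1) div 2))) = C * exp (- 2 * xs i)"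
      unfolding d .
  qed
  also have "\<dots> = C ^ n * (\<Prod>i<n. exp (- 2 * xs i))"
    by (simp add: prod.distrib lessThan_atLeast0)
  finally show ?thesis by (simp add: mult.assoc)
qed

lemma pf_cube_integral_bound:
  assumes "0 < C"
    and "\<And>a b. a < 2 * k \<Longrightarrow> b < 2 * k \<Longrightarrow> (\<lambda>xs. A xs a b) \<in> borel_measurable (cubeM k)"
    and "\<And>xs a b. xs \<in> cube k x \<Longrightarrow> a < 2 * k \<Longrightarrow> b < 2 * k \<Longrightarrow>
      cmod (A xs a b) \<le> C * exp (- xs (a div 2)) * exp (- xs (b div 2))"
  shows "cmod (integral_over_cube k x (\<lambda>xs. pf k (A xs))) \<le> pf_const k * (C * exp (- 2 * x) / 2) ^ k"
proof -
  have "cmod (integral_over_cube k x (\<lambda>xs. pf k (A xs))) \<le> pf_const k * C ^ k * (exp (- 2 * x) / 2) ^ k"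
    using assms by (intro cube_norm_le pf_measurable pf_cube_bound) auto
  then show ?thesis by (simp add: power_mult_distrib power_divide)
qed

lemma pf_cube_tendsto:
  assumes C: "0 < C"
    and meas: "\<And>s a b. a < 2 * k \<Longrightarrow> b < 2 * k \<Longrightarrow> (\<lambda>xs. A s xs a b) \<in> borel_measurable (cubeM k)"
    and meas': "\<And>a b. a < 2 * k \<Longrightarrow> b < 2 * k \<Longrightarrow> (\<lambda>xs. B xs a b) \<in> borel_measurable (cubeM k)"
    and bound: "\<And>s xs a b. xs \<in> cube k x \<Longrightarrow> a < 2 * k \<Longrightarrow> b < 2 * k \<Longrightarrow>
      cmod (A s xs a b) \<le> C * exp (- xs (a div 2)) * exp (- xs (b div 2))"
    and lim: "\<And>xs a b. xs \<in> cube k x \<Longrightarrow> a < 2 * k \<Longrightarrow> b < 2 * k \<Longrightarrow> (\<lambda>s. A s xs a b) \<longlonglongrightarrow> B xs a b"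
  shows "(\<lambda>s. integral_over_cube k x (\<lambda>xs. pf k (A s xs))) \<longlonglongrightarrow> integral_over_cube k x (\<lambda>xs. pf k (B xs))"
  unfolding integral_over_cube_def set_lebesgue_integral_def
proof (rule integral_dominated_convergence)
  let ?w = "\<lambda>xs. indicator (cube k x) xs *\<^sub>R (pf_const k * C ^ k * (\<Prod>i<k. exp (- 2 * xs i)))"
  show "integrable (cubeM k) ?w"
    using cube_exp(1)[of 2 k x, THEN set_integrable_mult_right, of "pf_const k * C ^ k"]
    by (simp add: set_integrable_def)
  show "AE xs in cubeM k. norm (indicator (cube k x) xs *\<^sub>R pf k (A s xs)) \<le> ?w xs" for s
    using pf_cube_bound[OF C] bound by (intro AE_I2) (auto simp: indicator_def)
  show "AE xs in cubeM k. (\<lambda>s. indicator (cube k x) xs *\<^sub>R pf k (A s xs)) \<longlonglongrightarrow> indicator (cube k x) xs *\<^sub>R pf k (B xs)"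
  proof (rule AE_I2)
    fix xs
    show "(\<lambda>s. indicator (cube k x) xs *\<^sub>R pf k (A s xs)) \<longlonglongrightarrow> indicator (cube k x) xs *\<^sub>R pf k (B xs)"
    proof (cases "xs \<in> cube k x")
      case True
      then have "(\<lambda>s. pf k (A s xs)) \<longlonglongrightarrow> pf k (B xs)"
        unfolding pf_def
        by (intro tendsto_mult tendsto_const tendsto_sum tendsto_prod lim) (auto simp: permutes_less)
      then show ?thesis by (intro tendsto_scaleR tendsto_const)
    qed simp
  qed
  show "(\<lambda>xs. indicator (cube k x) xs *\<^sub>R pf k (B xs)) \<in> borel_measurable (cubeM k)"
    using pf_measurable[OF meas'] by measurable
  show "(\<lambda>xs. indicator (cube k x) xs *\<^sub>R pf k (A s xs)) \<in> borel_measurable (cubeM k)" for s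
    using pf_measurable[OF meas] by measurable
qed

section \<open>Pfaffian expansion and integration of rows\<close>

text \<open>The entries of \<open>block_matrix\<close> without its size, so that one function serves
  every number of points. Even and odd positions are the first and the second row of a
  point.\<close>

definition blk :: "(nat \<Rightarrow> nat \<Rightarrow> real \<Rightarrow> real \<Rightarrow> complex) \<Rightarrow> (nat \<Rightarrow> real) \<Rightarrow> nat \<Rightarrow> nat \<Rightarrow> complex" where
  "blk K xs a b = K (a mod 2 + 1) (b mod 2 + 1) (xs (a div 2)) (xs (b div 2))"

definition oddR :: "(real \<Rightarrow> real \<Rightarrow> complex) \<Rightarrow> (nat \<Rightarrow> real) \<Rightarrow> nat \<Rightarrow> nat \<Rightarrow> complex" where
  "oddR R xs a b = (if odd a \<and> odd b then R (xs (a div 2)) (xs (b div 2)) else 0)"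

lemma measurable_kernel_coordinates:
  fixes f :: "real \<Rightarrow> real \<Rightarrow> complex"
  assumes f: "(\<lambda>p. f (fst p) (snd p)) \<in> borel_measurable borel" and "i < k" "j < k"
  shows "(\<lambda>xs. f (xs i) (xs j)) \<in> borel_measurable (cubeM k)"
proof -
  have "(\<lambda>xs. (xs i, xs j)) \<in> measurable (cubeM k) (borel \<Otimes>\<^sub>M borel)"
    using assms(2,3) by (intro measurable_Pair) auto
  then have "(\<lambda>xs. (xs i, xs j)) \<in> measurable (cubeM k) borel" by (simp add: borel_prod)
  from measurable_compose[OF this f] show ?thesis by simp
qed

lemma cube_sum:
  assumes "finite P" "\<And>p. p \<in> P \<Longrightarrow> set_integrable (cubeM k) (cube k x) (f p)"
  shows "integral_over_cube k x (\<lambda>xs. \<Sum>p\<in>P. w p * f p xs) = (\<Sum>p\<in>P. w p * integral_over_cube k x (f p))"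
proof -
  have "integral_over_cube k x (\<lambda>xs. \<Sum>p\<in>P. w p * f p xs)
      = (\<integral>xs. (\<Sum>p\<in>P. w p * (indicator (cube k x) xs *\<^sub>R f p xs)) \<partial>cubeM k)"
    unfolding integral_over_cube_def set_lebesgue_integral_def
    by (intro Bochner_Integration.integral_cong) (auto simp: scaleR_sum_right)
  also have "\<dots> = (\<Sum>p\<in>P. \<integral>xs. w p * (indicator (cube k x) xs *\<^sub>R f p xs) \<partial>cubeM k)"
    using assms by (intro Bochner_Integration.integral_sum integrable_mult_right) (auto simp: set_integrable_def)
  finally show ?thesis
    by (simp only: integral_mult_right_zero integral_over_cube_def set_lebesgue_integral_def)
qed

lemma cube_mult: "integral_over_cube k x (\<lambda>xs. w * f xs) = w * integral_over_cube k x f"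
  unfolding integral_over_cube_def by simp

text \<open>Both parts decay exponentially, so the expansion in the number of factors
  \<open>R\<close> may be integrated term by term. Integration makes the points exchangeable, and
  this reduces each term to the arrangement in which \<open>R\<close> joins the points
  \<open>i\<close> and \<open>k - m + i\<close>. Every factor takes the second rows of two points,
  hence \<open>2 * m \<le> k\<close>.\<close>

lemma cube_pf_expansion:
  fixes K :: "nat \<Rightarrow> nat \<Rightarrow> real \<Rightarrow> real \<Rightarrow> complex" and R :: "real \<Rightarrow> real \<Rightarrow> complex"
  assumes Km: "\<And>i j. (\<lambda>p. K i j (fst p) (snd p)) \<in> borel_measurable borel"
    and Rm: "(\<lambda>p. R (fst p) (snd p)) \<in> borel_measurable borel"
    and c: "0 < c" and C: "0 \<le> C"
    and Kb: "\<And>i j s t. x < s \<Longrightarrow> x < t \<Longrightarrow> cmod (K i j s t) \<le> C * exp (- c * s) * exp (- c * t)"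
    and Rb: "\<And>s t. x < s \<Longrightarrow> x < t \<Longrightarrow> cmod (R s t) \<le> C * exp (- c * s) * exp (- c * t)"
  shows "(- 1) ^ k / fact k * integral_over_cube k x (\<lambda>xs. pf k (\<lambda>a b. blk K xs a b + oddR R xs a b)) =
    (\<Sum>m | 2 * m \<le> k. (- 1) ^ (k - m) / (fact m * fact (k - 2 * m)) *
      integral_over_cube k x (\<lambda>xs. (\<Prod>i<m. R (xs i) (xs (k - m + i)) / 2) *
        pf (k - m) (\<lambda>a b. blk K xs (cross (k - m) m a) (cross (k - m) m b))))"
proof -
  let ?P = "{p. p permutes {0..<2 * k}}"
  define G where "G n p xs = (\<Prod>i = 0..<n. blk K xs (p (2 * i)) (p (2 * i + 1))) *
      (\<Prod>i = n..<k. oddR R xs (p (2 * i)) (p (2 * i + 1)))" for n and p :: "nat \<Rightarrow> nat" and xs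
  define T where "T n p = integral_over_cube k x (G n p)" for n p
  have blk_meas: "(\<lambda>xs. blk K xs a b) \<in> borel_measurable (cubeM k)" if "a < 2 * k" "b < 2 * k" for a b
    unfolding blk_def using that by (intro measurable_kernel_coordinates Km) auto
  have odd_meas: "(\<lambda>xs. oddR R xs a b) \<in> borel_measurable (cubeM k)" if "a < 2 * k" "b < 2 * k" for a b
  proof (cases "odd a \<and> odd b")
    case True
    then have "(\<lambda>xs. oddR R xs a b) = (\<lambda>xs. R (xs (a div 2)) (xs (b div 2)))" by (simp add: oddR_def)
    then show ?thesis
      using that by (simp only:) (intro measurable_kernel_coordinates[where f = R] Rm; auto)
  next
    case False
    then have "(\<lambda>xs. oddR R xs a b) = (\<lambda>xs. 0)" by (auto simp: oddR_def)
    then show ?thesis by (simp only: borel_measurable_const)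
  qed
  have Gmeas: "G n p \<in> borel_measurable (cubeM k)" if "p permutes {0..<2 * k}" "n \<le> k" for n p
    unfolding G_def using that permutes_less[OF that(1)]
    by (intro borel_measurable_times borel_measurable_prod blk_meas odd_meas) auto
  have Gbound: "cmod (G n p xs) \<le> C ^ k * (\<Prod>i<k. exp (- (2 * c) * xs i))"
    if p: "p permutes {0..<2 * k}" and n: "n \<le> k" and xs: "xs \<in> cube k x" for n p xs
  proof -
    let ?e = "\<lambda>a. exp (- c * xs (a div 2))" and ?b = "\<lambda>i. C * exp (- c * xs (p (2 * i) div 2)) * exp (- c * xs (p (2 * i + 1) div 2))"
    have pt: "x < xs (p a div 2)" if "a < 2 * k" for a
      using cube_less[OF xs, of "p a div 2"] that permutes_less[OF p, of a] by auto
    have b0: "0 \<le> ?b i" for i using C by simp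
    have "cmod (G n p xs) \<le> (\<Prod>i = 0..<n. ?b i) * (\<Prod>i = n..<k. ?b i)"
      unfolding G_def norm_mult prod_norm[symmetric]
    proof (intro mult_mono prod_mono conjI norm_ge_zero prod_nonneg ballI b0)
      fix i assume "i \<in> {0..<n}"
      then show "cmod (blk K xs (p (2 * i)) (p (2 * i + 1))) \<le> ?b i"
        unfolding blk_def using n by (intro Kb pt) auto
    next
      fix i assume i: "i \<in> {n..<k}"
      have "cmod (R (xs (p (2 * i) div 2)) (xs (p (2 * i + 1) div 2))) \<le> ?b i"
        using i by (intro Rb pt) auto
      then show "cmod (oddR R xs (p (2 * i)) (p (2 * i + 1))) \<le> ?b i"
        using b0[of i] by (simp only: oddR_def split: if_split) simp
    qed
    also have "\<dots> = (\<Prod>i = 0..<k. ?b i)"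
      by (rule prod.atLeastLessThan_concat) (use n in auto)
    also have "\<dots> = C ^ k * (\<Prod>i = 0..<k. ?e (p (2 * i)) * ?e (p (2 * i + 1)))"
      by (simp only: mult.assoc prod.distrib[of "\<lambda>_. C"] prod_constant card_atLeastLessThan diff_zero)
    also have "(\<Prod>i = 0..<k. ?e (p (2 * i)) * ?e (p (2 * i + 1))) = (\<Prod>a<2 * k. ?e a)"
      by (rule prod_pairs_permutes[OF p])
    also have "\<dots> = (\<Prod>i = 0..<k. ?e (2 * i) * ?e (2 * i + 1))" by (rule prod_pairs)
    also have "\<dots> = (\<Prod>i<k. exp (- (2 * c) * xs i))"
      unfolding lessThan_atLeast0 by (rule prod.cong) (auto simp flip: exp_add)
    finally show ?thesis .
  qed
  have Gint: "set_integrable (cubeM k) (cube k x) (G n p)" if "p permutes {0..<2 * k}" "n \<le> k" for n p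
    using c by (intro set_integrable_cube_bound[OF Gmeas[OF that], of "2 * c" x "C ^ k"] Gbound[OF that]) auto
  have inv: "T n (lift2 q \<circ> p) = T n p" if q: "q permutes {0..<k}" and p: "p permutes {0..<2 * k}" and n: "n \<le> k" for n q p
  proof -
    have l: "lift2 q a div 2 = q (a div 2)" "lift2 q a mod 2 = a mod 2" "even (lift2 q a) \<longleftrightarrow> even a" for a
      by (auto simp: lift2_def)
    have "G n (lift2 q \<circ> p) xs = G n p (xs \<circ> q)" for xs
      by (simp only: G_def blk_def oddR_def o_apply l)
    then have "T n (lift2 q \<circ> p) = integral_over_cube k x (\<lambda>xs. G n p (xs \<circ> q))" unfolding T_def by (intro cube_cong) (simp only:)
    also have "\<dots> = T n p" unfolding T_def by (rule cube_permute[OF q Gmeas[OF p n]])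
    finally show ?thesis .
  qed
  \<comment> \<open>\<open>R\<close> sits only in the odd positions, so a tail position sent to an
    even one makes a factor vanish.\<close>
  have zero: "T n p = 0" if "2 * n \<le> a" "a < 2 * k" "even (p a)" for n p a
  proof -
    have "oddR R xs (p (2 * (a div 2))) (p (2 * (a div 2) + 1)) = 0" for xs
      using that(3) by (cases "even a") (auto simp: oddR_def)
    then have "(\<Prod>i = n..<k. oddR R xs (p (2 * i)) (p (2 * i + 1))) = 0" for xs
      using that by (intro prod_zero bexI[of _ "a div 2"]) auto
    then have "G n p = (\<lambda>_. 0)" by (simp add: G_def fun_eq_iff)
    then show ?thesis by (simp add: T_def integral_over_cube_def)
  qed
  define \<tau> where "\<tau> m = integral_over_cube k x (\<lambda>xs. (\<Prod>i<m. R (xs i) (xs (k - m + i)) / 2) *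
        pf (k - m) (\<lambda>a b. blk K xs (cross (k - m) m a) (cross (k - m) m b)))" for m
  \<comment> \<open>In the canonical arrangement the tail pairs do not depend on \<sigma>, so the
    factors \<open>R\<close> come out and an unnormalised Pfaffian remains. It accounts for
    \<open>2 ^ n * fact n\<close>; the other \<open>2 ^ m\<close> goes into the halves of
    \<open>R\<close>.\<close>
  have canonical: "(\<Sum>\<sigma> | \<sigma> permutes {0..<2 * n}. of_int (sign \<sigma>) * T n (cross n m \<circ> \<sigma>)) = 2 ^ k * fact n * \<tau> m"
    if nm: "n + m = k" "m \<le> n" for n m
  proof -
    let ?S = "{\<sigma>. \<sigma> permutes {0..<2 * n}}"
    let ?B = "\<lambda>xs a b. blk K xs (cross n m a) (cross n m b)"
    have perm: "cross n m \<circ> \<sigma> permutes {0..<2 * k}" if "\<sigma> \<in> ?S" for \<sigma>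
    proof -
      have "\<sigma> permutes {0..<2 * k}" using that nm by (auto intro: permutes_subset)
      then show ?thesis using cross_permutes_sign[OF nm(2), of m] nm by (auto intro: permutes_compose)
    qed
    have G: "G n (cross n m \<circ> \<sigma>) xs = (\<Prod>i<m. R (xs i) (xs (n + i))) * (\<Prod>i = 0..<n. ?B xs (\<sigma> (2 * i)) (\<sigma> (2 * i + 1)))"
      if "\<sigma> \<in> ?S" for \<sigma> xs
    proof -
      have "(\<Prod>i = n..<k. oddR R xs ((cross n m \<circ> \<sigma>) (2 * i)) ((cross n m \<circ> \<sigma>) (2 * i + 1)))
          = (\<Prod>i = n..<k. R (xs (i - n)) (xs i))"
      proof (rule prod.cong[OF refl])
        fix i assume i: "i \<in> {n..<k}"
        have s: "\<sigma> (2 * i) = 2 * i" "\<sigma> (2 * i + 1) = 2 * i + 1" using that i by (auto simp: permutes_def)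
        have "cross n m (2 * i) = 2 * (i - n) + 1" "cross n m (2 * i + 1) = 2 * i + 1"
          unfolding cross_even cross_odd using i nm by auto
        then have "(cross n m \<circ> \<sigma>) (2 * i) = 2 * (i - n) + 1" "(cross n m \<circ> \<sigma>) (2 * i + 1) = 2 * i + 1"
          unfolding o_apply s by blast+
        then show "oddR R xs ((cross n m \<circ> \<sigma>) (2 * i)) ((cross n m \<circ> \<sigma>) (2 * i + 1)) = R (xs (i - n)) (xs i)"
          by (simp only: oddR_def) simp
      qed
      also have "\<dots> = (\<Prod>i = 0..<m. R (xs i) (xs (n + i)))"
        using prod.shift_bounds_nat_ivl[of "\<lambda>i. R (xs (i - n)) (xs i)" 0 n m] nm by (simp add: add.commute)
      finally show ?thesis by (simp add: G_def lessThan_atLeast0 mult.commute)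
    qed
    have "(\<Sum>\<sigma>\<in>?S. of_int (sign \<sigma>) * T n (cross n m \<circ> \<sigma>))
        = integral_over_cube k x (\<lambda>xs. \<Sum>\<sigma>\<in>?S. of_int (sign \<sigma>) * G n (cross n m \<circ> \<sigma>) xs)"
      unfolding T_def using nm
      by (intro cube_sum[symmetric] Gint perm) (auto intro: finite_permutations)
    also have "\<dots> = integral_over_cube k x (\<lambda>xs. 2 ^ k * fact n * ((\<Prod>i<m. R (xs i) (xs (k - m + i)) / 2) *
        pf (k - m) (\<lambda>a b. blk K xs (cross (k - m) m a) (cross (k - m) m b))))"
    proof (rule cube_cong)
      fix xs
      have n: "k - m = n" using nm by auto
      have pk: "(2 :: complex) ^ k = 2 ^ n * 2 ^ m" by (simp add: nm(1)[symmetric] power_add)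
      have "(\<Sum>\<sigma>\<in>?S. of_int (sign \<sigma>) * G n (cross n m \<circ> \<sigma>) xs)
          = (\<Prod>i<m. R (xs i) (xs (n + i))) * (\<Sum>\<sigma>\<in>?S. of_int (sign \<sigma>) * (\<Prod>i = 0..<n. ?B xs (\<sigma> (2 * i)) (\<sigma> (2 * i + 1))))"
        unfolding sum_distrib_left by (rule sum.cong) (auto simp only: G mult_ac)
      also have "\<dots> = (\<Prod>i<m. R (xs i) (xs (n + i))) * (2 ^ n * fact n * pf n (?B xs))"
        by (simp add: pf_def)
      also have "(\<Prod>i<m. R (xs i) (xs (n + i))) = 2 ^ m * (\<Prod>i<m. R (xs i) (xs (n + i)) / 2)"
        by (simp add: prod_dividef)
      finally show "(\<Sum>\<sigma>\<in>?S. of_int (sign \<sigma>) * G n (cross n m \<circ> \<sigma>) xs) = 2 ^ k * fact n * ((\<Prod>i<m. R (xs i) (xs (k - m + i)) / 2) *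
        pf (k - m) (\<lambda>a b. blk K xs (cross (k - m) m a) (cross (k - m) m b)))"
        unfolding n pk by (simp only: mult_ac)
    qed
    also have "\<dots> = 2 ^ k * fact n * \<tau> m" unfolding \<tau>_def by (rule cube_mult)
    finally show ?thesis .
  qed
  have "integral_over_cube k x (\<lambda>xs. pf k (\<lambda>a b. blk K xs a b + oddR R xs a b))
      = integral_over_cube k x (\<lambda>xs. 1 / (2 ^ k * fact k) * (\<Sum>n\<in>{0..k}. of_nat (k choose n) * (\<Sum>p\<in>?P. of_int (sign p) * G n p xs)))"
  proof (rule cube_cong)
    fix xs
    show "pf k (\<lambda>a b. blk K xs a b + oddR R xs a b) = 1 / (2 ^ k * fact k) * (\<Sum>n\<in>{0..k}. of_nat (k choose n) * (\<Sum>p\<in>?P. of_int (sign p) * G n p xs))"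
      unfolding pf_def G_def sum_prod_add_permutations[where A = "blk K xs" and B = "oddR R xs" and k = k] ..
  qed
  also have "\<dots> = 1 / (2 ^ k * fact k) * (\<Sum>n\<in>{0..k}. of_nat (k choose n) * (\<Sum>p\<in>?P. of_int (sign p) * T n p))"
  proof -
    have fin: "finite ?P" by (intro finite_permutations) simp
    have i1: "integral_over_cube k x (\<lambda>xs. \<Sum>p\<in>?P. of_int (sign p) * G n p xs) = (\<Sum>p\<in>?P. of_int (sign p) * T n p)"
      if "n \<le> k" for n
      unfolding T_def using that by (intro cube_sum fin Gint) auto
    have "integral_over_cube k x (\<lambda>xs. \<Sum>n\<in>{0..k}. of_nat (k choose n) * (\<Sum>p\<in>?P. of_int (sign p) * G n p xs))
        = (\<Sum>n\<in>{0..k}. of_nat (k choose n) * integral_over_cube k x (\<lambda>xs. \<Sum>p\<in>?P. of_int (sign p) * G n p xs))"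
    proof (rule cube_sum)
      fix n assume n: "n \<in> {0..k}"
      show "set_integrable (cubeM k) (cube k x) (\<lambda>xs. \<Sum>p\<in>?P. of_int (sign p) * G n p xs)"
        unfolding set_integrable_def scaleR_sum_right
      proof (rule Bochner_Integration.integrable_sum)
        fix p assume "p \<in> ?P"
        then have "integrable (cubeM k) (\<lambda>xs. indicator (cube k x) xs *\<^sub>R G n p xs)"
          using Gint[of p n] n by (simp add: set_integrable_def)
        from integrable_mult_right[OF this, of "of_int (sign p)"]
        show "integrable (cubeM k) (\<lambda>xs. indicator (cube k x) xs *\<^sub>R (of_int (sign p) * G n p xs))"
          by simp
      qed
    qed simp
    also have "\<dots> = (\<Sum>n\<in>{0..k}. of_nat (k choose n) * (\<Sum>p\<in>?P. of_int (sign p) * T n p))"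
      by (intro sum.cong refl arg_cong2[of _ _ _ _ "(*)"] i1) simp
    finally show ?thesis by (simp only: cube_mult)
  qed
  also have "(\<Sum>n\<in>{0..k}. of_nat (k choose n) * (\<Sum>p\<in>?P. of_int (sign p) * T n p))
      = (\<Sum>n\<in>{0..k}. of_nat (k choose n) * (if k - n \<le> n then fact k / fact (n - (k - n)) * (- 1) ^ (k - n) * (2 ^ k * fact n * \<tau> (k - n)) else 0))"
  proof (rule sum.cong[OF refl])
    fix n assume "n \<in> {0..k}"
    then have n: "n + (k - n) = k" "n \<le> k" by auto
    have "(\<Sum>p | p permutes {0..<2 * (n + (k - n))}. of_int (sign p) * T n p) = (if k - n \<le> n then fact (n + (k - n)) / fact (n - (k - n)) * (- 1) ^ (k - n) *
      (\<Sum>\<sigma> | \<sigma> permutes {0..<2 * n}. of_int (sign \<sigma>) * T n (cross n (k - n) \<circ> \<sigma>)) else 0)"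
      by (rule sum_permutations_odd_tail) (use n in \<open>auto intro: inv zero\<close>)
    then show "of_nat (k choose n) * (\<Sum>p\<in>?P. of_int (sign p) * T n p)
        = of_nat (k choose n) * (if k - n \<le> n then fact k / fact (n - (k - n)) * (- 1) ^ (k - n) * (2 ^ k * fact n * \<tau> (k - n)) else 0)"
      using canonical[OF n(1)] by (simp only: n(1) split: if_split) auto
  qed
  also have "\<dots> = (\<Sum>n\<in>{n\<in>{0..k}. k - n \<le> n}. of_nat (k choose n) * (fact k / fact (n - (k - n)) * (- 1) ^ (k - n) * (2 ^ k * fact n * \<tau> (k - n))))"
    by (rule sum.mono_neutral_cong_right) auto
  also have "\<dots> = (\<Sum>n\<in>{n\<in>{0..k}. k - n \<le> n}. of_nat (k choose n) * (fact k / fact (k - 2 * (k - n)) * (- 1) ^ (k - n) * (2 ^ k * fact n * \<tau> (k - n))))"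
  proof (rule sum.cong[OF refl])
    fix n assume "n \<in> {n\<in>{0..k}. k - n \<le> n}"
    then have "n - (k - n) = k - 2 * (k - n)" by auto
    then show "of_nat (k choose n) * (fact k / fact (n - (k - n)) * (- 1) ^ (k - n) * (2 ^ k * fact n * \<tau> (k - n)))
        = of_nat (k choose n) * (fact k / fact (k - 2 * (k - n)) * (- 1) ^ (k - n) * (2 ^ k * fact n * \<tau> (k - n)))"
      by (simp only:)
  qed
  also have "\<dots> = (\<Sum>m | 2 * m \<le> k. of_nat (k choose (k - m)) * (fact k / fact (k - 2 * m) * (- 1) ^ m * (2 ^ k * fact (k - m) * \<tau> m)))"
    by (rule sum.reindex_bij_witness[of _ "\<lambda>m. k - m" "\<lambda>n. k - n"]) auto
  finally have main: "integral_over_cube k x (\<lambda>xs. pf k (\<lambda>a b. blk K xs a b + oddR R xs a b))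
      = 1 / (2 ^ k * fact k) * (\<Sum>m | 2 * m \<le> k. of_nat (k choose (k - m)) * (fact k / fact (k - 2 * m) * (- 1) ^ m * (2 ^ k * fact (k - m) * \<tau> m)))" .
  show ?thesis
    unfolding main \<tau>_def[symmetric] sum_distrib_left
  proof (rule sum.cong[OF refl])
    fix m assume "m \<in> {m. 2 * m \<le> k}"
    then have m: "m \<le> k" "2 * m \<le> k" by auto
    \<comment> \<open>The binomial coefficient absorbs \<open>fact (k - m)\<close>, and the two
      factors \<open>fact k\<close> that remain cancel the two denominators.\<close>
    have ch: "of_nat (k choose (k - m)) = (fact k / (fact (k - m) * fact m) :: complex)"
      using m by (subst binomial_fact) auto
    have sgn: "(- 1 :: complex) ^ k * (- 1) ^ m = (- 1) ^ (k - m)"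
    proof -
      have "k + m = k - m + 2 * m" using m by simp
      then have "(- 1 :: complex) ^ k * (- 1) ^ m = (- 1) ^ (k - m + 2 * m)"
        by (simp only: power_add[symmetric])
      then show ?thesis by (simp add: power_add power_mult)
    qed
    have "(- 1) ^ k / fact k * (1 / (2 ^ k * fact k) * (of_nat (k choose (k - m)) * (fact k / fact (k - 2 * m) * (- 1) ^ m * (2 ^ k * fact (k - m) * \<tau> m))))
       = ((- 1) ^ k * (- 1) ^ m) / (fact m * fact (k - 2 * m)) * \<tau> m"
      unfolding ch by (simp add: field_simps)
    then show "(- 1) ^ k / fact k * (1 / (2 ^ k * fact k) * (of_nat (k choose (k - m)) * (fact k / fact (k - 2 * m) * (- 1) ^ m * (2 ^ k * fact (k - m) * \<tau> m))))
       = (- 1) ^ (k - m) / (fact m * fact (k - 2 * m)) * \<tau> m"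
      unfolding sgn .
  qed
qed

definition lab :: "(nat \<Rightarrow> nat \<Rightarrow> real \<Rightarrow> real \<Rightarrow> complex) \<Rightarrow> nat \<Rightarrow> (nat \<Rightarrow> real) \<Rightarrow> nat \<Rightarrow> nat \<Rightarrow> complex" where
  "lab \<kappa> m xs a b = \<kappa> (if even a then 1 else if a div 2 < m then 3 else 2)
     (if even b then 1 else if b div 2 < m then 3 else 2) (xs (a div 2)) (xs (b div 2))"

text \<open>Labels \<open>1\<close> and \<open>2\<close> are the two rows of the kernel at a point, and label \<open>3\<close> is the row
  obtained by integrating the first rows against \<open>r\<close>, up to a multiple of the first row. The points
  \<open>xs (n + i)\<close>, on which the integrand depends through a single row, are integrated one at a time.\<close>

lemma row_integration:
  fixes \<kappa> :: "nat \<Rightarrow> nat \<Rightarrow> real \<Rightarrow> real \<Rightarrow> complex" and r :: "real \<Rightarrow> real \<Rightarrow> complex" and d :: "real \<Rightarrow> complex"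
  assumes skew: "\<And>i j s t. \<kappa> i j s t = - \<kappa> j i t s"
    and km: "\<And>i j. (\<lambda>p. \<kappa> i j (fst p) (snd p)) \<in> borel_measurable borel"
    and rm: "(\<lambda>p. r (fst p) (snd p)) \<in> borel_measurable borel"
    and C: "0 < C" and D: "0 \<le> D"
    and kb: "\<And>i j s t. x < s \<Longrightarrow> x < t \<Longrightarrow> cmod (\<kappa> i j s t) \<le> C * exp (- s) * exp (- t)"
    and rb: "\<And>s t. x < s \<Longrightarrow> x < t \<Longrightarrow> cmod (r s t) \<le> D"
    and row: "\<And>j s t. x < s \<Longrightarrow> x < t \<Longrightarrow>
      \<kappa> 3 j s t = (\<integral>y. indicator {x<..} y *\<^sub>R (r s y * \<kappa> 1 j y t) \<partial>lborel) - d s * \<kappa> 1 j s t"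
    and mn: "m \<le> n"
  shows "integral_over_cube (n + m) x (\<lambda>xs. (\<Prod>i<m. r (xs i) (xs (n + i))) *
        pf n (\<lambda>a b. blk \<kappa> xs (cross n m a) (cross n m b)))
    = integral_over_cube n x (\<lambda>xs. pf n (lab \<kappa> m xs))"
proof -
  interpret product_sigma_finite "\<lambda>i :: nat. lborel :: real measure"
    by (rule product_sigma_finite_lborel)
  \<comment> \<open>At stage \<open>s\<close> the points \<open>n + i\<close> with
    \<open>i < s\<close> are not yet integrated, and the odd position of \<open>i\<close> holds row
    1 taken at \<open>xs (n + i)\<close>. Stage \<open>m\<close> is the left-hand side and stage 0
    the right-hand side.\<close>
  define ty where "ty s a = (if even a \<or> a div 2 < s then 1 else if a div 2 < m then 3 else 2 :: nat)" for s a
  define pt where "pt s xs a = (xs (if odd a \<and> a div 2 < s then n + a div 2 else a div 2) :: real)" for s and xs :: "nat \<Rightarrow> real" and a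
  define A where "A s xs a b = \<kappa> (ty s a) (ty s b) (pt s xs a) (pt s xs b)" for s xs a b
  define g where "g s xs = (\<Prod>i<s. r (xs i) (xs (n + i))) * pf n (A s xs)" for s xs
  define Q where "Q s = integral_over_cube (n + s) x (g s)" for s
  have Am: "(\<lambda>xs. A s xs a b) \<in> borel_measurable (cubeM (n + s))" if "a < 2 * n" "b < 2 * n" for s a b
  proof -
    have "a div 2 < n" "b div 2 < n" using that by auto
    then show ?thesis unfolding A_def pt_def
      by (intro measurable_kernel_coordinates km) auto
  qed
  have gm: "g s \<in> borel_measurable (cubeM (n + s))" if "s \<le> n" for s
    unfolding g_def using that
    by (intro borel_measurable_times borel_measurable_prod pf_measurable Am measurable_kernel_coordinates[where f = r] rm) auto
  \<comment> \<open>The points \<open>i\<close> and \<open>n + i\<close> with \<open>i < s\<close>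
    enter through one row each, the other points through two. Bounding the surplus exponential of
    the latter by \<open>w\<close> leaves exactly one exponential per point.\<close>
  define w where "w = max 1 (exp (- x))"
  have w1: "1 \<le> w" by (simp add: w_def)
  have gint: "set_integrable (cubeM (n + s)) (cube (n + s) x) (g s)" if sn: "s \<le> n" for s
  proof (rule set_integrable_cube_bound[OF gm[OF sn], where c = 1])
    fix xs assume xs: "xs \<in> cube (n + s) x"
    have pt: "x < pt s xs a" if "a < 2 * n" for a
      unfolding pt_def using that sn by (auto intro!: cube_less[OF xs])
    have p1: "cmod (\<Prod>i<s. r (xs i) (xs (n + i))) \<le> D ^ s"
    proof -
      have "cmod (\<Prod>i<s. r (xs i) (xs (n + i))) \<le> (\<Prod>i<s. D)"
        unfolding prod_norm[symmetric] using sn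
        by (intro prod_mono conjI norm_ge_zero rb cube_less[OF xs]) auto
      then show ?thesis by simp
    qed
    have "cmod (pf n (A s xs)) \<le> pf_const n * (\<Prod>a<2 * n. sqrt C * exp (- pt s xs a))"
    proof (rule pf_bound)
      fix a b assume ab: "a < 2 * n" "b < 2 * n"
      have "cmod (A s xs a b) \<le> C * exp (- pt s xs a) * exp (- pt s xs b)"
        unfolding A_def by (intro kb pt ab)
      also have "C = sqrt C * sqrt C" using C by simp
      finally show "cmod (A s xs a b) \<le> sqrt C * exp (- pt s xs a) * (sqrt C * exp (- pt s xs b))"
        by (simp only: mult_ac)
    qed (use C in auto)
    also have "(\<Prod>a<2 * n. sqrt C * exp (- pt s xs a)) = sqrt C ^ (2 * n) * (\<Prod>a<2 * n. exp (- pt s xs a))"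
      by (simp add: prod.distrib)
    also have "(\<Prod>a<2 * n. exp (- pt s xs a)) \<le> w ^ n * (\<Prod>i<n + s. exp (- 1 * xs i))"
    proof -
      have "(\<Prod>a<2 * n. exp (- pt s xs a)) = (\<Prod>i = 0..<n. exp (- xs i) * (if i < s then exp (- xs (n + i)) else exp (- xs i)))"
        unfolding prod_pairs by (rule prod.cong) (auto simp: pt_def)
      also have "\<dots> \<le> (\<Prod>i = 0..<n. exp (- xs i) * (w * (if i < s then exp (- xs (n + i)) else 1)))"
      proof (intro prod_mono conjI mult_left_mono)
        fix i assume "i \<in> {0..<n}"
        then have "x < xs i" by (intro cube_less[OF xs]) auto
        then have "exp (- xs i) \<le> w" by (simp add: w_def le_max_iff_disj)
        then show "(if i < s then exp (- xs (n + i)) else exp (- xs i)) \<le> w * (if i < s then exp (- xs (n + i)) else 1)"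
          using w1 mult_right_mono[OF w1, of "exp (- xs (n + i))"] by auto
      qed auto
      also have "\<dots> = (\<Prod>i<n. exp (- xs i)) * (w ^ n * (\<Prod>i = 0..<n. if i < s then exp (- xs (n + i)) else 1))"
        by (simp add: prod.distrib lessThan_atLeast0)
      also have "(\<Prod>i = 0..<n. if i < s then exp (- xs (n + i)) else 1) = (\<Prod>i<s. exp (- xs (n + i)))"
        using sn by (intro prod.mono_neutral_cong_right) auto
      also have "(\<Prod>i<n. exp (- xs i)) * (w ^ n * (\<Prod>i<s. exp (- xs (n + i)))) = w ^ n * (\<Prod>i<n + s. exp (- 1 * xs i))"
      proof -
        have "(\<Prod>i<n + s. exp (- xs i)) = (\<Prod>i<n. exp (- xs i)) * (\<Prod>i<s. exp (- xs (n + i)))"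
          by (induction s) (auto simp: mult.assoc)
        then show ?thesis by simp
      qed
      finally show ?thesis .
    qed
    finally have p2: "cmod (pf n (A s xs)) \<le> pf_const n * (sqrt C ^ (2 * n) * (w ^ n * (\<Prod>i<n + s. exp (- 1 * xs i))))"
      using C pf_const_nonneg[of n] by (simp add: mult_left_mono)
    have "cmod (g s xs) \<le> D ^ s * (pf_const n * (sqrt C ^ (2 * n) * (w ^ n * (\<Prod>i<n + s. exp (- 1 * xs i)))))"
      unfolding g_def norm_mult using D by (intro mult_mono p1 p2) auto
    then show "cmod (g s xs) \<le> D ^ s * pf_const n * sqrt C ^ (2 * n) * w ^ n * (\<Prod>i<n + s. exp (- 1 * xs i))"
      by (simp only: mult.assoc)
  qed simp
  have step: "Q (Suc s) = Q s" if s: "s < m" for s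
  proof -
    have sn: "s < n" using s mn by simp
    let ?f = "\<lambda>xs. indicator (cube (n + Suc s) x) xs *\<^sub>R g (Suc s) xs"
    have ins: "insert (n + s) {0..<n + s} = {0..<n + Suc s}" by auto
    have int: "integrable (Pi\<^sub>M (insert (n + s) {0..<n + s}) (\<lambda>i. lborel)) ?f"
      using gint[of "Suc s"] sn unfolding ins set_integrable_def by simp
    have "Q (Suc s) = (\<integral>xs. ?f xs \<partial>Pi\<^sub>M (insert (n + s) {0..<n + s}) (\<lambda>i. lborel))"
      unfolding Q_def integral_over_cube_def set_lebesgue_integral_def ins ..
    also have "\<dots> = (\<integral>xs. (\<integral>y. ?f (xs(n + s := y)) \<partial>lborel) \<partial>cubeM (n + s))"
      by (rule product_integral_insert[OF _ _ int]) auto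
    also have "\<dots> = (\<integral>xs. indicator (cube (n + s) x) xs *\<^sub>R g s xs \<partial>cubeM (n + s))"
    proof (rule Bochner_Integration.integral_cong[OF refl])
      fix xs assume sp: "xs \<in> space (cubeM (n + s))"
      have ind: "indicator (cube (n + Suc s) x) (xs(n + s := y)) = (indicator (cube (n + s) x) xs * indicator {x<..} y :: real)" for y
      proof -
        have "xs(n + s := y) \<in> cube (n + Suc s) x \<longleftrightarrow> xs \<in> cube (n + s) x \<and> x < y"
          using sp by (auto simp: PiE_iff space_PiM extensional_def less_Suc_eq)
        then show ?thesis by (simp add: indicator_def)
      qed
      show "(\<integral>y. ?f (xs(n + s := y)) \<partial>lborel) = indicator (cube (n + s) x) xs *\<^sub>R g s xs"
      proof (cases "xs \<in> cube (n + s) x")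
        case False
        then show ?thesis unfolding ind by simp
      next
        case True
        have ptx: "x < pt s xs a" if "a < 2 * n" for a
          unfolding pt_def using that sn by (auto intro!: cube_less[OF True])
        have xss: "x < xs s" using sn by (intro cube_less[OF True]) auto
        let ?b = "2 * s + 1" and ?a = "2 * s"
        have ab: "?a < 2 * n" "?b < 2 * n" "?a \<noteq> ?b" using sn by auto
        let ?row = "\<lambda>y c. \<kappa> 1 (ty s c) y (pt s xs c)"
        have diag: "\<kappa> i i t t = 0" for i t using skew[of i i t t] by (simp add: eq_neg_iff_add_eq_0)
        have upd: "A (Suc s) (xs(n + s := y)) a b = set_row ?b (?row y) (A s xs) a b"
          if l: "a < 2 * n" "b < 2 * n" for y a b
        proof -
          have t: "ty (Suc s) c = (if c = ?b then 1 else ty s c)" for c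
            by (auto simp: ty_def less_Suc_eq elim!: oddE)
          have p: "pt (Suc s) (xs(n + s := y)) c = (if c = ?b then y else pt s xs c)" if "c < 2 * n" for c
          proof -
            have "c div 2 < n" using that by auto
            show ?thesis
            proof (cases "c = ?b")
              case True
              then show ?thesis by (simp add: pt_def)
            next
              case False
              then have "odd c \<and> c div 2 < Suc s \<longleftrightarrow> odd c \<and> c div 2 < s" by presburger
              then show ?thesis using False \<open>c div 2 < n\<close> by (auto simp: pt_def)
            qed
          qed
          show ?thesis
            unfolding A_def set_row_def t p[OF l(1)] p[OF l(2)]
            using skew[of 1 "ty s a" y "pt s xs a"] skew[of "ty s a" 1 "pt s xs a" y] diag by simp
        qed
        \<comment> \<open>As a function of \<open>y\<close> the Pfaffian is a finite linear form in
          the row at position \<open>?b\<close>, so the integral over \<open>y\<close> acts on this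
          row alone.\<close>
        obtain P :: "(nat \<Rightarrow> nat) set" and v cc where
          P: "finite P" "\<And>p. p \<in> P \<Longrightarrow> cc p < 2 * n \<and> cc p \<noteq> ?b"
            "\<And>\<rho>. pf n (set_row ?b \<rho> (A s xs)) = (\<Sum>p\<in>P. v p * \<rho> (cc p))"
          using pf_set_row[OF ab(2), of "A s xs"] by blast
        let ?pre = "\<Prod>i<s. r (xs i) (xs (n + i))"
        let ?I = "\<lambda>y c. indicator {x<..} y *\<^sub>R (r (xs s) y * ?row y c) :: complex"
        have g: "?f (xs(n + s := y)) = ?pre * (\<Sum>p\<in>P. v p * ?I y (cc p))" for y
        proof -
          have "g (Suc s) (xs(n + s := y)) = ?pre * r (xs s) y * pf n (A (Suc s) (xs(n + s := y)))"
            unfolding g_def using sn by (simp add: lessThan_Suc mult.commute)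
          also have "pf n (A (Suc s) (xs(n + s := y))) = pf n (set_row ?b (?row y) (A s xs))"
            by (rule pf_cong) (rule upd)
          finally have gS: "g (Suc s) (xs(n + s := y)) = ?pre * r (xs s) y * (\<Sum>p\<in>P. v p * ?row y (cc p))"
            unfolding P(3) .
          have i: "indicator (cube (n + Suc s) x) (xs(n + s := y)) = (indicator {x<..} y :: real)"
            unfolding ind using True by simp
          show ?thesis
            unfolding gS i sum_distrib_left scaleR_sum_right
            by (rule sum.cong[OF refl]) (simp only: mult_scaleR_right mult_ac)
        qed
        have Iint: "integrable lborel (\<lambda>y. ?I y c)" if c: "c < 2 * n" for c
        proof (rule Bochner_Integration.integrable_bound)
          show "integrable lborel (\<lambda>y. D * (C * exp (- pt s xs c)) * (indicator {x<..} y * exp (- 1 * y)))"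
            by (intro integrable_mult_right exp_tail(1)) simp
          have m1: "(\<lambda>y. r (xs s) y) \<in> borel_measurable borel"
            using measurable_compose[OF _ rm, of "\<lambda>y. (xs s, y)" borel] by (simp add: borel_prod[symmetric])
          have m2: "(\<lambda>y. \<kappa> 1 (ty s c) y (pt s xs c)) \<in> borel_measurable borel"
            using measurable_compose[OF _ km, of "\<lambda>y. (y, pt s xs c)" borel 1 "ty s c"] by (simp add: borel_prod[symmetric])
          show "(\<lambda>y. ?I y c) \<in> borel_measurable lborel" using m1 m2 by measurable
          show "AE y in lborel. norm (?I y c) \<le> norm (D * (C * exp (- pt s xs c)) * (indicator {x<..} y * exp (- 1 * y)))"
          proof (rule AE_I2)
            fix y
            show "norm (?I y c) \<le> norm (D * (C * exp (- pt s xs c)) * (indicator {x<..} y * exp (- 1 * y)))"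
            proof (cases "x < y")
              case True
              have "cmod (r (xs s) y * ?row y c) \<le> D * (C * exp (- y) * exp (- pt s xs c))"
                unfolding norm_mult using D by (intro mult_mono rb kb ptx[OF c] xss True) auto
              also have "\<dots> = D * (C * exp (- pt s xs c)) * exp (- 1 * y)" by simp
              finally have "norm (?I y c) \<le> D * (C * exp (- pt s xs c)) * (indicator {x<..} y * exp (- 1 * y))"
                using True by simp
              then show ?thesis unfolding real_norm_def by (rule order.trans[OF _ abs_ge_self])
            qed simp
          qed
        qed
        have "(\<integral>y. ?f (xs(n + s := y)) \<partial>lborel) = ?pre * (\<Sum>p\<in>P. v p * (\<integral>y. ?I y (cc p) \<partial>lborel))"
        proof -
          have "(\<integral>y. (\<Sum>p\<in>P. v p * ?I y (cc p)) \<partial>lborel) = (\<Sum>p\<in>P. \<integral>y. v p * ?I y (cc p) \<partial>lborel)"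
          proof (rule Bochner_Integration.integral_sum)
            fix p assume "p \<in> P"
            then have "cc p < 2 * n" using P(2) by blast
            from integrable_mult_right[OF Iint[OF this], of "v p"]
            show "integrable lborel (\<lambda>y. v p * ?I y (cc p))" .
          qed
          then show ?thesis unfolding g by (simp only: integral_mult_right_zero)
        qed
        also have "(\<Sum>p\<in>P. v p * (\<integral>y. ?I y (cc p) \<partial>lborel))
          = (\<Sum>p\<in>P. v p * (\<kappa> 3 (ty s (cc p)) (xs s) (pt s xs (cc p)) + d (xs s) * \<kappa> 1 (ty s (cc p)) (xs s) (pt s xs (cc p))))"
        proof (intro sum.cong refl arg_cong2[of _ _ _ _ "(*)"])
          fix p assume "p \<in> P"
          then have "cc p < 2 * n" using P(2) by blast
          from row[OF xss ptx[OF this], of "ty s (cc p)"]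
          show "(\<integral>y. ?I y (cc p) \<partial>lborel) = \<kappa> 3 (ty s (cc p)) (xs s) (pt s xs (cc p)) + d (xs s) * \<kappa> 1 (ty s (cc p)) (xs s) (pt s xs (cc p))"
            by simp
        qed
        also have "\<dots> = pf n (set_row ?b (\<lambda>c. \<kappa> 3 (ty s c) (xs s) (pt s xs c) + d (xs s) * \<kappa> 1 (ty s c) (xs s) (pt s xs c)) (A s xs))"
          unfolding P(3) ..
        \<comment> \<open>Position \<open>2 * s\<close> holds row 1 at \<open>xs s\<close>. The
          multiple \<open>d (xs s)\<close> of this row can therefore be added at position
          \<open>2 * s + 1\<close> for free.\<close>
        also have "\<dots> = pf n (A s xs)"
        proof (rule pf_add_multiple_row[OF ab, where \<alpha> = "d (xs s)"])
          show "A s xs c e = - A s xs e c" for c e unfolding A_def by (rule skew)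
          have "ty s ?b = 3" "ty s ?a = 1" "pt s xs ?b = xs s" "pt s xs ?a = xs s"
            using s by (auto simp: ty_def pt_def)
          then show "\<kappa> 3 (ty s c) (xs s) (pt s xs c) + d (xs s) * \<kappa> 1 (ty s c) (xs s) (pt s xs c) = A s xs ?b c + d (xs s) * A s xs ?a c" for c
            unfolding A_def by (simp only:)
        qed
        finally have L: "(\<integral>y. ?f (xs(n + s := y)) \<partial>lborel) = ?pre * pf n (A s xs)" .
        have "indicator (cube (n + s) x) xs *\<^sub>R g s xs = ?pre * pf n (A s xs)" using True by (simp add: g_def)
        then show ?thesis by (rule trans[OF L sym])
      qed
    qed
    also have "\<dots> = Q s"
      unfolding Q_def integral_over_cube_def set_lebesgue_integral_def ..
    finally show ?thesis .
  qed
  have Q0: "Q s = Q 0" if "s \<le> m" for s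
    using that by (induction s) (auto simp: step)
  have "Q m = Q 0" by (rule Q0[OF order_refl])
  moreover have "Q m = integral_over_cube (n + m) x (\<lambda>xs. (\<Prod>i<m. r (xs i) (xs (n + i))) *
        pf n (\<lambda>a b. blk \<kappa> xs (cross n m a) (cross n m b)))"
    unfolding Q_def g_def
  proof (rule cube_cong, rule arg_cong2[where f = "(*)", OF refl], rule pf_cong)
    fix xs a b assume ab: "a < 2 * n" "b < 2 * n"
    have t: "cross n m c mod 2 + 1 = ty m c \<and> xs (cross n m c div 2) = pt m xs c" if "c < 2 * n" for c
    proof (cases "even c")
      case True
      then obtain e where e: "c = 2 * e" by (rule evenE)
      then have "e < n" using that by simp
      then show ?thesis unfolding e cross_even ty_def pt_def by simp
    next
      case False
      then obtain e where e: "c = 2 * e + 1" by (rule oddE)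
      then have "e < n" using that by simp
      then show ?thesis unfolding e cross_odd ty_def pt_def by (cases "e < m") simp_all
    qed
    show "A m xs a b = blk \<kappa> xs (cross n m a) (cross n m b)"
      unfolding A_def blk_def using t[OF ab(1)] t[OF ab(2)] by simp
  qed
  moreover have "Q 0 = integral_over_cube n x (\<lambda>xs. pf n (lab \<kappa> m xs))"
    unfolding Q_def g_def A_def ty_def pt_def lab_def by simp
  ultimately show ?thesis by simp
qed

section \<open>Wedge integrals and Airy kernels\<close>

text \<open>Both rays become one path over the real line, the lower ray being traversed at negative
  parameters from infinity to the base point. A wedge integral is then a single Lebesgue integral,
  to which Fubini and dominated convergence apply.\<close>

definition wpath :: "real \<Rightarrow> real \<Rightarrow> real \<Rightarrow> complex" where
  "wpath a \<phi> t = of_real a + of_real \<bar>t\<bar> * cis (if 0 \<le> t then \<phi> else - \<phi>)"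

text \<open>The velocity of \<open>wpath\<close> divided by 2 pi i. On the lower ray the velocity is
  \<open>- cis (- \<phi>)\<close>, which reproduces the sign in
  \<open>wedge_integral\<close>.\<close>

definition wfac :: "real \<Rightarrow> real \<Rightarrow> complex" where
  "wfac \<phi> t = (if 0 \<le> t then cis \<phi> else - cis (- \<phi>)) / (2 * of_real pi * \<i>)"

lemma wpath_measurable [measurable]: "wpath a \<phi> \<in> borel_measurable borel"
  unfolding wpath_def by measurable

lemma wfac_measurable [measurable]: "wfac \<phi> \<in> borel_measurable borel"
  unfolding wfac_def by measurable

lemma norm_wfac: "cmod (wfac \<phi> t) \<le> 1"
  using pi_gt3 by (simp add: wfac_def norm_divide norm_mult)

lemma integrable_wfac:
  assumes "integrable lborel g"
  shows "integrable lborel (\<lambda>t. g t * wfac \<phi> t :: complex)"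
proof (rule Bochner_Integration.integrable_bound[OF assms])
  show "(\<lambda>t. g t * wfac \<phi> t) \<in> borel_measurable lborel"
    using borel_measurable_integrable[OF assms] by measurable
  show "AE t in lborel. norm (g t * wfac \<phi> t) \<le> norm (g t)"
    by (intro AE_I2) (simp add: norm_mult mult_left_le norm_wfac)
qed

lemma ray_integrable:
  assumes f: "integrable lborel (\<lambda>t. f (wpath a \<phi> t) :: complex)"
  shows "set_integrable lborel {0..} (\<lambda>t. f (of_real a + of_real t * cis \<phi>))"
    and "set_integrable lborel {0..} (\<lambda>t. f (of_real a + of_real t * cis (- \<phi>)))"
proof -
  have "integrable lborel (\<lambda>t. indicator {0..} t *\<^sub>R f (wpath a \<phi> t))"
    using f by (intro integrable_mult_indicator) auto
  also have "(\<lambda>t. indicator {0..} t *\<^sub>R f (wpath a \<phi> t)) = (\<lambda>t. indicator {0..} t *\<^sub>R f (of_real a + of_real t * cis \<phi>))"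
    by (auto simp: indicator_def wpath_def)
  finally show "set_integrable lborel {0..} (\<lambda>t. f (of_real a + of_real t * cis \<phi>))"
    by (simp add: set_integrable_def)
  have "integrable lborel (\<lambda>t. f (wpath a \<phi> (0 + (- 1) * t)))"
    using f by (rule lborel_integrable_real_affine) simp
  then have "integrable lborel (\<lambda>t. indicator {0..} t *\<^sub>R f (wpath a \<phi> (0 + (- 1) * t)))"
    by (intro integrable_mult_indicator) auto
  also have "(\<lambda>t. indicator {0..} t *\<^sub>R f (wpath a \<phi> (0 + (- 1) * t))) = (\<lambda>t. indicator {0..} t *\<^sub>R f (of_real a + of_real t * cis (- \<phi>)))"
    by (auto simp: indicator_def wpath_def fun_eq_iff)
  finally show "set_integrable lborel {0..} (\<lambda>t. f (of_real a + of_real t * cis (- \<phi>)))"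
    by (simp add: set_integrable_def)
qed

lemma wedge_eq:
  assumes f: "integrable lborel (\<lambda>t. f (wpath a \<phi> t))"
  shows "wedge_integral a \<phi> f = (\<integral>t. f (wpath a \<phi> t) * wfac \<phi> t \<partial>lborel)"
proof -
  let ?c = "1 / (2 * of_real pi * \<i>) :: complex" and ?G = "\<lambda>t. f (wpath a \<phi> t) * wfac \<phi> t"
  let ?u = "\<lambda>t. f (of_real a + of_real t * cis \<phi>) * cis \<phi>" and ?l = "\<lambda>t. f (of_real a + of_real t * cis (- \<phi>)) * cis (- \<phi>)"
  have G: "integrable lborel ?G" using f by (rule integrable_wfac)
  have "(\<integral>t. ?G t \<partial>lborel) = (\<integral>t. indicator {0..} t *\<^sub>R ?G t + indicator {..<0} t *\<^sub>R ?G t \<partial>lborel)"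
    by (rule Bochner_Integration.integral_cong) (auto simp: indicator_def)
  also have "\<dots> = (\<integral>t. indicator {0..} t *\<^sub>R ?G t \<partial>lborel) + (\<integral>t. indicator {..<0} t *\<^sub>R ?G t \<partial>lborel)"
    using G by (intro Bochner_Integration.integral_add integrable_mult_indicator) auto
  also have "(\<integral>t. indicator {0..} t *\<^sub>R ?G t \<partial>lborel) = (\<integral>t. ?c * (indicator {0..} t *\<^sub>R ?u t) \<partial>lborel)"
    by (rule Bochner_Integration.integral_cong) (auto simp: indicator_def wfac_def wpath_def)
  also have "\<dots> = ?c * (LINT t:{0..}|lborel. ?u t)"
    unfolding set_lebesgue_integral_def by (rule integral_mult_right_zero)
  also have "(\<integral>t. indicator {..<0} t *\<^sub>R ?G t \<partial>lborel)
      = \<bar>- 1\<bar> *\<^sub>R (\<integral>t. indicator {..<0} (0 + (- 1) * t) *\<^sub>R ?G (0 + (- 1) * t) \<partial>lborel)"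
    by (rule lborel_integral_real_affine) simp
  also have "\<dots> = (\<integral>t. - ?c * (indicator {0..} t *\<^sub>R ?l t) \<partial>lborel)"
  proof -
    have "(\<integral>t. indicator {..<0} (0 + (- 1) * t) *\<^sub>R ?G (0 + (- 1) * t) \<partial>lborel) = (\<integral>t. - ?c * (indicator {0..} t *\<^sub>R ?l t) \<partial>lborel)"
    proof (rule integral_cong_AE)
      show "(\<lambda>t. indicator {..<0} (0 + - 1 * t) *\<^sub>R ?G (0 + - 1 * t)) \<in> borel_measurable lborel"
      proof -
        have "integrable lborel (\<lambda>t. ?G (0 + (- 1) * t))"
          using lborel_integrable_real_affine[OF G, of "- 1" 0] by simp
        from borel_measurable_integrable[OF this] show ?thesis by measurable
      qed
      show "(\<lambda>t. - ?c * (indicator {0..} t *\<^sub>R ?l t)) \<in> borel_measurable lborel"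
      proof -
        have "(\<lambda>t. indicator {0..} t *\<^sub>R f (of_real a + of_real t * cis (- \<phi>))) \<in> borel_measurable lborel"
          using ray_integrable(2)[OF f] unfolding set_integrable_def by (rule borel_measurable_integrable)
        then have "(\<lambda>t. - ?c * cis (- \<phi>) * (indicator {0..} t *\<^sub>R f (of_real a + of_real t * cis (- \<phi>)))) \<in> borel_measurable lborel"
          by measurable
        also have "(\<lambda>t. - ?c * cis (- \<phi>) * (indicator {0..} t *\<^sub>R f (of_real a + of_real t * cis (- \<phi>))))
          = (\<lambda>t. - ?c * (indicator {0..} t *\<^sub>R ?l t))" by (auto simp: fun_eq_iff)
        finally show ?thesis .
      qed
      show "AE t in lborel. indicator {..<0} (0 + - 1 * t) *\<^sub>R ?G (0 + - 1 * t) = - ?c * (indicator {0..} t *\<^sub>R ?l t)"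
        using AE_lborel_singleton[of 0] by eventually_elim (auto simp: indicator_def wfac_def wpath_def)
    qed
    then show ?thesis by simp
  qed
  also have "\<dots> = - ?c * (LINT t:{0..}|lborel. ?l t)"
    unfolding set_lebesgue_integral_def by (rule integral_mult_right_zero)
  finally show ?thesis by (simp add: wedge_integral_def algebra_simps)
qed

section \<open>Deformation of contours by primitives\<close>

lemma ray_tendsto:
  assumes P: "\<And>z. (P has_field_derivative f z) (at z)"
    and int: "set_integrable lborel {0..} (\<lambda>t. f (of_real a + of_real t * cis \<phi>))"
  shows "((\<lambda>T. P (of_real a + of_real T * cis \<phi>) - P (of_real a)) \<longlongrightarrow>
    (LINT t:{0..}|lborel. f (of_real a + of_real t * cis \<phi>) * cis \<phi>)) at_top"
proof -
  let ?h = "\<lambda>t. f (of_real a + of_real t * cis \<phi>) * cis \<phi>"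
  \<comment> \<open>As the derivative of an entire function, \<open>f\<close> is itself entire and
    hence continuous along the ray.\<close>
  have "f = deriv P" using DERIV_imp_deriv[OF P] by auto
  moreover have "P holomorphic_on UNIV"
    using P by (auto simp: holomorphic_on_def field_differentiable_def intro: has_field_derivative_at_within)
  ultimately have "f holomorphic_on UNIV" by (auto intro: holomorphic_deriv)
  then have cont: "continuous_on UNIV f" by (rule holomorphic_on_imp_continuous_on)
  have FTC: "(LINT t:{0..T}|lborel. ?h t) = P (of_real a + of_real T * cis \<phi>) - P (of_real a)" if "0 \<le> T" for T
  proof -
    have "integral\<^sup>L lborel (\<lambda>t. indicator {0..T} t *\<^sub>R ?h t)
        = P (of_real a + of_real T * cis \<phi>) - P (of_real a + of_real 0 * cis \<phi>)"
    proof (rule integral_FTC_atLeastAtMost[OF that])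
      show "((\<lambda>t. P (of_real a + of_real t * cis \<phi>)) has_vector_derivative ?h t) (at t within {0..T})" for t
      proof -
        have "((\<lambda>t. of_real a + of_real t * cis \<phi>) has_vector_derivative cis \<phi>) (at t within {0..T})"
          by (auto intro!: derivative_eq_intros simp: scaleR_conv_of_real)
        from field_vector_diff_chain_within[OF this has_field_derivative_at_within[OF P]]
        show ?thesis by (simp add: o_def mult.commute)
      qed
      show "continuous_on {0..T} ?h"
        by (intro continuous_intros continuous_on_compose2[OF cont]) auto
    qed
    then show ?thesis
      unfolding set_lebesgue_integral_def by (simp only: of_real_0 mult_zero_left add_0_right)
  qed
  have "((\<lambda>T. LINT t:{0..T}|lborel. ?h t) \<longlongrightarrow> (LINT t:{0..}|lborel. ?h t)) at_top"
    by (rule tendsto_set_lebesgue_integral_at_top) (use int in \<open>auto intro: set_integrable_mult_left\<close>)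
  then show ?thesis
    by (rule Lim_transform_eventually) (rule eventually_mono[OF eventually_ge_at_top[of 0]], rule FTC)
qed

lemma wedge_tendsto:
  assumes P: "\<And>z. (P has_field_derivative f z) (at z)"
    and int: "integrable lborel (\<lambda>t. f (wpath a \<phi> t))"
  shows "((\<lambda>T. 1 / (2 * of_real pi * \<i>) * (P (of_real a + of_real T * cis \<phi>) - P (of_real a + of_real T * cis (- \<phi>))))
    \<longlongrightarrow> wedge_integral a \<phi> f) at_top"
proof -
  have "((\<lambda>T. 1 / (2 * of_real pi * \<i>) * ((P (of_real a + of_real T * cis \<phi>) - P (of_real a)) - (P (of_real a + of_real T * cis (- \<phi>)) - P (of_real a))))
    \<longlongrightarrow> wedge_integral a \<phi> f) at_top"
    unfolding wedge_integral_def
    by (intro tendsto_mult tendsto_const tendsto_diff ray_tendsto[OF P] ray_integrable[OF int])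
  then show ?thesis by simp
qed

text \<open>Through a primitive, a wedge integral is a limit of differences of endpoint values; two
  wedges agree once their far ends can be joined at vanishing cost. The map \<open>S\<close> matches
  ends reached at different speeds, as happens when the angles differ.\<close>

lemma wedge_shift:
  assumes P: "\<And>z. (P has_field_derivative f z) (at z)"
    and int: "integrable lborel (\<lambda>t. f (wpath a \<phi> t))" "integrable lborel (\<lambda>t. f (wpath b \<psi> t))"
    and S: "filterlim S at_top at_top"
    and lim: "((\<lambda>T. P (of_real a + of_real T * cis \<phi>) - P (of_real b + of_real (S T) * cis \<psi>)) \<longlongrightarrow> 0) at_top"
      "((\<lambda>T. P (of_real a + of_real T * cis (- \<phi>)) - P (of_real b + of_real (S T) * cis (- \<psi>))) \<longlongrightarrow> 0) at_top"
  shows "wedge_integral a \<phi> f = wedge_integral b \<psi> f"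
proof -
  let ?c = "1 / (2 * of_real pi * \<i>) :: complex"
  have "((\<lambda>T. ?c * (P (of_real b + of_real (S T) * cis \<psi>) - P (of_real b + of_real (S T) * cis (- \<psi>)))) \<longlongrightarrow> wedge_integral b \<psi> f) at_top"
    by (rule filterlim_compose[OF wedge_tendsto[OF P int(2)] S])
  moreover have "((\<lambda>T. ?c * ((P (of_real a + of_real T * cis \<phi>) - P (of_real b + of_real (S T) * cis \<psi>))
      - (P (of_real a + of_real T * cis (- \<phi>)) - P (of_real b + of_real (S T) * cis (- \<psi>))))) \<longlongrightarrow> ?c * (0 - 0)) at_top"
    by (intro tendsto_mult tendsto_const tendsto_diff lim)
  ultimately have lim': "((\<lambda>T. ?c * (P (of_real b + of_real (S T) * cis \<psi>) - P (of_real b + of_real (S T) * cis (- \<psi>)))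
      + ?c * ((P (of_real a + of_real T * cis \<phi>) - P (of_real b + of_real (S T) * cis \<psi>))
      - (P (of_real a + of_real T * cis (- \<phi>)) - P (of_real b + of_real (S T) * cis (- \<psi>))))) \<longlongrightarrow> wedge_integral b \<psi> f + ?c * (0 - 0)) at_top"
    by (rule tendsto_add)
  have eq: "k * (B - B') + k * ((A - B) - (A' - B')) = k * (A - A')" for k A A' B B' :: complex
    by (simp add: algebra_simps)
  have "((\<lambda>T. ?c * (P (of_real a + of_real T * cis \<phi>) - P (of_real a + of_real T * cis (- \<phi>)))) \<longlongrightarrow> wedge_integral b \<psi> f) at_top"
    by (rule lim'[unfolded eq diff_self mult_zero_right add_0_right])
  then show ?thesis
    by (rule tendsto_unique[OF trivial_limit_at_top_linorder wedge_tendsto[OF P int(1)]])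
qed

text \<open>Mean value inequality on the joining segment: \<open>B\<close> bounds the integrand
  there and \<open>L\<close> the length.\<close>

lemma primitive_diff_tendsto:
  fixes u v :: "real \<Rightarrow> complex"
  assumes P: "\<And>z. (P has_field_derivative f z) (at z)"
    and B: "eventually (\<lambda>T. \<forall>z\<in>closed_segment (u T) (v T). cmod (f z) \<le> B T) at_top"
    and L: "eventually (\<lambda>T. cmod (u T - v T) \<le> L T) at_top"
    and lim: "((\<lambda>T. B T * L T) \<longlongrightarrow> 0) at_top"
  shows "((\<lambda>T. P (u T) - P (v T)) \<longlongrightarrow> 0) at_top"
proof (rule Lim_null_comparison[OF _ lim])
  show "eventually (\<lambda>T. norm (P (u T) - P (v T)) \<le> B T * L T) at_top"
    using B L
  proof eventually_elim
    case (elim T)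
    have "norm (P (u T) - P (v T)) \<le> B T * norm (u T - v T)"
    proof (rule field_differentiable_bound)
      show "convex (closed_segment (u T) (v T))" by (rule convex_closed_segment)
      show "(P has_field_derivative f z) (at z within closed_segment (u T) (v T))" for z
        by (rule has_field_derivative_at_within[OF P])
      show "norm (f z) \<le> B T" if "z \<in> closed_segment (u T) (v T)" for z
        using elim(1) that by blast
    qed (rule ends_in_segment)+
    moreover have "cmod (f (u T)) \<le> B T" using elim(1) by auto
    then have "0 \<le> B T" by (rule order.trans[OF norm_ge_zero])
    then have "B T * norm (u T - v T) \<le> B T * L T" by (rule mult_left_mono[OF elim(2)])
    ultimately show ?case by linarith
  qed
qed

lemma primitive_exists:
  assumes "f holomorphic_on UNIV"
  obtains P where "\<And>z. (P has_field_derivative f z) (at z)"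
proof -
  have "f field_differentiable at z" for z
    using assms by (simp add: holomorphic_on_def)
  then obtain P where "\<And>z. z \<in> UNIV \<Longrightarrow> (P has_field_derivative f z) (at z within UNIV)"
    using holomorphic_convex_primitive[of UNIV "{}" f] holomorphic_on_imp_continuous_on[OF assms] by auto
  then show ?thesis using that by auto
qed

lemma fubini_bounded:
  fixes f :: "real \<times> real \<Rightarrow> complex" and u v :: "real \<Rightarrow> real"
  assumes f [measurable]: "f \<in> borel_measurable borel"
    and u: "integrable lborel u" and v: "integrable lborel v"
    and bound: "\<And>x y. cmod (f (x, y)) \<le> u x * v y"
  shows "integrable (lborel \<Otimes>\<^sub>M lborel) f"
    and "(\<integral>x. (\<integral>y. f (x, y) \<partial>lborel) \<partial>lborel) = (\<integral>y. (\<integral>x. f (x, y) \<partial>lborel) \<partial>lborel)"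
    and "integrable lborel (\<lambda>x. \<integral>y. f (x, y) \<partial>lborel)"
    and "integrable lborel (\<lambda>y. \<integral>x. f (x, y) \<partial>lborel)"
proof -
  have fm: "f \<in> borel_measurable (lborel \<Otimes>\<^sub>M lborel)"
    using f by (simp add: lborel_prod)
  have uv: "integrable (lborel \<Otimes>\<^sub>M lborel) (\<lambda>p. u (fst p) * v (snd p))"
  proof (rule lborel_pair.Fubini_integrable)
    show "(\<lambda>p. u (fst p) * v (snd p)) \<in> borel_measurable (lborel \<Otimes>\<^sub>M lborel)"
      using borel_measurable_integrable[OF u] borel_measurable_integrable[OF v] by measurable
    show "AE x in lborel. integrable lborel (\<lambda>y. u (fst (x, y)) * v (snd (x, y)))"
      using v by simp
    have "integrable lborel (\<lambda>x. \<bar>u x\<bar> * (\<integral>y. \<bar>v y\<bar> \<partial>lborel))"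
      using u by auto
    then show "integrable lborel (\<lambda>x. \<integral>y. norm (u (fst (x, y)) * v (snd (x, y))) \<partial>lborel)"
      by (simp add: abs_mult)
  qed
  show int: "integrable (lborel \<Otimes>\<^sub>M lborel) f"
    by (rule Bochner_Integration.integrable_bound[OF uv fm]) (use bound in \<open>auto intro!: AE_I2 order.trans[OF _ abs_ge_self]\<close>)
  then have int': "integrable (lborel \<Otimes>\<^sub>M lborel) (case_prod (\<lambda>x y. f (x, y)))" by simp
  show "(\<integral>x. (\<integral>y. f (x, y) \<partial>lborel) \<partial>lborel) = (\<integral>y. (\<integral>x. f (x, y) \<partial>lborel) \<partial>lborel)"
    using lborel_pair.Fubini_integral[OF int'] by simp
  show "integrable lborel (\<lambda>x. \<integral>y. f (x, y) \<partial>lborel)"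
    using lborel_pair.integrable_fst'[OF int] .
  show "integrable lborel (\<lambda>y. \<integral>x. f (x, y) \<partial>lborel)"
    using lborel_pair.integrable_snd[OF int'] .
qed

lemma integral_exp_minus_complex:
  assumes "0 < Re u"
  shows "integrable lborel (\<lambda>l :: real. indicator {0..} l *\<^sub>R exp (- of_real l * u))"
    and "(\<integral>l. indicator {0..} l *\<^sub>R exp (- of_real l * u) \<partial>lborel) = 1 / u"
proof -
  have u0: "u \<noteq> 0" using assms by auto
  have "(\<integral>\<^sup>+ l. ennreal (exp (- Re u * l)) * indicator {0..} l \<partial>lborel) = ennreal (0 - (- exp (- Re u * 0) / Re u))"
  proof (rule nn_integral_FTC_atLeast[where F = "\<lambda>l. - exp (- Re u * l) / Re u"])
    show "((\<lambda>t. - exp (- Re u * t) / Re u) has_real_derivative exp (- Re u * t)) (at t)" for t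
      using assms by (auto intro!: derivative_eq_intros)
    show "((\<lambda>t. - exp (- Re u * t) / Re u) \<longlongrightarrow> 0) at_top"
      using assms by real_asymp
  qed auto
  then have fin: "(\<integral>\<^sup>+ l. ennreal (norm (indicator {0..} l *\<^sub>R exp (- of_real l * u))) \<partial>lborel) < \<infinity>"
    by (subst nn_integral_cong[where v = "\<lambda>l. ennreal (exp (- Re u * l)) * indicator {0..} l"])
       (auto simp: indicator_def mult.commute)
  show int: "integrable lborel (\<lambda>l :: real. indicator {0..} l *\<^sub>R exp (- of_real l * u))"
    by (rule integrableI_bounded[OF _ fin]) measurable
  have FTC: "(LINT l:{0..T}|lborel. exp (- of_real l * u)) = 1 / u - exp (- of_real T * u) / u" if "0 \<le> T" for T
  proof -
    have "integral\<^sup>L lborel (\<lambda>l. indicator {0..T} l *\<^sub>R exp (- of_real l * u))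
        = - exp (- of_real T * u) / u - (- exp (- of_real 0 * u) / u)"
    proof (rule integral_FTC_atLeastAtMost[OF that])
      have "((\<lambda>z. - exp (- z * u) / u) has_field_derivative exp (- of_real t * u)) (at (of_real t))" for t :: real
        using u0 by (auto intro!: derivative_eq_intros)
      from has_vector_derivative_real_field[OF this]
      show "((\<lambda>t. - exp (- of_real t * u) / u) has_vector_derivative exp (- of_real t * u)) (at t within {0..T})" for t .
    qed (auto intro!: continuous_intros)
    then show ?thesis by (simp add: set_lebesgue_integral_def)
  qed
  have "((\<lambda>T. LINT l:{0..T}|lborel. exp (- of_real l * u)) \<longlongrightarrow> (LINT l:{0..}|lborel. exp (- of_real l * u))) at_top"
    by (rule tendsto_set_lebesgue_integral_at_top) (use int in \<open>auto simp: set_integrable_def\<close>)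
  moreover have "((\<lambda>T. LINT l:{0..T}|lborel. exp (- of_real l * u)) \<longlongrightarrow> 1 / u) at_top"
  proof -
    have "((\<lambda>T. exp (- of_real T * u) / u) \<longlongrightarrow> 0) at_top"
    proof (rule tendsto_norm_zero_cancel)
      have "((\<lambda>T. exp (- T * Re u) / cmod u) \<longlongrightarrow> 0) at_top"
        using assms u0 by real_asymp
      then show "((\<lambda>T. norm (exp (- of_real T * u) / u)) \<longlongrightarrow> 0) at_top"
        by (simp add: norm_divide)
    qed
    then have "((\<lambda>T. 1 / u - exp (- of_real T * u) / u) \<longlongrightarrow> 1 / u - 0) at_top"
      by (intro tendsto_diff tendsto_const)
    then have "((\<lambda>T. 1 / u - exp (- of_real T * u) / u) \<longlongrightarrow> 1 / u) at_top" by simp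
    then show ?thesis
      by (rule Lim_transform_eventually) (rule eventually_mono[OF eventually_ge_at_top[of 0]], rule FTC[symmetric])
  qed
  ultimately show "(\<integral>l. indicator {0..} l *\<^sub>R exp (- of_real l * u) \<partial>lborel) = 1 / u"
    using tendsto_unique[of at_top] by (force simp: set_lebesgue_integral_def)
qed

text \<open>The common weight for integrands on rays of angle pi / 3. There the cube of
  \<open>z\<close> is negative real to leading order, which gives
  \<open>- \<bar>t\<bar> ^ 3 / 3\<close>; lower order terms, polynomial factors and shifts of the
  base point are absorbed into \<open>C\<close>.\<close>

definition cw :: "real \<Rightarrow> real \<Rightarrow> real" where
  "cw C t = exp (C * (1 + \<bar>t\<bar> + t\<^sup>2) - \<bar>t\<bar> ^ 3 / 3)"

lemma cw_pos: "0 < cw C t" and cw_nonneg: "0 \<le> cw C t"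
  by (simp_all add: cw_def)

lemma cw_measurable [measurable]: "cw C \<in> borel_measurable borel"
  unfolding cw_def by measurable

lemma cw_mono: "C \<le> D \<Longrightarrow> cw C t \<le> cw D t"
  by (simp add: cw_def mult_right_mono)

lemma cw_mult_exp: "0 \<le> N \<Longrightarrow> exp (N * (1 + \<bar>t\<bar> + t\<^sup>2)) * cw C t = cw (C + N) t"
  by (simp add: cw_def algebra_simps flip: exp_add)

lemma power_le_exp: "(1 + \<bar>t\<bar>) ^ N \<le> exp (real N * (1 + \<bar>t\<bar> + t\<^sup>2))"
proof -
  have "1 + \<bar>t\<bar> \<le> exp \<bar>t\<bar>" by (rule exp_ge_add_one_self)
  also have "\<dots> \<le> exp (1 + \<bar>t\<bar> + t\<^sup>2)" by simp
  finally have "(1 + \<bar>t\<bar>) ^ N \<le> exp (1 + \<bar>t\<bar> + t\<^sup>2) ^ N" by (intro power_mono) auto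
  then show ?thesis by (simp add: exp_of_nat_mult)
qed

lemma power_mult_cw: "(1 + \<bar>t\<bar>) ^ N * cw C t \<le> cw (C + real N) t"
  using mult_right_mono[OF power_le_exp[of t N] cw_nonneg[of C t]] cw_mult_exp[of "real N" t C] by simp

lemma cw_le_exp:
  assumes "0 \<le> C"
  shows "\<exists>D\<ge>0. \<forall>t. cw C t \<le> D * exp (- \<bar>t\<bar>)"
proof -
  \<comment> \<open>Chosen so that \<open>S / 3 = 3 * C + 1\<close>: past \<open>S\<close> the cube
    outweighs the linear and quadratic terms.\<close>
  define S where "S = 9 * C + 3"
  have "C * (1 + s + s\<^sup>2) + s - s ^ 3 / 3 \<le> C * (1 + S + S\<^sup>2) + S" if s: "0 \<le> s" for s :: real
  proof (cases "s \<le> S")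
    case True
    have "C * (1 + s + s\<^sup>2) \<le> C * (1 + S + S\<^sup>2)"
      using True s assms by (intro mult_left_mono add_mono power_mono) auto
    moreover have "0 \<le> s ^ 3" using s by simp
    ultimately show ?thesis using True by linarith
  next
    case False
    then have sS: "S \<le> s" "1 \<le> s" using assms by (auto simp: S_def)
    have s2: "s \<le> s\<^sup>2" "1 \<le> s\<^sup>2" using sS(2) by (auto simp: power2_eq_square intro: order.trans[OF sS(2)])
    have "C * (1 + s + s\<^sup>2) + s \<le> C * (3 * s\<^sup>2) + s\<^sup>2"
      using s2 assms by (intro add_mono mult_left_mono) auto
    also have "\<dots> = S * s\<^sup>2 / 3" by (simp add: S_def algebra_simps)
    also have "\<dots> \<le> s * s\<^sup>2 / 3" using sS by (intro divide_right_mono mult_right_mono) auto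
    finally have "C * (1 + s + s\<^sup>2) + s - s ^ 3 / 3 \<le> 0" by (simp add: power3_eq_cube power2_eq_square)
    moreover have "0 \<le> C * (1 + S + S\<^sup>2) + S" using assms by (simp add: S_def)
    ultimately show ?thesis by linarith
  qed
  from this[of "\<bar>t\<bar>" for t]
  have "cw C t \<le> exp (C * (1 + S + S\<^sup>2) + S) * exp (- \<bar>t\<bar>)" for t
    by (simp add: cw_def flip: exp_add) (smt (verit) abs_ge_zero power2_abs)
  then show ?thesis by (intro exI[of _ "exp (C * (1 + S + S\<^sup>2) + S)"]) auto
qed

lemma integrable_exp_abs: "integrable lborel (\<lambda>t :: real. exp (- \<bar>t\<bar>))"
proof -
  have 1: "integrable lborel (\<lambda>t :: real. norm (indicator {0..} t *\<^sub>R exp (- of_real t * (1 :: complex))))"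
    by (intro integrable_norm integral_exp_minus_complex(1)) simp
  have 2: "integrable lborel (\<lambda>t :: real. norm (indicator {0..} (0 + (- 1) * t) *\<^sub>R exp (- of_real (0 + (- 1) * t) * (1 :: complex))))"
    using lborel_integrable_real_affine[OF 1, of "- 1" 0] by simp
  show ?thesis
    by (rule Bochner_Integration.integrable_bound[OF Bochner_Integration.integrable_add[OF 1 2]])
       (auto simp: indicator_def intro!: AE_I2)
qed

lemma cw_integrable: "0 \<le> C \<Longrightarrow> integrable lborel (cw C)"
proof -
  assume "0 \<le> C"
  then obtain D where D: "0 \<le> D" "\<And>t. cw C t \<le> D * exp (- \<bar>t\<bar>)" using cw_le_exp by blast
  show ?thesis
    by (rule Bochner_Integration.integrable_bound[OF integrable_mult_right[OF integrable_exp_abs, of D]])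
       (use D cw_nonneg[of C] in \<open>auto intro!: AE_I2 simp: abs_of_nonneg abs_mult\<close>)
qed

lemma cw_tendsto: "0 \<le> C \<Longrightarrow> ((\<lambda>T. K * cw C T) \<longlongrightarrow> 0) at_top"
proof -
  assume "0 \<le> C"
  then obtain D where D: "0 \<le> D" "\<And>t. cw C t \<le> D * exp (- \<bar>t\<bar>)" using cw_le_exp by blast
  have "((\<lambda>T. D * exp (- \<bar>T\<bar>)) \<longlongrightarrow> 0) at_top" by real_asymp
  then have "(cw C \<longlongrightarrow> 0) at_top"
    by (rule Lim_null_comparison[rotated]) (use D cw_nonneg[of C] in auto)
  from tendsto_mult[OF tendsto_const[of K] this] show ?thesis by simp
qed

text \<open>Completing the square in \<open>\<bar>t\<bar>\<close>.\<close>

lemma gauss_le_exp: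
  fixes a B t :: real
  assumes "0 < a"
  shows "exp (B * \<bar>t\<bar> - a * t\<^sup>2) \<le> exp ((B + 1)\<^sup>2 / (4 * a)) * exp (- \<bar>t\<bar>)"
proof -
  have "0 \<le> (2 * a * \<bar>t\<bar> - (B + 1))\<^sup>2 / (4 * a)" using assms by simp
  also have "\<dots> = a * t\<^sup>2 - (B + 1) * \<bar>t\<bar> + (B + 1)\<^sup>2 / (4 * a)"
    using assms by (simp add: power2_eq_square field_simps)
  finally show ?thesis by (simp add: algebra_simps flip: exp_add)
qed

lemma gauss_integrable:
  fixes a B :: real
  assumes "0 < a"
  shows "integrable lborel (\<lambda>t. exp (B * \<bar>t\<bar> - a * t\<^sup>2))"
  by (rule Bochner_Integration.integrable_bound[OF integrable_mult_right[OF integrable_exp_abs, of "exp ((B + 1)\<^sup>2 / (4 * a))"]])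
     (use gauss_le_exp[OF assms, of B] in \<open>auto intro!: AE_I2\<close>)

section \<open>Airy functions as wedge integrals\<close>

definition ex :: "real \<Rightarrow> complex \<Rightarrow> complex" where
  "ex x z = exp (z ^ 3 / 3 - of_real x * z)"

lemma airy_exp_eq: "airy_exp x y z w = ex x z * ex y w"
  by (simp add: airy_exp_def ex_def algebra_simps flip: exp_add)

lemma ex_measurable [measurable]: "ex x \<in> borel_measurable borel"
  unfolding ex_def by measurable

lemma Re_cube: "Re (z ^ 3) = (Re z) ^ 3 - 3 * Re z * (Im z)\<^sup>2"
  by (simp add: power3_eq_cube power2_eq_square algebra_simps)

lemma norm_ex: "cmod (ex x z) = exp (((Re z) ^ 3 - 3 * Re z * (Im z)\<^sup>2) / 3 - x * Re z)"
  by (simp add: ex_def Re_cube)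

lemma ex_add: "ex (x + l) z = ex x z * exp (- of_real l * z)"
  by (simp add: ex_def algebra_simps flip: exp_add)

text \<open>Raising \<open>x\<close> multiplies by an exponential in \<open>z\<close>, so the real
  part of the contour acts as a decay rate. This is the source of the decay in
  \<open>pbound_ex\<close>.\<close>

lemma norm_ex_le:
  assumes "x0 \<le> x" "a \<le> Re z"
  shows "cmod (ex x z) \<le> cmod (ex x0 z) * exp (- a * (x - x0))"
proof -
  have "ex x z = ex x0 z * exp (- of_real (x - x0) * z)" using ex_add[of x0 "x - x0" z] by simp
  then have "cmod (ex x z) = cmod (ex x0 z) * exp (- (x - x0) * Re z)" by (simp add: norm_mult)
  also have "\<dots> \<le> cmod (ex x0 z) * exp (- a * (x - x0))"
    using assms mult_left_mono[of a "Re z" "x - x0"] by (intro mult_left_mono) (auto simp: algebra_simps)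
  finally show ?thesis .
qed

lemma norm_wpath_le: "cmod (wpath a \<phi> t) \<le> \<bar>a\<bar> + \<bar>t\<bar>"
  unfolding wpath_def by (rule order.trans[OF norm_triangle_ineq]) (simp add: norm_mult)

lemma wpath_60: "Re (wpath a (pi / 3) t) = a + \<bar>t\<bar> / 2" "(Im (wpath a (pi / 3) t))\<^sup>2 = 3 / 4 * t\<^sup>2"
  by (simp_all add: wpath_def cos_60 sin_60 power_mult_distrib power_divide)

lemma wpath_90: "wpath a (pi / 2) t = Complex a t"
  by (simp add: wpath_def complex_eq_iff)

lemma wfac_90: "wfac (pi / 2) t = 1 / (2 * of_real pi)"
  by (simp add: wfac_def cis.ctr complex_eq_iff Re_divide Im_divide power2_eq_square)

text \<open>A point of either ray is described by its real part and the square of its imaginary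
  part. Since the bound is uniform in \<open>\<bar>c\<bar> \<le> M\<close>, it also covers the
  segments joining the ends of two wedges.\<close>

lemma norm_ex_60:
  assumes z: "Re z = c + T / 2" "(Im z)\<^sup>2 = 3 / 4 * T\<^sup>2" and c: "\<bar>c\<bar> \<le> M" and T: "0 \<le> T"
  shows "cmod (ex x z) \<le> cw (M ^ 3 + M\<^sup>2 + M + \<bar>x\<bar> * (1 + M)) T"
proof -
  have M: "0 \<le> M" using c by simp
  have "((Re z) ^ 3 - 3 * Re z * (Im z)\<^sup>2) / 3 - x * Re z
      = (c ^ 3 + 3 / 2 * c\<^sup>2 * T - 3 / 2 * c * T\<^sup>2 - T ^ 3) / 3 - x * (c + T / 2)"
    unfolding z by (simp add: power3_eq_cube power2_eq_square field_simps)
  also have "\<dots> \<le> (M ^ 3 + 3 / 2 * M\<^sup>2 * T + 3 / 2 * M * T\<^sup>2 - T ^ 3) / 3 + \<bar>x\<bar> * (M + T / 2)"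
  proof -
    have "c ^ 3 \<le> M ^ 3"
      using power_mono[OF c abs_ge_zero, of 3] by (simp add: power_abs[symmetric])
    moreover have "c\<^sup>2 * T \<le> M\<^sup>2 * T" using c T by (intro mult_right_mono) (auto simp: abs_le_square_iff[symmetric])
    moreover have "- c * T\<^sup>2 \<le> M * T\<^sup>2" using c by (intro mult_right_mono) auto
    moreover have "- x * (c + T / 2) \<le> \<bar>x\<bar> * (M + T / 2)"
    proof -
      have "- x * (c + T / 2) \<le> \<bar>x\<bar> * \<bar>c + T / 2\<bar>"
        using abs_ge_minus_self[of "x * (c + T / 2)"] by (simp add: abs_mult)
      also have "\<dots> \<le> \<bar>x\<bar> * (M + T / 2)" using c T by (intro mult_left_mono) auto
      finally show ?thesis .
    qed
    ultimately have "(c ^ 3 + 3 / 2 * (c\<^sup>2 * T) + 3 / 2 * (- c * T\<^sup>2) - T ^ 3) / 3 + - x * (c + T / 2)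
        \<le> (M ^ 3 + 3 / 2 * (M\<^sup>2 * T) + 3 / 2 * (M * T\<^sup>2) - T ^ 3) / 3 + \<bar>x\<bar> * (M + T / 2)"
      by (intro add_mono divide_right_mono diff_mono mult_left_mono order_refl) auto
    then show ?thesis by (simp add: algebra_simps)
  qed
  also have "\<dots> \<le> (M ^ 3 + M\<^sup>2 + M + \<bar>x\<bar> * (1 + M)) * (1 + T + T\<^sup>2) - T ^ 3 / 3"
  proof -
    define D where "D = M ^ 3 + M\<^sup>2 + M + \<bar>x\<bar> * (1 + M)"
    have D: "D = M ^ 3 + M\<^sup>2 + M + \<bar>x\<bar> + \<bar>x\<bar> * M" by (simp add: D_def algebra_simps)
    have "0 \<le> M ^ 3" "0 \<le> M\<^sup>2" "0 \<le> \<bar>x\<bar> * M" "0 \<le> \<bar>x\<bar>" using M by auto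
    then have u: "M ^ 3 / 3 + \<bar>x\<bar> * M \<le> D" "M\<^sup>2 / 2 + \<bar>x\<bar> / 2 \<le> D" "M / 2 \<le> D"
      unfolding D using M by linarith+
    have "(M ^ 3 + 3 / 2 * M\<^sup>2 * T + 3 / 2 * M * T\<^sup>2 - T ^ 3) / 3 + \<bar>x\<bar> * (M + T / 2)
        = (M ^ 3 / 3 + \<bar>x\<bar> * M + (M\<^sup>2 / 2 + \<bar>x\<bar> / 2) * T + M / 2 * T\<^sup>2) - T ^ 3 / 3"
      by (simp add: field_simps)
    also have "\<dots> \<le> (D + D * T + D * T\<^sup>2) - T ^ 3 / 3"
      by (rule diff_right_mono, rule add_mono[OF add_mono[OF u(1) mult_right_mono[OF u(2) T]] mult_right_mono[OF u(3) zero_le_power2]])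
    also have "\<dots> = D * (1 + T + T\<^sup>2) - T ^ 3 / 3" by (simp add: algebra_simps)
    finally show ?thesis unfolding D_def .
  qed
  finally show ?thesis using T by (simp add: norm_ex cw_def)
qed

definition ec :: "real \<Rightarrow> real \<Rightarrow> real" where
  "ec a x = \<bar>a\<bar> ^ 3 + \<bar>a\<bar>\<^sup>2 + \<bar>a\<bar> + \<bar>x\<bar> * (1 + \<bar>a\<bar>)"

lemma ec_nonneg: "0 \<le> ec a x"
  by (simp add: ec_def)

lemma norm_ex_wpath: "cmod (ex x (wpath a (pi / 3) t)) \<le> cw (ec a x) t"
proof -
  have "cmod (ex x (wpath a (pi / 3) t)) \<le> cw (ec a x) \<bar>t\<bar>"
    unfolding ec_def using wpath_60[of a t] by (intro norm_ex_60) auto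
  then show ?thesis by (simp add: cw_def)
qed

lemma norm_power_ex_wpath:
  "cmod (wpath a (pi / 3) t ^ k * ex x (wpath a (pi / 3) t)) \<le> (1 + \<bar>a\<bar>) ^ k * cw (ec a x + real k) t"
proof -
  have "cmod (wpath a (pi / 3) t) \<le> (1 + \<bar>a\<bar>) * (1 + \<bar>t\<bar>)"
    using norm_wpath_le[of a "pi / 3" t] by (simp add: algebra_simps) (smt (verit) abs_ge_zero mult_nonneg_nonneg)
  then have "cmod (wpath a (pi / 3) t ^ k) \<le> (1 + \<bar>a\<bar>) ^ k * (1 + \<bar>t\<bar>) ^ k"
    unfolding norm_power power_mult_distrib[symmetric] by (intro power_mono) auto
  then have "cmod (wpath a (pi / 3) t ^ k * ex x (wpath a (pi / 3) t)) \<le> ((1 + \<bar>a\<bar>) ^ k * (1 + \<bar>t\<bar>) ^ k) * cw (ec a x) t"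
    unfolding norm_mult by (intro mult_mono norm_ex_wpath) auto
  also have "\<dots> \<le> (1 + \<bar>a\<bar>) ^ k * cw (ec a x + real k) t"
    unfolding mult.assoc by (intro mult_left_mono power_mult_cw) auto
  finally show ?thesis .
qed

lemma integrable_power_ex: "integrable lborel (\<lambda>t. wpath a (pi / 3) t ^ k * ex x (wpath a (pi / 3) t))"
proof (rule Bochner_Integration.integrable_bound)
  show "integrable lborel (\<lambda>t. (1 + \<bar>a\<bar>) ^ k * cw (ec a x + real k) t)"
    by (intro integrable_mult_right cw_integrable add_nonneg_nonneg ec_nonneg) auto
  show "AE t in lborel. norm (wpath a (pi / 3) t ^ k * ex x (wpath a (pi / 3) t)) \<le> norm ((1 + \<bar>a\<bar>) ^ k * cw (ec a x + real k) t)"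
    using norm_power_ex_wpath cw_nonneg by (intro AE_I2) (simp add: abs_mult)
qed measurable

text \<open>On a vertical line the real part of the cube is quadratic in \<open>t\<close>; for
  \<open>b > 0\<close> this is Gaussian decay.\<close>

lemma norm_ex_vertical: "cmod (ex x (wpath b (pi / 2) t)) = exp (b ^ 3 / 3 - b * x) * exp (- b * t\<^sup>2)"
  by (simp add: norm_ex wpath_90 flip: exp_add)

lemma norm_power_ex_vertical:
  assumes "0 < b"
  shows "cmod (wpath b (pi / 2) t ^ k * ex x (wpath b (pi / 2) t))
    \<le> exp (b ^ 3 / 3 + real k * b) * exp (- b * x) * exp (real k * \<bar>t\<bar> - b * t\<^sup>2)"
proof -
  have "cmod (wpath b (pi / 2) t) \<le> exp (b + \<bar>t\<bar>)"
    using norm_wpath_le[of b "pi / 2" t] exp_ge_add_one_self[of "b + \<bar>t\<bar>"] assms by linarith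
  then have "cmod (wpath b (pi / 2) t ^ k) \<le> exp (b + \<bar>t\<bar>) ^ k"
    unfolding norm_power by (intro power_mono) auto
  then have "cmod (wpath b (pi / 2) t ^ k * ex x (wpath b (pi / 2) t)) \<le> exp (b + \<bar>t\<bar>) ^ k * (exp (b ^ 3 / 3 - b * x) * exp (- b * t\<^sup>2))"
    unfolding norm_mult norm_ex_vertical by (intro mult_right_mono) auto
  also have "\<dots> = exp (b ^ 3 / 3 + real k * b) * exp (- b * x) * exp (real k * \<bar>t\<bar> - b * t\<^sup>2)"
    by (simp add: algebra_simps flip: exp_add exp_of_nat_mult)
  finally show ?thesis .
qed

lemma integrable_power_ex_vertical:
  assumes "0 < b"
  shows "integrable lborel (\<lambda>t. wpath b (pi / 2) t ^ k * ex x (wpath b (pi / 2) t))"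
proof (rule Bochner_Integration.integrable_bound)
  show "integrable lborel (\<lambda>t. exp (b ^ 3 / 3 + real k * b) * exp (- b * x) * exp (real k * \<bar>t\<bar> - b * t\<^sup>2))"
    by (intro integrable_mult_right gauss_integrable assms)
  show "AE t in lborel. norm (wpath b (pi / 2) t ^ k * ex x (wpath b (pi / 2) t))
     \<le> norm (exp (b ^ 3 / 3 + real k * b) * exp (- b * x) * exp (real k * \<bar>t\<bar> - b * t\<^sup>2))"
    using norm_power_ex_vertical[OF assms] by (intro AE_I2) simp
qed measurable

text \<open>\<open>airy 0\<close> is the Airy function, and \<open>airy k\<close> is
  \<open>(- 1) ^ k\<close> times its \<open>k\<close>-th derivative.\<close>

definition airy :: "nat \<Rightarrow> real \<Rightarrow> complex" where
  "airy k x = wedge_integral 1 (pi / 3) (\<lambda>z. z ^ k * ex x z)"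

lemma ex_holomorphic: "(\<lambda>z. z ^ k * ex x z) holomorphic_on UNIV"
  unfolding ex_def by (intro holomorphic_intros) auto

lemma segment_same_direction:
  fixes z w :: complex
  assumes "z \<in> closed_segment (of_real a + w) (of_real b + w)"
  obtains c :: real where "z = of_real c + w" "\<bar>c\<bar> \<le> max \<bar>a\<bar> \<bar>b\<bar>"
proof -
  obtain u where u: "0 \<le> u" "u \<le> 1" "z = (1 - u) *\<^sub>R (of_real a + w) + u *\<^sub>R (of_real b + w)"
    using assms by (auto simp: in_segment)
  show ?thesis
  proof
    show "z = of_real ((1 - u) * a + u * b) + w"
      by (simp add: u(3) scaleR_conv_of_real algebra_simps)
    have "\<bar>(1 - u) * a + u * b\<bar> \<le> (1 - u) * \<bar>a\<bar> + u * \<bar>b\<bar>"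
      using u by (intro order.trans[OF abs_triangle_ineq]) (simp add: abs_mult)
    also have "\<dots> \<le> (1 - u) * max \<bar>a\<bar> \<bar>b\<bar> + u * max \<bar>a\<bar> \<bar>b\<bar>"
      using u by (intro add_mono mult_left_mono) auto
    finally show "\<bar>(1 - u) * a + u * b\<bar> \<le> max \<bar>a\<bar> \<bar>b\<bar>" by (simp add: algebra_simps)
  qed
qed

text \<open>At equal parameters the ends of the two wedges differ by the constant
  \<open>a - 1\<close>, and on the horizontal segment between them the integrand is at most a
  multiple of \<open>cw\<close> with a fixed constant.\<close>

lemma airy_base: "wedge_integral a (pi / 3) (\<lambda>z. z ^ k * ex x z) = airy k x"
  unfolding airy_def
proof -
  obtain P where P: "\<And>z. (P has_field_derivative z ^ k * ex x z) (at z)"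
    using primitive_exists[OF ex_holomorphic] by blast
  define M where "M = max \<bar>a\<bar> \<bar>1 :: real\<bar>"
  have M: "1 \<le> M" "\<bar>a\<bar> \<le> M" by (auto simp: M_def)
  have ends: "((\<lambda>T. P (of_real a + of_real T * cis \<theta>) - P (of_real 1 + of_real T * cis \<theta>)) \<longlongrightarrow> 0) at_top"
    if \<theta>: "cos \<theta> = 1 / 2" "(sin \<theta>)\<^sup>2 = 3 / 4" for \<theta>
  proof (rule primitive_diff_tendsto[OF P])
    show "\<forall>\<^sub>F T in at_top. \<forall>z\<in>closed_segment (of_real a + of_real T * cis \<theta>) (of_real 1 + of_real T * cis \<theta>).
        cmod (z ^ k * ex x z) \<le> exp (real k * M) * cw (ec M x + real k) T"
      using eventually_ge_at_top[of 0]
    proof eventually_elim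
      case (elim T)
      show ?case
      proof
        fix z assume "z \<in> closed_segment (of_real a + of_real T * cis \<theta>) (of_real 1 + of_real T * cis \<theta>)"
        then obtain c where c: "z = of_real c + of_real T * cis \<theta>" "\<bar>c\<bar> \<le> M"
          unfolding M_def by (rule segment_same_direction)
        have e: "cmod (ex x z) \<le> cw (M ^ 3 + M\<^sup>2 + M + \<bar>x\<bar> * (1 + M)) T"
          by (rule norm_ex_60[OF _ _ c(2) elim]) (simp_all add: c(1) \<theta> power_mult_distrib)
        have "cmod z \<le> M + T"
          unfolding c(1) using c(2) elim by (intro order.trans[OF norm_triangle_ineq]) (simp add: norm_mult)
        also have "\<dots> \<le> exp M * (1 + \<bar>T\<bar>)"
        proof -
          have "M + T \<le> (1 + M) * (1 + T)" using M elim by (simp add: algebra_simps)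
          also have "\<dots> \<le> exp M * (1 + T)" using elim by (intro mult_right_mono exp_ge_add_one_self) auto
          finally show ?thesis using elim by simp
        qed
        finally have "cmod z ^ k \<le> (exp M * (1 + \<bar>T\<bar>)) ^ k" by (intro power_mono) auto
        then have "cmod (z ^ k * ex x z) \<le> (exp M * (1 + \<bar>T\<bar>)) ^ k * cw (ec M x) T"
          unfolding norm_mult norm_power using e M by (intro mult_mono) (auto simp: ec_def)
        also have "\<dots> = exp (real k * M) * ((1 + \<bar>T\<bar>) ^ k * cw (ec M x) T)"
          by (simp add: power_mult_distrib exp_of_nat_mult)
        also have "\<dots> \<le> exp (real k * M) * cw (ec M x + real k) T"
          by (intro mult_left_mono power_mult_cw) auto
        finally show "cmod (z ^ k * ex x z) \<le> exp (real k * M) * cw (ec M x + real k) T" .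
      qed
    qed
    show "\<forall>\<^sub>F T in at_top. cmod (of_real a + of_real T * cis \<theta> - (of_real 1 + of_real T * cis \<theta>)) \<le> 2 * M"
    proof (rule always_eventually, rule allI)
      fix T
      have "cmod (of_real a - of_real 1) \<le> 2 * M"
        using M by (simp only: of_real_diff[symmetric] norm_of_real)
      then show "cmod (of_real a + of_real T * cis \<theta> - (of_real 1 + of_real T * cis \<theta>)) \<le> 2 * M"
        by (simp only: add_diff_cancel_right)
    qed
    have "((\<lambda>T. (exp (real k * M) * (2 * M)) * cw (ec M x + real k) T) \<longlongrightarrow> 0) at_top"
      by (intro cw_tendsto add_nonneg_nonneg ec_nonneg of_nat_0_le_iff)
    then show "((\<lambda>T. exp (real k * M) * cw (ec M x + real k) T * (2 * M)) \<longlongrightarrow> 0) at_top"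
      by (simp add: mult_ac)
  qed
  show "wedge_integral a (pi / 3) (\<lambda>z. z ^ k * ex x z) = wedge_integral 1 (pi / 3) (\<lambda>z. z ^ k * ex x z)"
    by (rule wedge_shift[OF P integrable_power_ex integrable_power_ex filterlim_ident])
       (rule ends; simp add: cos_60 sin_60 power_divide)+
qed

lemma wedge_cong:
  assumes "\<And>t. f (wpath a \<phi> t) = g (wpath a \<phi> t)"
  shows "wedge_integral a \<phi> f = wedge_integral a \<phi> g"
proof -
  have "f (of_real a + of_real t * cis \<phi>) = g (of_real a + of_real t * cis \<phi>)" if "0 \<le> t" for t
    using assms[of t] that by (simp add: wpath_def)
  moreover have "f (of_real a + of_real t * cis (- \<phi>)) = g (of_real a + of_real t * cis (- \<phi>))" if "0 \<le> t" for t
    using assms[of "- t"] that by (cases "t = 0") (simp_all add: wpath_def)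
  ultimately show ?thesis
    unfolding wedge_integral_def set_lebesgue_integral_def
    by (intro arg_cong2[of _ _ _ _ "(*)"] arg_cong2[of _ _ _ _ "(-)"] Bochner_Integration.integral_cong refl)
       (auto simp: indicator_def)
qed

lemma wedge_mult: "wedge_integral a \<phi> (\<lambda>z. c * f z) = c * wedge_integral a \<phi> f"
  unfolding wedge_integral_def by (simp add: mult.assoc right_diff_distrib)

lemma wedge_diff:
  assumes "integrable lborel (\<lambda>t. f (wpath a \<phi> t))" "integrable lborel (\<lambda>t. g (wpath a \<phi> t))"
  shows "wedge_integral a \<phi> (\<lambda>z. f z - g z) = wedge_integral a \<phi> f - wedge_integral a \<phi> g"
  using assms by (simp add: wedge_eq left_diff_distrib integrable_wfac)

section \<open>Laplace transforms along wedges\<close>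

lemma Re_wpath_ge: "0 \<le> cos \<phi> \<Longrightarrow> a \<le> Re (wpath a \<phi> t)"
  by (simp add: wpath_def)

text \<open>The wedge integral of \<open>p z * exp (- l * z)\<close>, written directly as a Lebesgue
  integral so that measurability in \<open>l\<close> does not depend on convergence.\<close>

definition lt :: "real \<Rightarrow> real \<Rightarrow> (complex \<Rightarrow> complex) \<Rightarrow> real \<Rightarrow> complex" where
  "lt a \<phi> p l = (\<integral>t. p (wpath a \<phi> t) * exp (- of_real l * wpath a \<phi> t) * wfac \<phi> t \<partial>lborel)"

lemma lt_measurable [measurable]:
  assumes [measurable]: "p \<in> borel_measurable borel"
  shows "lt a \<phi> p \<in> borel_measurable borel"
  unfolding lt_def by measurable

lemma norm_exp_minus_le:
  assumes "a \<le> Re z" "0 \<le> l"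
  shows "cmod (exp (- of_real l * z)) \<le> exp (- l * a)"
  using mult_left_mono[OF assms] by simp

lemma wedge_eq_lt:
  assumes [measurable]: "p \<in> borel_measurable borel" and int: "integrable lborel (\<lambda>t. p (wpath a \<phi> t))"
    and \<phi>: "0 \<le> cos \<phi>" and l: "0 \<le> l"
  shows "integrable lborel (\<lambda>t. p (wpath a \<phi> t) * exp (- of_real l * wpath a \<phi> t))"
    and "wedge_integral a \<phi> (\<lambda>z. p z * exp (- of_real l * z)) = lt a \<phi> p l"
    and "cmod (lt a \<phi> p l) \<le> exp (- l * a) * (\<integral>t. cmod (p (wpath a \<phi> t)) \<partial>lborel)"
proof -
  have b: "cmod (p (wpath a \<phi> t) * exp (- of_real l * wpath a \<phi> t)) \<le> exp (- l * a) * cmod (p (wpath a \<phi> t))" for t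
    unfolding norm_mult mult.commute[of "exp (- l * a)"]
    by (intro mult_left_mono norm_exp_minus_le Re_wpath_ge \<phi> l) auto
  show int': "integrable lborel (\<lambda>t. p (wpath a \<phi> t) * exp (- of_real l * wpath a \<phi> t))"
    by (rule Bochner_Integration.integrable_bound[OF integrable_mult_right[OF integrable_norm[OF int], of "exp (- l * a)"]])
       (use b in \<open>auto intro!: AE_I2 simp: abs_mult\<close>)
  then show "wedge_integral a \<phi> (\<lambda>z. p z * exp (- of_real l * z)) = lt a \<phi> p l"
    unfolding lt_def by (rule wedge_eq)
  have "cmod (lt a \<phi> p l) \<le> (\<integral>t. exp (- l * a) * cmod (p (wpath a \<phi> t)) \<partial>lborel)"
    unfolding lt_def
  proof (intro order.trans[OF integral_norm_bound] integral_mono integrable_norm integrable_wfac int' integrable_mult_right int)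
    fix t
    have "norm (p (wpath a \<phi> t) * exp (- of_real l * wpath a \<phi> t) * wfac \<phi> t) \<le> cmod (p (wpath a \<phi> t) * exp (- of_real l * wpath a \<phi> t)) * 1"
      unfolding norm_mult[of _ "wfac \<phi> t"] by (intro mult_left_mono norm_wfac) auto
    also have "\<dots> \<le> exp (- l * a) * cmod (p (wpath a \<phi> t))" using b[of t] by simp
    finally show "norm (p (wpath a \<phi> t) * exp (- of_real l * wpath a \<phi> t) * wfac \<phi> t) \<le> exp (- l * a) * cmod (p (wpath a \<phi> t))" .
  qed
  then show "cmod (lt a \<phi> p l) \<le> exp (- l * a) * (\<integral>t. cmod (p (wpath a \<phi> t)) \<partial>lborel)" by simp
qed

lemma integrable_exp_tail_weight:
  "0 < \<delta> \<Longrightarrow> integrable lborel (\<lambda>l :: real. indicator {0..} l * exp (- l * \<delta>))"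
  using integrable_norm[OF integral_exp_minus_complex(1)[of "of_real \<delta>"]] by simp

text \<open>Both identities below come from \<open>1 / u = \<integral> exp (- l u) dl\<close>, the integral being over
  \<open>l \<ge> 0\<close> and \<open>Re u > 0\<close>, and Fubini's theorem.\<close>

lemma wedge_laplace:
  assumes [measurable]: "p \<in> borel_measurable borel" and int: "integrable lborel (\<lambda>t. p (wpath a \<phi> t))"
    and \<phi>: "0 \<le> cos \<phi>" and c: "Re c < a"
  shows "wedge_integral a \<phi> (\<lambda>z. p z / (z - c)) = (\<integral>l. indicator {0..} l *\<^sub>R (exp (of_real l * c) * lt a \<phi> p l) \<partial>lborel)"
    and "integrable lborel (\<lambda>l. indicator {0..} l *\<^sub>R (exp (of_real l * c) * lt a \<phi> p l))"
    and "integrable lborel (\<lambda>t. p (wpath a \<phi> t) / (wpath a \<phi> t - c))"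
proof -
  define \<delta> where "\<delta> = a - Re c"
  have \<delta>: "0 < \<delta>" using c by (simp add: \<delta>_def)
  let ?g = "wpath a \<phi>"
  have Re: "\<delta> \<le> Re (?g t - c)" for t using Re_wpath_ge[OF \<phi>, of a t] by (simp add: \<delta>_def)
  show int1: "integrable lborel (\<lambda>t. p (?g t) / (?g t - c))"
  proof (rule Bochner_Integration.integrable_bound[OF integrable_mult_right[OF integrable_norm[OF int], of "1 / \<delta>"]])
    show "AE t in lborel. norm (p (?g t) / (?g t - c)) \<le> norm (1 / \<delta> * norm (p (?g t)))"
    proof (rule AE_I2)
      fix t
      have "\<delta> \<le> cmod (?g t - c)" using Re[of t] complex_Re_le_cmod[of "?g t - c"] by linarith
      then have "cmod (p (?g t)) / cmod (?g t - c) \<le> cmod (p (?g t)) / \<delta>"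
        using \<delta> by (intro divide_left_mono mult_pos_pos) auto
      then show "norm (p (?g t) / (?g t - c)) \<le> norm (1 / \<delta> * norm (p (?g t)))"
        using \<delta> by (simp add: norm_divide)
    qed
  qed measurable
  define F where "F = (\<lambda>(t, l). p (?g t) * wfac \<phi> t * (indicator {0..} l *\<^sub>R exp (- of_real l * (?g t - c))))"
  have Fm: "F \<in> borel_measurable borel"
  proof -
    have "F \<in> borel_measurable (borel \<Otimes>\<^sub>M borel)" unfolding F_def by measurable
    then show ?thesis by (simp add: borel_prod)
  qed
  have Fb: "cmod (F (t, l)) \<le> cmod (p (?g t)) * (indicator {0..} l * exp (- l * \<delta>))" for t l
  proof (cases "0 \<le> l")
    case True
    have "cmod (F (t, l)) = cmod (p (?g t)) * cmod (wfac \<phi> t) * cmod (exp (- of_real l * (?g t - c)))"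
      using True by (simp only: F_def prod.case norm_mult) simp
    also have "\<dots> \<le> cmod (p (?g t)) * 1 * exp (- l * \<delta>)"
      by (intro mult_mono norm_wfac norm_exp_minus_le Re True) auto
    finally show ?thesis using True by simp
  qed (simp add: F_def)
  note fub = fubini_bounded[OF Fm integrable_norm[OF int] integrable_exp_tail_weight[OF \<delta>] Fb]
  have inner_l: "(\<integral>l. F (t, l) \<partial>lborel) = p (?g t) / (?g t - c) * wfac \<phi> t" for t
  proof -
    have "(\<integral>l. F (t, l) \<partial>lborel) = p (?g t) * wfac \<phi> t * (\<integral>l. indicator {0..} l *\<^sub>R exp (- of_real l * (?g t - c)) \<partial>lborel)"
      unfolding F_def prod.case by (rule integral_mult_right_zero)
    also have "(\<integral>l. indicator {0..} l *\<^sub>R exp (- of_real l * (?g t - c)) \<partial>lborel) = 1 / (?g t - c)"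
      using Re[of t] \<delta> by (intro integral_exp_minus_complex(2)) linarith
    finally show ?thesis by simp
  qed
  have inner_t: "(\<integral>t. F (t, l) \<partial>lborel) = indicator {0..} l *\<^sub>R (exp (of_real l * c) * lt a \<phi> p l)" for l
  proof -
    have "(\<integral>t. F (t, l) \<partial>lborel) = (\<integral>t. (of_real (indicator {0..} l) * exp (of_real l * c)) * (p (?g t) * exp (- of_real l * ?g t) * wfac \<phi> t) \<partial>lborel)"
      by (rule Bochner_Integration.integral_cong[OF refl])
         (simp add: F_def scaleR_conv_of_real right_diff_distrib exp_diff exp_minus field_simps)
    also have "\<dots> = of_real (indicator {0..} l) * exp (of_real l * c) * lt a \<phi> p l"
      unfolding lt_def by (rule integral_mult_right_zero)
    finally show ?thesis by (simp add: scaleR_conv_of_real)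
  qed
  show "wedge_integral a \<phi> (\<lambda>z. p z / (z - c)) = (\<integral>l. indicator {0..} l *\<^sub>R (exp (of_real l * c) * lt a \<phi> p l) \<partial>lborel)"
    using fub(2) unfolding inner_l inner_t by (simp add: wedge_eq[OF int1])
  show "integrable lborel (\<lambda>l. indicator {0..} l *\<^sub>R (exp (of_real l * c) * lt a \<phi> p l))"
    using fub(4) unfolding inner_t .
qed

lemma double_wedge_laplace:
  assumes [measurable]: "p \<in> borel_measurable borel" "q \<in> borel_measurable borel"
    and pint: "integrable lborel (\<lambda>t. p (wpath a \<phi> t))" and qint: "integrable lborel (\<lambda>t. q (wpath b \<psi> t))"
    and \<phi>: "0 \<le> cos \<phi>" "0 \<le> cos \<psi>" and c: "c < a + b"
  shows "wedge_integral a \<phi> (\<lambda>z. wedge_integral b \<psi> (\<lambda>w. p z * q w / (z + w - of_real c)))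
      = (\<integral>l. indicator {0..} l *\<^sub>R (exp (of_real (l * c)) * lt a \<phi> p l * lt b \<psi> q l) \<partial>lborel)"
    and "integrable lborel (\<lambda>l. indicator {0..} l *\<^sub>R (exp (of_real (l * c)) * lt a \<phi> p l * lt b \<psi> q l))"
    and "integrable lborel (\<lambda>t. wedge_integral b \<psi> (\<lambda>w. p (wpath a \<phi> t) * q w / (wpath a \<phi> t + w - of_real c)))"
proof -
  define \<delta> where "\<delta> = a + b - c"
  have \<delta>: "0 < \<delta>" using c by (simp add: \<delta>_def)
  let ?g = "wpath a \<phi>"
  define k where "k = (\<integral>t. cmod (q (wpath b \<psi> t)) \<partial>lborel)"
  have k: "0 \<le> k" unfolding k_def by simp
  define F where "F = (\<lambda>(t, l). p (?g t) * (indicator {0..} l *\<^sub>R (exp (of_real l * (of_real c - ?g t)) * lt b \<psi> q l)))"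
  have Fm: "F \<in> borel_measurable borel"
  proof -
    have "F \<in> borel_measurable (borel \<Otimes>\<^sub>M borel)" unfolding F_def by measurable
    then show ?thesis by (simp add: borel_prod)
  qed
  have Fb: "cmod (F (t, l)) \<le> cmod (p (?g t)) * (k * (indicator {0..} l * exp (- l * \<delta>)))" for t l
  proof (cases "0 \<le> l")
    case True
    have "cmod (exp (of_real l * (of_real c - ?g t))) \<le> exp (- l * (a - c))"
    proof -
      have "l * a \<le> l * Re (?g t)" using Re_wpath_ge[OF \<phi>(1), of a t] True by (rule mult_left_mono)
      then show ?thesis by (simp add: algebra_simps)
    qed
    moreover have "cmod (lt b \<psi> q l) \<le> exp (- l * b) * k"
      unfolding k_def by (rule wedge_eq_lt(3)) (use qint \<phi> True in auto)
    ultimately have "cmod (exp (of_real l * (of_real c - ?g t)) * lt b \<psi> q l) \<le> exp (- l * (a - c)) * (exp (- l * b) * k)"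
      unfolding norm_mult by (intro mult_mono) auto
    also have "\<dots> = k * exp (- l * \<delta>)" by (simp add: \<delta>_def algebra_simps flip: exp_add)
    finally have le: "cmod (exp (of_real l * (of_real c - ?g t)) * lt b \<psi> q l) \<le> k * exp (- l * \<delta>)" .
    have F: "F (t, l) = p (?g t) * (exp (of_real l * (of_real c - ?g t)) * lt b \<psi> q l)"
      and i: "indicator {0..} l = (1 :: real)" using True by (simp_all add: F_def)
    show ?thesis
      unfolding F i norm_mult[of "p (?g t)"] mult_1_left by (rule mult_left_mono[OF le norm_ge_zero])
  qed (simp add: F_def)
  \<comment> \<open>For fixed \<open>z\<close> on the first wedge the pole in \<open>w\<close> lies
    at \<open>c - z\<close>. Its real part is at most \<open>c - a\<close>, hence below
    \<open>b\<close>, and the single-variable identity applies.\<close>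
  have inner: "wedge_integral b \<psi> (\<lambda>w. p (?g t) * q w / (?g t + w - of_real c)) = (\<integral>l. F (t, l) \<partial>lborel)" for t
  proof -
    have e: "(\<lambda>w. p (?g t) * q w / (?g t + w - of_real c)) = (\<lambda>w. p (?g t) * (q w / (w - (of_real c - ?g t))))"
      by (simp add: algebra_simps)
    have "Re (of_real c - ?g t) < b" using Re_wpath_ge[OF \<phi>(1), of a t] c by simp
    then have "wedge_integral b \<psi> (\<lambda>w. q w / (w - (of_real c - ?g t)))
        = (\<integral>l. indicator {0..} l *\<^sub>R (exp (of_real l * (of_real c - ?g t)) * lt b \<psi> q l) \<partial>lborel)"
      by (intro wedge_laplace(1) qint \<phi>) auto
    then show ?thesis unfolding e wedge_mult F_def prod.case by (simp only: integral_mult_right_zero)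
  qed
  note vint = integrable_mult_right[OF integrable_exp_tail_weight[OF \<delta>], of k]
  note fub = fubini_bounded[OF Fm integrable_norm[OF pint] vint Fb]
  show outer: "integrable lborel (\<lambda>t. wedge_integral b \<psi> (\<lambda>w. p (?g t) * q w / (?g t + w - of_real c)))"
    unfolding inner by (rule fub(3))
  define H where "H = (\<lambda>(t, l). F (t, l) * wfac \<phi> t)"
  have Hm: "H \<in> borel_measurable borel"
  proof -
    have "F \<in> borel_measurable (borel \<Otimes>\<^sub>M borel)" using Fm by (simp add: borel_prod)
    then have "H \<in> borel_measurable (borel \<Otimes>\<^sub>M borel)" unfolding H_def by measurable
    then show ?thesis by (simp add: borel_prod)
  qed
  have Hb: "cmod (H (t, l)) \<le> cmod (p (?g t)) * (k * (indicator {0..} l * exp (- l * \<delta>)))" for t l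
  proof -
    have "cmod (H (t, l)) \<le> cmod (F (t, l)) * 1"
      unfolding H_def prod.case norm_mult by (intro mult_left_mono norm_wfac) auto
    then show ?thesis using Fb[of t l] by simp
  qed
  note fubH = fubini_bounded[OF Hm integrable_norm[OF pint] vint Hb]
  have H_l: "(\<integral>l. H (t, l) \<partial>lborel) = (\<integral>l. F (t, l) \<partial>lborel) * wfac \<phi> t" for t
    unfolding H_def prod.case by (rule integral_mult_left_zero)
  have H_t: "(\<integral>t. H (t, l) \<partial>lborel) = indicator {0..} l *\<^sub>R (exp (of_real (l * c)) * lt a \<phi> p l * lt b \<psi> q l)" for l
  proof -
    have "(\<integral>t. H (t, l) \<partial>lborel) = (\<integral>t. (of_real (indicator {0..} l) * exp (of_real (l * c)) * lt b \<psi> q l) * (p (?g t) * exp (- of_real l * ?g t) * wfac \<phi> t) \<partial>lborel)"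
      by (rule Bochner_Integration.integral_cong[OF refl])
         (simp add: H_def F_def scaleR_conv_of_real right_diff_distrib exp_diff exp_minus field_simps)
    also have "\<dots> = of_real (indicator {0..} l) * exp (of_real (l * c)) * lt b \<psi> q l * lt a \<phi> p l"
      unfolding lt_def[of a] by (rule integral_mult_right_zero)
    finally show ?thesis by (simp add: scaleR_conv_of_real mult_ac)
  qed
  have "wedge_integral a \<phi> (\<lambda>z. wedge_integral b \<psi> (\<lambda>w. p z * q w / (z + w - of_real c)))
      = (\<integral>t. (\<integral>l. H (t, l) \<partial>lborel) \<partial>lborel)"
    unfolding H_l by (subst wedge_eq[OF outer]) (simp only: inner)
  also have "\<dots> = (\<integral>l. (\<integral>t. H (t, l) \<partial>lborel) \<partial>lborel)" by (rule fubH(2))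
  finally show "wedge_integral a \<phi> (\<lambda>z. wedge_integral b \<psi> (\<lambda>w. p z * q w / (z + w - of_real c)))
      = (\<integral>l. indicator {0..} l *\<^sub>R (exp (of_real (l * c)) * lt a \<phi> p l * lt b \<psi> q l) \<partial>lborel)"
    unfolding H_t .
  show "integrable lborel (\<lambda>l. indicator {0..} l *\<^sub>R (exp (of_real (l * c)) * lt a \<phi> p l * lt b \<psi> q l))"
    using fubH(4) unfolding H_t .
qed

lemma power_ex_measurable [measurable]: "(\<lambda>z. z ^ k * ex x z) \<in> borel_measurable borel"
  by measurable

lemma lt_airy: "0 \<le> l \<Longrightarrow> lt a (pi / 3) (\<lambda>z. z ^ k * ex x z) l = airy k (x + l)"
proof -
  assume l: "0 \<le> l"
  have "lt a (pi / 3) (\<lambda>z. z ^ k * ex x z) l = wedge_integral a (pi / 3) (\<lambda>z. z ^ k * ex x z * exp (- of_real l * z))"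
    by (rule wedge_eq_lt(2)[symmetric]) (use l integrable_power_ex in \<open>auto simp: cos_60\<close>)
  also have "\<dots> = airy k (x + l)"
    unfolding mult.assoc ex_add[symmetric] by (rule airy_base)
  finally show ?thesis .
qed

text \<open>For \<open>j = k = 0\<close> and \<open>c = 0\<close> this is the Airy kernel in its
  half-line form.\<close>

definition airy2 :: "nat \<Rightarrow> nat \<Rightarrow> real \<Rightarrow> real \<Rightarrow> real \<Rightarrow> complex" where
  "airy2 j k c x y = (\<integral>l. indicator {0..} l *\<^sub>R (exp (of_real (l * c)) * airy j (x + l) * airy k (y + l)) \<partial>lborel)"

text \<open>The Laplace variable separates \<open>z\<close> from \<open>w\<close>, and each factor
  is an Airy function that forgets its base point. Independence of \<open>a\<close> and
  \<open>b\<close> thus follows without moving two contours around a common pole.\<close>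

lemma double_wedge_airy:
  assumes "c < a + b"
  shows "wedge_integral a (pi / 3) (\<lambda>z. wedge_integral b (pi / 3) (\<lambda>w. (z ^ j * ex x z) * (w ^ k * ex y w) / (z + w - of_real c)))
      = airy2 j k c x y"
    and "integrable lborel (\<lambda>t. wedge_integral b (pi / 3) (\<lambda>w.
      (wpath a (pi / 3) t ^ j * ex x (wpath a (pi / 3) t)) * (w ^ k * ex y w) / (wpath a (pi / 3) t + w - of_real c)))"
proof -
  note D = double_wedge_laplace[OF power_ex_measurable power_ex_measurable integrable_power_ex integrable_power_ex _ _ assms]
  have "(\<integral>l. indicator {0..} l *\<^sub>R (exp (of_real (l * c)) * lt a (pi / 3) (\<lambda>z. z ^ j * ex x z) l * lt b (pi / 3) (\<lambda>z. z ^ k * ex y z) l) \<partial>lborel)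
     = airy2 j k c x y"
    unfolding airy2_def by (rule Bochner_Integration.integral_cong[OF refl]) (auto simp: indicator_def lt_airy)
  then show "wedge_integral a (pi / 3) (\<lambda>z. wedge_integral b (pi / 3) (\<lambda>w. (z ^ j * ex x z) * (w ^ k * ex y w) / (z + w - of_real c)))
      = airy2 j k c x y"
    using D(1)[of j x k y] by (simp add: cos_60)
  show "integrable lborel (\<lambda>t. wedge_integral b (pi / 3) (\<lambda>w.
      (wpath a (pi / 3) t ^ j * ex x (wpath a (pi / 3) t)) * (w ^ k * ex y w) / (wpath a (pi / 3) t + w - of_real c)))"
    using D(3)[of j x k y] by (simp add: cos_60)
qed

lemma segment_horizontal:
  assumes "z \<in> closed_segment (Complex p S) (Complex q S)"
  shows "Im z = S" "\<bar>Re z\<bar> \<le> max \<bar>p\<bar> \<bar>q\<bar>" "min p q \<le> Re z"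
proof -
  obtain u where u: "0 \<le> u" "u \<le> 1" "z = (1 - u) *\<^sub>R Complex p S + u *\<^sub>R Complex q S"
    using assms by (auto simp: in_segment)
  have Re: "Re z = (1 - u) * p + u * q" by (simp add: u(3))
  show "Im z = S" by (simp add: u(3) algebra_simps)
  have "\<bar>(1 - u) * p + u * q\<bar> \<le> (1 - u) * \<bar>p\<bar> + u * \<bar>q\<bar>"
    using u by (intro order.trans[OF abs_triangle_ineq]) (simp add: abs_mult)
  also have "\<dots> \<le> (1 - u) * max \<bar>p\<bar> \<bar>q\<bar> + u * max \<bar>p\<bar> \<bar>q\<bar>"
    using u by (intro add_mono mult_left_mono) auto
  finally show "\<bar>Re z\<bar> \<le> max \<bar>p\<bar> \<bar>q\<bar>" by (simp add: Re algebra_simps)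
  have "(1 - u) * min p q + u * min p q \<le> (1 - u) * p + u * q"
    using u by (intro add_mono mult_left_mono) auto
  then show "min p q \<le> Re z" by (simp add: Re algebra_simps)
qed

lemma ray_90: "of_real a + of_real T * cis (pi / 2) = Complex a T" "of_real a + of_real T * cis (- (pi / 2)) = Complex a (- T)"
  by (simp_all add: complex_eq_iff)

lemma ray_60: "of_real a + of_real T * cis (pi / 3) = Complex (a + T / 2) (T * sqrt 3 / 2)"
  "of_real a + of_real T * cis (- (pi / 3)) = Complex (a + T / 2) (- (T * sqrt 3 / 2))"
  by (simp_all add: complex_eq_iff cos_60 sin_60)

lemma norm_Complex_horizontal: "cmod (Complex p S - Complex q S) = \<bar>p - q\<bar>"
proof -
  have "Complex p S - Complex q S = of_real (p - q)" by (simp add: complex_eq_iff)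
  then show ?thesis by (simp only: norm_of_real)
qed

text \<open>Both a change of the base point of a vertical line and the passage from the wedge of angle
  \<open>\<pi> / 3\<close> to a vertical line are obtained by closing the contour with horizontal segments.\<close>

lemma vertical_shift:
  assumes f: "f holomorphic_on UNIV"
    and int: "integrable lborel (\<lambda>t. f (wpath a (pi / 2) t))" "integrable lborel (\<lambda>t. f (wpath b (pi / 2) t))"
    and B: "eventually (\<lambda>T. \<forall>z. \<bar>Im z\<bar> = T \<longrightarrow> min a b \<le> Re z \<longrightarrow> \<bar>Re z\<bar> \<le> max \<bar>a\<bar> \<bar>b\<bar> \<longrightarrow> cmod (f z) \<le> B T) at_top"
    and lim: "(B \<longlongrightarrow> 0) at_top"
  shows "wedge_integral a (pi / 2) f = wedge_integral b (pi / 2) f"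
proof -
  obtain P where P: "\<And>z. (P has_field_derivative f z) (at z)" using primitive_exists[OF f] by blast
  have ends: "((\<lambda>T. P (Complex a (s * T)) - P (Complex b (s * T))) \<longlongrightarrow> 0) at_top" if s: "\<bar>s\<bar> = 1" for s
  proof (rule primitive_diff_tendsto[OF P, where B = B and L = "\<lambda>_. \<bar>a - b\<bar>"])
    show "eventually (\<lambda>T. \<forall>z\<in>closed_segment (Complex a (s * T)) (Complex b (s * T)). cmod (f z) \<le> B T) at_top"
      using B eventually_ge_at_top[of 0]
    proof eventually_elim
      case (elim T)
      then show ?case using s segment_horizontal[of _ a "s * T" b] by (auto simp: abs_mult)
    qed
    show "eventually (\<lambda>T. cmod (Complex a (s * T) - Complex b (s * T)) \<le> \<bar>a - b\<bar>) at_top"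
      unfolding norm_Complex_horizontal by simp
    from tendsto_mult[OF lim tendsto_const[of "\<bar>a - b\<bar>"]] show "((\<lambda>T. B T * \<bar>a - b\<bar>) \<longlongrightarrow> 0) at_top" by simp
  qed
  show ?thesis
    by (rule wedge_shift[OF P int filterlim_ident]; unfold ray_90)
       (use ends[of 1] ends[of "- 1"] in simp_all)
qed

lemma wedge_60_90:
  assumes f: "f holomorphic_on UNIV"
    and int: "integrable lborel (\<lambda>t. f (wpath a (pi / 3) t))" "integrable lborel (\<lambda>t. f (wpath a (pi / 2) t))"
    and B: "eventually (\<lambda>T. \<forall>z. \<bar>Im z\<bar> = T * sqrt 3 / 2 \<longrightarrow> a \<le> Re z \<longrightarrow> Re z \<le> a + T / 2 \<longrightarrow> cmod (f z) \<le> B T) at_top"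
    and lim: "((\<lambda>T. B T * (T / 2)) \<longlongrightarrow> 0) at_top"
  shows "wedge_integral a (pi / 3) f = wedge_integral a (pi / 2) f"
proof -
  obtain P where P: "\<And>z. (P has_field_derivative f z) (at z)" using primitive_exists[OF f] by blast
  have ends: "((\<lambda>T. P (Complex (a + T / 2) (s * (T * sqrt 3 / 2))) - P (Complex a (s * (T * sqrt 3 / 2)))) \<longlongrightarrow> 0) at_top" if s: "\<bar>s\<bar> = 1" for s
  proof (rule primitive_diff_tendsto[OF P _ _ lim])
    show "eventually (\<lambda>T. \<forall>z\<in>closed_segment (Complex (a + T / 2) (s * (T * sqrt 3 / 2))) (Complex a (s * (T * sqrt 3 / 2))). cmod (f z) \<le> B T) at_top"
      using B eventually_ge_at_top[of 0]
    proof eventually_elim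
      case (elim T)
      show ?case
      proof
        fix z assume z: "z \<in> closed_segment (Complex (a + T / 2) (s * (T * sqrt 3 / 2))) (Complex a (s * (T * sqrt 3 / 2)))"
        have "Re z \<le> a + T / 2"
        proof -
          obtain u where u: "0 \<le> u" "u \<le> 1" "z = (1 - u) *\<^sub>R Complex (a + T / 2) (s * (T * sqrt 3 / 2)) + u *\<^sub>R Complex a (s * (T * sqrt 3 / 2))"
            using z by (auto simp: in_segment)
          have "Re z = (1 - u) * (a + T / 2) + u * a" by (simp add: u(3))
          also have "\<dots> = a + (1 - u) * (T / 2)" by (simp add: field_simps)
          finally have "Re z = a + (1 - u) * (T / 2)" .
          moreover have "(1 - u) * (T / 2) \<le> 1 * (T / 2)" using u elim(2) by (intro mult_right_mono) auto
          ultimately show ?thesis by simp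
        qed
        then show "cmod (f z) \<le> B T"
        proof -
          have "\<bar>Im z\<bar> = T * sqrt 3 / 2" unfolding segment_horizontal(1)[OF z] abs_mult using s elim(2) by simp
          moreover have "a \<le> Re z" using segment_horizontal(3)[OF z] elim(2) by simp
          ultimately show ?thesis using elim(1) \<open>Re z \<le> a + T / 2\<close> by blast
        qed
      qed
    qed
    show "eventually (\<lambda>T. cmod (Complex (a + T / 2) (s * (T * sqrt 3 / 2)) - Complex a (s * (T * sqrt 3 / 2))) \<le> T / 2) at_top"
      unfolding norm_Complex_horizontal using eventually_ge_at_top[of 0] by eventually_elim simp
  qed
  \<comment> \<open>At parameter \<open>T\<close> the slanted ray has reached the height
    \<open>T * sqrt 3 / 2\<close>; the vertical line is run to the same height, so the joining
    segment is horizontal.\<close>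
  have S: "filterlim (\<lambda>T. T * sqrt 3 / 2) at_top at_top" by real_asymp
  show ?thesis
    by (rule wedge_shift[OF P int S]; unfold ray_60 ray_90)
       (use ends[of 1] ends[of "- 1"] in simp_all)
qed

section \<open>Gaussian contour integrals and the closed form of R\<close>

definition gs :: "real \<Rightarrow> complex \<Rightarrow> complex \<Rightarrow> complex" where
  "gs \<eta> s z = exp (2 * of_real \<eta> * z\<^sup>2 - s * z)"

lemma gs_measurable [measurable]: "gs \<eta> s \<in> borel_measurable borel"
  unfolding gs_def by measurable

lemma norm_gs_le: "cmod (gs \<eta> s z) \<le> exp (2 * \<eta> * ((Re z)\<^sup>2 - (Im z)\<^sup>2) + cmod s * (\<bar>Re z\<bar> + \<bar>Im z\<bar>))"
proof -
  have "- Re (s * z) \<le> cmod s * (\<bar>Re z\<bar> + \<bar>Im z\<bar>)"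
  proof -
    have "- Re (s * z) \<le> cmod (s * z)" using abs_Re_le_cmod[of "s * z"] by linarith
    also have "\<dots> \<le> cmod s * (\<bar>Re z\<bar> + \<bar>Im z\<bar>)"
      unfolding norm_mult by (intro mult_left_mono cmod_le) auto
    finally show ?thesis .
  qed
  moreover have "Re (2 * of_real \<eta> * z\<^sup>2) = 2 * \<eta> * ((Re z)\<^sup>2 - (Im z)\<^sup>2)"
    by (simp add: power2_eq_square algebra_simps)
  ultimately show ?thesis unfolding gs_def norm_exp_eq_Re minus_complex.sel exp_le_cancel_iff by linarith
qed

lemma norm_power_gs_90:
  "cmod (wpath a (pi / 2) t ^ k * gs \<eta> s (wpath a (pi / 2) t))
    \<le> exp (real k * \<bar>a\<bar> + 2 * \<eta> * a\<^sup>2 + cmod s * \<bar>a\<bar>) * exp ((real k + cmod s) * \<bar>t\<bar> - 2 * \<eta> * t\<^sup>2)"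
proof -
  have "cmod (wpath a (pi / 2) t) \<le> exp (\<bar>a\<bar> + \<bar>t\<bar>)"
    using norm_wpath_le[of a "pi / 2" t] exp_ge_add_one_self[of "\<bar>a\<bar> + \<bar>t\<bar>"] by linarith
  then have "cmod (wpath a (pi / 2) t ^ k) \<le> exp (\<bar>a\<bar> + \<bar>t\<bar>) ^ k"
    unfolding norm_power by (intro power_mono) auto
  then have "cmod (wpath a (pi / 2) t ^ k * gs \<eta> s (wpath a (pi / 2) t))
      \<le> exp (\<bar>a\<bar> + \<bar>t\<bar>) ^ k * exp (2 * \<eta> * (a\<^sup>2 - t\<^sup>2) + cmod s * (\<bar>a\<bar> + \<bar>t\<bar>))"
    unfolding norm_mult using norm_gs_le[of \<eta> s "wpath a (pi / 2) t"]
    by (intro mult_mono) (auto simp: wpath_90)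
  also have "\<dots> = exp (real k * \<bar>a\<bar> + 2 * \<eta> * a\<^sup>2 + cmod s * \<bar>a\<bar>) * exp ((real k + cmod s) * \<bar>t\<bar> - 2 * \<eta> * t\<^sup>2)"
    by (simp add: algebra_simps flip: exp_add exp_of_nat_mult)
  finally show ?thesis .
qed

lemma integrable_power_gs_90:
  assumes "0 < \<eta>"
  shows "integrable lborel (\<lambda>t. wpath a (pi / 2) t ^ k * gs \<eta> s (wpath a (pi / 2) t))"
proof (rule Bochner_Integration.integrable_bound)
  show "integrable lborel (\<lambda>t. exp (real k * \<bar>a\<bar> + 2 * \<eta> * a\<^sup>2 + cmod s * \<bar>a\<bar>) * exp ((real k + cmod s) * \<bar>t\<bar> - 2 * \<eta> * t\<^sup>2))"
    using gauss_integrable[of "2 * \<eta>" "real k + cmod s"] assms by (intro integrable_mult_right) auto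
  show "AE t in lborel. norm (wpath a (pi / 2) t ^ k * gs \<eta> s (wpath a (pi / 2) t)) \<le>
     norm (exp (real k * \<bar>a\<bar> + 2 * \<eta> * a\<^sup>2 + cmod s * \<bar>a\<bar>) * exp ((real k + cmod s) * \<bar>t\<bar> - 2 * \<eta> * t\<^sup>2))"
    using norm_power_gs_90 by (intro AE_I2) simp
qed measurable

lemma integrable_power_gs_60:
  assumes "0 < \<eta>"
  shows "integrable lborel (\<lambda>t. wpath 0 (pi / 3) t ^ k * gs \<eta> s (wpath 0 (pi / 3) t))"
proof (rule Bochner_Integration.integrable_bound)
  show "integrable lborel (\<lambda>t. exp ((real k + 2 * cmod s) * \<bar>t\<bar> - \<eta> * t\<^sup>2))"
    using assms by (intro gauss_integrable)
  show "AE t in lborel. norm (wpath 0 (pi / 3) t ^ k * gs \<eta> s (wpath 0 (pi / 3) t)) \<le> norm (exp ((real k + 2 * cmod s) * \<bar>t\<bar> - \<eta> * t\<^sup>2))"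
  proof (rule AE_I2)
    fix t
    have n: "cmod (wpath 0 (pi / 3) t) \<le> \<bar>t\<bar>" using norm_wpath_le[of 0 "pi / 3" t] by simp
    then have "cmod (wpath 0 (pi / 3) t) \<le> exp \<bar>t\<bar>" using exp_ge_add_one_self[of "\<bar>t\<bar>"] by linarith
    then have 1: "cmod (wpath 0 (pi / 3) t ^ k) \<le> exp \<bar>t\<bar> ^ k"
      unfolding norm_power by (intro power_mono) auto
    have "\<bar>Re (wpath 0 (pi / 3) t)\<bar> + \<bar>Im (wpath 0 (pi / 3) t)\<bar> \<le> 2 * \<bar>t\<bar>"
      using n abs_Re_le_cmod[of "wpath 0 (pi / 3) t"] abs_Im_le_cmod[of "wpath 0 (pi / 3) t"] by linarith
    then have "cmod s * (\<bar>Re (wpath 0 (pi / 3) t)\<bar> + \<bar>Im (wpath 0 (pi / 3) t)\<bar>) \<le> cmod s * (2 * \<bar>t\<bar>)"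
      by (intro mult_left_mono) auto
    moreover have "2 * \<eta> * ((Re (wpath 0 (pi / 3) t))\<^sup>2 - (Im (wpath 0 (pi / 3) t))\<^sup>2) = - \<eta> * t\<^sup>2"
      by (simp add: wpath_60 power_divide)
    ultimately have 2: "cmod (gs \<eta> s (wpath 0 (pi / 3) t)) \<le> exp (- \<eta> * t\<^sup>2 + cmod s * (2 * \<bar>t\<bar>))"
      using norm_gs_le[of \<eta> s "wpath 0 (pi / 3) t"] by (smt (verit) exp_le_cancel_iff)
    have "norm (wpath 0 (pi / 3) t ^ k * gs \<eta> s (wpath 0 (pi / 3) t)) \<le> exp \<bar>t\<bar> ^ k * exp (- \<eta> * t\<^sup>2 + cmod s * (2 * \<bar>t\<bar>))"
      unfolding norm_mult by (intro mult_mono 1 2) auto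
    also have "\<dots> = exp ((real k + 2 * cmod s) * \<bar>t\<bar> - \<eta> * t\<^sup>2)"
      by (simp add: algebra_simps flip: exp_add exp_of_nat_mult)
    finally show "norm (wpath 0 (pi / 3) t ^ k * gs \<eta> s (wpath 0 (pi / 3) t)) \<le> norm (exp ((real k + 2 * cmod s) * \<bar>t\<bar> - \<eta> * t\<^sup>2))"
      by simp
  qed
qed measurable

lemma gs_holomorphic: "gs \<eta> s holomorphic_on UNIV"
  unfolding gs_def by (intro holomorphic_intros)

text \<open>For real \<open>s\<close> this is the density at \<open>s\<close> of the centred normal
  law of variance \<open>4 * \<eta>\<close>; the formula continues it to complex
  \<open>s\<close>.\<close>

definition gk :: "real \<Rightarrow> complex \<Rightarrow> complex" where
  "gk \<eta> s = exp (- (s\<^sup>2) / (8 * of_real \<eta>)) / of_real (sqrt (8 * pi * \<eta>))"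

lemma gauss_integral:
  assumes "0 < \<eta>"
  shows "(\<integral>t. exp (- 2 * \<eta> * (t - t0)\<^sup>2) \<partial>lborel) = sqrt (pi / (2 * \<eta>))"
proof -
  define \<sigma> where "\<sigma> = sqrt (1 / (4 * \<eta>))"
  have \<sigma>: "\<sigma>\<^sup>2 = 1 / (4 * \<eta>)" "0 < \<sigma>" using assms by (auto simp: \<sigma>_def)
  have e: "exp (- 2 * \<eta> * (t - t0)\<^sup>2) = sqrt (pi / (2 * \<eta>)) * normal_density t0 \<sigma> t" for t
  proof -
    have "sqrt (2 * pi * \<sigma>\<^sup>2) = sqrt (pi / (2 * \<eta>))" unfolding \<sigma>(1) by simp
    moreover have "sqrt (pi / (2 * \<eta>)) \<noteq> 0" using assms by simp
    moreover have "- (t - t0)\<^sup>2 / (2 * \<sigma>\<^sup>2) = - 2 * \<eta> * (t - t0)\<^sup>2" unfolding \<sigma>(1) using assms by simp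
    ultimately show ?thesis unfolding normal_density_def by simp
  qed
  show ?thesis unfolding e using \<sigma>(2) by simp
qed

text \<open>The saddle of the exponent is \<open>s / (4 * \<eta>)\<close>. On the vertical line
  through the saddle, completing the square leaves a real Gaussian in \<open>t\<close>, centred at
  the imaginary part of the saddle.\<close>

lemma gauss_wedge_90:
  assumes \<eta>: "0 < \<eta>"
  shows "wedge_integral a (pi / 2) (gs \<eta> s) = gk \<eta> s"
proof -
  define c where "c = Re s / (4 * \<eta>)"
  define t0 where "t0 = Im s / (4 * \<eta>)"
  have s: "s = 4 * of_real \<eta> * Complex c t0" using \<eta> by (simp add: complex_eq_iff c_def t0_def)
  have int: "integrable lborel (\<lambda>t. gs \<eta> s (wpath a (pi / 2) t))" for a
    using integrable_power_gs_90[OF \<eta>, of a 0 s] by simp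
  define M where "M = max \<bar>a\<bar> \<bar>c\<bar>"
  have "wedge_integral a (pi / 2) (gs \<eta> s) = wedge_integral c (pi / 2) (gs \<eta> s)"
  proof (rule vertical_shift[OF gs_holomorphic int int])
    show "eventually (\<lambda>T. \<forall>z. \<bar>Im z\<bar> = T \<longrightarrow> min a c \<le> Re z \<longrightarrow> \<bar>Re z\<bar> \<le> max \<bar>a\<bar> \<bar>c\<bar> \<longrightarrow>
        cmod (gs \<eta> s z) \<le> exp (2 * \<eta> * (M\<^sup>2 - T\<^sup>2) + cmod s * (M + T))) at_top"
    proof (intro always_eventually allI impI)
      fix T z assume z: "\<bar>Im z\<bar> = T" "\<bar>Re z\<bar> \<le> max \<bar>a\<bar> \<bar>c\<bar>"
      have "(Re z)\<^sup>2 \<le> M\<^sup>2" using z(2) by (simp add: M_def abs_le_square_iff[symmetric])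
      moreover have "(Im z)\<^sup>2 = T\<^sup>2" using z(1) by auto
      ultimately have "2 * \<eta> * ((Re z)\<^sup>2 - (Im z)\<^sup>2) \<le> 2 * \<eta> * (M\<^sup>2 - T\<^sup>2)" using \<eta> by simp
      moreover have "cmod s * (\<bar>Re z\<bar> + \<bar>Im z\<bar>) \<le> cmod s * (M + T)"
        using z by (intro mult_left_mono) (auto simp: M_def)
      ultimately show "cmod (gs \<eta> s z) \<le> exp (2 * \<eta> * (M\<^sup>2 - T\<^sup>2) + cmod s * (M + T))"
        by (intro order.trans[OF norm_gs_le]) simp
    qed
    show "((\<lambda>T. exp (2 * \<eta> * (M\<^sup>2 - T\<^sup>2) + cmod s * (M + T))) \<longlongrightarrow> 0) at_top"
      using \<eta> by real_asymp
  qed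
  also have "\<dots> = (\<integral>t. gs \<eta> s (wpath c (pi / 2) t) * wfac (pi / 2) t \<partial>lborel)"
    by (rule wedge_eq[OF int])
  also have "\<dots> = (\<integral>t. (exp (- (s\<^sup>2) / (8 * of_real \<eta>)) / (2 * of_real pi)) * of_real (exp (- 2 * \<eta> * (t - t0)\<^sup>2)) \<partial>lborel)"
  proof (rule Bochner_Integration.integral_cong[OF refl])
    fix t
    have "2 * of_real \<eta> * (Complex c t)\<^sup>2 - s * Complex c t = - (s\<^sup>2) / (8 * of_real \<eta>) + of_real (- 2 * \<eta> * (t - t0)\<^sup>2)"
      unfolding s using \<eta> by (simp add: complex_eq_iff power2_eq_square Re_divide Im_divide field_simps)
    then show "gs \<eta> s (wpath c (pi / 2) t) * wfac (pi / 2) t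
        = (exp (- (s\<^sup>2) / (8 * of_real \<eta>)) / (2 * of_real pi)) * of_real (exp (- 2 * \<eta> * (t - t0)\<^sup>2))"
      unfolding gs_def wpath_90 wfac_90 by (simp only: exp_add exp_of_real) simp
  qed
  also have "\<dots> = (exp (- (s\<^sup>2) / (8 * of_real \<eta>)) / (2 * of_real pi)) * of_real (sqrt (pi / (2 * \<eta>)))"
    by (simp only: integral_mult_right_zero integral_complex_of_real gauss_integral[OF \<eta>])
  also have "\<dots> = gk \<eta> s"
  proof -
    have "sqrt (pi / (2 * \<eta>)) / (2 * pi) = 1 / sqrt (8 * pi * \<eta>)"
    proof -
      have "sqrt (pi / (2 * \<eta>)) * sqrt (8 * pi * \<eta>) = sqrt ((2 * pi)\<^sup>2)"
        unfolding real_sqrt_mult[symmetric] using \<eta> by (simp add: power2_eq_square)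
      also have "\<dots> = 2 * pi" unfolding real_sqrt_abs by simp
      finally show ?thesis using \<eta> by (simp add: field_simps)
    qed
    then have "complex_of_real (sqrt (pi / (2 * \<eta>)) / (2 * pi)) = of_real (1 / sqrt (8 * pi * \<eta>))" by (simp only:)
    then have r: "of_real (sqrt (pi / (2 * \<eta>))) / (2 * of_real pi) = (1 / of_real (sqrt (8 * pi * \<eta>)) :: complex)"
      unfolding of_real_divide of_real_mult of_real_numeral of_real_1 .
    have "e / (2 * of_real pi) * of_real (sqrt (pi / (2 * \<eta>))) = e * (of_real (sqrt (pi / (2 * \<eta>))) / (2 * of_real pi))" for e :: complex
      by (simp only: times_divide_eq_left times_divide_eq_right)
    then show ?thesis unfolding gk_def r by (simp only: times_divide_eq_right mult_1_right)
  qed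
  finally show ?thesis .
qed

lemma gauss_wedge_60:
  assumes \<eta>: "0 < \<eta>"
  shows "wedge_integral 0 (pi / 3) (gs \<eta> s) = gk \<eta> s"
proof -
  have "wedge_integral 0 (pi / 3) (gs \<eta> s) = wedge_integral 0 (pi / 2) (gs \<eta> s)"
  proof (rule wedge_60_90[OF gs_holomorphic])
    show "integrable lborel (\<lambda>t. gs \<eta> s (wpath 0 (pi / 3) t))" using integrable_power_gs_60[OF \<eta>, of 0 s] by simp
    show "integrable lborel (\<lambda>t. gs \<eta> s (wpath 0 (pi / 2) t))" using integrable_power_gs_90[OF \<eta>, of 0 0 s] by simp
    show "eventually (\<lambda>T. \<forall>z. \<bar>Im z\<bar> = T * sqrt 3 / 2 \<longrightarrow> 0 \<le> Re z \<longrightarrow> Re z \<le> 0 + T / 2 \<longrightarrow>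
        cmod (gs \<eta> s z) \<le> exp (- \<eta> * T\<^sup>2 + cmod s * (2 * T))) at_top"
      using eventually_ge_at_top[of 0]
    proof (eventually_elim, intro allI impI)
      fix T :: real and z assume T: "0 \<le> T" and z: "\<bar>Im z\<bar> = T * sqrt 3 / 2" "0 \<le> Re z" "Re z \<le> 0 + T / 2"
      have "(Re z)\<^sup>2 \<le> (T / 2)\<^sup>2" using z by (intro power_mono) auto
      moreover have "(Im z)\<^sup>2 = (T * sqrt 3 / 2)\<^sup>2" using z(1) by (metis power2_abs)
      moreover have "(T * sqrt 3 / 2)\<^sup>2 = 3 / 4 * T\<^sup>2" by (simp add: power_mult_distrib power_divide)
      ultimately have "(Re z)\<^sup>2 - (Im z)\<^sup>2 \<le> - T\<^sup>2 / 2" by (simp add: power_divide)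
      then have "2 * \<eta> * ((Re z)\<^sup>2 - (Im z)\<^sup>2) \<le> 2 * \<eta> * (- T\<^sup>2 / 2)" using \<eta> by (intro mult_left_mono) auto
      moreover have "cmod s * (\<bar>Re z\<bar> + \<bar>Im z\<bar>) \<le> cmod s * (2 * T)"
      proof (intro mult_left_mono)
        have "sqrt 3 \<le> sqrt 4" by (intro real_sqrt_le_mono) auto
        then have "T * sqrt 3 \<le> T * 2" using T by (intro mult_left_mono) auto
        then show "\<bar>Re z\<bar> + \<bar>Im z\<bar> \<le> 2 * T" using z T by simp
      qed simp
      ultimately show "cmod (gs \<eta> s z) \<le> exp (- \<eta> * T\<^sup>2 + cmod s * (2 * T))"
        by (intro order.trans[OF norm_gs_le]) simp
    qed
    show "((\<lambda>T. exp (- \<eta> * T\<^sup>2 + cmod s * (2 * T)) * (T / 2)) \<longlongrightarrow> 0) at_top"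
      using \<eta> by real_asymp
  qed
  then show ?thesis using gauss_wedge_90[OF \<eta>] by simp
qed

text \<open>The derivative of \<open>gs \<eta> s\<close> is \<open>(4 \<eta> z - s) gs \<eta> s z\<close>, and its integral vanishes.\<close>

lemma gauss_wedge_moment:
  assumes \<eta>: "0 < \<eta>" and \<phi>: "a = 0 \<and> \<phi> = pi / 3 \<or> \<phi> = pi / 2"
  shows "wedge_integral a \<phi> (\<lambda>z. z * gs \<eta> s z) = s / (4 * of_real \<eta>) * gk \<eta> s"
proof -
  have i0: "integrable lborel (\<lambda>t. gs \<eta> s (wpath a \<phi> t))"
    using \<phi> integrable_power_gs_90[OF \<eta>, of a 0 s] integrable_power_gs_60[OF \<eta>, of 0 s]
    unfolding power_0 mult_1_left by metis
  have i1: "integrable lborel (\<lambda>t. wpath a \<phi> t * gs \<eta> s (wpath a \<phi> t))"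
    using \<phi> integrable_power_gs_90[OF \<eta>, of a 1 s] integrable_power_gs_60[OF \<eta>, of 1 s]
    unfolding power_one_right by metis
  have w0: "wedge_integral a \<phi> (gs \<eta> s) = gk \<eta> s"
    using \<phi> gauss_wedge_90[OF \<eta>] gauss_wedge_60[OF \<eta>] by metis
  let ?h = "\<lambda>z. 4 * of_real \<eta> * (z * gs \<eta> s z) - s * gs \<eta> s z"
  have D: "(gs \<eta> s has_field_derivative ?h z) (at z)" for z
    unfolding gs_def by (auto intro!: derivative_eq_intros simp: algebra_simps)
  have "integrable lborel (\<lambda>t. ?h (wpath a \<phi> t))" using i0 i1 by simp
  from wedge_tendsto[OF D this]
  have lim: "((\<lambda>T. 1 / (2 * of_real pi * \<i>) * (gs \<eta> s (of_real a + of_real T * cis \<phi>) - gs \<eta> s (of_real a + of_real T * cis (- \<phi>))))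
    \<longlongrightarrow> wedge_integral a \<phi> ?h) at_top" .
  have e90: "((\<lambda>T. gs \<eta> s (Complex a (r * T))) \<longlongrightarrow> 0) at_top" if r: "\<bar>r\<bar> = 1" for r
  proof (rule Lim_null_comparison)
    show "eventually (\<lambda>T. norm (gs \<eta> s (Complex a (r * T))) \<le> exp (2 * \<eta> * (a\<^sup>2 - T\<^sup>2) + cmod s * (\<bar>a\<bar> + T))) at_top"
      using eventually_ge_at_top[of 0]
    proof eventually_elim
      case (elim T)
      have "(r * T)\<^sup>2 = T\<^sup>2" using r by (auto simp: abs_if split: if_splits)
      then show ?case using norm_gs_le[of \<eta> s "Complex a (r * T)"] elim r by (simp add: abs_mult)
    qed
    show "((\<lambda>T. exp (2 * \<eta> * (a\<^sup>2 - T\<^sup>2) + cmod s * (\<bar>a\<bar> + T))) \<longlongrightarrow> 0) at_top"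
      using \<eta> by real_asymp
  qed
  have e60: "((\<lambda>T. gs \<eta> s (Complex (0 + T / 2) (r * (T * sqrt 3 / 2)))) \<longlongrightarrow> 0) at_top" if r: "\<bar>r\<bar> = 1" for r
  proof (rule Lim_null_comparison)
    show "eventually (\<lambda>T. norm (gs \<eta> s (Complex (0 + T / 2) (r * (T * sqrt 3 / 2)))) \<le> exp (- \<eta> * T\<^sup>2 + cmod s * (T / 2 + T * sqrt 3 / 2))) at_top"
      using eventually_ge_at_top[of 0]
    proof eventually_elim
      case (elim T)
      have "(r * (T * sqrt 3 / 2))\<^sup>2 = 3 / 4 * T\<^sup>2"
        using r by (auto simp: abs_if power_mult_distrib power_divide split: if_splits)
      then show ?case using norm_gs_le[of \<eta> s "Complex (0 + T / 2) (r * (T * sqrt 3 / 2))"] elim r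
        by (simp add: abs_mult power_divide)
    qed
    show "((\<lambda>T. exp (- \<eta> * T\<^sup>2 + cmod s * (T / 2 + T * sqrt 3 / 2))) \<longlongrightarrow> 0) at_top"
      using \<eta> by real_asymp
  qed
  have z: "((\<lambda>T. gs \<eta> s (of_real a + of_real T * cis \<phi>)) \<longlongrightarrow> 0) at_top" "((\<lambda>T. gs \<eta> s (of_real a + of_real T * cis (- \<phi>))) \<longlongrightarrow> 0) at_top"
  proof -
    have "((\<lambda>T. gs \<eta> s (of_real a + of_real T * cis \<phi>)) \<longlongrightarrow> 0) at_top \<and> ((\<lambda>T. gs \<eta> s (of_real a + of_real T * cis (- \<phi>))) \<longlongrightarrow> 0) at_top"
      using \<phi>
    proof
      assume a: "a = 0 \<and> \<phi> = pi / 3"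
      show ?thesis using e60[of 1] e60[of "- 1"] unfolding conjunct1[OF a] conjunct2[OF a] ray_60 by simp
    next
      assume a: "\<phi> = pi / 2"
      show ?thesis using e90[of 1] e90[of "- 1"] unfolding a ray_90 by simp
    qed
    then show "((\<lambda>T. gs \<eta> s (of_real a + of_real T * cis \<phi>)) \<longlongrightarrow> 0) at_top" "((\<lambda>T. gs \<eta> s (of_real a + of_real T * cis (- \<phi>))) \<longlongrightarrow> 0) at_top"
      by blast+
  qed
  have "((\<lambda>T. 1 / (2 * of_real pi * \<i>) * (gs \<eta> s (of_real a + of_real T * cis \<phi>) - gs \<eta> s (of_real a + of_real T * cis (- \<phi>)))) \<longlongrightarrow> 1 / (2 * of_real pi * \<i>) * (0 - 0)) at_top"
    by (intro tendsto_mult tendsto_const tendsto_diff z)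
  from tendsto_unique[OF _ lim this] have "wedge_integral a \<phi> ?h = 0" by simp
  moreover have "wedge_integral a \<phi> ?h = 4 * of_real \<eta> * wedge_integral a \<phi> (\<lambda>z. z * gs \<eta> s z) - s * wedge_integral a \<phi> (gs \<eta> s)"
    using i0 i1 by (subst wedge_diff) (auto simp: wedge_mult)
  ultimately have e: "4 * of_real \<eta> * wedge_integral a \<phi> (\<lambda>z. z * gs \<eta> s z) = s * gk \<eta> s"
    unfolding w0 by (metis eq_iff_diff_eq_0)
  have "4 * complex_of_real \<eta> \<noteq> 0" using \<eta> by simp
  then show ?thesis unfolding times_divide_eq_left using e by (metis nonzero_mult_div_cancel_left)
qed

text \<open>\<open>- (x - y) / (2 * \<eta>)\<close> times the Gaussian factor is twice the
  derivative of the normal density of variance \<open>4 * \<eta>\<close> at \<open>x - y\<close>. As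
  \<eta> tends to 0 this approaches twice the derivative of a Dirac mass.\<close>

definition Rk :: "real \<Rightarrow> real \<Rightarrow> real \<Rightarrow> real" where
  "Rk \<eta> x y = - (x - y) / (2 * \<eta>) * (exp (- (x - y)\<^sup>2 / (8 * \<eta>)) / sqrt (8 * pi * \<eta>)) * exp (2 * \<eta> ^ 3 / 3 - (x + y) * \<eta>)"

lemma gk_of_real: "gk \<eta> (of_real s) = of_real (exp (- s\<^sup>2 / (8 * \<eta>)) / sqrt (8 * pi * \<eta>))"
proof -
  have "- ((of_real s)\<^sup>2) / (8 * of_real \<eta>) = (of_real (- s\<^sup>2 / (8 * \<eta>)) :: complex)" by simp
  then have e: "exp (- ((of_real s)\<^sup>2) / (8 * of_real \<eta>)) = complex_of_real (exp (- s\<^sup>2 / (8 * \<eta>)))"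
    by (simp only: exp_of_real)
  show ?thesis unfolding gk_def e of_real_divide ..
qed

text \<open>The cubes in the exponent combine to
  \<open>2 * \<eta> ^ 3 / 3 + 2 * \<eta> * z ^ 2\<close>, so the integral is a first Gaussian
  moment. The result changes sign when \<open>x\<close> and \<open>y\<close> are exchanged, and the
  three cases of \<open>RSU22\<close> merge into one formula.\<close>

lemma RSU22_eq:
  assumes \<eta>: "0 < \<eta>"
  shows "RSU22 \<eta> x y = of_real (Rk \<eta> x y)"
proof -
  have upper: "RSU22_upper \<eta> x y = of_real (Rk \<eta> x y)" for x y
  proof -
    let ?c = "exp (of_real (2 * \<eta> ^ 3 / 3 - (x + y) * \<eta>)) :: complex"
    have e: "z * exp ((z + of_real \<eta>) ^ 3 / 3 + (- z + of_real \<eta>) ^ 3 / 3 - of_real x * (z + of_real \<eta>) - of_real y * (- z + of_real \<eta>))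
        = ?c * (z * gs \<eta> (of_real (x - y)) z)" for z
    proof -
      have "(z + of_real \<eta>) ^ 3 / 3 + (- z + of_real \<eta>) ^ 3 / 3 - of_real x * (z + of_real \<eta>) - of_real y * (- z + of_real \<eta>)
          = of_real (2 * \<eta> ^ 3 / 3 - (x + y) * \<eta>) + (2 * of_real \<eta> * z\<^sup>2 - of_real (x - y) * z)"
        by (simp add: power3_eq_cube power2_eq_square field_simps)
      then show ?thesis by (simp only: exp_add gs_def mult_ac)
    qed
    have "RSU22_upper \<eta> x y = - 2 * (?c * (of_real (x - y) / (4 * of_real \<eta>) * gk \<eta> (of_real (x - y))))"
      unfolding RSU22_upper_def e wedge_mult using gauss_wedge_moment[OF \<eta>, of 0 "pi / 3"] by simp
    also have "\<dots> = of_real (Rk \<eta> x y)"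
    proof -
      have "- 2 * (c * (d / (4 * h) * (E / r))) = - d / (2 * h) * (E / r) * c" for c d h E r :: complex
        by (cases "h = 0"; cases "r = 0") (simp_all add: field_simps)
      then show ?thesis
        unfolding gk_of_real exp_of_real Rk_def of_real_mult of_real_divide of_real_minus of_real_numeral .
    qed
    finally show ?thesis .
  qed
  have anti: "- Rk \<eta> y x = Rk \<eta> x y"
    unfolding Rk_def power2_commute[of y x] add.commute[of y x] minus_diff_eq
    by (simp only: minus_mult_left minus_divide_left minus_diff_eq)
  have "Rk \<eta> x x = 0" by (simp add: Rk_def)
  then show ?thesis
    unfolding RSU22_def upper using anti by (auto simp flip: of_real_minus)
qed

section \<open>Airy functions on vertical lines: decay and the two-sided Laplace transform\<close>

lemma airy_vertical:
  assumes b: "0 < b"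
  shows "wedge_integral b (pi / 2) (\<lambda>z. z ^ k * ex x z) = airy k x"
proof -
  have "wedge_integral b (pi / 3) (\<lambda>z. z ^ k * ex x z) = wedge_integral b (pi / 2) (\<lambda>z. z ^ k * ex x z)"
  proof (rule wedge_60_90[OF ex_holomorphic integrable_power_ex integrable_power_ex_vertical[OF b]])
    show "eventually (\<lambda>T. \<forall>z. \<bar>Im z\<bar> = T * sqrt 3 / 2 \<longrightarrow> b \<le> Re z \<longrightarrow> Re z \<le> b + T / 2 \<longrightarrow>
        cmod (z ^ k * ex x z) \<le> exp ((2 * real k + \<bar>x\<bar>) * T - 5 / 12 * b * T\<^sup>2)) at_top"
      \<comment> \<open>From \<open>T \<ge> 2 * b\<close> on, the real part along the joining
        segment is at most \<open>T\<close>, while the squared height is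
        \<open>3 / 4 * T ^ 2\<close>. The cube then has real part below a negative multiple of
        \<open>b * T ^ 2\<close>.\<close>
      using eventually_ge_at_top[of "2 * b"]
    proof (eventually_elim, intro allI impI)
      fix T z assume T: "2 * b \<le> T" and z: "\<bar>Im z\<bar> = T * sqrt 3 / 2" "b \<le> Re z" "Re z \<le> b + T / 2"
      have T0: "0 \<le> T" using T b by simp
      have r: "0 \<le> Re z" "Re z \<le> T" using z T b by auto
      have "(Im z)\<^sup>2 = (T * sqrt 3 / 2)\<^sup>2" using z(1) by (metis power2_abs)
      then have im: "(Im z)\<^sup>2 = 3 / 4 * T\<^sup>2" by (simp add: power_mult_distrib power_divide)
      have "sqrt 3 \<le> sqrt 4" by (intro real_sqrt_le_mono) auto
      then have "T * sqrt 3 \<le> T * 2" using T0 by (intro mult_left_mono) auto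
      then have "cmod z \<le> 2 * T" using cmod_le[of z] z r by linarith
      also have "\<dots> \<le> exp (2 * T)" using exp_ge_add_one_self[of "2 * T"] by linarith
      finally have "cmod z ^ k \<le> exp (2 * T) ^ k" by (intro power_mono) auto
      then have 1: "cmod (z ^ k) \<le> exp (2 * real k * T)" by (simp add: norm_power exp_of_nat_mult[symmetric] mult_ac)
      have "(Re z) ^ 3 - 3 * Re z * (Im z)\<^sup>2 = Re z * ((Re z)\<^sup>2 - 9 / 4 * T\<^sup>2)"
        unfolding im by (simp add: power3_eq_cube power2_eq_square algebra_simps)
      also have "\<dots> \<le> Re z * (- 5 / 4 * T\<^sup>2)"
      proof (rule mult_left_mono[OF _ r(1)])
        have "(Re z)\<^sup>2 \<le> T\<^sup>2" using r by (intro power_mono) auto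
        then show "(Re z)\<^sup>2 - 9 / 4 * T\<^sup>2 \<le> - 5 / 4 * T\<^sup>2" by linarith
      qed
      also have "\<dots> \<le> b * (- 5 / 4 * T\<^sup>2)"
        using mult_right_mono[OF z(2), of "5 / 4 * T\<^sup>2"] by simp
      finally have "((Re z) ^ 3 - 3 * Re z * (Im z)\<^sup>2) / 3 \<le> - (5 / 12 * b * T\<^sup>2)" by simp
      moreover have "- x * Re z \<le> \<bar>x\<bar> * T"
        using r by (intro mult_mono) auto
      ultimately have 2: "cmod (ex x z) \<le> exp (- (5 / 12 * b * T\<^sup>2) + \<bar>x\<bar> * T)"
        unfolding norm_ex exp_le_cancel_iff by linarith
      have "cmod (z ^ k * ex x z) \<le> exp (2 * real k * T) * exp (- (5 / 12 * b * T\<^sup>2) + \<bar>x\<bar> * T)"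
        unfolding norm_mult by (intro mult_mono 1 2) auto
      then show "cmod (z ^ k * ex x z) \<le> exp ((2 * real k + \<bar>x\<bar>) * T - 5 / 12 * b * T\<^sup>2)"
        by (simp add: algebra_simps flip: exp_add)
    qed
    show "((\<lambda>T. exp ((2 * real k + \<bar>x\<bar>) * T - 5 / 12 * b * T\<^sup>2) * (T / 2)) \<longlongrightarrow> 0) at_top"
      using b by real_asymp
  qed
  then show ?thesis by (simp add: airy_base)
qed

text \<open>The vertical line may stand at any \<open>b > 0\<close>, and its position is the rate: a
  large \<open>b\<close> controls the right tail, a small \<open>b\<close> limits the growth on the
  left.\<close>

lemma airy_bound:
  assumes "0 < b"
  shows "\<exists>C>0. \<forall>x. cmod (airy k x) \<le> C * exp (- b * x)"
proof -
  let ?w = "\<lambda>t. exp (real k * \<bar>t\<bar> - b * t\<^sup>2)"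
  define C where "C = exp (b ^ 3 / 3 + real k * b) * (\<integral>t. ?w t \<partial>lborel) + 1"
  have "cmod (airy k x) \<le> C * exp (- b * x)" for x
  proof -
    note int = integrable_power_ex_vertical[OF assms, of k x]
    have eq: "airy k x = (\<integral>t. wpath b (pi / 2) t ^ k * ex x (wpath b (pi / 2) t) * wfac (pi / 2) t \<partial>lborel)"
      using airy_vertical[OF assms] wedge_eq[OF int] by simp
    have "cmod (airy k x) \<le> (\<integral>t. exp (b ^ 3 / 3 + real k * b) * exp (- b * x) * ?w t \<partial>lborel)"
      unfolding eq
    proof (intro order.trans[OF integral_norm_bound] integral_mono integrable_norm integrable_wfac int integrable_mult_right gauss_integrable assms)
      fix t
      have "norm (wpath b (pi / 2) t ^ k * ex x (wpath b (pi / 2) t) * wfac (pi / 2) t)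
          \<le> cmod (wpath b (pi / 2) t ^ k * ex x (wpath b (pi / 2) t)) * 1"
        unfolding norm_mult[of _ "wfac (pi / 2) t"] by (intro mult_left_mono norm_wfac) auto
      then show "norm (wpath b (pi / 2) t ^ k * ex x (wpath b (pi / 2) t) * wfac (pi / 2) t)
          \<le> exp (b ^ 3 / 3 + real k * b) * exp (- b * x) * ?w t"
        using norm_power_ex_vertical[OF assms, of t k x] by simp
    qed
    also have "\<dots> = exp (b ^ 3 / 3 + real k * b) * exp (- b * x) * (\<integral>t. ?w t \<partial>lborel)"
      by (rule integral_mult_right_zero)
    also have "\<dots> \<le> exp (b ^ 3 / 3 + real k * b) * exp (- b * x) * (\<integral>t. ?w t \<partial>lborel) + exp (- b * x)"
      by (simp only: le_add_same_cancel1 exp_ge_zero)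
    also have "\<dots> = C * exp (- b * x)"
      unfolding C_def distrib_right mult_1_left by (simp only: mult_ac)
    finally show ?thesis .
  qed
  moreover have "0 < C"
  proof -
    have I: "0 \<le> (\<integral>t. ?w t \<partial>lborel)" by (rule Bochner_Integration.integral_nonneg) simp
    have "0 \<le> exp (b ^ 3 / 3 + real k * b) * (\<integral>t. ?w t \<partial>lborel)" by (rule mult_nonneg_nonneg[OF exp_ge_zero I])
    then show ?thesis unfolding C_def by linarith
  qed
  ultimately show ?thesis by blast
qed

lemma airy_measurable [measurable]: "airy k \<in> borel_measurable borel"
proof -
  have "airy k = (\<lambda>x. \<integral>t. wpath 1 (pi / 3) t ^ k * ex x (wpath 1 (pi / 3) t) * wfac (pi / 3) t \<partial>lborel)"
    unfolding airy_def by (rule ext, rule wedge_eq[OF integrable_power_ex])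
  moreover have "(\<lambda>x. \<integral>t. wpath 1 (pi / 3) t ^ k * ex x (wpath 1 (pi / 3) t) * wfac (pi / 3) t \<partial>lborel) \<in> borel_measurable borel"
    unfolding ex_def by measurable
  ultimately show ?thesis by simp
qed

lemma airy_exp_integrable:
  assumes "1 < s"
  shows "integrable lborel (\<lambda>l. exp (s * l) * cmod (airy k (x + l)))"
proof -
  \<comment> \<open>Rate \<open>s + 1\<close> beats \<open>exp (s * l)\<close> on the right. On the
    left the rate \<open>(s - 1) / 2\<close>, positive because \<open>s > 1\<close>, leaves the
    factor \<open>exp ((s + 1) / 2 * l)\<close>, which decays there.\<close>
  obtain B where B: "0 < B" "\<And>x. cmod (airy k x) \<le> B * exp (- (s + 1) * x)"
    using airy_bound[of "s + 1" k] assms by auto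
  obtain A where A: "0 < A" "\<And>x. cmod (airy k x) \<le> A * exp (- ((s - 1) / 2 + 0) * x)"
    using airy_bound[of "(s - 1) / 2 + 0" k] assms by auto
  define D where "D = max (B * exp (- (s + 1) * x)) (A * exp (- ((s - 1) / 2) * x))"
  have D0: "0 \<le> D" unfolding D_def using B(1) by (simp add: le_max_iff_disj)
  define r where "r = min 1 ((s + 1) / 2)"
  have r: "0 < r" using assms by (simp add: r_def)
  have "integrable lborel (\<lambda>l :: real. D * exp (- \<bar>0 + r * l\<bar>))"
    using lborel_integrable_real_affine[OF integrable_exp_abs, of r 0] r by (intro integrable_mult_right) auto
  then show ?thesis
  proof (rule Bochner_Integration.integrable_bound)
    show "AE l in lborel. norm (exp (s * l) * cmod (airy k (x + l))) \<le> norm (D * exp (- \<bar>0 + r * l\<bar>))"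
    proof (rule AE_I2)
      fix l
      have "exp (s * l) * cmod (airy k (x + l)) \<le> D * exp (- \<bar>0 + r * l\<bar>)"
      proof (cases "0 \<le> l")
        case True
        have "exp (s * l) * cmod (airy k (x + l)) \<le> exp (s * l) * (B * exp (- (s + 1) * (x + l)))"
          by (intro mult_left_mono B) auto
        also have "\<dots> = (B * exp (- (s + 1) * x)) * exp (- l)"
          by (simp add: algebra_simps flip: exp_add)
        also have "\<dots> \<le> D * exp (- \<bar>0 + r * l\<bar>)"
        proof (intro mult_mono D0)
          have "r * l \<le> 1 * l" using True by (intro mult_right_mono) (auto simp: r_def)
          then show "exp (- l) \<le> exp (- \<bar>0 + r * l\<bar>)" using True r by simp
        qed (auto simp: D_def)
        finally show ?thesis .
      next
        case False
        have "exp (s * l) * cmod (airy k (x + l)) \<le> exp (s * l) * (A * exp (- ((s - 1) / 2 + 0) * (x + l)))"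
          by (intro mult_left_mono A) auto
        also have "\<dots> = (A * exp (- ((s - 1) / 2) * x)) * exp ((s + 1) / 2 * l)"
          by (simp add: field_simps flip: exp_add)
        also have "\<dots> \<le> D * exp (- \<bar>0 + r * l\<bar>)"
        proof (intro mult_mono)
          have "\<bar>r * l\<bar> = - (r * l)" using False r by (simp add: abs_mult)
          moreover have "r \<le> (s + 1) / 2" unfolding r_def by (rule min.cobounded2)
          then have "(s + 1) / 2 * l \<le> r * l" using False by (intro mult_right_mono_neg) auto
          ultimately show "exp ((s + 1) / 2 * l) \<le> exp (- \<bar>0 + r * l\<bar>)" by simp
        qed (use D0 in \<open>auto simp: D_def\<close>)
        finally show ?thesis .
      qed
      then show "norm (exp (s * l) * cmod (airy k (x + l))) \<le> norm (D * exp (- \<bar>0 + r * l\<bar>))" by simp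
    qed
  qed measurable
qed

text \<open>The reflection reverses the line, and the sign of dz restores the orientation.\<close>

lemma wedge_reflect:
  assumes "integrable lborel (\<lambda>t. f (wpath b (pi / 2) t))"
  shows "integrable lborel (\<lambda>t. f (- wpath (- b) (pi / 2) t))"
    and "wedge_integral b (pi / 2) f = wedge_integral (- b) (pi / 2) (\<lambda>z. f (- z))"
proof -
  have p: "- wpath (- b) (pi / 2) t = wpath b (pi / 2) (0 + (- 1) * t)" for t
    by (simp add: wpath_90 complex_eq_iff)
  show int: "integrable lborel (\<lambda>t. f (- wpath (- b) (pi / 2) t))"
    unfolding p by (rule lborel_integrable_real_affine[OF assms]) simp
  have "wedge_integral b (pi / 2) f = (\<integral>t. f (wpath b (pi / 2) t) * (1 / (2 * of_real pi)) \<partial>lborel)"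
    unfolding wedge_eq[OF assms] wfac_90 ..
  also have "\<dots> = \<bar>- 1\<bar> *\<^sub>R (\<integral>t. f (wpath b (pi / 2) (0 + (- 1) * t)) * (1 / (2 * of_real pi)) \<partial>lborel)"
    by (rule lborel_integral_real_affine) simp
  also have "\<dots> = wedge_integral (- b) (pi / 2) (\<lambda>z. f (- z))"
    unfolding wedge_eq[OF int] wfac_90 p by simp
  finally show "wedge_integral b (pi / 2) f = wedge_integral (- b) (pi / 2) (\<lambda>z. f (- z))" .
qed

text \<open>Subtracting a Gaussian whose inverse transform is known explicitly removes the pole at \<open>p\<close>, so
  that the lines to the left and to the right of \<open>p\<close> contribute opposite amounts.\<close>

lemma airy_laplace:
  assumes p: "1 < Re p"
  shows "(\<integral>l. exp (p * of_real l) * airy k l \<partial>lborel) = p ^ k * exp (p ^ 3 / 3)"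
proof -
  define K where "K = p ^ k * exp (p ^ 3 / 3)"
  \<comment> \<open>The Gaussian equals 1 at \<open>p\<close> and decays along vertical lines; with
    the factor \<open>K\<close> the difference vanishes at \<open>p\<close>. \<open>A\<close> below
    is the inverse transform of this difference.\<close>
  define \<Phi> where "\<Phi> z = z ^ k * ex 0 z - K * exp ((z - p)\<^sup>2)" for z
  define A where "A l = airy k l - K * (exp (- p * of_real l) * of_real (exp (- l\<^sup>2 / 4) / sqrt (4 * pi)))" for l
  have \<Phi>p: "\<Phi> p = 0" by (simp add: \<Phi>_def K_def ex_def)
  have gs: "exp ((z - p)\<^sup>2) = exp (p\<^sup>2) * gs (1 / 2) (2 * p) z" for z
    unfolding gs_def by (simp add: power2_eq_square algebra_simps flip: exp_add)
  have \<Phi>m [measurable]: "\<Phi> \<in> borel_measurable borel" unfolding \<Phi>_def by measurable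
  have gs_l: "gs (1 / 2) (2 * p) z * exp (- of_real l * z) = gs (1 / 2) (2 * p + of_real l) z" for z l
    unfolding gs_def by (simp add: algebra_simps flip: exp_add)
  have igs: "integrable lborel (\<lambda>t. gs (1 / 2) s (wpath b (pi / 2) t))" for s b
    using integrable_power_gs_90[of "1 / 2" b 0 s] by simp
  have \<Phi>int: "integrable lborel (\<lambda>t. \<Phi> (wpath b (pi / 2) t))" if "0 < b" for b
    unfolding \<Phi>_def gs using integrable_power_ex_vertical[OF that, of k 0] igs[of "2 * p" b]
    by (intro Bochner_Integration.integrable_diff integrable_mult_right) auto
  have wA: "wedge_integral b (pi / 2) (\<lambda>z. \<Phi> z * exp (- of_real l * z)) = A l" if b: "0 < b" for b l
  proof -
    have e: "\<Phi> z * exp (- of_real l * z) = z ^ k * ex (0 + l) z - (K * exp (p\<^sup>2)) * gs (1 / 2) (2 * p + of_real l) z" for z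
      unfolding \<Phi>_def gs ex_add gs_l[symmetric] by (simp add: algebra_simps)
    have "wedge_integral b (pi / 2) (\<lambda>z. \<Phi> z * exp (- of_real l * z))
        = wedge_integral b (pi / 2) (\<lambda>z. z ^ k * ex (0 + l) z) - wedge_integral b (pi / 2) (\<lambda>z. (K * exp (p\<^sup>2)) * gs (1 / 2) (2 * p + of_real l) z)"
      unfolding e by (rule wedge_diff) (use integrable_power_ex_vertical[OF b] igs in auto)
    also have "\<dots> = airy k l - (K * exp (p\<^sup>2)) * gk (1 / 2) (2 * p + of_real l)"
      using airy_vertical[OF b, of k l] by (simp add: wedge_mult gauss_wedge_90)
    finally have w: "wedge_integral b (pi / 2) (\<lambda>z. \<Phi> z * exp (- of_real l * z)) = airy k l - (K * exp (p\<^sup>2)) * gk (1 / 2) (2 * p + of_real l)" .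
    have g: "exp (p\<^sup>2) * gk (1 / 2) (2 * p + of_real l) = exp (- p * of_real l) * of_real (exp (- l\<^sup>2 / 4) / sqrt (4 * pi))"
    proof -
      have 1: "exp (p\<^sup>2) * exp (- ((2 * p + of_real l)\<^sup>2) / (8 * of_real (1 / 2))) = exp (- p * of_real l) * of_real (exp (- l\<^sup>2 / 4))"
        unfolding exp_of_real[symmetric] exp_add[symmetric] by (rule arg_cong[of _ _ exp]) (simp add: power2_eq_square field_simps)
      have 2: "8 * pi * (1 / 2) = 4 * pi" by simp
      show ?thesis
        unfolding gk_def 2 unfolding times_divide_eq_right[of "exp (p\<^sup>2)"] 1
        by (simp only: of_real_divide times_divide_eq_right)
    qed
    show ?thesis unfolding w A_def g[symmetric] by (simp only: mult.assoc)
  qed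
  define b where "b = 1 + Re p"
  have b: "0 < b" "Re p < b" using p by (auto simp: b_def)
  have cs: "0 \<le> cos (pi / 2)" by simp
  have ltA: "lt b (pi / 2) \<Phi> l = A l" if "0 \<le> l" for l
    using wedge_eq_lt(2)[OF \<Phi>m \<Phi>int[OF b(1)] cs that] wA[OF b(1), of l] by simp
  note right = wedge_laplace[OF \<Phi>m \<Phi>int[OF b(1)] cs b(2)]
  have r_eq: "indicator {0..} l *\<^sub>R (exp (of_real l * p) * lt b (pi / 2) \<Phi> l) = indicator {0..} l *\<^sub>R (exp (p * of_real l) * A l)" for l
    by (cases "0 \<le> l") (simp_all add: ltA mult.commute)
  \<comment> \<open>On the line to the left of \<open>p\<close> the variable is reflected, since
    \<open>wedge_laplace\<close> asks for the pole to the left of the line. The half-line integral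
    so obtained is the part over negative \<open>l\<close>.\<close>
  let ?N = "\<lambda>z. \<Phi> (- z)"
  have Nm: "?N \<in> borel_measurable borel" by measurable
  have Nint: "integrable lborel (\<lambda>t. ?N (wpath (- 1) (pi / 2) t))"
    by (rule wedge_reflect(1)[OF \<Phi>int]) simp
  have mp: "Re (- p) < - 1" using p by simp
  note left = wedge_laplace[OF Nm Nint cs mp]
  have ltN: "lt (- 1) (pi / 2) ?N l = A (- l)" if l: "0 \<le> l" for l
  proof -
    have i: "integrable lborel (\<lambda>t. \<Phi> (wpath 1 (pi / 2) t) * exp (- of_real (- l) * wpath 1 (pi / 2) t))"
    proof -
      have "integrable lborel (\<lambda>t. (\<lambda>z. \<Phi> (- z) * exp (- of_real (- l) * - z)) (wpath (- 1) (pi / 2) t))"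
        using wedge_eq_lt(1)[OF Nm Nint cs l] by simp
      from wedge_reflect(1)[OF this] show ?thesis by simp
    qed
    have "lt (- 1) (pi / 2) ?N l = wedge_integral (- 1) (pi / 2) (\<lambda>z. \<Phi> (- z) * exp (- of_real (- l) * - z))"
      using wedge_eq_lt(2)[OF Nm Nint cs l] by simp
    also have "\<dots> = wedge_integral 1 (pi / 2) (\<lambda>z. \<Phi> z * exp (- of_real (- l) * z))"
      using wedge_reflect(2)[OF i] by simp
    also have "\<dots> = A (- l)" by (rule wA) simp
    finally show ?thesis .
  qed
  have l_eq: "indicator {0..} l *\<^sub>R (exp (of_real l * - p) * lt (- 1) (pi / 2) ?N l) = indicator {0..} l *\<^sub>R (exp (p * of_real (- l)) * A (- l))" for l
    by (cases "0 \<le> l") (simp_all add: ltN mult.commute)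
  have pole: "wedge_integral b (pi / 2) (\<lambda>z. \<Phi> z / (z - p)) = wedge_integral 1 (pi / 2) (\<lambda>z. \<Phi> z / (z - p))"
  proof -
    \<comment> \<open>\<open>\<Phi> z / (z - p)\<close> with its removable singularity filled in. It
      is entire, so the two lines give the same integral.\<close>
    define \<Psi> where "\<Psi> z = (if z = p then deriv \<Phi> p else (\<Phi> z - \<Phi> p) / (z - p))" for z
    have "\<Phi> holomorphic_on UNIV" unfolding \<Phi>_def ex_def by (intro holomorphic_intros) auto
    then have \<Psi>h: "\<Psi> holomorphic_on UNIV" unfolding \<Psi>_def by (rule pole_lemma_open) simp
    have \<Psi>: "\<Psi> z = \<Phi> z / (z - p)" if "z \<noteq> p" for z using that by (simp add: \<Psi>_def \<Phi>p)
    have off: "wpath c (pi / 2) t \<noteq> p" if "c \<noteq> Re p" for c t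
      using that by (auto simp: wpath_90 complex_eq_iff)
    have off': "wpath b (pi / 2) t \<noteq> p" "wpath 1 (pi / 2) t \<noteq> p" for t
      using off[of b t] off[of 1 t] b p by auto
    have i1: "integrable lborel (\<lambda>t. \<Phi> (wpath 1 (pi / 2) t) / (wpath 1 (pi / 2) t - p))"
    proof (rule Bochner_Integration.integrable_bound[OF integrable_mult_right[OF integrable_norm[OF \<Phi>int[of 1]], of "1 / (Re p - 1)"]])
      show "AE t in lborel. norm (\<Phi> (wpath 1 (pi / 2) t) / (wpath 1 (pi / 2) t - p)) \<le> norm (1 / (Re p - 1) * norm (\<Phi> (wpath 1 (pi / 2) t)))"
      proof (rule AE_I2)
        fix t
        have "Re p - 1 \<le> cmod (wpath 1 (pi / 2) t - p)"
          using abs_Re_le_cmod[of "wpath 1 (pi / 2) t - p"] by (simp add: wpath_90)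
        then have "cmod (\<Phi> (wpath 1 (pi / 2) t)) / cmod (wpath 1 (pi / 2) t - p) \<le> cmod (\<Phi> (wpath 1 (pi / 2) t)) / (Re p - 1)"
          using p by (intro divide_left_mono mult_pos_pos) auto
        then show "norm (\<Phi> (wpath 1 (pi / 2) t) / (wpath 1 (pi / 2) t - p)) \<le> norm (1 / (Re p - 1) * norm (\<Phi> (wpath 1 (pi / 2) t)))"
          using p by (simp add: norm_divide)
      qed
    qed (simp, measurable)
    have sh: "wedge_integral b (pi / 2) \<Psi> = wedge_integral 1 (pi / 2) \<Psi>"
    proof (rule vertical_shift[OF \<Psi>h])
      show "integrable lborel (\<lambda>t. \<Psi> (wpath b (pi / 2) t))" using right(3) by (simp add: \<Psi> off')
      show "integrable lborel (\<lambda>t. \<Psi> (wpath 1 (pi / 2) t))" using i1 by (simp add: \<Psi> off')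
      let ?B = "\<lambda>T. exp (real k * (b + T)) * exp (b ^ 3 / 3 - T\<^sup>2) + cmod K * exp ((b + cmod p)\<^sup>2 - (T - \<bar>Im p\<bar>)\<^sup>2)"
      show "eventually (\<lambda>T. \<forall>z. \<bar>Im z\<bar> = T \<longrightarrow> min b 1 \<le> Re z \<longrightarrow> \<bar>Re z\<bar> \<le> max \<bar>b\<bar> \<bar>1\<bar> \<longrightarrow> cmod (\<Psi> z) \<le> ?B T) at_top"
        using eventually_ge_at_top[of "\<bar>Im p\<bar> + 1"]
      proof (eventually_elim, intro allI impI)
        fix T z assume T: "\<bar>Im p\<bar> + 1 \<le> T" and z: "\<bar>Im z\<bar> = T" "min b 1 \<le> Re z" "\<bar>Re z\<bar> \<le> max \<bar>b\<bar> \<bar>1\<bar>"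
        have b1: "1 < b" using p by (simp add: b_def)
        have r: "1 \<le> Re z" "Re z \<le> b" using z b1 by auto
        have im: "T - \<bar>Im p\<bar> \<le> \<bar>Im (z - p)\<bar>" using z(1) by auto
        have one: "1 \<le> cmod (z - p)" using im T abs_Im_le_cmod[of "z - p"] by linarith
        have "z \<noteq> p" using one by auto
        moreover have "cmod (\<Phi> z) / cmod (z - p) \<le> cmod (\<Phi> z) / 1" using one by (intro frac_le) auto
        ultimately have "cmod (\<Psi> z) \<le> cmod (\<Phi> z)" by (simp add: \<Psi> norm_divide)
        also have "\<dots> \<le> cmod (z ^ k * ex 0 z) + cmod (K * exp ((z - p)\<^sup>2))"
          unfolding \<Phi>_def by (rule norm_triangle_ineq4)
        also have "cmod (z ^ k * ex 0 z) \<le> exp (real k * (b + T)) * exp (b ^ 3 / 3 - T\<^sup>2)"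
        proof -
          have "cmod z \<le> b + T" using cmod_le[of z] z r by linarith
          also have "\<dots> \<le> exp (b + T)" using exp_ge_add_one_self[of "b + T"] by linarith
          finally have "cmod z ^ k \<le> exp (b + T) ^ k" by (intro power_mono) auto
          then have 1: "cmod (z ^ k) \<le> exp (real k * (b + T))" by (simp add: norm_power exp_of_nat_mult)
          have "(Re z) ^ 3 \<le> b ^ 3" using r by (intro power_mono) auto
          moreover have "1 * T\<^sup>2 \<le> Re z * (Im z)\<^sup>2" using r z(1) by (intro mult_mono) auto
          ultimately have "cmod (ex 0 z) \<le> exp (b ^ 3 / 3 - T\<^sup>2)" unfolding norm_ex by (simp add: diff_divide_distrib)
          then show ?thesis unfolding norm_mult using 1 by (intro mult_mono) auto
        qed
        also have "cmod (K * exp ((z - p)\<^sup>2)) \<le> cmod K * exp ((b + cmod p)\<^sup>2 - (T - \<bar>Im p\<bar>)\<^sup>2)"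
        proof -
          have "\<bar>Re (z - p)\<bar> \<le> b + cmod p" using r abs_Re_le_cmod[of p] unfolding minus_complex.sel by linarith
          then have "(Re (z - p))\<^sup>2 \<le> (b + cmod p)\<^sup>2" by (simp add: abs_le_square_iff[symmetric])
          moreover have "(T - \<bar>Im p\<bar>)\<^sup>2 \<le> (Im (z - p))\<^sup>2" using im T by (simp add: abs_le_square_iff[symmetric])
          moreover have "Re ((z - p)\<^sup>2) = (Re (z - p))\<^sup>2 - (Im (z - p))\<^sup>2" by (simp add: power2_eq_square)
          ultimately have "cmod (exp ((z - p)\<^sup>2)) \<le> exp ((b + cmod p)\<^sup>2 - (T - \<bar>Im p\<bar>)\<^sup>2)"
            unfolding norm_exp_eq_Re by simp
          then show ?thesis unfolding norm_mult by (rule mult_left_mono) simp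
        qed
        finally show "cmod (\<Psi> z) \<le> ?B T" by simp
      qed
      have "((\<lambda>T. cmod K * exp ((b + cmod p)\<^sup>2 - (T - \<bar>Im p\<bar>)\<^sup>2)) \<longlongrightarrow> cmod K * 0) at_top"
        by (intro tendsto_mult tendsto_const) real_asymp
      then have 1: "((\<lambda>T. cmod K * exp ((b + cmod p)\<^sup>2 - (T - \<bar>Im p\<bar>)\<^sup>2)) \<longlongrightarrow> 0) at_top" by simp
      have "((\<lambda>T :: real. exp (C + N * T - T\<^sup>2)) \<longlongrightarrow> 0) at_top" for C N :: real by real_asymp
      moreover have "exp (real k * (b + T)) * exp (b ^ 3 / 3 - T\<^sup>2) = exp ((real k * b + b ^ 3 / 3) + real k * T - T\<^sup>2)" for T
        unfolding exp_add[symmetric] by (rule arg_cong[of _ _ exp]) (simp add: algebra_simps)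
      ultimately have 2: "((\<lambda>T. exp (real k * (b + T)) * exp (b ^ 3 / 3 - T\<^sup>2)) \<longlongrightarrow> 0) at_top"
        by (simp only:)
      show "(?B \<longlongrightarrow> 0) at_top" using tendsto_add[OF 2 1] by simp
    qed
    have cg: "wedge_integral c (pi / 2) \<Psi> = wedge_integral c (pi / 2) (\<lambda>z. \<Phi> z / (z - p))" if "c \<noteq> Re p" for c
      by (rule wedge_cong) (use \<Psi> off[OF that] in auto)
    have nb: "b \<noteq> Re p" and n1: "1 \<noteq> Re p" using b p by auto
    show ?thesis using sh unfolding cg[OF nb] cg[OF n1] .
  qed
  have iA1: "integrable lborel (\<lambda>l. indicator {0..} l *\<^sub>R (exp (p * of_real l) * A l))" using right(2) unfolding r_eq .
  have iA2: "integrable lborel (\<lambda>l. indicator {0..} l *\<^sub>R (exp (p * of_real (- l)) * A (- l)))" using left(2) unfolding l_eq .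
  have n: "\<Phi> (- z) / (z - - p) = - (\<Phi> (- z) / (- z - p))" for z
  proof -
    have "- z - p = - (z + p)" by simp
    then show ?thesis unfolding \<open>- z - p = - (z + p)\<close> divide_minus_right by simp
  qed
  have i1: "integrable lborel (\<lambda>t. \<Phi> (wpath 1 (pi / 2) t) / (wpath 1 (pi / 2) t - p))"
  proof -
    have "integrable lborel (\<lambda>t. - (\<Phi> (- wpath (- 1) (pi / 2) t) / (- wpath (- 1) (pi / 2) t - p)))"
      using left(3) unfolding n .
    from Bochner_Integration.integrable_minus[OF this]
    have "integrable lborel (\<lambda>t. (\<lambda>z. \<Phi> (- z) / (- z - p)) (wpath (- 1) (pi / 2) t))" by simp
    from wedge_reflect(1)[OF this] show ?thesis by simp
  qed
  have "(\<integral>l. indicator {0..} l *\<^sub>R (exp (p * of_real (- l)) * A (- l)) \<partial>lborel) = wedge_integral (- 1) (pi / 2) (\<lambda>z. ?N z / (z - - p))"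
    using left(1) unfolding l_eq by simp
  also have "\<dots> = wedge_integral (- 1) (pi / 2) (\<lambda>z. - 1 * (\<Phi> (- z) / (- z - p)))"
    unfolding n by simp
  also have "\<dots> = - wedge_integral 1 (pi / 2) (\<lambda>z. \<Phi> z / (z - p))"
    unfolding wedge_mult wedge_reflect(2)[where f = "\<lambda>z. \<Phi> z / (z - p)", OF i1] by simp
  finally have sumA: "(\<integral>l. indicator {0..} l *\<^sub>R (exp (p * of_real l) * A l) \<partial>lborel) + (\<integral>l. indicator {0..} l *\<^sub>R (exp (p * of_real (- l)) * A (- l)) \<partial>lborel) = 0"
    using right(1) pole unfolding r_eq by simp
  have iA3: "integrable lborel (\<lambda>l. indicator {0..} (0 + (- 1) * l) *\<^sub>R (exp (p * of_real l) * A l))"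
    using lborel_integrable_real_affine[OF iA2, of "- 1" 0] by simp
  have "(\<integral>l. indicator {0..} l *\<^sub>R (exp (p * of_real (- l)) * A (- l)) \<partial>lborel)
      = (\<integral>l. indicator {0..} (0 + (- 1) * l) *\<^sub>R (exp (p * of_real l) * A l) \<partial>lborel)"
    using lborel_integral_real_affine[of "- 1" "\<lambda>l. indicator {0..} l *\<^sub>R (exp (p * of_real (- l)) * A (- l))" 0] by simp
  then have "(\<integral>l. indicator {0..} l *\<^sub>R (exp (p * of_real l) * A l) + indicator {0..} (0 + (- 1) * l) *\<^sub>R (exp (p * of_real l) * A l) \<partial>lborel) = 0"
    using sumA by (subst Bochner_Integration.integral_add[OF iA1 iA3]) simp
  then have Z: "(\<integral>l. indicator {0..} l *\<^sub>R (exp (p * of_real l) * A l) + indicator {0..} (0 + (- 1) * l) *\<^sub>R (exp (p * of_real l) * A l) \<partial>lborel) = 0" .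
  have AE: "AE l in lborel. indicator {0..} l *\<^sub>R (exp (p * of_real l) * A l) + indicator {0..} (0 + (- 1) * l) *\<^sub>R (exp (p * of_real l) * A l) = exp (p * of_real l) * A l"
    using AE_lborel_singleton[of 0] by eventually_elim (auto simp: indicator_def)
  have Am: "(\<lambda>l. exp (p * of_real l) * A l) \<in> borel_measurable lborel" unfolding A_def by measurable
  have i12: "integrable lborel (\<lambda>l. indicator {0..} l *\<^sub>R (exp (p * of_real l) * A l) + indicator {0..} (0 + (- 1) * l) *\<^sub>R (exp (p * of_real l) * A l))"
    by (rule Bochner_Integration.integrable_add[OF iA1 iA3])
  have zero: "(\<integral>l. exp (p * of_real l) * A l \<partial>lborel) = 0"
    by (rule trans[OF integral_cong_AE[OF borel_measurable_integrable[OF i12] Am AE, symmetric] Z])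
  have intA: "integrable lborel (\<lambda>l. exp (p * of_real l) * A l)"
    by (rule integrable_cong_AE_imp[OF i12 Am AE])
  \<comment> \<open>Weighted by \<open>exp (p * l)\<close>, the inverse transform of the subtracted
    Gaussian is \<open>K\<close> times a normal density of variance 2, so its contribution is
    exactly \<open>K\<close>.\<close>
  have g: "exp (p * of_real l) * (exp (- p * of_real l) * of_real (exp (- l\<^sup>2 / 4) / sqrt (4 * pi))) = of_real (normal_density 0 (sqrt 2) l)" for l
  proof -
    have "exp (p * of_real l) * exp (- p * of_real l) = 1" by (simp flip: exp_add)
    then show ?thesis unfolding mult.assoc[symmetric] normal_density_def by (simp add: real_sqrt_mult)
  qed
  have intg: "integrable lborel (\<lambda>l. complex_of_real (normal_density 0 (sqrt 2) l))"
    by (intro integrable_of_real integrable_normal_density) simp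
  have "exp (p * of_real l) * airy k l = exp (p * of_real l) * A l + K * of_real (normal_density 0 (sqrt 2) l)" for l
    unfolding g[symmetric] A_def by (simp add: algebra_simps)
  then have "(\<integral>l. exp (p * of_real l) * airy k l \<partial>lborel) = (\<integral>l. exp (p * of_real l) * A l \<partial>lborel) + (\<integral>l. K * of_real (normal_density 0 (sqrt 2) l) \<partial>lborel)"
    using intA intg by (simp only:) (intro Bochner_Integration.integral_add integrable_mult_right)
  also have "\<dots> = K" by (simp add: zero integral_mult_right_zero)
  finally show ?thesis by (simp add: K_def)
qed

section \<open>Double integrals along a fixed contour\<close>

abbreviation cpath :: "real \<Rightarrow> complex" where "cpath \<equiv> wpath 1 (pi / 3)"
abbreviation cfac :: "real \<Rightarrow> complex" where "cfac \<equiv> wfac (pi / 3)"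

text \<open>Both contours are fixed at base point 1, and arbitrary functions \<open>p\<close> and
  \<open>q\<close> take the place of the exponentials, because the corrected rows are no longer of
  the form \<open>ex x\<close>.\<close>

definition dbl :: "(complex \<Rightarrow> complex \<Rightarrow> complex) \<Rightarrow> (complex \<Rightarrow> complex) \<Rightarrow> (complex \<Rightarrow> complex) \<Rightarrow> complex" where
  "dbl \<kappa> p q = (\<integral>v. \<kappa> (cpath (fst v)) (cpath (snd v)) * p (cpath (fst v)) * q (cpath (snd v)) * cfac (fst v) * cfac (snd v)
     \<partial>(lborel \<Otimes>\<^sub>M lborel))"

definition inner_int :: "(complex \<Rightarrow> complex \<Rightarrow> complex) \<Rightarrow> (complex \<Rightarrow> complex) \<Rightarrow> complex \<Rightarrow> complex" where
  "inner_int \<kappa> q z = (\<integral>s. \<kappa> z (cpath s) * q (cpath s) * cfac s \<partial>lborel)"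

text \<open>One linear factor per variable is allowed on account of numerators such as
  \<open>z - w\<close>; the cubic decay of \<open>p\<close> and \<open>q\<close> absorbs it.\<close>

definition cbound :: "real \<Rightarrow> (complex \<Rightarrow> complex \<Rightarrow> complex) \<Rightarrow> bool" where
  "cbound K \<kappa> \<longleftrightarrow> 0 \<le> K \<and> case_prod \<kappa> \<in> borel_measurable (borel \<Otimes>\<^sub>M borel) \<and>
     (\<forall>t s. cmod (\<kappa> (cpath t) (cpath s)) \<le> K * (1 + \<bar>t\<bar>) * (1 + \<bar>s\<bar>))"

text \<open>\<open>c\<close> is the shape of the decay along the contour; \<open>A\<close> is kept
  apart because it carries the decay in the point to which a row belongs.\<close>

definition pbound :: "real \<Rightarrow> real \<Rightarrow> (complex \<Rightarrow> complex) \<Rightarrow> bool" where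
  "pbound c A p \<longleftrightarrow> 0 \<le> c \<and> 0 \<le> A \<and> p \<in> borel_measurable borel \<and> (\<forall>t. cmod (p (cpath t)) \<le> A * cw c t)"

definition cmass :: "real \<Rightarrow> real" where
  "cmass c = (\<integral>t. cw (c + 1) t \<partial>lborel)"

lemma cmass_nonneg: "0 \<le> cmass c"
  unfolding cmass_def by (rule Bochner_Integration.integral_nonneg) (rule cw_nonneg)

lemma linear_mult_cw: "(1 + \<bar>t\<bar>) * cw c t \<le> cw (c + 1) t"
  using power_mult_cw[of t 1 c] by simp

lemma cpair_measurable:
  assumes [measurable]: "case_prod \<kappa> \<in> borel_measurable (borel \<Otimes>\<^sub>M borel)"
  shows "(\<lambda>v. \<kappa> (cpath (fst v)) (cpath (snd v))) \<in> borel_measurable (borel \<Otimes>\<^sub>M borel)"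
  by measurable

lemma dbl_integrand:
  assumes \<kappa>: "cbound K \<kappa>" and p: "pbound c A p" and q: "pbound c B q"
  defines "F \<equiv> \<lambda>v. \<kappa> (cpath (fst v)) (cpath (snd v)) * p (cpath (fst v)) * q (cpath (snd v)) * cfac (fst v) * cfac (snd v)"
  shows "F \<in> borel_measurable (borel \<Otimes>\<^sub>M borel)"
    and "cmod (F (t, s)) \<le> (K * A * B * cw (c + 1) t) * cw (c + 1) s"
    and "integrable (lborel \<Otimes>\<^sub>M lborel) F"
    and "integrable (lborel \<Otimes>\<^sub>M lborel) (\<lambda>v. (K * A * B * cw (c + 1) (fst v)) * cw (c + 1) (snd v))"
    and "dbl \<kappa> p q = (\<integral>t. p (cpath t) * cfac t * inner_int \<kappa> q (cpath t) \<partial>lborel)"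
    and "integrable lborel (\<lambda>t. p (cpath t) * cfac t * inner_int \<kappa> q (cpath t))"
proof -
  note [measurable] = cpair_measurable[of \<kappa>]
  have c: "0 \<le> c" "0 \<le> A" "0 \<le> B" "0 \<le> K" using \<kappa> p q by (auto simp: pbound_def cbound_def)
  have [measurable]: "p \<in> borel_measurable borel" "q \<in> borel_measurable borel"
    "case_prod \<kappa> \<in> borel_measurable (borel \<Otimes>\<^sub>M borel)"
    using \<kappa> p q by (auto simp: pbound_def cbound_def)
  show Fm: "F \<in> borel_measurable (borel \<Otimes>\<^sub>M borel)" unfolding F_def by measurable
  have Fb: "cmod (F (t, s)) \<le> (K * A * B * cw (c + 1) t) * cw (c + 1) s" for t s
  proof -
    have "cmod (F (t, s)) \<le> (K * (1 + \<bar>t\<bar>) * (1 + \<bar>s\<bar>)) * (A * cw c t) * (B * cw c s) * 1 * 1"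
      unfolding F_def norm_mult fst_conv snd_conv using \<kappa> p q c cw_nonneg
      by (intro mult_mono norm_wfac mult_nonneg_nonneg) (auto simp: pbound_def cbound_def)
    also have "\<dots> = (K * A * B) * (((1 + \<bar>t\<bar>) * cw c t) * ((1 + \<bar>s\<bar>) * cw c s))" by simp
    also have "\<dots> \<le> (K * A * B) * (cw (c + 1) t * cw (c + 1) s)"
      using c cw_nonneg by (intro mult_left_mono mult_mono linear_mult_cw) auto
    finally show ?thesis by (simp add: mult.assoc)
  qed
  show "cmod (F (t, s)) \<le> (K * A * B * cw (c + 1) t) * cw (c + 1) s" by (rule Fb)
  have i: "integrable lborel (\<lambda>t. K * A * B * cw (c + 1) t)" "integrable lborel (cw (c + 1))"
    using c by (auto intro!: integrable_mult_right cw_integrable)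
  have Fm': "F \<in> borel_measurable borel" using Fm by (simp add: borel_prod)
  note fub = fubini_bounded[OF Fm' i Fb]
  show "integrable (lborel \<Otimes>\<^sub>M lborel) F" by (rule fub(1))
  have gm: "(\<lambda>v. complex_of_real ((K * A * B * cw (c + 1) (fst v)) * cw (c + 1) (snd v))) \<in> borel_measurable borel"
  proof -
    have "(\<lambda>v. complex_of_real ((K * A * B * cw (c + 1) (fst v)) * cw (c + 1) (snd v))) \<in> borel_measurable (borel \<Otimes>\<^sub>M borel)"
      by measurable
    then show ?thesis by (simp add: borel_prod)
  qed
  have "integrable (lborel \<Otimes>\<^sub>M lborel) (\<lambda>v. complex_of_real ((K * A * B * cw (c + 1) (fst v)) * cw (c + 1) (snd v)))"
    by (rule fubini_bounded(1)[OF gm i]) (use c cw_nonneg in \<open>simp add: norm_mult\<close>)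
  from integrable_Re[OF this] show "integrable (lborel \<Otimes>\<^sub>M lborel) (\<lambda>v. (K * A * B * cw (c + 1) (fst v)) * cw (c + 1) (snd v))"
    by simp
  have inner: "(\<integral>s. F (t, s) \<partial>lborel) = p (cpath t) * cfac t * inner_int \<kappa> q (cpath t)" for t
  proof -
    have "(\<integral>s. F (t, s) \<partial>lborel) = (\<integral>s. (p (cpath t) * cfac t) * (\<kappa> (cpath t) (cpath s) * q (cpath s) * cfac s) \<partial>lborel)"
      by (rule Bochner_Integration.integral_cong) (auto simp: F_def)
    then show ?thesis unfolding inner_int_def by simp
  qed
  have "dbl \<kappa> p q = (\<integral>t. (\<integral>s. F (t, s) \<partial>lborel) \<partial>lborel)"
    unfolding dbl_def F_def[symmetric] by (rule lborel_pair.integral_fst'[symmetric, OF fub(1)])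
  then show "dbl \<kappa> p q = (\<integral>t. p (cpath t) * cfac t * inner_int \<kappa> q (cpath t) \<partial>lborel)"
    unfolding inner .
  show "integrable lborel (\<lambda>t. p (cpath t) * cfac t * inner_int \<kappa> q (cpath t))"
    using fub(3) unfolding inner .
qed

lemma dbl_bound:
  assumes \<kappa>: "cbound K \<kappa>" and p: "pbound c A p" and q: "pbound c B q"
  shows "cmod (dbl \<kappa> p q) \<le> K * A * B * (cmass c)\<^sup>2"
proof -
  note D = dbl_integrand[OF assms]
  have c: "0 \<le> c" using p by (simp add: pbound_def)
  have "cmod (dbl \<kappa> p q) \<le> (\<integral>v. (K * A * B * cw (c + 1) (fst v)) * cw (c + 1) (snd v) \<partial>(lborel \<Otimes>\<^sub>M lborel))"
    unfolding dbl_def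
    by (rule order.trans[OF integral_norm_bound], rule integral_mono[OF integrable_norm[OF D(3)] D(4)])
       (metis D(2) prod.collapse)
  also have "\<dots> = (\<integral>t. (\<integral>s. (K * A * B * cw (c + 1) t) * cw (c + 1) s \<partial>lborel) \<partial>lborel)"
    using lborel_pair.integral_fst'[OF D(4)] by simp
  also have "\<dots> = K * A * B * (cmass c)\<^sup>2"
    by (simp add: cmass_def power2_eq_square)
  finally show ?thesis .
qed

lemma inner_int_bound:
  assumes \<kappa>: "cbound K \<kappa>" and q: "pbound c B q"
  shows "cmod (inner_int \<kappa> q (cpath t)) \<le> K * B * cmass c * (1 + \<bar>t\<bar>)"
proof -
  have c: "0 \<le> c" "0 \<le> B" "0 \<le> K" using \<kappa> q by (auto simp: pbound_def cbound_def)
  have b: "cmod (\<kappa> (cpath t) (cpath s) * q (cpath s) * cfac s) \<le> K * B * (1 + \<bar>t\<bar>) * cw (c + 1) s" for s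
  proof -
    have "cmod (\<kappa> (cpath t) (cpath s) * q (cpath s) * cfac s) \<le> (K * (1 + \<bar>t\<bar>) * (1 + \<bar>s\<bar>)) * (B * cw c s) * 1"
      unfolding norm_mult using \<kappa> q c cw_nonneg
      by (intro mult_mono norm_wfac mult_nonneg_nonneg) (auto simp: pbound_def cbound_def)
    also have "\<dots> = K * B * (1 + \<bar>t\<bar>) * ((1 + \<bar>s\<bar>) * cw c s)" by simp
    also have "\<dots> \<le> K * B * (1 + \<bar>t\<bar>) * cw (c + 1) s"
      using c by (intro mult_left_mono linear_mult_cw) auto
    finally show ?thesis .
  qed
  have "cmod (inner_int \<kappa> q (cpath t)) \<le> (\<integral>s. K * B * (1 + \<bar>t\<bar>) * cw (c + 1) s \<partial>lborel)"
    unfolding inner_int_def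
  proof (rule order.trans[OF integral_norm_bound], rule integral_mono')
    show "integrable lborel (\<lambda>s. K * B * (1 + \<bar>t\<bar>) * cw (c + 1) s)"
      using c by (intro integrable_mult_right cw_integrable) auto
  qed (use b c cw_nonneg in auto)
  also have "\<dots> = K * B * cmass c * (1 + \<bar>t\<bar>)" by (simp add: cmass_def)
  finally show ?thesis .
qed

lemma inner_int_measurable:
  assumes [measurable]: "case_prod \<kappa> \<in> borel_measurable (borel \<Otimes>\<^sub>M borel)" "q \<in> borel_measurable borel"
  shows "inner_int \<kappa> q \<in> borel_measurable borel"
  unfolding inner_int_def by measurable

lemma dbl_tendsto:
  assumes \<kappa>: "\<And>n. cbound K (\<kappa> n)" and p: "\<And>n. pbound c A (p n)" and q: "\<And>n. pbound c B (q n)"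
    and m: "case_prod \<kappa>' \<in> borel_measurable (borel \<Otimes>\<^sub>M borel)" "p' \<in> borel_measurable borel" "q' \<in> borel_measurable borel"
    and lim: "\<And>t s. (\<lambda>n. \<kappa> n (cpath t) (cpath s)) \<longlonglongrightarrow> \<kappa>' (cpath t) (cpath s)"
      "\<And>t. (\<lambda>n. p n (cpath t)) \<longlonglongrightarrow> p' (cpath t)" "\<And>t. (\<lambda>n. q n (cpath t)) \<longlonglongrightarrow> q' (cpath t)"
  shows "(\<lambda>n. dbl (\<kappa> n) (p n) (q n)) \<longlonglongrightarrow> dbl \<kappa>' p' q'"
  unfolding dbl_def
proof (rule integral_dominated_convergence)
  note D = dbl_integrand[OF \<kappa> p q]
  note [measurable] = m
  show "integrable (lborel \<Otimes>\<^sub>M lborel) (\<lambda>v. (K * A * B * cw (c + 1) (fst v)) * cw (c + 1) (snd v))" by (rule D(4))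
  have s: "borel_measurable (lborel \<Otimes>\<^sub>M lborel) = borel_measurable (borel \<Otimes>\<^sub>M borel)"
    by (rule measurable_cong_sets) (auto intro: sets_pair_measure_cong)
  show "(\<lambda>v. \<kappa> n (cpath (fst v)) (cpath (snd v)) * p n (cpath (fst v)) * q n (cpath (snd v)) * cfac (fst v) * cfac (snd v))
      \<in> borel_measurable (lborel \<Otimes>\<^sub>M lborel)" for n
    unfolding s by (rule D(1))
  show "(\<lambda>v. \<kappa>' (cpath (fst v)) (cpath (snd v)) * p' (cpath (fst v)) * q' (cpath (snd v)) * cfac (fst v) * cfac (snd v))
      \<in> borel_measurable (lborel \<Otimes>\<^sub>M lborel)"
    unfolding s by measurable
  show "AE v in lborel \<Otimes>\<^sub>M lborel. norm (\<kappa> n (cpath (fst v)) (cpath (snd v)) * p n (cpath (fst v)) * q n (cpath (snd v)) * cfac (fst v) * cfac (snd v))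
      \<le> (K * A * B * cw (c + 1) (fst v)) * cw (c + 1) (snd v)" for n
  proof (rule AE_I2)
    fix v
    show "norm (\<kappa> n (cpath (fst v)) (cpath (snd v)) * p n (cpath (fst v)) * q n (cpath (snd v)) * cfac (fst v) * cfac (snd v))
        \<le> (K * A * B * cw (c + 1) (fst v)) * cw (c + 1) (snd v)"
      using dbl_integrand(2)[OF \<kappa>[of n] p[of n] q[of n], of "fst v" "snd v"] by simp
  qed
  show "AE v in lborel \<Otimes>\<^sub>M lborel. (\<lambda>n. \<kappa> n (cpath (fst v)) (cpath (snd v)) * p n (cpath (fst v)) * q n (cpath (snd v)) * cfac (fst v) * cfac (snd v))
      \<longlonglongrightarrow> \<kappa>' (cpath (fst v)) (cpath (snd v)) * p' (cpath (fst v)) * q' (cpath (snd v)) * cfac (fst v) * cfac (snd v)"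
    by (intro AE_I2 tendsto_mult tendsto_const lim)
qed

lemma dbl_swap: "dbl \<kappa> p q = dbl (\<lambda>z w. \<kappa> w z) q p"
proof -
  let ?F = "\<lambda>v. \<kappa> (cpath (fst v)) (cpath (snd v)) * p (cpath (fst v)) * q (cpath (snd v)) * cfac (fst v) * cfac (snd v)"
  have "dbl \<kappa> p q = (\<integral>v. ?F v \<partial>distr (lborel \<Otimes>\<^sub>M lborel) (lborel \<Otimes>\<^sub>M lborel) (\<lambda>(x, y). (y, x)))"
    unfolding dbl_def by (subst lborel_pair.distr_pair_swap) (rule refl)
  show ?thesis
  proof (cases "?F \<in> borel_measurable (lborel \<Otimes>\<^sub>M lborel)")
    case True
    then have "dbl \<kappa> p q = (\<integral>v. ?F (snd v, fst v) \<partial>(lborel \<Otimes>\<^sub>M lborel))"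
      unfolding dbl_def using lborel_pair.integral_product_swap[of ?F] by (simp add: case_prod_unfold)
    then show ?thesis unfolding dbl_def by (simp add: mult_ac)
  next
    \<comment> \<open>Without measurability neither integral exists, and both sides take the default
      value 0.\<close>
    case False
    let ?G = "\<lambda>v. \<kappa> (cpath (snd v)) (cpath (fst v)) * q (cpath (fst v)) * p (cpath (snd v)) * cfac (fst v) * cfac (snd v)"
    have "?G \<notin> borel_measurable (lborel \<Otimes>\<^sub>M lborel)"
    proof
      assume "?G \<in> borel_measurable (lborel \<Otimes>\<^sub>M lborel)"
      then have "(\<lambda>v. ?G (snd v, fst v)) \<in> borel_measurable (lborel \<Otimes>\<^sub>M lborel)" by measurable
      then show False using False by (simp add: mult_ac)
    qed
    then show ?thesis using False unfolding dbl_def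
      by (metis (no_types, lifting) borel_measurable_integrable not_integrable_integral_eq)
  qed
qed

lemma dbl_uminus: "dbl (\<lambda>z w. - \<kappa> z w) p q = - dbl \<kappa> p q"
  unfolding dbl_def by simp

lemma dbl_cong:
  assumes "\<And>t s. \<kappa> (cpath t) (cpath s) * p (cpath t) * q (cpath s) = \<kappa>' (cpath t) (cpath s) * p' (cpath t) * q' (cpath s)"
  shows "dbl \<kappa> p q = dbl \<kappa>' p' q'"
  unfolding dbl_def by (simp only: assms)

lemma pbound_ex: "x0 \<le> x \<Longrightarrow> pbound (ec 1 x0) (exp (x0 - x)) (ex x)"
proof -
  assume x: "x0 \<le> x"
  have "cmod (ex x (cpath t)) \<le> exp (x0 - x) * cw (ec 1 x0) t" for t
  proof -
    have "cmod (ex x (cpath t)) \<le> cmod (ex x0 (cpath t)) * exp (- 1 * (x - x0))"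
      by (rule norm_ex_le[OF x]) (simp add: wpath_60)
    also have "\<dots> \<le> cw (ec 1 x0) t * exp (- 1 * (x - x0))"
      by (intro mult_right_mono norm_ex_wpath) auto
    finally show ?thesis by (simp add: mult.commute)
  qed
  then show ?thesis by (simp add: pbound_def ec_nonneg)
qed

lemma pbound_mono: "pbound c A p \<Longrightarrow> c \<le> d \<Longrightarrow> A \<le> B \<Longrightarrow> pbound d B p"
proof -
  assume h: "pbound c A p" "c \<le> d" "A \<le> B"
  have "A * cw c t \<le> B * cw d t" for t
    using h by (intro mult_mono cw_mono cw_nonneg) (auto simp: pbound_def)
  then show ?thesis using h unfolding pbound_def by (meson order.trans)
qed

lemma cpath_bounds: "1 \<le> Re (cpath t)" "cmod (cpath t) \<le> 1 + \<bar>t\<bar>" "cpath t \<noteq> 0"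
proof -
  show 1: "1 \<le> Re (cpath t)" by (simp add: wpath_60)
  show "cmod (cpath t) \<le> 1 + \<bar>t\<bar>" using norm_wpath_le[of 1 "pi / 3" t] by simp
  show "cpath t \<noteq> 0" using 1 by auto
qed

text \<open>Under \<open>cbound\<close> the integrand has a product majorant, which turns the
  iterated wedge integral into one integral over the plane.\<close>

lemma double_airy_eq_dbl:
  assumes \<kappa>: "cbound K \<kappa>"
  shows "double_airy_integral 1 1 \<kappa> x y = dbl \<kappa> (ex x) (ex y)"
proof -
  define x0 where "x0 = min x y"
  have px: "pbound (ec 1 x0) 1 (ex x)" "pbound (ec 1 x0) 1 (ex y)"
    by (auto intro!: pbound_mono[OF pbound_ex[of x0]] simp: x0_def)
  note D = dbl_integrand[OF \<kappa> px]
  have c: "0 \<le> ec 1 x0" by (rule ec_nonneg)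
  have K: "0 \<le> K" using \<kappa> by (simp add: cbound_def)
  have [measurable]: "case_prod \<kappa> \<in> borel_measurable (borel \<Otimes>\<^sub>M borel)" using \<kappa> by (simp add: cbound_def)
  have inner: "wedge_integral 1 (pi / 3) (\<lambda>w. \<kappa> (cpath t) w * airy_exp x y (cpath t) w) = ex x (cpath t) * inner_int \<kappa> (ex y) (cpath t)" for t
  proof -
    have "integrable lborel (\<lambda>s. \<kappa> (cpath t) (cpath s) * ex y (cpath s))"
    proof (rule Bochner_Integration.integrable_bound[of lborel "\<lambda>s. K * (1 + \<bar>t\<bar>) * cw (ec 1 x0 + 1) s"])
      show "integrable lborel (\<lambda>s. K * (1 + \<bar>t\<bar>) * cw (ec 1 x0 + 1) s)"
        using c by (intro integrable_mult_right cw_integrable) auto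
      show "AE s in lborel. norm (\<kappa> (cpath t) (cpath s) * ex y (cpath s)) \<le> norm (K * (1 + \<bar>t\<bar>) * cw (ec 1 x0 + 1) s)"
      proof (rule AE_I2)
        fix s
        have "norm (\<kappa> (cpath t) (cpath s) * ex y (cpath s)) \<le> (K * (1 + \<bar>t\<bar>) * (1 + \<bar>s\<bar>)) * (1 * cw (ec 1 x0) s)"
          unfolding norm_mult using \<kappa> px(2) K by (intro mult_mono) (auto simp: cbound_def pbound_def)
        also have "\<dots> = K * (1 + \<bar>t\<bar>) * ((1 + \<bar>s\<bar>) * cw (ec 1 x0) s)" by simp
        also have "\<dots> \<le> K * (1 + \<bar>t\<bar>) * cw (ec 1 x0 + 1) s"
          using K by (intro mult_left_mono linear_mult_cw) auto
        finally show "norm (\<kappa> (cpath t) (cpath s) * ex y (cpath s)) \<le> norm (K * (1 + \<bar>t\<bar>) * cw (ec 1 x0 + 1) s)"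
          unfolding real_norm_def by (rule order.trans[OF _ abs_ge_self])
      qed
    qed measurable
    from wedge_eq[OF this]
    have "wedge_integral 1 (pi / 3) (\<lambda>w. \<kappa> (cpath t) w * ex y w) = inner_int \<kappa> (ex y) (cpath t)"
      unfolding inner_int_def .
    moreover have "(\<lambda>w. \<kappa> (cpath t) w * airy_exp x y (cpath t) w) = (\<lambda>w. ex x (cpath t) * (\<kappa> (cpath t) w * ex y w))"
      by (simp add: airy_exp_eq mult_ac)
    ultimately show ?thesis by (simp only: wedge_mult)
  qed
  have int: "integrable lborel (\<lambda>t. ex x (cpath t) * inner_int \<kappa> (ex y) (cpath t))"
  proof (rule Bochner_Integration.integrable_bound[of lborel "\<lambda>t. K * cmass (ec 1 x0) * cw (ec 1 x0 + 1) t"])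
    show "integrable lborel (\<lambda>t. K * cmass (ec 1 x0) * cw (ec 1 x0 + 1) t)"
      using c by (intro integrable_mult_right cw_integrable) auto
    show "AE t in lborel. norm (ex x (cpath t) * inner_int \<kappa> (ex y) (cpath t)) \<le> norm (K * cmass (ec 1 x0) * cw (ec 1 x0 + 1) t)"
    proof (rule AE_I2)
      fix t
      have "norm (ex x (cpath t) * inner_int \<kappa> (ex y) (cpath t)) \<le> (1 * cw (ec 1 x0) t) * (K * 1 * cmass (ec 1 x0) * (1 + \<bar>t\<bar>))"
        unfolding norm_mult using px(1) inner_int_bound[OF \<kappa> px(2), of t] cw_nonneg
        by (intro mult_mono) (auto simp: pbound_def)
      also have "\<dots> = K * cmass (ec 1 x0) * ((1 + \<bar>t\<bar>) * cw (ec 1 x0) t)" by simp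
      also have "\<dots> \<le> K * cmass (ec 1 x0) * cw (ec 1 x0 + 1) t"
        using K cmass_nonneg by (intro mult_left_mono linear_mult_cw) auto
      finally show "norm (ex x (cpath t) * inner_int \<kappa> (ex y) (cpath t)) \<le> norm (K * cmass (ec 1 x0) * cw (ec 1 x0 + 1) t)"
        unfolding real_norm_def by (rule order.trans[OF _ abs_ge_self])
    qed
    have "inner_int \<kappa> (ex y) \<in> borel_measurable borel" by (rule inner_int_measurable) measurable
    then show "(\<lambda>t. ex x (cpath t) * inner_int \<kappa> (ex y) (cpath t)) \<in> borel_measurable lborel" by measurable
  qed
  have "double_airy_integral 1 1 \<kappa> x y = wedge_integral 1 (pi / 3) (\<lambda>z. ex x z * inner_int \<kappa> (ex y) z)"
    unfolding double_airy_integral_def by (rule wedge_cong) (rule inner)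
  also have "\<dots> = (\<integral>t. ex x (cpath t) * inner_int \<kappa> (ex y) (cpath t) * cfac t \<partial>lborel)"
    by (rule wedge_eq[OF int])
  also have "\<dots> = dbl \<kappa> (ex x) (ex y)" unfolding D(5) by (simp add: mult_ac)
  finally show ?thesis .
qed

section \<open>The kernel entries in terms of Airy functions\<close>

lemma partial_fractions_12:
  fixes z w e :: complex
  assumes "z + e \<noteq> 0" "z + w \<noteq> 0"
  shows "(z - w + 2 * e) / (2 * (z + e) * (z + w)) = 1 / (z + w) - 1 / (2 * (z + e))"
proof -
  have "1 / (z + w) - 1 / (2 * (z + e)) = (1 * (2 * (z + e)) - 1 * (z + w)) / ((z + w) * (2 * (z + e)))"
  proof (rule diff_frac_eq[OF assms(2)])
    show "2 * (z + e) \<noteq> 0" unfolding mult_eq_0_iff using assms by simp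
  qed
  also have "1 * (2 * (z + e)) - 1 * (z + w) = z - w + 2 * e" by (simp add: algebra_simps)
  also have "(z + w) * (2 * (z + e)) = 2 * (z + e) * (z + w)" by (simp only: mult_ac)
  finally show ?thesis ..
qed

lemma inner_wedge_integrable:
  fixes c :: real
  assumes "c < Re z + b"
  shows "integrable lborel (\<lambda>s. (z ^ j * ex x z) * (wpath b (pi / 3) s ^ k * ex y (wpath b (pi / 3) s)) / (z + wpath b (pi / 3) s - of_real c))"
proof -
  have "Re (of_real c - z) < b" using assms by simp
  from wedge_laplace(3)[OF power_ex_measurable integrable_power_ex _ this, of k y]
  have "integrable lborel (\<lambda>s. (z ^ j * ex x z) * ((wpath b (pi / 3) s ^ k * ex y (wpath b (pi / 3) s)) / (wpath b (pi / 3) s - (of_real c - z))))"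
    by (intro integrable_mult_right) (simp add: cos_60)
  then show ?thesis by (simp add: algebra_simps)
qed

text \<open>Partial fractions split the integrand into that of the Airy kernel and a term that
  factorises in \<open>z\<close> and \<open>w\<close>, whose pole at \<open>- \<eta>\<close> is
  handled by \<open>wedge_laplace\<close>. Neither part retains \<open>a\<close> or
  \<open>b\<close>, which is what \<open>KSU12_base\<close> exploits.\<close>

lemma KSU12_airy:
  assumes "- \<eta> < a" "0 < a + b"
  shows "KSU12 a b \<eta> x y = airy2 0 0 0 x y
    - (\<integral>l. indicator {0..} l *\<^sub>R (exp (of_real l * of_real (- \<eta>)) * airy 0 (x + l)) \<partial>lborel) * airy 0 y / 2"
proof -
  let ?a = "wpath a (pi / 3)" and ?b = "wpath b (pi / 3)"
  let ?A = "\<lambda>z w. (z ^ 0 * ex x z) * (w ^ 0 * ex y w) / (z + w - of_real 0)"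
  have ra: "a \<le> Re (?a t)" and rb: "b \<le> Re (?b t)" for t by (auto intro: Re_wpath_ge simp: cos_60)
  have inner: "wedge_integral b (pi / 3) (\<lambda>w. (?a t - w + 2 * of_real \<eta>) / (2 * (?a t + of_real \<eta>) * (?a t + w)) * airy_exp x y (?a t) w)
      = wedge_integral b (pi / 3) (?A (?a t)) - (airy 0 y / 2) * ((?a t ^ 0 * ex x (?a t)) / (?a t - of_real (- \<eta>)))" for t
  proof -
    let ?z = "?a t"
    have "wedge_integral b (pi / 3) (\<lambda>w. (?z - w + 2 * of_real \<eta>) / (2 * (?z + of_real \<eta>) * (?z + w)) * airy_exp x y ?z w)
        = wedge_integral b (pi / 3) (\<lambda>w. ?A ?z w - (ex x ?z / (2 * (?z + of_real \<eta>))) * (w ^ 0 * ex y w))"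
    proof (rule wedge_cong)
      fix s
      have "Re (?z + of_real \<eta>) \<noteq> 0" "Re (?z + ?b s) \<noteq> 0" using ra[of t] rb[of s] assms by auto
      then have nz: "?z + of_real \<eta> \<noteq> 0" "?z + ?b s \<noteq> 0" by (metis zero_complex.sel(1))+
      have "(?z - ?b s + 2 * of_real \<eta>) / (2 * (?z + of_real \<eta>) * (?z + ?b s)) = 1 / (?z + ?b s) - 1 / (2 * (?z + of_real \<eta>))"
        by (rule partial_fractions_12[OF nz])
      then show "(?z - ?b s + 2 * of_real \<eta>) / (2 * (?z + of_real \<eta>) * (?z + ?b s)) * airy_exp x y ?z (?b s)
          = ?A ?z (?b s) - (ex x ?z / (2 * (?z + of_real \<eta>))) * (?b s ^ 0 * ex y (?b s))"
        by (simp add: airy_exp_eq left_diff_distrib)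
    qed
    also have "\<dots> = wedge_integral b (pi / 3) (?A ?z) - wedge_integral b (pi / 3) (\<lambda>w. (ex x ?z / (2 * (?z + of_real \<eta>))) * (w ^ 0 * ex y w))"
    proof (rule wedge_diff)
      show "integrable lborel (\<lambda>s. ?A ?z (?b s))" by (rule inner_wedge_integrable) (use ra[of t] assms in auto)
      show "integrable lborel (\<lambda>s. (ex x ?z / (2 * (?z + of_real \<eta>))) * (?b s ^ 0 * ex y (?b s)))"
        by (intro integrable_mult_right integrable_power_ex)
    qed
    also have "wedge_integral b (pi / 3) (\<lambda>w. (ex x ?z / (2 * (?z + of_real \<eta>))) * (w ^ 0 * ex y w)) = (ex x ?z / (2 * (?z + of_real \<eta>))) * airy 0 y"
      unfolding wedge_mult airy_base ..
    finally show ?thesis by (simp add: mult_ac)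
  qed
  have c: "Re (of_real (- \<eta>)) < a" using assms by simp
  note L = wedge_laplace[OF power_ex_measurable integrable_power_ex _ c, of 0 x]
  have "KSU12 a b \<eta> x y = wedge_integral a (pi / 3) (\<lambda>z. wedge_integral b (pi / 3) (?A z) - (airy 0 y / 2) * ((z ^ 0 * ex x z) / (z - of_real (- \<eta>))))"
    unfolding KSU12_def double_airy_integral_def by (rule wedge_cong) (rule inner)
  also have "\<dots> = wedge_integral a (pi / 3) (\<lambda>z. wedge_integral b (pi / 3) (?A z)) - wedge_integral a (pi / 3) (\<lambda>z. (airy 0 y / 2) * ((z ^ 0 * ex x z) / (z - of_real (- \<eta>))))"
  proof (rule wedge_diff)
    show "integrable lborel (\<lambda>t. wedge_integral b (pi / 3) (?A (?a t)))" by (rule double_wedge_airy(2)) (use assms in simp)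
    show "integrable lborel (\<lambda>t. (airy 0 y / 2) * ((?a t ^ 0 * ex x (?a t)) / (?a t - of_real (- \<eta>))))"
      by (intro integrable_mult_right L(3)) (simp add: cos_60)
  qed
  also have "wedge_integral a (pi / 3) (\<lambda>z. wedge_integral b (pi / 3) (?A z)) = airy2 0 0 0 x y"
    by (rule double_wedge_airy(1)) (use assms in simp)
  also have "wedge_integral a (pi / 3) (\<lambda>z. (airy 0 y / 2) * ((z ^ 0 * ex x z) / (z - of_real (- \<eta>))))
      = (airy 0 y / 2) * (\<integral>l. indicator {0..} l *\<^sub>R (exp (of_real l * of_real (- \<eta>)) * lt a (pi / 3) (\<lambda>z. z ^ 0 * ex x z) l) \<partial>lborel)"
    unfolding wedge_mult by (subst L(1)) (simp_all add: cos_60)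
  also have "(\<integral>l. indicator {0..} l *\<^sub>R (exp (of_real l * of_real (- \<eta>)) * lt a (pi / 3) (\<lambda>z. z ^ 0 * ex x z) l) \<partial>lborel)
      = (\<integral>l. indicator {0..} l *\<^sub>R (exp (of_real l * of_real (- \<eta>)) * airy 0 (x + l)) \<partial>lborel)"
    by (rule Bochner_Integration.integral_cong[OF refl]) (auto simp: indicator_def lt_airy[of _ a 0, simplified])
  finally show ?thesis by (simp add: mult_ac)
qed

lemma KSU12_base:
  assumes "0 < \<eta>" "- \<eta> < a" "0 < a + b"
  shows "KSU12 a b \<eta> x y = KSU12 1 1 \<eta> x y"
  using KSU12_airy[OF assms(2,3)] KSU12_airy[of \<eta> 1 1] assms(1) by simp

text \<open>The numerator puts one power on \<open>z\<close> or on \<open>w\<close>, which produces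
  a Wronskian of Airy functions. The pole of \<open>z + w\<close> at \<open>2 * \<eta>\<close> turns
  into the growing weight \<open>exp (2 * \<eta> * l)\<close>.\<close>

lemma double_airy_22:
  assumes "\<eta> < a" "\<eta> < b"
  shows "double_airy_integral a b (\<lambda>z w. (z - w) / (z + w - 2 * of_real \<eta>)) x y = airy2 1 0 (2 * \<eta>) x y - airy2 0 1 (2 * \<eta>) x y"
proof -
  let ?a = "wpath a (pi / 3)" and ?b = "wpath b (pi / 3)"
  let ?A = "\<lambda>j k z w. (z ^ j * ex x z) * (w ^ k * ex y w) / (z + w - of_real (2 * \<eta>))"
  have ra: "a \<le> Re (?a t)" for t by (auto intro: Re_wpath_ge simp: cos_60)
  have ab: "2 * \<eta> < a + b" using assms by simp
  have inner: "wedge_integral b (pi / 3) (\<lambda>w. (?a t - w) / (?a t + w - 2 * of_real \<eta>) * airy_exp x y (?a t) w)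
      = wedge_integral b (pi / 3) (?A 1 0 (?a t)) - wedge_integral b (pi / 3) (?A 0 1 (?a t))" for t
  proof -
    have "(\<lambda>w. (?a t - w) / (?a t + w - 2 * of_real \<eta>) * airy_exp x y (?a t) w) = (\<lambda>w. ?A 1 0 (?a t) w - ?A 0 1 (?a t) w)"
    proof (rule ext)
      fix w
      have "(?a t - w) / D * (p * q) = (?a t * p) * q / D - p * (w * q) / D" for p q D :: complex
        unfolding times_divide_eq_left diff_divide_distrib[symmetric]
        by (rule arg_cong[of _ _ "\<lambda>n. n / D"]) (simp add: algebra_simps)
      then show "(?a t - w) / (?a t + w - 2 * of_real \<eta>) * airy_exp x y (?a t) w = ?A 1 0 (?a t) w - ?A 0 1 (?a t) w"
        by (simp only: airy_exp_eq power_0 power_one_right mult_1_left of_real_mult of_real_numeral)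
    qed
    then show ?thesis
      by (simp only:) (rule wedge_diff; rule inner_wedge_integrable; use ra[of t] ab in simp)
  qed
  have "double_airy_integral a b (\<lambda>z w. (z - w) / (z + w - 2 * of_real \<eta>)) x y
      = wedge_integral a (pi / 3) (\<lambda>z. wedge_integral b (pi / 3) (?A 1 0 z) - wedge_integral b (pi / 3) (?A 0 1 z))"
    unfolding double_airy_integral_def by (rule wedge_cong) (rule inner)
  also have "\<dots> = wedge_integral a (pi / 3) (\<lambda>z. wedge_integral b (pi / 3) (?A 1 0 z)) - wedge_integral a (pi / 3) (\<lambda>z. wedge_integral b (pi / 3) (?A 0 1 z))"
    by (rule wedge_diff; rule double_wedge_airy(2)[OF ab])
  also have "\<dots> = airy2 1 0 (2 * \<eta>) x y - airy2 0 1 (2 * \<eta>) x y"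
    unfolding double_wedge_airy(1)[OF ab] ..
  finally show ?thesis .
qed

lemma KSU22_eq:
  assumes "0 < \<eta>" "\<eta> < a" "\<eta> < b"
  shows "KSU22 a b \<eta> x y = airy2 1 0 (2 * \<eta>) x y - airy2 0 1 (2 * \<eta>) x y + of_real (Rk \<eta> x y)"
  unfolding KSU22_def double_airy_22[OF assms(2,3)] RSU22_eq[OF assms(1)] ..

text \<open>For fixed \<open>w\<close> the integral over all real \<open>l\<close> is the two-sided
  transform of \<open>airy j\<close> at \<open>2 * \<eta> - w\<close>. With \<open>w\<close> on the
  line at 1 and \<open>\<eta> > 1\<close>, this point has real part above 1, as
  \<open>airy_laplace\<close> demands.\<close>

lemma airy_cross:
  fixes \<eta> x y :: real and j k :: nat
  assumes \<eta>: "1 < \<eta>"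
  defines "F \<equiv> \<lambda>w. (w ^ k * ex y w) * ((2 * of_real \<eta> - w) ^ j * ex x (2 * of_real \<eta> - w))"
  shows "(\<integral>l. exp (of_real (l * (2 * \<eta>))) * airy j (x + l) * airy k (y + l) \<partial>lborel) = wedge_integral 1 (pi / 2) F"
    and "integrable lborel (\<lambda>l. exp (of_real (l * (2 * \<eta>))) * airy j (x + l) * airy k (y + l))"
    and "integrable lborel (\<lambda>t. F (wpath 1 (pi / 2) t))"
proof -
  let ?w = "wpath 1 (pi / 2)"
  define H where "H = (\<lambda>(t, l). (?w t ^ k * ex y (?w t)) * (exp ((2 * of_real \<eta> - ?w t) * of_real l) * airy j (x + l)))"
  have Hm: "H \<in> borel_measurable borel"
  proof -
    have "H \<in> borel_measurable (borel \<Otimes>\<^sub>M borel)" unfolding H_def by measurable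
    then show ?thesis by (simp add: borel_prod)
  qed
  have Hb: "cmod (H (t, l)) \<le> cmod (?w t ^ k * ex y (?w t)) * (exp ((2 * \<eta> - 1) * l) * cmod (airy j (x + l)))" for t l
    unfolding H_def prod.case norm_mult by (simp add: wpath_90)
  have i: "integrable lborel (\<lambda>t. cmod (?w t ^ k * ex y (?w t)))"
    by (intro integrable_norm integrable_power_ex_vertical) simp
  have v: "integrable lborel (\<lambda>l. exp ((2 * \<eta> - 1) * l) * cmod (airy j (x + l)))"
    by (rule airy_exp_integrable) (use \<eta> in simp)
  note fub = fubini_bounded[OF Hm i v Hb]
  have H_l: "(\<integral>l. H (t, l) \<partial>lborel) = F (?w t)" for t
  proof -
    define p where "p = 2 * of_real \<eta> - ?w t"
    have p: "1 < Re p" using \<eta> by (simp add: p_def wpath_90)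
    have "(\<integral>l. H (t, l) \<partial>lborel) = (?w t ^ k * ex y (?w t)) * (\<integral>l. exp (p * of_real l) * airy j (x + l) \<partial>lborel)"
      unfolding H_def prod.case p_def by simp
    also have "(\<integral>l. exp (p * of_real l) * airy j (x + l) \<partial>lborel) = (\<integral>l. exp (p * of_real (l - x)) * airy j l \<partial>lborel)"
      using lborel_integral_real_affine[of 1 "\<lambda>l. exp (p * of_real (l - x)) * airy j l" x] by simp
    also have "\<dots> = (\<integral>l. exp (- p * of_real x) * (exp (p * of_real l) * airy j l) \<partial>lborel)"
      by (rule Bochner_Integration.integral_cong[OF refl]) (simp add: algebra_simps exp_diff exp_minus field_simps)
    also have "\<dots> = exp (- p * of_real x) * (p ^ j * exp (p ^ 3 / 3))"
      unfolding airy_laplace[OF p, symmetric] by (rule integral_mult_right_zero)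
    also have "\<dots> = p ^ j * ex x p"
      unfolding ex_def mult.left_commute[of "exp (- p * of_real x)"] exp_add[symmetric] by (simp add: algebra_simps)
    finally show ?thesis by (simp add: F_def p_def)
  qed
  show Fi: "integrable lborel (\<lambda>t. F (?w t))" using fub(3) unfolding H_l .
  have wF: "wedge_integral 1 (pi / 2) F = (\<integral>t. F (?w t) \<partial>lborel) * (1 / (2 * of_real pi))"
    unfolding wedge_eq[OF Fi] wfac_90 by (rule integral_mult_left_zero)
  have H_t: "(\<integral>t. H (t, l) \<partial>lborel) * (1 / (2 * of_real pi)) = exp (of_real (l * (2 * \<eta>))) * airy j (x + l) * airy k (y + l)" for l
  proof -
    have "(\<integral>t. H (t, l) \<partial>lborel) = (\<integral>t. (exp (of_real (l * (2 * \<eta>))) * airy j (x + l)) * (?w t ^ k * ex (y + l) (?w t)) \<partial>lborel)"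
    proof (rule Bochner_Integration.integral_cong[OF refl])
      fix t
      have "exp ((2 * of_real \<eta> - w) * of_real l) = exp (of_real (l * (2 * \<eta>))) * exp (- of_real l * w)" for w :: complex
        unfolding exp_add[symmetric] by (rule arg_cong[of _ _ exp]) (simp add: algebra_simps)
      then show "H (t, l) = (exp (of_real (l * (2 * \<eta>))) * airy j (x + l)) * (?w t ^ k * ex (y + l) (?w t))"
        by (simp only: H_def prod.case ex_add mult_ac)
    qed
    also have "\<dots> = (exp (of_real (l * (2 * \<eta>))) * airy j (x + l)) * (\<integral>t. ?w t ^ k * ex (y + l) (?w t) \<partial>lborel)"
      by (rule integral_mult_right_zero)
    finally have 1: "(\<integral>t. H (t, l) \<partial>lborel) = (exp (of_real (l * (2 * \<eta>))) * airy j (x + l)) * (\<integral>t. ?w t ^ k * ex (y + l) (?w t) \<partial>lborel)" .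
    have 2: "(\<integral>t. ?w t ^ k * ex (y + l) (?w t) \<partial>lborel) * (1 / (2 * of_real pi)) = airy k (y + l)"
      using wedge_eq[OF integrable_power_ex_vertical[of 1 k "y + l"]] airy_vertical[of 1 k "y + l"] unfolding wfac_90 by simp
    show ?thesis unfolding 1 by (simp only: mult.assoc 2)
  qed
  have "(\<integral>l. exp (of_real (l * (2 * \<eta>))) * airy j (x + l) * airy k (y + l) \<partial>lborel) = (\<integral>l. (\<integral>t. H (t, l) \<partial>lborel) \<partial>lborel) * (1 / (2 * of_real pi))"
    unfolding H_t[symmetric] by (rule integral_mult_left_zero)
  also have "\<dots> = wedge_integral 1 (pi / 2) F"
    unfolding wF fub(2)[symmetric] H_l ..
  finally show "(\<integral>l. exp (of_real (l * (2 * \<eta>))) * airy j (x + l) * airy k (y + l) \<partial>lborel) = wedge_integral 1 (pi / 2) F" .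
  have "integrable lborel (\<lambda>l. (\<integral>t. H (t, l) \<partial>lborel) * (1 / (2 * of_real pi)))"
    using fub(4) by (rule integrable_mult_left)
  then show "integrable lborel (\<lambda>l. exp (of_real (l * (2 * \<eta>))) * airy j (x + l) * airy k (y + l))"
    unfolding H_t .
qed

text \<open>The full integral of the Wronskian cancels the Gaussian part of the kernel; on the half line
  that remains, the exponential factor is integrable against the growth of the Airy functions.\<close>

lemma KSU22_bound:
  "\<exists>C>0. \<forall>\<eta>\<ge>2. \<forall>a>\<eta>. \<forall>b>\<eta>. \<forall>x y. cmod (KSU22 a b \<eta> x y) \<le> C / \<eta> * exp (- x) * exp (- y)"
proof -
  obtain C0 where C0: "0 < C0" "\<And>x. cmod (airy 0 x) \<le> C0 * exp (- 1 * x)" using airy_bound[of 1 0] by auto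
  obtain C1 where C1: "0 < C1" "\<And>x. cmod (airy 1 x) \<le> C1 * exp (- 1 * x)" using airy_bound[of 1 1] by auto
  have "cmod (KSU22 a b \<eta> x y) \<le> (2 * C0 * C1) / \<eta> * exp (- x) * exp (- y)"
    if \<eta>: "2 \<le> \<eta>" and ab: "\<eta> < a" "\<eta> < b" for \<eta> a b x y
  proof -
    let ?e = "\<lambda>l. exp (complex_of_real (l * (2 * \<eta>)))"
    define w where "w l = ?e l * airy 1 (x + l) * airy 0 (y + l) - ?e l * airy 0 (x + l) * airy 1 (y + l)" for l
    have \<eta>1: "1 < \<eta>" using \<eta> by simp
    note c10 = airy_cross[OF \<eta>1, where j = 1 and k = 0 and x = x and y = y]
    note c01 = airy_cross[OF \<eta>1, where j = 0 and k = 1 and x = x and y = y]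
    have wint: "integrable lborel w" unfolding w_def using c10(2) c01(2) by (intro Bochner_Integration.integrable_diff)
    let ?c = "exp (complex_of_real (2 * \<eta> ^ 3 / 3 - (x + y) * \<eta>))"
    have "(\<integral>l. w l \<partial>lborel) = wedge_integral 1 (pi / 2) (\<lambda>w. (w ^ 0 * ex y w) * ((2 * of_real \<eta> - w) ^ 1 * ex x (2 * of_real \<eta> - w)))
        - wedge_integral 1 (pi / 2) (\<lambda>w. (w ^ 1 * ex y w) * ((2 * of_real \<eta> - w) ^ 0 * ex x (2 * of_real \<eta> - w)))"
      unfolding w_def c10(1)[symmetric] c01(1)[symmetric] by (rule Bochner_Integration.integral_diff[OF c10(2) c01(2)])
    also have "\<dots> = wedge_integral 1 (pi / 2) (\<lambda>w. (w ^ 0 * ex y w) * ((2 * of_real \<eta> - w) ^ 1 * ex x (2 * of_real \<eta> - w))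
        - (w ^ 1 * ex y w) * ((2 * of_real \<eta> - w) ^ 0 * ex x (2 * of_real \<eta> - w)))"
      by (rule wedge_diff[symmetric, OF c10(3) c01(3)])
    \<comment> \<open>Writing \<open>w = \<eta> + v\<close> makes the cubes of \<open>v\<close>
      cancel: the product of the two exponentials is Gaussian in \<open>v\<close>, and the two
      numerators differ by \<open>- 2 * v\<close>.\<close>
    also have "\<dots> = (\<integral>t. ((- 2 * ?c) * (wpath (1 - \<eta>) (pi / 2) t * gs \<eta> (of_real (y - x)) (wpath (1 - \<eta>) (pi / 2) t))) * wfac (pi / 2) t \<partial>lborel)"
    proof (subst wedge_eq[OF Bochner_Integration.integrable_diff[OF c10(3) c01(3)]], rule Bochner_Integration.integral_cong[OF refl])
      fix t
      define v where "v = wpath (1 - \<eta>) (pi / 2) t"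
      have w: "wpath 1 (pi / 2) t = of_real \<eta> + v" by (simp add: v_def wpath_90 complex_eq_iff)
      have "(of_real \<eta> + v) ^ 3 / 3 - of_real y * (of_real \<eta> + v) + ((of_real \<eta> - v) ^ 3 / 3 - of_real x * (of_real \<eta> - v))
          = of_real (2 * \<eta> ^ 3 / 3 - (x + y) * \<eta>) + (2 * of_real \<eta> * v\<^sup>2 - of_real (y - x) * v)"
        by (simp add: power3_eq_cube power2_eq_square field_simps)
      then have e: "ex y (of_real \<eta> + v) * ex x (of_real \<eta> - v) = ?c * gs \<eta> (of_real (y - x)) v"
        unfolding ex_def gs_def exp_add[symmetric] by (simp only:)
      have m: "2 * of_real \<eta> - (of_real \<eta> + v) = of_real \<eta> - v" by simp
      have "(of_real \<eta> + v) ^ 0 * ex y (of_real \<eta> + v) * ((of_real \<eta> - v) ^ 1 * ex x (of_real \<eta> - v))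
          - (of_real \<eta> + v) ^ 1 * ex y (of_real \<eta> + v) * ((of_real \<eta> - v) ^ 0 * ex x (of_real \<eta> - v))
          = (- 2 * v) * (ex y (of_real \<eta> + v) * ex x (of_real \<eta> - v))"
        by (simp add: algebra_simps)
      then show "(wpath 1 (pi / 2) t ^ 0 * ex y (wpath 1 (pi / 2) t) * ((2 * of_real \<eta> - wpath 1 (pi / 2) t) ^ 1 * ex x (2 * of_real \<eta> - wpath 1 (pi / 2) t))
          - wpath 1 (pi / 2) t ^ 1 * ex y (wpath 1 (pi / 2) t) * ((2 * of_real \<eta> - wpath 1 (pi / 2) t) ^ 0 * ex x (2 * of_real \<eta> - wpath 1 (pi / 2) t))) * wfac (pi / 2) t
          = ((- 2 * ?c) * (wpath (1 - \<eta>) (pi / 2) t * gs \<eta> (of_real (y - x)) (wpath (1 - \<eta>) (pi / 2) t))) * wfac (pi / 2) t"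
        unfolding w m v_def[symmetric] e by (simp add: mult_ac)
    qed
    also have "\<dots> = wedge_integral (1 - \<eta>) (pi / 2) (\<lambda>v. (- 2 * ?c) * (v * gs \<eta> (of_real (y - x)) v))"
    proof (rule wedge_eq[symmetric])
      show "integrable lborel (\<lambda>t. (- 2 * ?c) * (wpath (1 - \<eta>) (pi / 2) t * gs \<eta> (of_real (y - x)) (wpath (1 - \<eta>) (pi / 2) t)))"
        using integrable_power_gs_90[of \<eta> "1 - \<eta>" 1 "of_real (y - x)"] \<eta> by (intro integrable_mult_right) simp
    qed
    also have "\<dots> = (- 2 * ?c) * (of_real (y - x) / (4 * of_real \<eta>) * gk \<eta> (of_real (y - x)))"
      unfolding wedge_mult using gauss_wedge_moment[of \<eta> "1 - \<eta>" "pi / 2"] \<eta> by simp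
    also have "\<dots> = - of_real (Rk \<eta> x y)"
    proof -
      have "(y - x)\<^sup>2 = (x - y)\<^sup>2" by (rule power2_commute)
      then show ?thesis
        unfolding gk_of_real exp_of_real Rk_def using \<eta>
        by (simp only: of_real_mult of_real_divide of_real_minus of_real_diff of_real_numeral) (simp add: field_simps)
    qed
    finally have full: "(\<integral>l. w l \<partial>lborel) = - of_real (Rk \<eta> x y)" .
    have i0: "integrable lborel (\<lambda>l. indicator {0..} l *\<^sub>R w l)" "integrable lborel (\<lambda>l. indicator {..<0} l *\<^sub>R w l)"
      using wint by (auto intro!: integrable_mult_indicator)
    have ih: "integrable lborel (\<lambda>l. indicator {0..} l *\<^sub>R (?e l * airy j (x + l) * airy k (y + l)))" for j k
      using airy_cross(2)[OF \<eta>1, of j x k y] by (intro integrable_mult_indicator) auto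
    have half: "airy2 1 0 (2 * \<eta>) x y - airy2 0 1 (2 * \<eta>) x y = (\<integral>l. indicator {0..} l *\<^sub>R w l \<partial>lborel)"
      unfolding airy2_def w_def scaleR_diff_right by (rule Bochner_Integration.integral_diff[symmetric, OF ih ih])
    have "(\<integral>l. w l \<partial>lborel) = (\<integral>l. indicator {0..} l *\<^sub>R w l + indicator {..<0} l *\<^sub>R w l \<partial>lborel)"
      by (rule Bochner_Integration.integral_cong) (auto simp: indicator_def)
    also have "\<dots> = (\<integral>l. indicator {0..} l *\<^sub>R w l \<partial>lborel) + (\<integral>l. indicator {..<0} l *\<^sub>R w l \<partial>lborel)"
      by (rule Bochner_Integration.integral_add[OF i0])
    finally have dec: "- of_real (Rk \<eta> x y) = (\<integral>l. indicator {0..} l *\<^sub>R w l \<partial>lborel) + (\<integral>l. indicator {..<0} l *\<^sub>R w l \<partial>lborel)"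
      unfolding full .
    have R: "complex_of_real (Rk \<eta> x y) = - ((\<integral>l. indicator {0..} l *\<^sub>R w l \<partial>lborel) + (\<integral>l. indicator {..<0} l *\<^sub>R w l \<partial>lborel))"
      unfolding dec[symmetric] by simp
    have \<eta>0: "0 < \<eta>" using \<eta> by simp
    \<comment> \<open>The contour part of the entry is the integral over \<open>l \<ge> 0\<close>,
      and R is minus the full integral; their sum is minus the integral over
      \<open>l < 0\<close>.\<close>
    have K: "KSU22 a b \<eta> x y = - (\<integral>l. indicator {..<0} l *\<^sub>R w l \<partial>lborel)"
      unfolding KSU22_eq[OF \<eta>0 ab] half R by simp
    \<comment> \<open>The rate \<open>?s\<close> is \<open>2 * \<eta>\<close> from the weight, less
      1 for each of the two Airy factors bounded at rate 1. It is at least \<eta> when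
      \<open>\<eta> \<ge> 2\<close>, which gives the factor \<open>1 / \<eta>\<close>.\<close>
    let ?D = "2 * C0 * C1 * exp (- x) * exp (- y)" and ?s = "2 * \<eta> - 2"
    have s: "0 < ?s" using \<eta> by simp
    have wb: "cmod (w l) \<le> ?D * exp (?s * l)" for l
    proof -
      have e: "cmod (?e l) = exp (2 * \<eta> * l)" by (simp add: mult.commute)
      have "cmod (w l) \<le> cmod (?e l * airy 1 (x + l) * airy 0 (y + l)) + cmod (?e l * airy 0 (x + l) * airy 1 (y + l))"
        unfolding w_def by (rule norm_triangle_ineq4)
      also have "\<dots> \<le> exp (2 * \<eta> * l) * (C1 * exp (- 1 * (x + l))) * (C0 * exp (- 1 * (y + l))) + exp (2 * \<eta> * l) * (C0 * exp (- 1 * (x + l))) * (C1 * exp (- 1 * (y + l)))"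
        unfolding norm_mult e using C0(1) C1(1) by (intro add_mono mult_mono C0(2) C1(2)) auto
      also have "\<dots> = ?D * exp (?s * l)"
        by (simp add: algebra_simps flip: exp_add)
      finally show ?thesis .
    qed
    have i1: "integrable lborel (\<lambda>l. indicator {0..} l * exp (- l * ?s))" by (rule integrable_exp_tail_weight[OF s])
    have v1: "(\<integral>l. indicator {0..} l * exp (- l * ?s) \<partial>lborel) = 1 / ?s"
    proof -
      have "complex_of_real (\<integral>l. indicator {0..} l * exp (- l * ?s) \<partial>lborel) = (\<integral>l. indicator {0..} l *\<^sub>R exp (- of_real l * of_real ?s) \<partial>lborel)"
        unfolding integral_complex_of_real[symmetric]
      proof (rule Bochner_Integration.integral_cong[OF refl])
        fix l
        have "exp (- of_real l * of_real ?s) = complex_of_real (exp (- l * ?s))"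
          by (simp only: exp_of_real[symmetric] of_real_mult of_real_minus)
        then show "complex_of_real (indicator {0..} l * exp (- l * ?s)) = indicator {0..} l *\<^sub>R exp (- of_real l * of_real ?s)"
          by (simp only: scaleR_conv_of_real of_real_mult)
      qed
      also have "\<dots> = 1 / of_real ?s" by (rule integral_exp_minus_complex(2)) (use s in simp)
      finally show ?thesis by (metis of_real_1 of_real_divide of_real_eq_iff)
    qed
    have i2: "integrable lborel (\<lambda>l. ?D * (indicator {0..} (0 + (- 1) * l) * exp (- (0 + (- 1) * l) * ?s)))"
      by (intro integrable_mult_right lborel_integrable_real_affine[OF i1]) simp
    have "cmod (\<integral>l. indicator {..<0} l *\<^sub>R w l \<partial>lborel) \<le> (\<integral>l. ?D * (indicator {0..} (0 + (- 1) * l) * exp (- (0 + (- 1) * l) * ?s)) \<partial>lborel)"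
    proof (rule order.trans[OF integral_norm_bound], rule integral_mono[OF integrable_norm[OF i0(2)] i2])
      fix l
      show "norm (indicator {..<0} l *\<^sub>R w l) \<le> ?D * (indicator {0..} (0 + (- 1) * l) * exp (- (0 + (- 1) * l) * ?s))"
        using wb[of l] C0(1) C1(1) by (cases "l < 0") (auto simp: mult.commute)
    qed
    also have "\<dots> = ?D * (1 / ?s)"
      using lborel_integral_real_affine[of "- 1" "\<lambda>l. indicator {0..} l * exp (- l * ?s)" 0] v1 by simp
    also have "\<dots> \<le> ?D * (1 / \<eta>)"
      using \<eta> C0(1) C1(1) by (intro mult_left_mono divide_left_mono) auto
    finally show ?thesis unfolding K by (simp add: mult_ac)
  qed
  then show ?thesis using C0(1) C1(1) by (intro exI[of _ "2 * C0 * C1"]) auto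
qed

section \<open>Bounds for the kernel functions on the fixed contour\<close>

lemma cis_120: "cis (2 * pi / 3) = - cis (- (pi / 3))" "cis (- (2 * pi / 3)) = - cis (pi / 3)"
  by (simp_all add: complex_eq_iff cos_120 sin_120 cos_60 sin_60)

text \<open>The map from \<open>z\<close> to \<open>- z\<close> exchanges the upper and the lower
  ray and changes the sign of dz; the two effects on the orientation compensate.\<close>

lemma wedge_reflect_120: "wedge_integral (- 1) (2 * pi / 3) f = wedge_integral 1 (pi / 3) (\<lambda>z. f (- z))"
proof -
  have e: "of_real (- 1) + of_real t * cis (2 * pi / 3) = - (of_real 1 + of_real t * cis (- (pi / 3)))"
    "of_real (- 1) + of_real t * cis (- (2 * pi / 3)) = - (of_real 1 + of_real t * cis (pi / 3))" for t
    unfolding cis_120 by simp_all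
  show ?thesis unfolding wedge_integral_def e unfolding cis_120 set_lebesgue_integral_def by simp
qed

definition k11 :: "real \<Rightarrow> complex \<Rightarrow> complex \<Rightarrow> complex" where
  "k11 \<eta> z w = (z - w) / (4 * (z + of_real \<eta>) * (w + of_real \<eta>) * (z + w + 2 * of_real \<eta>))"

definition k12 :: "real \<Rightarrow> complex \<Rightarrow> complex \<Rightarrow> complex" where
  "k12 \<eta> z w = (z - w + 2 * of_real \<eta>) / (2 * (z + of_real \<eta>) * (z + w))"

definition k22 :: "real \<Rightarrow> complex \<Rightarrow> complex \<Rightarrow> complex" where
  "k22 \<eta> z w = (z - w) / (z + w - 2 * of_real \<eta>)"

lemma cboundI:
  assumes "case_prod \<kappa> \<in> borel_measurable (borel \<Otimes>\<^sub>M borel)"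
    and "\<And>z w. 1 \<le> Re z \<Longrightarrow> 1 \<le> Re w \<Longrightarrow> cmod (\<kappa> z w) \<le> cmod z + cmod w"
  shows "cbound 2 \<kappa>"
  unfolding cbound_def
proof (intro conjI allI assms(1))
  fix t s
  have "cmod (\<kappa> (cpath t) (cpath s)) \<le> cmod (cpath t) + cmod (cpath s)" by (intro assms(2) cpath_bounds)
  also have "\<dots> \<le> (1 + \<bar>t\<bar>) + (1 + \<bar>s\<bar>)" by (intro add_mono cpath_bounds)
  also have "\<dots> \<le> 2 * (1 + \<bar>t\<bar>) * (1 + \<bar>s\<bar>)" by (simp add: algebra_simps)
  finally show "cmod (\<kappa> (cpath t) (cpath s)) \<le> 2 * (1 + \<bar>t\<bar>) * (1 + \<bar>s\<bar>)" .
qed simp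

lemma Re_ge_norm: "a \<le> Re z \<Longrightarrow> a \<le> cmod z"
  using complex_Re_le_cmod[of z] by linarith

text \<open>The difference in the numerator is resolved as
  \<open>1 / (w + \<eta>) - 1 / (z + \<eta>)\<close>, which is bounded; the remaining denominator
  \<open>z + w + 2 * \<eta>\<close> supplies the decay used for large \<eta>.\<close>

lemma norm_k11: "0 \<le> \<eta> \<Longrightarrow> 1 \<le> Re z \<Longrightarrow> 1 \<le> Re w \<Longrightarrow> cmod (k11 \<eta> z w) \<le> 1 / (2 + 2 * \<eta>)"
proof -
  assume h: "0 \<le> \<eta>" "1 \<le> Re z" "1 \<le> Re w"
  have n: "1 + \<eta> \<le> cmod (z + of_real \<eta>)" "1 + \<eta> \<le> cmod (w + of_real \<eta>)" "2 + 2 * \<eta> \<le> cmod (z + w + 2 * of_real \<eta>)"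
    using h by (auto intro!: Re_ge_norm)
  then have nz: "z + of_real \<eta> \<noteq> 0" "w + of_real \<eta> \<noteq> 0" "z + w + 2 * of_real \<eta> \<noteq> 0" using h by auto
  have "(z - w) / ((z + of_real \<eta>) * (w + of_real \<eta>)) = 1 / (w + of_real \<eta>) - 1 / (z + of_real \<eta>)"
    using nz by (simp add: field_simps)
  moreover have "k11 \<eta> z w = ((z - w) / ((z + of_real \<eta>) * (w + of_real \<eta>))) / (4 * (z + w + 2 * of_real \<eta>))"
    by (simp only: k11_def divide_divide_eq_left mult_ac)
  ultimately have "k11 \<eta> z w = (1 / (w + of_real \<eta>) - 1 / (z + of_real \<eta>)) / (4 * (z + w + 2 * of_real \<eta>))"
    by (simp only:)
  also have "cmod \<dots> = cmod (1 / (w + of_real \<eta>) - 1 / (z + of_real \<eta>)) / (4 * cmod (z + w + 2 * of_real \<eta>))"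
    unfolding norm_divide norm_mult by simp
  also have "\<dots> \<le> 2 / (4 * (2 + 2 * \<eta>))"
  proof (intro frac_le)
    have "1 / cmod (w + of_real \<eta>) \<le> 1" "1 / cmod (z + of_real \<eta>) \<le> 1" using n h by (auto simp: divide_le_eq)
    then show "cmod (1 / (w + of_real \<eta>) - 1 / (z + of_real \<eta>)) \<le> 2"
      using norm_triangle_ineq4[of "1 / (w + of_real \<eta>)" "1 / (z + of_real \<eta>)"] by (simp add: norm_divide)
  qed (use n h in auto)
  also have "\<dots> \<le> 1 / (2 + 2 * \<eta>)" using h by (simp add: field_simps)
  finally show ?thesis .
qed

lemma k12_split:
  assumes "0 \<le> \<eta>" "1 \<le> Re z" "1 \<le> Re w"
  shows "k12 \<eta> z w = 1 / (z + w) - 1 / (2 * (z + of_real \<eta>))"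
proof -
  have "Re (z + of_real \<eta>) \<noteq> 0" "Re (z + w) \<noteq> 0" using assms by auto
  then have "z + of_real \<eta> \<noteq> 0" "z + w \<noteq> 0" by (metis zero_complex.sel(1))+
  then show ?thesis unfolding k12_def by (rule partial_fractions_12)
qed

lemma cbound_k11: "0 \<le> \<eta> \<Longrightarrow> cbound 2 (k11 \<eta>)"
proof (rule cboundI)
  show "case_prod (k11 \<eta>) \<in> borel_measurable (borel \<Otimes>\<^sub>M borel)" unfolding k11_def by measurable
  fix z w :: complex assume h: "0 \<le> \<eta>" "1 \<le> Re z" "1 \<le> Re w"
  have "cmod (k11 \<eta> z w) \<le> 1 / (2 + 2 * \<eta>)" by (rule norm_k11[OF h])
  also have "\<dots> \<le> 1" using h by (simp add: divide_le_eq)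
  also have "\<dots> \<le> cmod z + cmod w" using Re_ge_norm[OF h(2)] Re_ge_norm[OF h(3)] by linarith
  finally show "cmod (k11 \<eta> z w) \<le> cmod z + cmod w" .
qed

lemma cbound_k12: "0 \<le> \<eta> \<Longrightarrow> cbound 2 (k12 \<eta>)"
proof (rule cboundI)
  show "case_prod (k12 \<eta>) \<in> borel_measurable (borel \<Otimes>\<^sub>M borel)" unfolding k12_def by measurable
  fix z w :: complex assume h: "0 \<le> \<eta>" "1 \<le> Re z" "1 \<le> Re w"
  have n: "2 \<le> cmod (z + w)" "1 \<le> cmod (z + of_real \<eta>)" using h by (auto intro!: Re_ge_norm)
  have "cmod (k12 \<eta> z w) \<le> cmod (1 / (z + w)) + cmod (1 / (2 * (z + of_real \<eta>)))"
    unfolding k12_split[OF h] by (rule norm_triangle_ineq4)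
  also have "\<dots> = 1 / cmod (z + w) + 1 / (2 * cmod (z + of_real \<eta>))" unfolding norm_divide norm_mult by simp
  also have "\<dots> \<le> 1 / 2 + 1 / (2 * 1)" using n by (intro add_mono divide_left_mono mult_left_mono) auto
  also have "\<dots> \<le> cmod z + cmod w" using Re_ge_norm[OF h(2)] Re_ge_norm[OF h(3)] by linarith
  finally show "cmod (k12 \<eta> z w) \<le> cmod z + cmod w" .
qed

text \<open>On the fixed contour \<open>z + w\<close> has real part at least 2, so
  \<open>\<eta> \<le> 1 / 2\<close> keeps the denominator at distance 1 from 0.\<close>

lemma cbound_k22: "\<eta> \<le> 1 / 2 \<Longrightarrow> cbound 2 (k22 \<eta>)"
proof (rule cboundI)
  show "case_prod (k22 \<eta>) \<in> borel_measurable (borel \<Otimes>\<^sub>M borel)" unfolding k22_def by measurable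
  fix z w :: complex assume h: "\<eta> \<le> 1 / 2" "1 \<le> Re z" "1 \<le> Re w"
  have n: "1 \<le> cmod (z + w - 2 * of_real \<eta>)" using h by (auto intro!: Re_ge_norm)
  have "cmod (k22 \<eta> z w) = cmod (z - w) / cmod (z + w - 2 * of_real \<eta>)" by (simp add: k22_def norm_divide)
  also have "\<dots> \<le> cmod (z - w) / 1" using n by (intro divide_left_mono) auto
  also have "\<dots> \<le> cmod z + cmod w" using norm_triangle_ineq4[of z w] by simp
  finally show "cmod (k22 \<eta> z w) \<le> cmod z + cmod w" .
qed

lemma cbound_Ai: "cbound 2 (\<lambda>z w. 1 / (z + w))"
proof (rule cboundI)
  show "case_prod (\<lambda>z w. 1 / (z + w) :: complex) \<in> borel_measurable (borel \<Otimes>\<^sub>M borel)" by measurable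
  fix z w :: complex assume h: "1 \<le> Re z" "1 \<le> Re w"
  have n: "2 \<le> cmod (z + w)" using h by (auto intro!: Re_ge_norm)
  have "cmod (1 / (z + w)) = 1 / cmod (z + w)" by (simp add: norm_divide)
  also have "\<dots> \<le> 1 / 2" using n by (intro divide_left_mono) auto
  also have "\<dots> \<le> cmod z + cmod w" using Re_ge_norm[OF h(1)] Re_ge_norm[OF h(2)] by linarith
  finally show "cmod (1 / (z + w)) \<le> cmod z + cmod w" .
qed

lemma KSU11_dbl: "0 \<le> \<eta> \<Longrightarrow> KSU11 \<eta> x y = dbl (k11 \<eta>) (ex x) (ex y)"
  unfolding KSU11_def using double_airy_eq_dbl[OF cbound_k11, of \<eta> x y] unfolding k11_def by simp

lemma KSU12_dbl: "0 < \<eta> \<Longrightarrow> - \<eta> < a \<Longrightarrow> 0 < a + b \<Longrightarrow> KSU12 a b \<eta> x y = dbl (k12 \<eta>) (ex x) (ex y)"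
  using double_airy_eq_dbl[OF cbound_k12, of \<eta> x y] KSU12_base[of \<eta> a b x y]
  unfolding KSU12_def k12_def by simp

lemma KSU22_dbl:
  assumes "0 < \<eta>" "\<eta> \<le> 1 / 2" "\<eta> < a" "\<eta> < b"
  shows "KSU22 a b \<eta> x y = dbl (k22 \<eta>) (ex x) (ex y) + of_real (Rk \<eta> x y)"
proof -
  have "double_airy_integral a b (k22 \<eta>) x y = double_airy_integral 1 1 (k22 \<eta>) x y"
    unfolding k22_def using double_airy_22[OF assms(3,4)] double_airy_22[of \<eta> 1 1] assms by simp
  then show ?thesis
    using double_airy_eq_dbl[OF cbound_k22, of \<eta> x y] assms unfolding KSU22_def RSU22_eq[OF assms(1)] k22_def by simp
qed

text \<open>Reflecting the contour of \<open>w\<close> turns \<open>1 / (z - w)\<close> into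
  \<open>1 / (z + w)\<close> and the quotient of exponentials into a product. The variables come out
  in reverse order, which the symmetry of \<open>1 / (z + w)\<close> repairs.\<close>

lemma K_Ai_dbl: "K_Ai u v = dbl (\<lambda>z w. 1 / (z + w)) (ex u) (ex v)"
proof -
  have "K_Ai u v = double_airy_integral 1 1 (\<lambda>w z. 1 / (z + w)) v u"
  proof -
    have e: "exp (z ^ 3 / 3 - z * of_real u) / exp ((- w) ^ 3 / 3 - (- w) * of_real v) * (1 / (z - (- w)))
        = 1 / (z + w) * exp (w ^ 3 / 3 + z ^ 3 / 3 - of_real v * w - of_real u * z)" for z w :: complex
    proof -
      have "z ^ 3 / 3 - z * of_real u - ((- w) ^ 3 / 3 - (- w) * of_real v) = w ^ 3 / 3 + z ^ 3 / 3 - of_real v * w - of_real u * z"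
        by (simp add: power3_eq_cube)
      then show ?thesis unfolding exp_diff[symmetric] diff_minus_eq_add by (simp only: mult.commute)
    qed
    show ?thesis
      unfolding K_Ai_def wedge_reflect_120 double_airy_integral_def airy_exp_def e ..
  qed
  also have "(\<lambda>w z. 1 / (z + w)) = (\<lambda>z w. 1 / (z + w :: complex))" by (simp add: add.commute)
  also have "double_airy_integral 1 1 (\<lambda>z w. 1 / (z + w)) v u = dbl (\<lambda>z w. 1 / (z + w)) (ex v) (ex u)"
    by (rule double_airy_eq_dbl[OF cbound_Ai])
  also have "\<dots> = dbl (\<lambda>z w. 1 / (z + w)) (ex u) (ex v)"
    by (subst dbl_swap) (simp add: add.commute)
  finally show ?thesis .
qed

section \<open>The limit of the degenerate rows\<close>

text \<open>The convolution concerns only the factor \<open>ex y z\<close>, so it can be performed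
  inside the double integral for each \<open>z\<close> separately. The subtracted
  \<open>ex s z\<close> keeps the result bounded when \<open>s\<close> approaches
  \<open>x\<close>.\<close>

definition Ew :: "real \<Rightarrow> real \<Rightarrow> real \<Rightarrow> complex \<Rightarrow> complex" where
  "Ew \<eta> x s z = (\<integral>y. indicator {x<..} y *\<^sub>R (of_real (Rk \<eta> s y / 2) * (ex y z - ex s z)) \<partial>lborel)"

text \<open>The integrand of \<open>Ew (q\<^sup>2) x s\<close> after the substitution \<open>y = s + q u\<close>.\<close>

definition gE :: "real \<Rightarrow> real \<Rightarrow> real \<Rightarrow> complex \<Rightarrow> real \<Rightarrow> complex" where
  "gE q x s z u = indicator {x<..} (s + q * u) *\<^sub>R (of_real (u / (4 * q) * normal_density 0 2 u * exp (2 * q ^ 6 / 3 - (2 * s + q * u) * q\<^sup>2))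
     * (ex (s + q * u) z - ex s z))"

lemma Ew_measurable: "(\<lambda>p. Ew \<eta> x (fst p) (snd p)) \<in> borel_measurable (borel \<Otimes>\<^sub>M borel)"
  unfolding Ew_def ex_def Rk_def by measurable

lemma Ew_measurable' [measurable]: "Ew \<eta> x s \<in> borel_measurable borel"
  unfolding Ew_def ex_def Rk_def by measurable

text \<open>Mean value inequality for \<open>exp\<close> on a half plane. The factor
  \<open>\<bar>y - s\<bar>\<close> is the gain that offsets the singularity of R.\<close>

lemma norm_ex_diff:
  assumes "x < s" "x < y" "1 \<le> Re z"
  shows "cmod (ex y z - ex s z) \<le> \<bar>y - s\<bar> * cmod z * (exp \<bar>y - s\<bar> * exp (x - s) * cmod (ex x z))"
proof -
  \<comment> \<open>Both exponents have real part at most \<open>- m\<close>, because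
    \<open>Re z \<ge> 1\<close> and both points lie to the right of \<open>x\<close>.\<close>
  define m where "m = min (y - x) (s - x)"
  let ?S = "{\<zeta>. Re \<zeta> \<le> - m}"
  have e: "ex u z = ex x z * exp (- of_real (u - x) * z)" for u using ex_add[of x "u - x" z] by simp
  have S: "- of_real (u - x) * z \<in> ?S" if "m \<le> u - x" "x < u" for u
  proof -
    have "(u - x) * 1 \<le> (u - x) * Re z" using that assms(3) by (intro mult_left_mono) auto
    then show ?thesis using that(1) by (simp add: left_diff_distrib)
  qed
  have "norm (exp (- of_real (y - x) * z) - exp (- of_real (s - x) * z))
      \<le> exp (- m) * norm (- of_real (y - x) * z - (- of_real (s - x) * z))"
  proof (rule field_differentiable_bound[where S = ?S and f' = exp])
    show "convex ?S" by (rule convex_halfspace_Re_le)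
    show "(exp has_field_derivative exp \<zeta>) (at \<zeta> within ?S)" for \<zeta> :: complex
      by (rule has_field_derivative_at_within[OF DERIV_exp])
    show "norm (exp \<zeta>) \<le> exp (- m)" if "\<zeta> \<in> ?S" for \<zeta> using that by simp
    show "- of_real (y - x) * z \<in> ?S" by (rule S) (use assms in \<open>auto simp: m_def\<close>)
    show "- of_real (s - x) * z \<in> ?S" by (rule S) (use assms in \<open>auto simp: m_def\<close>)
  qed
  also have "- of_real (y - x) * z - (- of_real (s - x) * z) = of_real (s - y) * z" by (simp add: algebra_simps)
  also have "norm (of_real (s - y) * z) = \<bar>y - s\<bar> * cmod z" unfolding norm_mult norm_of_real by (simp add: abs_minus_commute)
  also have "exp (- m) * (\<bar>y - s\<bar> * cmod z) \<le> (exp \<bar>y - s\<bar> * exp (x - s)) * (\<bar>y - s\<bar> * cmod z)"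
  proof (rule mult_right_mono)
    have "- m \<le> \<bar>y - s\<bar> + (x - s)" by (auto simp: m_def min_def abs_if)
    then show "exp (- m) \<le> exp \<bar>y - s\<bar> * exp (x - s)" unfolding exp_add[symmetric] by simp
  qed simp
  finally have le: "norm (exp (- of_real (y - x) * z) - exp (- of_real (s - x) * z))
      \<le> (exp \<bar>y - s\<bar> * exp (x - s)) * (\<bar>y - s\<bar> * cmod z)" .
  have "cmod (ex y z - ex s z) = cmod (ex x z) * norm (exp (- of_real (y - x) * z) - exp (- of_real (s - x) * z))"
    unfolding e[of y] e[of s] right_diff_distrib[symmetric] norm_mult ..
  also have "\<dots> \<le> cmod (ex x z) * ((exp \<bar>y - s\<bar> * exp (x - s)) * (\<bar>y - s\<bar> * cmod z))"
    by (rule mult_left_mono[OF le norm_ge_zero])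
  finally show ?thesis by (simp only: mult_ac)
qed

lemma normal_density_2: "normal_density 0 2 u = exp (- u\<^sup>2 / 8) / sqrt (8 * pi)"
proof -
  have "2 * pi * 2\<^sup>2 = 8 * pi" "2 * 2\<^sup>2 = (8 :: real)" by simp_all
  then show ?thesis unfolding normal_density_def by simp
qed

lemma Ew_subst:
  assumes q: "0 < q"
  shows "Ew (q\<^sup>2) x s z = (\<integral>u. gE q x s z u \<partial>lborel)"
proof -
  have r: "q * (Rk (q\<^sup>2) s (s + q * u) / 2) = u / (4 * q) * normal_density 0 2 u * exp (2 * q ^ 6 / 3 - (2 * s + q * u) * q\<^sup>2)" for u
  proof -
    have 1: "sqrt (8 * pi * q\<^sup>2) = sqrt (8 * pi) * q" using q by (simp add: real_sqrt_mult)
    have 2: "- (s - (s + q * u))\<^sup>2 / (8 * q\<^sup>2) = - u\<^sup>2 / 8" using q by (simp add: power_mult_distrib)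
    have 3: "2 * (q\<^sup>2) ^ 3 / 3 - (s + (s + q * u)) * q\<^sup>2 = 2 * q ^ 6 / 3 - (2 * s + q * u) * q\<^sup>2"
      by (simp add: power_mult[symmetric])
    have 4: "q * (- (s - (s + q * u)) / (2 * q\<^sup>2) * (a / (b * q)) * c / 2) = u / (4 * q) * (a / b) * c" for a b c
      using q by (simp add: power2_eq_square mult_ac)
    show ?thesis unfolding Rk_def 1 2 3 normal_density_2 by (rule 4)
  qed
  have "Ew (q\<^sup>2) x s z = \<bar>q\<bar> *\<^sub>R (\<integral>u. indicator {x<..} (s + q * u) *\<^sub>R (of_real (Rk (q\<^sup>2) s (s + q * u) / 2) * (ex (s + q * u) z - ex s z)) \<partial>lborel)"
    unfolding Ew_def by (rule lborel_integral_real_affine) (use q in simp)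
  also have "\<dots> = (\<integral>u. q *\<^sub>R (indicator {x<..} (s + q * u) *\<^sub>R (of_real (Rk (q\<^sup>2) s (s + q * u) / 2) * (ex (s + q * u) z - ex s z))) \<partial>lborel)"
    by (simp only: integral_scaleR_right abs_of_pos[OF q])
  also have "\<dots> = (\<integral>u. gE q x s z u \<partial>lborel)"
  proof (rule Bochner_Integration.integral_cong[OF refl])
    fix u
    show "q *\<^sub>R (indicator {x<..} (s + q * u) *\<^sub>R (of_real (Rk (q\<^sup>2) s (s + q * u) / 2) * (ex (s + q * u) z - ex s z))) = gE q x s z u"
      unfolding gE_def r[symmetric] of_real_mult by (simp only: scaleR_conv_of_real mult_ac)
  qed
  finally show ?thesis .
qed

text \<open>The \<open>1 / q\<close> of the rescaled kernel meets the
  \<open>q * \<bar>u\<bar>\<close> of \<open>norm_ex_diff\<close>, and no power of \<open>q\<close>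
  is left. The other exponential is bounded because \<open>s\<close> and \<open>s + q * u\<close>
  both exceed \<open>x\<close> and \<open>q \<le> 1\<close>.\<close>

lemma norm_gE:
  assumes q: "0 < q" "q \<le> 1" and s: "x < s" and z: "1 \<le> Re z"
  shows "cmod (gE q x s z u) \<le> exp (1 + 2 * \<bar>x\<bar>) * (cmod z * exp (x - s) * cmod (ex x z)) * exp (2 * \<bar>u\<bar> - 1 / 8 * u\<^sup>2)"
proof (cases "x < s + q * u")
  case False
  then show ?thesis by (simp add: gE_def)
next
  case True
  let ?E = "exp (2 * q ^ 6 / 3 - (2 * s + q * u) * q\<^sup>2)"
  have E: "?E \<le> exp (1 + 2 * \<bar>x\<bar>)"
  proof -
    have q2: "q ^ 6 \<le> 1" "q\<^sup>2 \<le> 1" using q by (auto intro: power_le_one)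
    have "- (2 * \<bar>x\<bar>) \<le> 2 * s + q * u" using s True by linarith
    then have "- (2 * \<bar>x\<bar>) * q\<^sup>2 \<le> (2 * s + q * u) * q\<^sup>2" by (rule mult_right_mono) simp
    moreover have "2 * \<bar>x\<bar> * q\<^sup>2 \<le> 2 * \<bar>x\<bar> * 1" using q2 by (intro mult_left_mono) auto
    ultimately have "2 * q ^ 6 / 3 - (2 * s + q * u) * q\<^sup>2 \<le> 1 + 2 * \<bar>x\<bar>" using q2(1) by linarith
    then show ?thesis by simp
  qed
  have nd: "normal_density 0 2 u \<le> exp (- u\<^sup>2 / 8)"
  proof -
    have "1 \<le> sqrt (8 * pi)" using pi_gt3 by simp
    then have "exp (- u\<^sup>2 / 8) / sqrt (8 * pi) \<le> exp (- u\<^sup>2 / 8) / 1" by (intro divide_left_mono) auto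
    then show ?thesis unfolding normal_density_2 by simp
  qed
  have u2: "u\<^sup>2 / 4 \<le> exp \<bar>u\<bar>" 
    using exp_lower_Taylor_quadratic[OF abs_ge_zero, of u] zero_le_power2[of u] abs_ge_zero[of u]
    unfolding power2_abs by linarith
  have qu: "exp \<bar>q * u\<bar> \<le> exp \<bar>u\<bar>" using q mult_right_mono[of q 1 "\<bar>u\<bar>"] by (simp add: abs_mult)
  have "cmod (gE q x s z u) = \<bar>u\<bar> / (4 * q) * normal_density 0 2 u * ?E * cmod (ex (s + q * u) z - ex s z)"
  proof -
    have i: "indicator {x<..} (s + q * u) = (1 :: real)" using True by simp
    show ?thesis
      unfolding gE_def i scaleR_one norm_mult norm_of_real abs_mult abs_divide
      using q normal_density_nonneg[of 0 2 u] by simp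
  qed
  also have "\<dots> \<le> \<bar>u\<bar> / (4 * q) * normal_density 0 2 u * ?E * (\<bar>q * u\<bar> * cmod z * (exp \<bar>q * u\<bar> * exp (x - s) * cmod (ex x z)))"
    using norm_ex_diff[OF s True z] q normal_density_nonneg[of 0 2 u] by (intro mult_left_mono) auto
  also have "\<dots> = (u\<^sup>2 / 4) * normal_density 0 2 u * ?E * exp \<bar>q * u\<bar> * (cmod z * exp (x - s) * cmod (ex x z))"
    using q by (simp add: abs_mult power2_eq_square)
  also have "\<dots> \<le> exp \<bar>u\<bar> * exp (- u\<^sup>2 / 8) * exp (1 + 2 * \<bar>x\<bar>) * exp \<bar>u\<bar> * (cmod z * exp (x - s) * cmod (ex x z))"
    using normal_density_nonneg[of 0 2 u] by (intro mult_right_mono mult_mono u2 nd E qu mult_nonneg_nonneg) auto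
  also have "\<dots> = exp (1 + 2 * \<bar>x\<bar>) * (cmod z * exp (x - s) * cmod (ex x z)) * (exp \<bar>u\<bar> * exp \<bar>u\<bar> * exp (- u\<^sup>2 / 8))"
    by (simp only: mult_ac)
  also have "exp \<bar>u\<bar> * exp \<bar>u\<bar> * exp (- u\<^sup>2 / 8) = exp (2 * \<bar>u\<bar> - 1 / 8 * u\<^sup>2)"
    unfolding exp_add[symmetric] by (rule arg_cong[of _ _ exp]) simp
  finally show ?thesis .
qed

lemma gE_measurable [measurable]: "gE q x s z \<in> borel_measurable borel"
  unfolding gE_def ex_def by measurable

lemma norm_Ew:
  assumes \<eta>: "0 < \<eta>" "\<eta> \<le> 1" and s: "x < s" and z: "1 \<le> Re z"
  shows "cmod (Ew \<eta> x s z) \<le> exp (1 + 2 * \<bar>x\<bar>) * (cmod z * exp (x - s) * cmod (ex x z)) * (\<integral>u. exp (2 * \<bar>u\<bar> - 1 / 8 * u\<^sup>2) \<partial>lborel)"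
proof -
  define q where "q = sqrt \<eta>"
  have q: "0 < q" "q \<le> 1" "q\<^sup>2 = \<eta>" using \<eta> by (auto simp: q_def)
  have "cmod (Ew \<eta> x s z) \<le> (\<integral>u. exp (1 + 2 * \<bar>x\<bar>) * (cmod z * exp (x - s) * cmod (ex x z)) * exp (2 * \<bar>u\<bar> - 1 / 8 * u\<^sup>2) \<partial>lborel)"
    unfolding q(3)[symmetric] Ew_subst[OF q(1)]
  proof (rule order.trans[OF integral_norm_bound], rule integral_mono')
    show "integrable lborel (\<lambda>u. exp (1 + 2 * \<bar>x\<bar>) * (cmod z * exp (x - s) * cmod (ex x z)) * exp (2 * \<bar>u\<bar> - 1 / 8 * u\<^sup>2))"
      by (intro integrable_mult_right gauss_integrable) simp
    show "cmod (gE q x s z u) \<le> exp (1 + 2 * \<bar>x\<bar>) * (cmod z * exp (x - s) * cmod (ex x z)) * exp (2 * \<bar>u\<bar> - 1 / 8 * u\<^sup>2)" for u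
      by (rule norm_gE[OF q(1,2) s z])
    show "0 \<le> exp (1 + 2 * \<bar>x\<bar>) * (cmod z * exp (x - s) * cmod (ex x z)) * exp (2 * \<bar>u\<bar> - 1 / 8 * u\<^sup>2)" for u
      by (intro mult_nonneg_nonneg) auto
  qed
  then show ?thesis by simp
qed

text \<open>The difference quotient of \<open>ex\<close> tends to \<open>- u * z * ex s z\<close>.
  Multiplied by \<open>u / 4\<close> it is averaged over a normal law of variance 4, whose second
  moment cancels the 4. Since \<open>x < s\<close> is strict, the indicator tends to 1.\<close>

lemma Ew_tendsto:
  assumes q: "\<And>n. 0 < q n" "\<And>n. q n \<le> 1" "q \<longlonglongrightarrow> 0" and s: "x < s" and z: "1 \<le> Re z"
  shows "(\<lambda>n. Ew ((q n)\<^sup>2) x s z) \<longlonglongrightarrow> - z * ex s z"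
proof -
  let ?l = "\<lambda>u. of_real (normal_density 0 2 u * u\<^sup>2) * (- z * ex s z / 4)"
  have "(\<lambda>n. (\<integral>u. gE (q n) x s z u \<partial>lborel)) \<longlonglongrightarrow> (\<integral>u. ?l u \<partial>lborel)"
  proof (rule integral_dominated_convergence)
    show "integrable lborel (\<lambda>u. exp (1 + 2 * \<bar>x\<bar>) * (cmod z * exp (x - s) * cmod (ex x z)) * exp (2 * \<bar>u\<bar> - 1 / 8 * u\<^sup>2))"
      by (intro integrable_mult_right gauss_integrable) simp
    show "AE u in lborel. norm (gE (q n) x s z u) \<le> exp (1 + 2 * \<bar>x\<bar>) * (cmod z * exp (x - s) * cmod (ex x z)) * exp (2 * \<bar>u\<bar> - 1 / 8 * u\<^sup>2)" for n
      by (intro AE_I2 norm_gE q s z)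
    show "AE u in lborel. (\<lambda>n. gE (q n) x s z u) \<longlonglongrightarrow> ?l u"
    proof (rule AE_I2)
      fix u
      have "(\<lambda>n. s + q n * u) \<longlonglongrightarrow> s + 0 * u" by (intro tendsto_intros q)
      then have "eventually (\<lambda>n. x < s + q n * u) sequentially" using s by (intro order_tendstoD(1)) auto
      then have "eventually (\<lambda>n. indicator {x<..} (s + q n * u) = (1 :: real)) sequentially"
        by eventually_elim simp
      then have 1: "(\<lambda>n. indicator {x<..} (s + q n * u) :: real) \<longlonglongrightarrow> 1" by (rule tendsto_eventually)
      have "(\<lambda>n. exp (2 * q n ^ 6 / 3 - (2 * s + q n * u) * (q n)\<^sup>2)) \<longlonglongrightarrow> exp (2 * 0 ^ 6 / 3 - (2 * s + 0 * u) * 0\<^sup>2)"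
        by (intro tendsto_intros q) simp
      then have 2: "(\<lambda>n. complex_of_real (u / 4 * normal_density 0 2 u * exp (2 * q n ^ 6 / 3 - (2 * s + q n * u) * (q n)\<^sup>2)))
          \<longlonglongrightarrow> of_real (u / 4 * normal_density 0 2 u * 1)"
        by (intro tendsto_of_real tendsto_mult tendsto_const) simp
      define c where "c = - of_real u * z"
      have "((\<lambda>h. exp (h * c)) has_field_derivative c) (at 0)" by (auto intro!: derivative_eq_intros)
      then have D: "((\<lambda>h. (exp (h * c) - 1) / h) \<longlongrightarrow> c) (at 0)" unfolding has_field_derivative_iff by simp
      have "filterlim (\<lambda>n. complex_of_real (q n)) (at 0) sequentially"
        unfolding filterlim_at using tendsto_of_real[OF q(3), where 'a = complex] q(1)
        by (auto intro!: always_eventually simp: less_imp_neq[symmetric])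
      from filterlim_compose[OF D this]
      have 3: "(\<lambda>n. ex s z * ((exp (of_real (q n) * c) - 1) / of_real (q n))) \<longlonglongrightarrow> ex s z * c" by (rule tendsto_mult_left)
      have "gE (q n) x s z u = indicator {x<..} (s + q n * u) *\<^sub>R (of_real (u / 4 * normal_density 0 2 u * exp (2 * q n ^ 6 / 3 - (2 * s + q n * u) * (q n)\<^sup>2))
           * (ex s z * ((exp (of_real (q n) * c) - 1) / of_real (q n))))" for n
        unfolding gE_def ex_add c_def by (simp add: field_simps)
      then have "(\<lambda>n. gE (q n) x s z u) \<longlonglongrightarrow> 1 *\<^sub>R (of_real (u / 4 * normal_density 0 2 u * 1) * (ex s z * c))"
        by (simp only:) (intro tendsto_scaleR tendsto_mult 1 2 3)
      also have "1 *\<^sub>R (of_real (u / 4 * normal_density 0 2 u * 1) * (ex s z * c)) = ?l u"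
        by (simp add: c_def power2_eq_square)
      finally show "(\<lambda>n. gE (q n) x s z u) \<longlonglongrightarrow> ?l u" .
    qed
  qed measurable
  also have "(\<integral>u. ?l u \<partial>lborel) = of_real (\<integral>u. normal_density 0 2 u * u\<^sup>2 \<partial>lborel) * (- z * ex s z / 4)"
    unfolding integral_mult_left_zero by (simp only: integral_complex_of_real)
  also have "(\<integral>u. normal_density 0 2 u * u\<^sup>2 \<partial>lborel) = 4"
    using integral_normal_moment_even[of 2 0 1] by simp
  finally show ?thesis unfolding Ew_subst[OF q(1)] by simp
qed

lemma pbound_Ew:
  assumes \<eta>: "0 < \<eta>" "\<eta> \<le> 1" and s: "x < s"
  shows "pbound (ec 1 x + 1) (exp (1 + 2 * \<bar>x\<bar>) * (\<integral>u. exp (2 * \<bar>u\<bar> - 1 / 8 * u\<^sup>2) \<partial>lborel) * exp (x - s)) (Ew \<eta> x s)"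
    (is "pbound _ (?A * ?V * _) _")
  unfolding pbound_def
proof (intro conjI allI)
  fix t
  have V: "0 \<le> ?V" by simp
  have "cmod (Ew \<eta> x s (cpath t)) \<le> ?A * (cmod (cpath t) * exp (x - s) * cmod (ex x (cpath t))) * ?V"
    by (rule norm_Ew[OF \<eta> s cpath_bounds(1)])
  also have "\<dots> \<le> ?A * ((1 + \<bar>t\<bar>) * exp (x - s) * cw (ec 1 x) t) * ?V"
    using V by (intro mult_right_mono mult_left_mono mult_mono cpath_bounds norm_ex_wpath) auto
  also have "\<dots> = ?A * ?V * exp (x - s) * ((1 + \<bar>t\<bar>) * cw (ec 1 x) t)" by (simp only: mult_ac)
  also have "\<dots> \<le> ?A * ?V * exp (x - s) * cw (ec 1 x + 1) t"
    using V by (intro mult_left_mono linear_mult_cw) auto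
  finally show "cmod (Ew \<eta> x s (cpath t)) \<le> ?A * ?V * exp (x - s) * cw (ec 1 x + 1) t" .
qed (auto simp: ec_nonneg)

text \<open>The constant diverges as \<eta> tends to 0; this bound serves absolute convergence at
  fixed \<eta> and not the limit.\<close>

lemma Rk_bound:
  assumes "0 < \<eta>"
  shows "\<bar>Rk \<eta> s y\<bar> \<le> ((1 + 8 * \<eta>) / (2 * \<eta> * sqrt (8 * pi * \<eta>)) * exp (2 * \<eta> ^ 3 / 3)) * exp (- \<eta> * s) * exp (- \<eta> * y)"
proof -
  define a where "a = s - y"
  have "\<bar>a\<bar> \<le> 1 + a\<^sup>2"
  proof -
    have "0 \<le> (\<bar>a\<bar> - 1)\<^sup>2" by simp
    then have "2 * \<bar>a\<bar> \<le> 1 + a\<^sup>2" by (simp add: power2_diff)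
    then show ?thesis by (simp add: abs_if split: if_splits)
  qed
  also have "\<dots> \<le> (1 + 8 * \<eta>) * (1 + a\<^sup>2 / (8 * \<eta>))" using assms by (simp add: field_simps)
  also have "\<dots> \<le> (1 + 8 * \<eta>) * exp (a\<^sup>2 / (8 * \<eta>))"
    using assms by (intro mult_left_mono exp_ge_add_one_self) auto
  finally have "\<bar>a\<bar> * exp (- a\<^sup>2 / (8 * \<eta>)) \<le> (1 + 8 * \<eta>) * exp (a\<^sup>2 / (8 * \<eta>)) * exp (- a\<^sup>2 / (8 * \<eta>))"
    by (rule mult_right_mono) simp
  also have "\<dots> = 1 + 8 * \<eta>" unfolding mult.assoc exp_add[symmetric] by simp
  finally have ae: "\<bar>a\<bar> * exp (- a\<^sup>2 / (8 * \<eta>)) \<le> 1 + 8 * \<eta>" .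
  have "\<bar>Rk \<eta> s y\<bar> = (\<bar>a\<bar> * exp (- a\<^sup>2 / (8 * \<eta>))) / (2 * \<eta> * sqrt (8 * pi * \<eta>)) * exp (2 * \<eta> ^ 3 / 3 - (s + y) * \<eta>)"
    unfolding Rk_def a_def[symmetric] using assms by (simp add: abs_mult)
  also have "\<dots> \<le> (1 + 8 * \<eta>) / (2 * \<eta> * sqrt (8 * pi * \<eta>)) * exp (2 * \<eta> ^ 3 / 3 - (s + y) * \<eta>)"
    using assms by (intro mult_right_mono divide_right_mono ae) auto
  also have "exp (2 * \<eta> ^ 3 / 3 - (s + y) * \<eta>) = exp (2 * \<eta> ^ 3 / 3) * exp (- \<eta> * s) * exp (- \<eta> * y)"
    unfolding exp_add[symmetric] by (rule arg_cong[of _ _ exp]) (simp add: algebra_simps)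
  finally show ?thesis by (simp only: mult.assoc)
qed

lemma Rk_measurable: "(\<lambda>p. Rk \<eta> (fst p) (snd p)) \<in> borel_measurable borel"
proof -
  have "(\<lambda>p. Rk \<eta> (fst p) (snd p)) \<in> borel_measurable (borel \<Otimes>\<^sub>M borel)" unfolding Rk_def by measurable
  then show ?thesis by (simp add: borel_prod)
qed

lemma Rk_integrable:
  assumes \<eta>: "0 < \<eta>"
  shows "integrable lborel (\<lambda>y. indicator {x<..} y * \<bar>Rk \<eta> s y / 2\<bar>)"
proof -
  let ?C = "((1 + 8 * \<eta>) / (2 * \<eta> * sqrt (8 * pi * \<eta>)) * exp (2 * \<eta> ^ 3 / 3)) * exp (- \<eta> * s)"
  have "integrable lborel (\<lambda>y. ?C * (indicator {x<..} y * exp (- \<eta> * y)))"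
    by (intro integrable_mult_right exp_tail(1) \<eta>)
  then show ?thesis
  proof (rule Bochner_Integration.integrable_bound)
    show "(\<lambda>y. indicator {x<..} y * \<bar>Rk \<eta> s y / 2\<bar>) \<in> borel_measurable lborel" unfolding Rk_def by measurable
    show "AE y in lborel. norm (indicator {x<..} y * \<bar>Rk \<eta> s y / 2\<bar>) \<le> norm (?C * (indicator {x<..} y * exp (- \<eta> * y)))"
    proof (rule AE_I2)
      fix y
      have "\<bar>Rk \<eta> s y / 2\<bar> \<le> ?C * exp (- \<eta> * y)" using Rk_bound[OF \<eta>, of s y] by simp
      also have "\<dots> \<le> \<bar>?C * exp (- \<eta> * y)\<bar>" by (rule abs_ge_self)
      finally show "norm (indicator {x<..} y * \<bar>Rk \<eta> s y / 2\<bar>) \<le> norm (?C * (indicator {x<..} y * exp (- \<eta> * y)))"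
        by (cases "x < y") simp_all
    qed
  qed
qed

text \<open>Fubini moves the integral over \<open>y\<close> out of the contour integral. The result
  has the form that \<open>row_integration\<close> expects of row 3, with the integral of half of R
  as the coefficient \<open>d\<close>.\<close>

lemma Ew_row:
  assumes \<eta>: "0 < \<eta>" "\<eta> \<le> 1" and s: "x < s" and \<kappa>: "cbound K \<kappa>" and q: "pbound (ec 1 x + 1) B q"
  shows "dbl \<kappa> (Ew \<eta> x s) q = (\<integral>y. indicator {x<..} y *\<^sub>R (of_real (Rk \<eta> s y / 2) * dbl \<kappa> (ex y) q) \<partial>lborel)
    - (\<integral>y. indicator {x<..} y *\<^sub>R of_real (Rk \<eta> s y / 2) \<partial>lborel) * dbl \<kappa> (ex s) q"
proof -
  let ?c = "ec 1 x + 1" and ?J = "inner_int \<kappa> q"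
  define r where "r y = complex_of_real (Rk \<eta> s y / 2)" for y
  define F where "F = (\<lambda>(t, y). (indicator {x<..} y *\<^sub>R (r y * (ex y (cpath t) - ex s (cpath t)))) * (cfac t * ?J (cpath t)))"
  have pe: "pbound ?c 1 (ex y)" if "x < y" for y
    using that by (auto intro!: pbound_mono[OF pbound_ex[of x]])
  have c0: "0 \<le> ?c" "0 \<le> K" "0 \<le> B" using ec_nonneg[of 1 x] \<kappa> q by (auto simp: cbound_def pbound_def)
  have [measurable]: "?J \<in> borel_measurable borel"
    using \<kappa> q by (intro inner_int_measurable) (auto simp: cbound_def pbound_def)
  have Fm: "F \<in> borel_measurable borel"
  proof -
    have "F \<in> borel_measurable (borel \<Otimes>\<^sub>M borel)" unfolding F_def r_def Rk_def ex_def by measurable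
    then show ?thesis by (simp add: borel_prod)
  qed
  let ?u = "\<lambda>t. 2 * (K * B * cmass ?c) * cw (?c + 1) t" and ?v = "\<lambda>y. indicator {x<..} y * \<bar>Rk \<eta> s y / 2\<bar>"
  have u: "integrable lborel ?u" using c0 by (intro integrable_mult_right cw_integrable) auto
  have v: "integrable lborel ?v" by (rule Rk_integrable[OF \<eta>(1)])
  have Fb: "cmod (F (t, y)) \<le> ?u t * ?v y" for t y
  proof (cases "x < y")
    case True
    have "cmod (ex y (cpath t) - ex s (cpath t)) \<le> cmod (ex y (cpath t)) + cmod (ex s (cpath t))" by (rule norm_triangle_ineq4)
    also have "\<dots> \<le> 1 * cw ?c t + 1 * cw ?c t"
      using pe[OF True] pe[OF s] by (intro add_mono) (auto simp: pbound_def)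
    finally have d: "cmod (ex y (cpath t) - ex s (cpath t)) \<le> 2 * cw ?c t" by simp
    have "cmod (F (t, y)) = \<bar>Rk \<eta> s y / 2\<bar> * (cmod (ex y (cpath t) - ex s (cpath t)) * (cmod (cfac t) * cmod (?J (cpath t))))"
      using True by (simp only: F_def r_def prod.case norm_mult norm_of_real norm_scaleR) simp
    also have "\<dots> \<le> \<bar>Rk \<eta> s y / 2\<bar> * (2 * cw ?c t * (1 * (K * B * cmass ?c * (1 + \<bar>t\<bar>))))"
      by (intro mult_left_mono mult_mono d norm_wfac inner_int_bound[OF \<kappa> q] mult_nonneg_nonneg) (auto simp: cw_nonneg)
    also have "\<dots> = \<bar>Rk \<eta> s y / 2\<bar> * (2 * (K * B * cmass ?c) * ((1 + \<bar>t\<bar>) * cw ?c t))" by simp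
    also have "\<dots> \<le> \<bar>Rk \<eta> s y / 2\<bar> * ?u t"
      using c0 cmass_nonneg by (intro mult_left_mono linear_mult_cw mult_nonneg_nonneg) auto
    finally show ?thesis using True by (simp add: mult.commute)
  qed (simp add: F_def)
  note fub = fubini_bounded[OF Fm u v Fb]
  have Fy: "(\<integral>y. F (t, y) \<partial>lborel) = Ew \<eta> x s (cpath t) * cfac t * ?J (cpath t)" for t
    unfolding F_def prod.case Ew_def r_def mult.assoc by (rule integral_mult_left_zero)
  have Ft: "(\<integral>t. F (t, y) \<partial>lborel) = indicator {x<..} y *\<^sub>R (r y * dbl \<kappa> (ex y) q) - indicator {x<..} y *\<^sub>R r y * dbl \<kappa> (ex s) q" for y
  proof (cases "x < y")
    case True
    note Dy = dbl_integrand(5,6)[OF \<kappa> pe[OF True] q] and Ds = dbl_integrand(5,6)[OF \<kappa> pe[OF s] q]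
    have "(\<integral>t. F (t, y) \<partial>lborel) = (\<integral>t. r y * (ex y (cpath t) * cfac t * ?J (cpath t) - ex s (cpath t) * cfac t * ?J (cpath t)) \<partial>lborel)"
      using True by (intro Bochner_Integration.integral_cong) (auto simp: F_def algebra_simps)
    also have "\<dots> = r y * (dbl \<kappa> (ex y) q - dbl \<kappa> (ex s) q)"
      unfolding Dy(1) Ds(1) integral_mult_right_zero by (subst Bochner_Integration.integral_diff[OF Dy(2) Ds(2)]) (rule refl)
    finally show ?thesis using True by (simp add: right_diff_distrib)
  qed (simp add: F_def)
  have rint: "integrable lborel (\<lambda>y. indicator {x<..} y *\<^sub>R r y)"
  proof (rule Bochner_Integration.integrable_bound[OF v])
    show "(\<lambda>y. indicator {x<..} y *\<^sub>R r y) \<in> borel_measurable lborel" unfolding r_def Rk_def by measurable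
    show "AE y in lborel. norm (indicator {x<..} y *\<^sub>R r y) \<le> norm (?v y)"
      by (intro AE_I2) (simp add: r_def indicator_def)
  qed
  have i1: "integrable lborel (\<lambda>y. indicator {x<..} y *\<^sub>R (r y * dbl \<kappa> (ex y) q) - indicator {x<..} y *\<^sub>R r y * dbl \<kappa> (ex s) q)"
    using fub(4) unfolding Ft .
  have i2: "integrable lborel (\<lambda>y. indicator {x<..} y *\<^sub>R r y * dbl \<kappa> (ex s) q)"
    using rint by (rule integrable_mult_left)
  have i3: "integrable lborel (\<lambda>y. indicator {x<..} y *\<^sub>R (r y * dbl \<kappa> (ex y) q))"
    using Bochner_Integration.integrable_add[OF i1 i2] by simp
  have "dbl \<kappa> (Ew \<eta> x s) q = (\<integral>t. (\<integral>y. F (t, y) \<partial>lborel) \<partial>lborel)"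
    unfolding Fy by (rule dbl_integrand(5)[OF \<kappa> pbound_Ew[OF \<eta> s] q])
  also have "\<dots> = (\<integral>y. indicator {x<..} y *\<^sub>R (r y * dbl \<kappa> (ex y) q) - indicator {x<..} y *\<^sub>R r y * dbl \<kappa> (ex s) q \<partial>lborel)"
    unfolding fub(2) Ft ..
  also have "\<dots> = (\<integral>y. indicator {x<..} y *\<^sub>R (r y * dbl \<kappa> (ex y) q) \<partial>lborel) - (\<integral>y. indicator {x<..} y *\<^sub>R r y \<partial>lborel) * dbl \<kappa> (ex s) q"
    unfolding Bochner_Integration.integral_diff[OF i3 i2] integral_mult_left_zero ..
  finally show ?thesis unfolding r_def .
qed

text \<open>Row \<open>3\<close> is the corrected convolution of row \<open>1\<close>; any other index stands for row \<open>2\<close>.\<close>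

definition kap :: "real \<Rightarrow> nat \<Rightarrow> nat \<Rightarrow> complex \<Rightarrow> complex \<Rightarrow> complex" where
  "kap \<eta> i j = (if i \<in> {1, 3} then if j \<in> {1, 3} then k11 \<eta> else k12 \<eta>
     else if j \<in> {1, 3} then (\<lambda>z w. - k12 \<eta> w z) else k22 \<eta>)"

definition row_fn :: "(real \<Rightarrow> complex \<Rightarrow> complex) \<Rightarrow> nat \<Rightarrow> real \<Rightarrow> complex \<Rightarrow> complex" where
  "row_fn E i s = (if i = 3 then E s else ex s)"

text \<open>The labels 1 and 2 give the kernel without R; for \<open>E = Ew \<eta> x\<close> the
  label 3 adds the corrected row.\<close>

definition KK :: "real \<Rightarrow> (real \<Rightarrow> complex \<Rightarrow> complex) \<Rightarrow> nat \<Rightarrow> nat \<Rightarrow> real \<Rightarrow> real \<Rightarrow> complex" where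
  "KK \<eta> E i j s t = dbl (kap \<eta> i j) (row_fn E i s) (row_fn E j t)"

lemma kap_swap: "kap \<eta> i j w z = - kap \<eta> j i z w"
proof -
  have d: "4 * (w + of_real \<eta>) * (z + of_real \<eta>) * (w + z + 2 * of_real \<eta>) = 4 * (z + of_real \<eta>) * (w + of_real \<eta>) * (z + w + 2 * of_real \<eta>)"
    "w + z - 2 * of_real \<eta> = z + w - 2 * of_real \<eta>"
    by (simp_all only: mult_ac add_ac)
  have "k11 \<eta> w z = - k11 \<eta> z w" "k22 \<eta> w z = - k22 \<eta> z w"
    unfolding k11_def k22_def d minus_divide_left minus_diff_eq by (rule refl)+
  then show ?thesis by (simp add: kap_def)
qed

lemma KK_skew: "KK \<eta> E i j s t = - KK \<eta> E j i t s"
proof -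
  have e: "(\<lambda>z w. kap \<eta> i j w z) = (\<lambda>z w. - kap \<eta> j i z w)" by (intro ext kap_swap)
  have "KK \<eta> E i j s t = dbl (\<lambda>z w. kap \<eta> i j w z) (row_fn E j t) (row_fn E i s)"
    unfolding KK_def by (rule dbl_swap)
  then show ?thesis unfolding e dbl_uminus KK_def .
qed

lemma cbound_swap:
  assumes "cbound K \<kappa>"
  shows "cbound K (\<lambda>z w. - \<kappa> w z)"
proof -
  have [measurable]: "case_prod \<kappa> \<in> borel_measurable (borel \<Otimes>\<^sub>M borel)" using assms by (simp add: cbound_def)
  have "(\<lambda>p. - \<kappa> (snd p) (fst p)) \<in> borel_measurable (borel \<Otimes>\<^sub>M borel)" by measurable
  moreover have "cmod (- \<kappa> (cpath s) (cpath t)) \<le> K * (1 + \<bar>t\<bar>) * (1 + \<bar>s\<bar>)" for t s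
  proof -
    have "cmod (- \<kappa> (cpath s) (cpath t)) \<le> K * (1 + \<bar>s\<bar>) * (1 + \<bar>t\<bar>)" using assms by (simp add: cbound_def)
    then show ?thesis by (simp only: mult_ac)
  qed
  ultimately show ?thesis using assms by (simp add: cbound_def case_prod_unfold)
qed

lemma cbound_kap: "0 \<le> \<eta> \<Longrightarrow> \<eta> \<le> 1 / 2 \<Longrightarrow> cbound 2 (kap \<eta> i j)"
  using cbound_k11[of \<eta>] cbound_k12[of \<eta>] cbound_swap[OF cbound_k12[of \<eta>]] cbound_k22[of \<eta>]
  by (simp add: kap_def)

lemma kap_tendsto:
  assumes "\<And>n. 0 \<le> e n" "\<And>n. e n \<le> 1 / 2" "e \<longlonglongrightarrow> 0" "1 \<le> Re z" "1 \<le> Re w"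
  shows "(\<lambda>n. kap (e n) i j z w) \<longlonglongrightarrow> kap 0 i j z w"
proof -
  have nz: "z \<noteq> 0" "w \<noteq> 0" "z + w \<noteq> 0"
  proof -
    have "Re z \<noteq> 0" "Re w \<noteq> 0" "Re (z + w) \<noteq> 0" using assms(4,5) by auto
    then show "z \<noteq> 0" "w \<noteq> 0" "z + w \<noteq> 0" by (metis zero_complex.sel(1))+
  qed
  have nz': "w + z \<noteq> 0" using nz(3) by (simp add: add.commute)
  have e: "(\<lambda>n. complex_of_real (e n)) \<longlonglongrightarrow> of_real 0" by (rule tendsto_of_real[OF assms(3)])
  note intros = tendsto_divide tendsto_mult tendsto_add tendsto_diff tendsto_const e
  have 1: "(\<lambda>n. k11 (e n) z w) \<longlonglongrightarrow> k11 0 z w"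
    unfolding k11_def by (intro intros) (use nz in simp)
  have 2: "(\<lambda>n. k12 (e n) z w) \<longlonglongrightarrow> k12 0 z w"
    unfolding k12_def by (intro intros) (use nz in simp)
  have 3: "(\<lambda>n. k12 (e n) w z) \<longlonglongrightarrow> k12 0 w z"
    unfolding k12_def by (intro intros) (use nz nz' in simp)
  have 4: "(\<lambda>n. k22 (e n) z w) \<longlonglongrightarrow> k22 0 z w"
    unfolding k22_def by (intro intros) (use nz in simp)
  show ?thesis unfolding kap_def using 1 2 tendsto_minus[OF 3] 4 by simp
qed

text \<open>One constant serves all small \<eta>, for the corrected row as for the ordinary ones.
  This is the domination that survives the limit.\<close>

lemma pbound_row_fn:
  "\<exists>M>0. \<forall>\<eta> s i. 0 < \<eta> \<longrightarrow> \<eta> \<le> 1 \<longrightarrow> x < s \<longrightarrow> pbound (ec 1 x + 1) (M * exp (- s)) (row_fn (Ew \<eta> x) i s)"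
proof -
  define A where "A = exp (1 + 2 * \<bar>x\<bar>) * (\<integral>u. exp (2 * \<bar>u\<bar> - 1 / 8 * u\<^sup>2) \<partial>lborel)"
  have A: "0 \<le> A" unfolding A_def by simp
  have "pbound (ec 1 x + 1) ((A + 1) * exp x * exp (- s)) (row_fn (Ew \<eta> x) i s)" if "0 < \<eta>" "\<eta> \<le> 1" "x < s" for \<eta> s i
  proof -
    have e: "exp (x - s) = exp x * exp (- s)" unfolding exp_add[symmetric] by simp
    have "pbound (ec 1 x + 1) ((A + 1) * exp (x - s)) (Ew \<eta> x s)"
      by (rule pbound_mono[OF pbound_Ew[OF that]]) (auto simp: A_def)
    moreover have "pbound (ec 1 x + 1) ((A + 1) * exp (x - s)) (ex s)"
    proof (rule pbound_mono[OF pbound_ex])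
      show "x \<le> s" using that by simp
      show "exp (x - s) \<le> (A + 1) * exp (x - s)" using A by simp
    qed simp
    ultimately show ?thesis unfolding row_fn_def e by (simp add: mult.assoc)
  qed
  then show ?thesis using A by (intro exI[of _ "(A + 1) * exp x"]) (auto intro!: mult_pos_pos)
qed

lemma KK_bound:
  "\<exists>C>0. \<forall>\<eta> i j s t. 0 < \<eta> \<longrightarrow> \<eta> \<le> 1 / 2 \<longrightarrow> x < s \<longrightarrow> x < t \<longrightarrow> cmod (KK \<eta> (Ew \<eta> x) i j s t) \<le> C * exp (- s) * exp (- t)"
proof -
  obtain M where M: "0 < M" "\<And>\<eta> s i. 0 < \<eta> \<Longrightarrow> \<eta> \<le> 1 \<Longrightarrow> x < s \<Longrightarrow> pbound (ec 1 x + 1) (M * exp (- s)) (row_fn (Ew \<eta> x) i s)"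
    using pbound_row_fn[of x] by auto
  define C where "C = 2 * M * M * (cmass (ec 1 x + 1))\<^sup>2 + 1"
  have "cmod (KK \<eta> (Ew \<eta> x) i j s t) \<le> C * exp (- s) * exp (- t)" if "0 < \<eta>" "\<eta> \<le> 1 / 2" "x < s" "x < t" for \<eta> i j s t
  proof -
    have "cmod (KK \<eta> (Ew \<eta> x) i j s t) \<le> 2 * (M * exp (- s)) * (M * exp (- t)) * (cmass (ec 1 x + 1))\<^sup>2"
      unfolding KK_def by (rule dbl_bound[OF cbound_kap M(2) M(2)]) (use that in auto)
    also have "\<dots> = (C - 1) * exp (- s) * exp (- t)" by (simp add: C_def mult_ac)
    also have "\<dots> \<le> C * exp (- s) * exp (- t)" by (intro mult_right_mono) auto
    finally show ?thesis .
  qed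
  moreover have "0 < C" using M(1) by (simp add: C_def add_nonneg_pos)
  ultimately show ?thesis by blast
qed

section \<open>Measurability and convergence of the labelled kernel\<close>

lemma row_fn_measurable:
  assumes "(\<lambda>p. E (fst p) (snd p)) \<in> borel_measurable (borel \<Otimes>\<^sub>M borel)"
  shows "(\<lambda>p. row_fn E i (fst p) (snd p)) \<in> borel_measurable (borel \<Otimes>\<^sub>M borel)"
proof -
  have "(\<lambda>p. ex (fst p) (snd p)) \<in> borel_measurable (borel \<Otimes>\<^sub>M borel)" unfolding ex_def by measurable
  then show ?thesis using assms by (cases "i = 3") (simp_all add: row_fn_def)
qed

lemma dbl_measurable:
  fixes E E' :: "real \<Rightarrow> complex \<Rightarrow> complex"
  assumes \<kappa>: "cbound K \<kappa>"
    and E: "(\<lambda>p. E (fst p) (snd p)) \<in> borel_measurable (borel \<Otimes>\<^sub>M borel)"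
      "(\<lambda>p. E' (fst p) (snd p)) \<in> borel_measurable (borel \<Otimes>\<^sub>M borel)"
  shows "(\<lambda>p. dbl \<kappa> (E (fst p)) (E' (snd p))) \<in> borel_measurable borel"
proof -
  have sf: "sigma_finite_measure (lborel \<Otimes>\<^sub>M lborel :: (real \<times> real) measure)"
    by (rule sigma_finite_pair_measure; rule sigma_finite_lborel)
  let ?N = "borel \<Otimes>\<^sub>M borel :: (real \<times> real) measure"
  have [measurable]: "case_prod \<kappa> \<in> borel_measurable (borel \<Otimes>\<^sub>M borel)"
    using \<kappa> by (simp add: cbound_def)
  have [measurable]: "(\<lambda>p. E (fst (fst p)) (cpath (fst (snd p)))) \<in> borel_measurable (?N \<Otimes>\<^sub>M (lborel \<Otimes>\<^sub>M lborel))"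
    using measurable_compose[OF _ E(1), of "\<lambda>p. (fst (fst p), cpath (fst (snd p)))" "?N \<Otimes>\<^sub>M (lborel \<Otimes>\<^sub>M lborel)"] by simp
  have [measurable]: "(\<lambda>p. E' (snd (fst p)) (cpath (snd (snd p)))) \<in> borel_measurable (?N \<Otimes>\<^sub>M (lborel \<Otimes>\<^sub>M lborel))"
    using measurable_compose[OF _ E(2), of "\<lambda>p. (snd (fst p), cpath (snd (snd p)))" "?N \<Otimes>\<^sub>M (lborel \<Otimes>\<^sub>M lborel)"] by simp
  have "(\<lambda>p. dbl \<kappa> (E (fst p)) (E' (snd p))) \<in> borel_measurable ?N"
    unfolding dbl_def
    by (rule sigma_finite_measure.borel_measurable_lebesgue_integral[OF sf]) (simp only: case_prod_unfold; measurable)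
  then show ?thesis by (simp add: borel_prod)
qed

lemma ex_jointly_measurable: "(\<lambda>p. ex (fst p) (snd p)) \<in> borel_measurable (borel \<Otimes>\<^sub>M borel)"
  unfolding ex_def by measurable

lemma KK_measurable:
  assumes \<eta>: "0 \<le> \<eta>" "\<eta> \<le> 1 / 2" and E: "(\<lambda>p. E (fst p) (snd p)) \<in> borel_measurable (borel \<Otimes>\<^sub>M borel)"
  shows "(\<lambda>p. KK \<eta> E i j (fst p) (snd p)) \<in> borel_measurable borel"
  unfolding KK_def by (rule dbl_measurable[OF cbound_kap[OF \<eta>] row_fn_measurable[OF E] row_fn_measurable[OF E]])

lemma KK_row:
  assumes \<eta>: "0 < \<eta>" "\<eta> \<le> 1 / 2" and "x < s" "x < t"
  shows "KK \<eta> (Ew \<eta> x) 3 j s t = (\<integral>y. indicator {x<..} y *\<^sub>R (of_real (Rk \<eta> s y / 2) * KK \<eta> (Ew \<eta> x) 1 j y t) \<partial>lborel)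
    - (\<integral>y. indicator {x<..} y *\<^sub>R of_real (Rk \<eta> s y / 2) \<partial>lborel) * KK \<eta> (Ew \<eta> x) 1 j s t"
proof -
  obtain M where M: "\<And>\<eta> s i. 0 < \<eta> \<Longrightarrow> \<eta> \<le> 1 \<Longrightarrow> x < s \<Longrightarrow> pbound (ec 1 x + 1) (M * exp (- s)) (row_fn (Ew \<eta> x) i s)"
    using pbound_row_fn[of x] by auto
  have k: "kap \<eta> 3 j = kap \<eta> 1 j" by (simp add: kap_def)
  have r: "row_fn (Ew \<eta> x) 3 s = Ew \<eta> x s" "row_fn (Ew \<eta> x) 1 y = ex y" for y by (simp_all add: row_fn_def)
  show ?thesis
    unfolding KK_def k r
    by (rule Ew_row[OF _ _ assms(3) cbound_kap M]) (use assms in auto)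
qed

text \<open>The derivative of \<open>ex s z\<close> in \<open>s\<close>, which is the limit of
  \<open>Ew\<close>.\<close>

definition E0 :: "real \<Rightarrow> complex \<Rightarrow> complex" where
  "E0 s z = - z * ex s z"

lemma E0_measurable: "(\<lambda>p. E0 (fst p) (snd p)) \<in> borel_measurable (borel \<Otimes>\<^sub>M borel)"
  unfolding E0_def ex_def by measurable

lemma row_fn_measurable_snd:
  assumes "(\<lambda>p. E (fst p) (snd p)) \<in> borel_measurable (borel \<Otimes>\<^sub>M borel)"
  shows "row_fn E i s \<in> borel_measurable borel"
  using measurable_compose[OF measurable_Pair[OF measurable_const measurable_ident_sets[OF refl]] row_fn_measurable[OF assms, of i], of s] by simp

lemma KK_tendsto:
  assumes q: "\<And>n. 0 < q n" "\<And>n. q n \<le> 1 / 2" "q \<longlonglongrightarrow> 0" and st: "x < s" "x < t"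
  shows "(\<lambda>n. KK ((q n)\<^sup>2) (Ew ((q n)\<^sup>2) x) i j s t) \<longlonglongrightarrow> KK 0 E0 i j s t"
proof -
  obtain M where M: "\<And>\<eta> s i. 0 < \<eta> \<Longrightarrow> \<eta> \<le> 1 \<Longrightarrow> x < s \<Longrightarrow> pbound (ec 1 x + 1) (M * exp (- s)) (row_fn (Ew \<eta> x) i s)"
    using pbound_row_fn[of x] by auto
  have q2: "0 < (q n)\<^sup>2" "0 \<le> (q n)\<^sup>2" "(q n)\<^sup>2 \<le> 1 / 2" "(q n)\<^sup>2 \<le> 1" "q n \<le> 1" for n
  proof -
    have "(q n)\<^sup>2 \<le> (1 / 2)\<^sup>2" using q(1)[of n] q(2)[of n] by (intro power_mono) auto
    then show "(q n)\<^sup>2 \<le> 1 / 2" "(q n)\<^sup>2 \<le> 1" by (auto simp: power2_eq_square)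
  qed (use q(1)[of n] q(2)[of n] in auto)
  have lim0: "(\<lambda>n. (q n)\<^sup>2) \<longlonglongrightarrow> 0" using tendsto_power[OF q(3), of 2] by simp
  have row: "(\<lambda>n. row_fn (Ew ((q n)\<^sup>2) x) i s (cpath t)) \<longlonglongrightarrow> row_fn E0 i s (cpath t)" if "x < s" for i s t
    using Ew_tendsto[OF q(1) q2(5) q(3) that cpath_bounds(1)] by (simp add: row_fn_def E0_def)
  show ?thesis
    unfolding KK_def
  proof (rule dbl_tendsto)
    show "cbound 2 (kap ((q n)\<^sup>2) i j)" for n by (rule cbound_kap[OF q2(2,3)])
    show "pbound (ec 1 x + 1) (M * exp (- s)) (row_fn (Ew ((q n)\<^sup>2) x) i s)" for n by (rule M[OF q2(1,4) st(1)])
    show "pbound (ec 1 x + 1) (M * exp (- t)) (row_fn (Ew ((q n)\<^sup>2) x) j t)" for n by (rule M[OF q2(1,4) st(2)])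
    show "case_prod (kap 0 i j) \<in> borel_measurable (borel \<Otimes>\<^sub>M borel)" using cbound_kap[of 0] by (simp add: cbound_def)
    show "row_fn E0 i s \<in> borel_measurable borel" "row_fn E0 j t \<in> borel_measurable borel"
      by (rule row_fn_measurable_snd[OF E0_measurable])+
    show "(\<lambda>n. kap ((q n)\<^sup>2) i j (cpath a) (cpath b)) \<longlonglongrightarrow> kap 0 i j (cpath a) (cpath b)" for a b
      by (rule kap_tendsto[OF q2(2,3) lim0 cpath_bounds(1) cpath_bounds(1)])
    show "(\<lambda>n. row_fn (Ew ((q n)\<^sup>2) x) i s (cpath a)) \<longlonglongrightarrow> row_fn E0 i s (cpath a)" for a by (rule row[OF st(1)])
    show "(\<lambda>n. row_fn (Ew ((q n)\<^sup>2) x) j t (cpath a)) \<longlonglongrightarrow> row_fn E0 j t (cpath a)" for a by (rule row[OF st(2)])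
  qed
qed

lemma dbl_mult: "dbl (\<lambda>z w. a * \<kappa> z w) p q = a * dbl \<kappa> p q"
  unfolding dbl_def mult.assoc by (rule integral_mult_right_zero)

text \<open>At \<eta> = 0 the second row of the kernel is \<open>2 * z\<close> times the first
  inside the integral, while row 3 carries the factor \<open>- z\<close>. Skew-symmetry transfers
  the relation to columns.\<close>

lemma KK_0_row_3:
  defines "c \<equiv> \<lambda>i :: nat. if i = 3 then - (1 / 2) else 1 :: complex" and "l \<equiv> \<lambda>i :: nat. if i = 3 then 2 else i"
  shows "KK 0 E0 i j s t = c i * c j * KK 0 E0 (l i) (l j) s t"
proof -
  have 3: "KK 0 E0 3 j s t = - (1 / 2) * KK 0 E0 2 j s t" for j s t
  proof -
    have kk: "kap 0 3 j z w * (- z) = - (1 / 2) * kap 0 2 j z w" if "z \<noteq> 0" "w \<noteq> 0" "z + w \<noteq> 0" for z w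
    proof -
      have A: "(z - w) / (4 * z * w * r) * (- z) = - (1 / 2) * (- ((w - z) / (2 * w * r)))"
        and B: "(z - w) / (2 * z * r) * (- z) = - (1 / 2) * ((z - w) / r)" if "r \<noteq> 0" for r :: complex
        using that \<open>z \<noteq> 0\<close> \<open>w \<noteq> 0\<close> by (simp_all add: field_simps)
      have k: "k11 0 z w = (z - w) / (4 * z * w * (z + w))" "k12 0 w z = (w - z) / (2 * w * (z + w))"
        "k12 0 z w = (z - w) / (2 * z * (z + w))" "k22 0 z w = (z - w) / (z + w)"
        by (simp_all add: k11_def k12_def k22_def add.commute)
      have "kap 0 3 j z w = (if j \<in> {1, 3} then k11 0 z w else k12 0 z w)"
        "kap 0 2 j z w = (if j \<in> {1, 3} then - k12 0 w z else k22 0 z w)"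
        by (simp_all add: kap_def)
      then show ?thesis
        using A[OF that(3)] B[OF that(3)] unfolding k by (cases "j \<in> {1, 3}") (simp_all only: if_True if_False)
    qed
    have nz: "cpath a + cpath b \<noteq> 0" for a b
    proof -
      have "Re (cpath a + cpath b) \<noteq> 0" using cpath_bounds(1)[of a] cpath_bounds(1)[of b] by simp
      then show ?thesis by (metis zero_complex.sel(1))
    qed
    have k: "kap 0 3 j (cpath a) (cpath b) * (- cpath a) = - (1 / 2) * kap 0 2 j (cpath a) (cpath b)" for a b
      by (rule kk[OF cpath_bounds(3) cpath_bounds(3) nz])
    have "KK 0 E0 3 j s t = dbl (\<lambda>z w. - (1 / 2) * kap 0 2 j z w) (ex s) (row_fn E0 j t)"
      unfolding KK_def
    proof (rule dbl_cong)
      fix a b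
      have "kap 0 3 j (cpath a) (cpath b) * row_fn E0 3 s (cpath a) = (kap 0 3 j (cpath a) (cpath b) * (- cpath a)) * ex s (cpath a)"
        by (simp add: row_fn_def E0_def)
      then show "kap 0 3 j (cpath a) (cpath b) * row_fn E0 3 s (cpath a) * row_fn E0 j t (cpath b)
          = - (1 / 2) * kap 0 2 j (cpath a) (cpath b) * ex s (cpath a) * row_fn E0 j t (cpath b)"
        unfolding k by simp
    qed
    also have "\<dots> = - (1 / 2) * KK 0 E0 2 j s t" unfolding dbl_mult KK_def by (simp add: row_fn_def)
    finally show ?thesis .
  qed
  have col: "KK 0 E0 i 3 s t = - (1 / 2) * KK 0 E0 i 2 s t" for i s t
    unfolding KK_skew[of 0 E0 i 3] KK_skew[of 0 E0 i 2] 3 by simp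
  show ?thesis unfolding c_def l_def by (cases "i = 3"; cases "j = 3") (simp_all add: 3 col)
qed

section \<open>Series and limits\<close>

text \<open>A term of the Fredholm series, arranged so that the leading 1 is the term with
  \<open>k = 0\<close>.\<close>

definition cterm :: "nat \<Rightarrow> real \<Rightarrow> ((nat \<Rightarrow> real) \<Rightarrow> nat \<Rightarrow> nat \<Rightarrow> complex) \<Rightarrow> complex" where
  "cterm k x A = (- 1) ^ k / fact k * integral_over_cube k x (\<lambda>xs. pf k (A xs))"

definition dominated :: "real \<Rightarrow> real \<Rightarrow> ((nat \<Rightarrow> real) \<Rightarrow> nat \<Rightarrow> nat \<Rightarrow> complex) \<Rightarrow> bool" where
  "dominated C x A \<longleftrightarrow> (\<forall>k a b. a < 2 * k \<longrightarrow> b < 2 * k \<longrightarrow> (\<lambda>xs. A xs a b) \<in> borel_measurable (cubeM k)) \<and>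
     (\<forall>k xs a b. xs \<in> cube k x \<longrightarrow> a < 2 * k \<longrightarrow> b < 2 * k \<longrightarrow>
        cmod (A xs a b) \<le> C * exp (- xs (a div 2)) * exp (- xs (b div 2)))"

lemma integral_over_cube_0: "integral_over_cube 0 x (\<lambda>xs. 1) = 1"
proof -
  have "integral_over_cube 0 x (\<lambda>xs. 1) = of_real (LINT xs:cube 0 x|cubeM 0. \<Prod>i<0. exp (- 1 * xs i))"
    unfolding integral_over_cube_def set_lebesgue_integral_def integral_complex_of_real[symmetric]
    by (rule Bochner_Integration.integral_cong) (simp_all add: scaleR_conv_of_real)
  then show ?thesis using cube_exp(2)[of 1 0 x] by simp
qed

lemma cterm_0: "cterm 0 x A = 1"
  by (simp add: cterm_def pf_def integral_over_cube_0)

lemma fredholm_pf_eq: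
  assumes "summable (\<lambda>k. cterm k x (blk K))"
  shows "fredholm_pf K x = (\<Sum>k. cterm k x (blk K))"
proof -
  have "pfaffian (block_matrix K k xs) = pf k (blk K xs)" for k xs
    using pfaffian_mat[of k "blk K xs"] unfolding block_matrix_def blk_def .
  then have "fredholm_pf K x = 1 + (\<Sum>k. cterm (Suc k) x (blk K))"
    unfolding fredholm_pf_def cterm_def by simp
  also have "\<dots> = (\<Sum>k. cterm k x (blk K))"
    using suminf_split_head[OF assms] by (simp add: cterm_0)
  finally show ?thesis .
qed

lemma cterm_bound:
  assumes C: "0 < C" and A: "dominated C x A"
  shows "cmod (cterm k x A) \<le> pf_const k * (C * exp (- 2 * x) / 2) ^ k / fact k"
proof -
  have "cmod (integral_over_cube k x (\<lambda>xs. pf k (A xs))) \<le> pf_const k * (C * exp (- 2 * x) / 2) ^ k"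
    by (rule pf_cube_integral_bound[OF C]) (use A in \<open>auto simp: dominated_def\<close>)
  then show ?thesis
    unfolding cterm_def by (simp add: norm_mult norm_divide norm_power divide_right_mono)
qed

lemma cterm_tendsto:
  assumes C: "0 < C" and A: "\<And>s. dominated C x (A s)"
    and B: "\<And>k a b. a < 2 * k \<Longrightarrow> b < 2 * k \<Longrightarrow> (\<lambda>xs. B xs a b) \<in> borel_measurable (cubeM k)"
    and lim: "\<And>k xs a b. xs \<in> cube k x \<Longrightarrow> a < 2 * k \<Longrightarrow> b < 2 * k \<Longrightarrow> (\<lambda>s. A s xs a b) \<longlonglongrightarrow> B xs a b"
  shows "(\<lambda>s. cterm k x (A s)) \<longlonglongrightarrow> cterm k x B"
  unfolding cterm_def
proof (intro tendsto_mult tendsto_const)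
  show "(\<lambda>s. integral_over_cube k x (\<lambda>xs. pf k (A s xs))) \<longlonglongrightarrow> integral_over_cube k x (\<lambda>xs. pf k (B xs))"
    by (rule pf_cube_tendsto[OF C]) (use A B lim in \<open>auto simp: dominated_def\<close>)
qed

lemma suminf_tendsto:
  fixes a :: "nat \<Rightarrow> nat \<Rightarrow> complex"
  assumes "\<And>k. (\<lambda>s. a k s) \<longlonglongrightarrow> b k" "\<And>k s. cmod (a k s) \<le> M k" "summable M"
  shows "summable b" and "(\<lambda>s. \<Sum>k. a k s) \<longlonglongrightarrow> suminf b"
proof -
  have "eventually (\<lambda>(k, s). norm (a k s) \<le> M k) (at_top \<times>\<^sub>F sequentially)"
    using assms(2) by (intro always_eventually) auto
  from tannerys_theorem[OF assms(1) this assms(3)]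
  show "summable b" "(\<lambda>s. \<Sum>k. a k s) \<longlonglongrightarrow> suminf b" by (auto intro: summable_norm_cancel)
qed

lemma dominated_blk:
  assumes "\<And>i j. (\<lambda>p. K i j (fst p) (snd p)) \<in> borel_measurable borel"
    and "\<And>i j s t. x < s \<Longrightarrow> x < t \<Longrightarrow> cmod (K i j s t) \<le> C * exp (- s) * exp (- t)"
  shows "dominated C x (blk K)"
  unfolding dominated_def blk_def
proof (intro conjI allI impI)
  fix k a b :: nat assume ab: "a < 2 * k" "b < 2 * k"
  then show "(\<lambda>xs. K (a mod 2 + 1) (b mod 2 + 1) (xs (a div 2)) (xs (b div 2))) \<in> borel_measurable (cubeM k)"
    by (intro measurable_kernel_coordinates assms(1)) auto
next
  fix k a b :: nat and xs assume "xs \<in> cube k x" "a < 2 * k" "b < 2 * k"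
  then show "cmod (K (a mod 2 + 1) (b mod 2 + 1) (xs (a div 2)) (xs (b div 2))) \<le> C * exp (- xs (a div 2)) * exp (- xs (b div 2))"
    by (intro assms(2) cube_less) auto
qed

lemma dbl_ex_bound:
  assumes "cbound 2 \<kappa>" "x < s" "x < t"
  shows "cmod (dbl \<kappa> (ex s) (ex t)) \<le> (2 * exp (2 * x) * (cmass (ec 1 x))\<^sup>2) * exp (- s) * exp (- t)"
proof -
  have "cmod (dbl \<kappa> (ex s) (ex t)) \<le> 2 * exp (x - s) * exp (x - t) * (cmass (ec 1 x))\<^sup>2"
    by (rule dbl_bound[OF assms(1)]) (use assms in \<open>auto intro!: pbound_ex\<close>)
  also have "2 * exp (x - s) * exp (x - t) = 2 * exp (2 * x) * exp (- s) * exp (- t)"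
    by (simp add: mult.assoc flip: exp_add)
  finally show ?thesis by (simp add: mult_ac)
qed

section \<open>The limit of large \<eta>\<close>

lemma KSU22_measurable:
  assumes "0 < \<eta>" "\<eta> < a" "\<eta> < b"
  shows "(\<lambda>p. KSU22 a b \<eta> (fst p) (snd p)) \<in> borel_measurable borel"
proof -
  have "(\<lambda>p. KSU22 a b \<eta> (fst p) (snd p)) \<in> borel_measurable (borel \<Otimes>\<^sub>M borel)"
    unfolding KSU22_eq[OF assms] airy2_def Rk_def by measurable
  then show ?thesis by (simp add: borel_prod)
qed

text \<open>With vanishing diagonal blocks the matrix has the shape required by
  \<open>pf_off_diagonal\<close>, and the Pfaffian series becomes the determinant series term by
  term.\<close>

lemma cterm_K_Ai:
  "cterm k x (blk (skew_kernel (\<lambda>_ _. 0) K_Ai (\<lambda>_ _. 0)))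
    = (- 1) ^ k / fact k * integral_over_cube k x (\<lambda>xs. Determinant.det (mat k k (\<lambda>(i, j). K_Ai (xs i) (xs j))))"
proof -
  have "pf k (blk (skew_kernel (\<lambda>_ _. 0) K_Ai (\<lambda>_ _. 0)) xs) = Determinant.det (mat k k (\<lambda>(i, j). K_Ai (xs i) (xs j)))" for xs
  proof -
    let ?A = "blk (skew_kernel (\<lambda>_ _. 0) K_Ai (\<lambda>_ _. 0)) xs"
    have A: "?A a b = (if even a then if even b then 0 else K_Ai (xs (a div 2)) (xs (b div 2))
        else if even b then - K_Ai (xs (b div 2)) (xs (a div 2)) else 0)" for a b
      by (simp add: blk_def skew_kernel_def mod_2_eq_odd)
    have "pf k ?A = Determinant.det (mat k k (\<lambda>(i, j). ?A (2 * i) (2 * j + 1)))"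
    proof (rule pf_off_diagonal)
      show "?A a b = - ?A b a" for a b unfolding A by simp
      show "?A a b = 0" if "even (a + b)" for a b using that unfolding A by simp
    qed
    also have "(\<lambda>(i, j). ?A (2 * i) (2 * j + 1)) = (\<lambda>(i, j). K_Ai (xs i) (xs j))"
      unfolding A by (simp add: fun_eq_iff)
    finally show ?thesis .
  qed
  then show ?thesis unfolding cterm_def by simp
qed

lemma F_SU_at_top:
  fixes az aw bz bw :: "real \<Rightarrow> real" and x :: real
  assumes a: "\<And>\<eta>. \<eta> > 0 \<Longrightarrow> az \<eta> > - \<eta>" "\<And>\<eta>. \<eta> > 0 \<Longrightarrow> az \<eta> + aw \<eta> > 0"
    and b: "\<And>\<eta>. \<eta> > 0 \<Longrightarrow> bz \<eta> > \<eta>" "\<And>\<eta>. \<eta> > 0 \<Longrightarrow> bw \<eta> > \<eta>"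
  shows "((\<lambda>\<eta>. F_SU (az \<eta>) (aw \<eta>) (bz \<eta>) (bw \<eta>) \<eta> x) \<longlongrightarrow> F_GUE x) at_top"
proof (rule tendsto_at_topI_sequentially)
  fix X :: "nat \<Rightarrow> real" assume X: "filterlim X at_top sequentially"
  \<comment> \<open>The cap at 2 makes the bounds hold for every \<open>n\<close>, so that one
    majorant serves the whole sequence; it agrees with \<open>X\<close> eventually.\<close>
  define e where "e n = max 2 (X n)" for n
  have e2: "2 \<le> e n" "0 < e n" "0 \<le> e n" for n by (auto simp: e_def)
  have eX: "eventually (\<lambda>n. e n = X n) sequentially"
    using X[unfolded filterlim_at_top, rule_format, of 2] by eventually_elim (simp add: e_def)
  have e: "filterlim e at_top sequentially"
    by (rule filterlim_at_top_mono[OF X]) (auto simp: e_def)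
  define S where "S n = skew_kernel (KSU11 (e n)) (KSU12 (az (e n)) (aw (e n)) (e n)) (KSU22 (bz (e n)) (bw (e n)) (e n))" for n
  define L where "L = skew_kernel (\<lambda>_ _. 0) K_Ai (\<lambda>_ _. 0)"
  obtain D where D: "0 < D" "\<And>\<eta> a b s t. 2 \<le> \<eta> \<Longrightarrow> \<eta> < a \<Longrightarrow> \<eta> < b \<Longrightarrow> cmod (KSU22 a b \<eta> s t) \<le> D / \<eta> * exp (- s) * exp (- t)"
    using KSU22_bound by blast
  define C where "C = 2 * exp (2 * x) * (cmass (ec 1 x))\<^sup>2 + D"
  have C: "0 < C" "2 * exp (2 * x) * (cmass (ec 1 x))\<^sup>2 \<le> C" "D \<le> C"
    using D(1) by (auto simp: C_def add_nonneg_pos)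
  have K11: "KSU11 (e n) = (\<lambda>s t. dbl (k11 (e n)) (ex s) (ex t))" for n
    by (intro ext KSU11_dbl e2)
  have K12: "KSU12 (az (e n)) (aw (e n)) (e n) = (\<lambda>s t. dbl (k12 (e n)) (ex s) (ex t))" for n
    by (intro ext KSU12_dbl a e2)
  have K22: "cmod (KSU22 (bz (e n)) (bw (e n)) (e n) s t) \<le> D / e n * exp (- s) * exp (- t)" for n s t
    by (rule D(2)[OF e2(1) b(1)[OF e2(2)] b(2)[OF e2(2)]])
  have KC: "(2 * exp (2 * x) * (cmass (ec 1 x))\<^sup>2) * exp (- s) * exp (- t) \<le> C * exp (- s) * exp (- t)" for s t
    by (intro mult_right_mono C) auto
  have bound: "cmod (S n i j s t) \<le> C * exp (- s) * exp (- t)" if "x < s" "x < t" for n i j s t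
  proof -
    have 1: "cmod (KSU11 (e n) s t) \<le> C * exp (- s) * exp (- t)"
      unfolding K11 by (rule order.trans[OF dbl_ex_bound[OF cbound_k11[OF e2(3)] that] KC])
    have 2: "cmod (KSU12 (az (e n)) (aw (e n)) (e n) s t) \<le> C * exp (- s) * exp (- t)"
      unfolding K12 by (rule order.trans[OF dbl_ex_bound[OF cbound_k12[OF e2(3)] that] KC])
    have 3: "cmod (KSU12 (az (e n)) (aw (e n)) (e n) t s) \<le> C * exp (- s) * exp (- t)"
      unfolding K12 using order.trans[OF dbl_ex_bound[OF cbound_k12[OF e2(3)] that(2,1)] KC] by (simp only: mult_ac)
    have "D / e n \<le> D / 1" using D(1) e2[of n] by (intro divide_left_mono) auto
    then have "D / e n \<le> C" using C(3) by simp
    then have "D / e n * exp (- s) * exp (- t) \<le> C * exp (- s) * exp (- t)" by (intro mult_right_mono) auto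
    then have 4: "cmod (KSU22 (bz (e n)) (bw (e n)) (e n) s t) \<le> C * exp (- s) * exp (- t)"
      by (rule order.trans[OF K22])
    show ?thesis using 1 2 3 4 by (simp add: S_def skew_kernel_def)
  qed
  have skew_meas: "(\<lambda>p. skew_kernel K1 K2 K3 i j (fst p) (snd p)) \<in> borel_measurable borel"
    if "(\<lambda>p. K1 (fst p) (snd p)) \<in> borel_measurable borel" "(\<lambda>p. K2 (fst p) (snd p)) \<in> borel_measurable borel"
      "(\<lambda>p. K3 (fst p) (snd p)) \<in> borel_measurable borel" for K1 K2 K3 :: "real \<Rightarrow> real \<Rightarrow> complex" and i j
  proof -
    have "(\<lambda>p :: real \<times> real. (snd p, fst p)) \<in> borel_measurable borel"
      by (intro borel_measurable_continuous_onI continuous_intros)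
    from measurable_compose[OF this that(2)]
    have "(\<lambda>p. - K2 (snd p) (fst p)) \<in> borel_measurable borel" by simp
    then show ?thesis using that by (simp add: skew_kernel_def)
  qed
  have meas: "(\<lambda>p. S n i j (fst p) (snd p)) \<in> borel_measurable borel" for n i j
    unfolding S_def
  proof (rule skew_meas)
    show "(\<lambda>p. KSU11 (e n) (fst p) (snd p)) \<in> borel_measurable borel"
      unfolding K11 by (rule dbl_measurable[OF cbound_k11[OF e2(3)] ex_jointly_measurable ex_jointly_measurable])
    show "(\<lambda>p. KSU12 (az (e n)) (aw (e n)) (e n) (fst p) (snd p)) \<in> borel_measurable borel"
      unfolding K12 by (rule dbl_measurable[OF cbound_k12[OF e2(3)] ex_jointly_measurable ex_jointly_measurable])
    show "(\<lambda>p. KSU22 (bz (e n)) (bw (e n)) (e n) (fst p) (snd p)) \<in> borel_measurable borel"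
      by (rule KSU22_measurable[OF e2(2) b(1)[OF e2(2)] b(2)[OF e2(2)]])
  qed
  have Lmeas: "(\<lambda>p. L i j (fst p) (snd p)) \<in> borel_measurable borel" for i j
    unfolding L_def
    by (rule skew_meas) (use dbl_measurable[OF cbound_Ai ex_jointly_measurable ex_jointly_measurable] in \<open>simp_all add: K_Ai_dbl[abs_def]\<close>)
  have inv: "(\<lambda>n. inverse (e n)) \<longlonglongrightarrow> 0" by (rule tendsto_inverse_0_at_top[OF e])
  have pt: "pbound (ec 1 x) 1 (ex s)" if "x < s" for s
    using that by (auto intro!: pbound_mono[OF pbound_ex[of x]])
  have L11: "(\<lambda>n. dbl (k11 (e n)) (ex s) (ex t)) \<longlonglongrightarrow> 0" if st: "x < s" "x < t" for s t
  proof -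
    have "(\<lambda>n. dbl (k11 (e n)) (ex s) (ex t)) \<longlonglongrightarrow> dbl (\<lambda>_ _. 0) (ex s) (ex t)"
    proof (rule dbl_tendsto)
      show "(\<lambda>n. k11 (e n) (cpath a) (cpath b)) \<longlonglongrightarrow> 0" for a b
      proof (rule Lim_null_comparison[OF _ inv], rule always_eventually, rule allI)
        fix n
        have "cmod (k11 (e n) (cpath a) (cpath b)) \<le> 1 / (2 + 2 * e n)" by (intro norm_k11 e2 cpath_bounds)
        also have "\<dots> \<le> 1 / e n" using e2[of n] by (intro divide_left_mono) auto
        finally show "norm (k11 (e n) (cpath a) (cpath b)) \<le> inverse (e n)" by (simp add: inverse_eq_divide)
      qed
    qed (use cbound_k11[OF e2(3)] pt st in auto)
    then show ?thesis by (simp add: dbl_def)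
  qed
  have L12: "(\<lambda>n. dbl (k12 (e n)) (ex s) (ex t)) \<longlonglongrightarrow> K_Ai s t" if st: "x < s" "x < t" for s t
    unfolding K_Ai_dbl
  proof (rule dbl_tendsto)
    show "(\<lambda>n. k12 (e n) (cpath a) (cpath b)) \<longlonglongrightarrow> 1 / (cpath a + cpath b)" for a b
    proof -
      have "(\<lambda>n. 1 / (2 * (cpath a + of_real (e n)))) \<longlonglongrightarrow> 0"
      proof (rule Lim_null_comparison[OF _ inv], rule always_eventually, rule allI)
        fix n
        have "1 + e n \<le> cmod (cpath a + of_real (e n))" using cpath_bounds(1)[of a] by (intro Re_ge_norm) auto
        then have "e n \<le> 2 * cmod (cpath a + of_real (e n))" using e2(3)[of n] by linarith
        then have "1 / (2 * cmod (cpath a + of_real (e n))) \<le> 1 / e n" using e2(2)[of n] by (intro frac_le) auto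
        then show "norm (1 / (2 * (cpath a + of_real (e n)))) \<le> inverse (e n)"
          unfolding norm_divide norm_mult by (simp add: inverse_eq_divide)
      qed
      from tendsto_diff[OF tendsto_const this, of "1 / (cpath a + cpath b)"] show ?thesis
        by (simp only: k12_split[OF e2(3) cpath_bounds(1) cpath_bounds(1)] diff_zero)
    qed
    show "cbound 2 (k12 (e n))" for n by (rule cbound_k12[OF e2(3)])
    show "case_prod (\<lambda>z w. 1 / (z + w) :: complex) \<in> borel_measurable (borel \<Otimes>\<^sub>M borel)" using cbound_Ai by (simp add: cbound_def)
  qed (use pt st in auto)
  have L22: "(\<lambda>n. KSU22 (bz (e n)) (bw (e n)) (e n) s t) \<longlonglongrightarrow> 0" for s t
  proof (rule Lim_null_comparison[of _ "\<lambda>n. D * exp (- s) * exp (- t) * inverse (e n)"])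
    show "eventually (\<lambda>n. norm (KSU22 (bz (e n)) (bw (e n)) (e n) s t) \<le> D * exp (- s) * exp (- t) * inverse (e n)) sequentially"
    proof (rule always_eventually, rule allI)
      fix n
      have "D / e n * exp (- s) * exp (- t) = D * exp (- s) * exp (- t) * inverse (e n)" by (simp add: divide_inverse)
      then show "norm (KSU22 (bz (e n)) (bw (e n)) (e n) s t) \<le> D * exp (- s) * exp (- t) * inverse (e n)" using K22[of n s t] by simp
    qed
    show "(\<lambda>n. D * exp (- s) * exp (- t) * inverse (e n)) \<longlonglongrightarrow> 0" by (rule tendsto_mult_right_zero[OF inv])
  qed
  have lim: "(\<lambda>n. S n i j s t) \<longlonglongrightarrow> L i j s t" if "x < s" "x < t" for i j s t
    using L11[OF that] L12[OF that] tendsto_minus[OF L12[OF that(2,1)]] L22[of s t]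
    unfolding S_def L_def skew_kernel_def K11 K12 by simp
  have dom: "dominated C x (blk (S n))" for n
    by (rule dominated_blk[OF meas bound])
  have lim': "(\<lambda>n. cterm k x (blk (S n))) \<longlonglongrightarrow> cterm k x (blk L)" for k
  proof (rule cterm_tendsto[OF C(1) dom])
    show "(\<lambda>xs. blk L xs a b) \<in> borel_measurable (cubeM k)" if "a < 2 * k" "b < 2 * k" for k a b
      unfolding blk_def using that by (intro measurable_kernel_coordinates Lmeas) auto
    show "(\<lambda>n. blk (S n) xs a b) \<longlonglongrightarrow> blk L xs a b" if "xs \<in> cube k x" "a < 2 * k" "b < 2 * k" for k xs a b
      unfolding blk_def using that by (intro lim cube_less) auto
  qed
  have sM: "summable (\<lambda>k. pf_const k * (C * exp (- 2 * x) / 2) ^ k / fact k)"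
    by (rule summable_pf_const) (use C(1) in simp)
  note T = suminf_tendsto[OF lim' cterm_bound[OF C(1) dom] sM]
  have "fredholm_pf (S n) x = (\<Sum>k. cterm k x (blk (S n)))" for n
    by (rule fredholm_pf_eq, rule summable_comparison_test'[OF sM, of 0]) (rule cterm_bound[OF C(1) dom])
  moreover have "F_GUE x = (\<Sum>k. cterm k x (blk L))"
  proof -
    have "F_GUE x = 1 + (\<Sum>k. cterm (Suc k) x (blk L))"
      unfolding F_GUE_def fredholm_det_def L_def cterm_K_Ai ..
    also have "\<dots> = (\<Sum>k. cterm k x (blk L))"
      using suminf_split_head[OF T(1)] by (simp add: cterm_0)
    finally show ?thesis .
  qed
  ultimately have "(\<lambda>n. F_SU (az (e n)) (aw (e n)) (bz (e n)) (bw (e n)) (e n) x) \<longlonglongrightarrow> F_GUE x"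
    using T(2) unfolding F_SU_def S_def by simp
  then show "(\<lambda>n. F_SU (az (X n)) (aw (X n)) (bz (X n)) (bw (X n)) (X n) x) \<longlonglongrightarrow> F_GUE x"
    by (rule Lim_transform_eventually) (use eX in \<open>eventually_elim, simp\<close>)
qed

section \<open>Reordering of the double series and the limit of small \<eta>\<close>

lemma sums_regroup:
  fixes t :: "nat \<Rightarrow> nat \<Rightarrow> complex"
  assumes bound: "\<And>n. (\<Sum>m\<le>n. cmod (t n m)) \<le> M n" and M: "summable M"
  shows "(\<lambda>k. \<Sum>m | 2 * m \<le> k. t (k - m) m) sums (\<Sum>n. \<Sum>m\<le>n. t n m)"
proof -
  let ?S = "Sigma UNIV (\<lambda>n. {..n})" and ?T = "Sigma UNIV (\<lambda>k. {m. 2 * m \<le> k})"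
  have "(\<lambda>n. \<Sum>m\<le>n. cmod (t n m)) summable_on UNIV"
  proof (rule summable_nonneg_imp_summable_on)
    show "summable (\<lambda>n. \<Sum>m\<le>n. cmod (t n m))"
      by (rule summable_comparison_test'[OF M, of 0]) (use bound in \<open>simp add: sum_nonneg\<close>)
  qed (simp add: sum_nonneg)
  then have "(\<lambda>p. cmod (t (fst p) (snd p))) summable_on ?S"
    by (intro summable_on_SigmaI[where g = "\<lambda>n. \<Sum>m\<le>n. cmod (t n m)"]) (auto intro!: has_sum_finiteI)
  then have "(\<lambda>p. t (fst p) (snd p)) summable_on ?S" by (rule abs_summable_summable)
  then obtain V where V: "((\<lambda>p. t (fst p) (snd p)) has_sum V) ?S" unfolding summable_on_def by blast
  have 1: "((\<lambda>n. \<Sum>m\<le>n. t n m) has_sum V) UNIV"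
    by (rule has_sum_SigmaD[OF V]) (auto intro!: has_sum_finiteI)
  \<comment> \<open>With \<open>k = n + m\<close> the condition \<open>m \<le> n\<close> becomes
    \<open>2 * m \<le> k\<close>, so both orders of summation run over the same absolutely summable
    family.\<close>
  have "bij_betw (\<lambda>p :: nat \<times> nat. (fst p - snd p, snd p)) ?T ?S"
    by (rule bij_betw_byWitness[where f' = "\<lambda>p. (fst p + snd p, snd p)"]) auto
  from has_sum_reindex_bij_betw[OF this, of "\<lambda>p. t (fst p) (snd p)"] V
  have V': "((\<lambda>p. t (fst p - snd p) (snd p)) has_sum V) ?T" by simp
  have "((\<lambda>k. \<Sum>m | 2 * m \<le> k. t (k - m) m) has_sum V) UNIV"
  proof (rule has_sum_SigmaD[OF V'])
    fix k :: nat
    have "finite {m. 2 * m \<le> k}" by (rule finite_subset[of _ "{..k}"]) auto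
    then show "((\<lambda>m. t (fst (k, m) - snd (k, m)) (snd (k, m))) has_sum (\<Sum>m | 2 * m \<le> k. t (k - m) m)) {m. 2 * m \<le> k}"
      by (intro has_sum_finiteI) auto
  qed
  moreover have "V = (\<Sum>n. \<Sum>m\<le>n. t n m)" using has_sum_imp_sums[OF 1] by (simp add: sums_iff)
  ultimately show ?thesis by (simp add: has_sum_imp_sums)
qed

text \<open>What the term with \<open>n + m\<close> points and \<open>m\<close> factors R becomes
  after integration: \<open>m\<close> of the \<open>n\<close> remaining points carry the rows 1 and
  3. The weight is that of \<open>cube_pf_expansion\<close>, where
  \<open>k - 2 * m = n - m\<close>.\<close>

definition lterm :: "(nat \<Rightarrow> nat \<Rightarrow> real \<Rightarrow> real \<Rightarrow> complex) \<Rightarrow> real \<Rightarrow> nat \<Rightarrow> nat \<Rightarrow> complex" where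
  "lterm \<kappa> x n m = (- 1) ^ n / (fact m * fact (n - m)) * integral_over_cube n x (\<lambda>xs. pf n (lab \<kappa> m xs))"

lemma lab_measurable:
  assumes "\<And>i j. (\<lambda>p. \<kappa> i j (fst p) (snd p)) \<in> borel_measurable borel" "a < 2 * k" "b < 2 * k"
  shows "(\<lambda>xs. lab \<kappa> m xs a b) \<in> borel_measurable (cubeM k)"
  unfolding lab_def using assms(2,3) by (intro measurable_kernel_coordinates assms(1)) auto

lemma sum_inverse_fact: "(\<Sum>m\<le>n. z ^ m / (fact m * fact (n - m))) = (1 + z) ^ n / (fact n :: 'a :: field_char_0)"
proof -
  have "(1 + z) ^ n / fact n = (\<Sum>m\<le>n. of_nat (n choose m) * z ^ m / fact n)"
    using binomial_ring[of z 1 n] by (simp add: add.commute sum_divide_distrib)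
  also have "\<dots> = (\<Sum>m\<le>n. z ^ m / (fact m * fact (n - m)))"
    by (rule sum.cong) (simp_all add: binomial_fact)
  finally show ?thesis by simp
qed

text \<open>The weights sum to \<open>2 ^ n / fact n\<close>. The power of 2 is paid for by the cube
  integral, where decay at rate 2 gives one factor 1 / 2 per point.\<close>

lemma lterm_sum_bound:
  assumes C: "0 < C" and m: "\<And>i j. (\<lambda>p. \<kappa> i j (fst p) (snd p)) \<in> borel_measurable borel"
    and b: "\<And>i j s t. x < s \<Longrightarrow> x < t \<Longrightarrow> cmod (\<kappa> i j s t) \<le> C * exp (- s) * exp (- t)"
  shows "(\<Sum>m\<le>n. cmod (lterm \<kappa> x n m)) \<le> pf_const n * (C * exp (- 2 * x)) ^ n / fact n"
proof -
  let ?B = "pf_const n * (C * exp (- 2 * x) / 2) ^ n"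
  have "cmod (integral_over_cube n x (\<lambda>xs. pf n (lab \<kappa> m xs))) \<le> ?B" for m
  proof (rule pf_cube_integral_bound[OF C lab_measurable[OF assms(2)]])
    fix xs a b assume "xs \<in> cube n x" "a < 2 * n" "b < 2 * n"
    then show "cmod (lab \<kappa> m xs a b) \<le> C * exp (- xs (a div 2)) * exp (- xs (b div 2))"
      unfolding lab_def by (intro assms(3) cube_less) auto
  qed
  then have "cmod (lterm \<kappa> x n m) \<le> ?B * (1 ^ m / (fact m * fact (n - m)))" for m
    unfolding lterm_def by (simp add: norm_mult norm_divide norm_power divide_right_mono)
  then have "(\<Sum>m\<le>n. cmod (lterm \<kappa> x n m)) \<le> (\<Sum>m\<le>n. ?B * (1 ^ m / (fact m * fact (n - m))))" by (intro sum_mono)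
  also have "\<dots> = ?B * ((1 + 1) ^ n / fact n)" unfolding sum_distrib_left[symmetric] sum_inverse_fact ..
  also have "\<dots> = pf_const n * (C * exp (- 2 * x)) ^ n / fact n" by (simp add: power_divide)
  finally show ?thesis .
qed

text \<open>An identity at fixed \<eta>, where all sums and integrals converge absolutely. Only the
  terms on the right admit bounds uniform in \<eta>.\<close>

lemma F_SU_expansion:
  assumes \<eta>: "0 < \<eta>" "\<eta> \<le> 1 / 2" and a: "- \<eta> < az" "0 < az + aw" and b: "\<eta> < bz" "\<eta> < bw"
  shows "F_SU az aw bz bw \<eta> x = (\<Sum>n. \<Sum>m\<le>n. lterm (KK \<eta> (Ew \<eta> x)) x n m)"
proof -
  let ?\<kappa> = "KK \<eta> (Ew \<eta> x)"
  define R where "R s t = complex_of_real (Rk \<eta> s t)" for s t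
  define S where "S = skew_kernel (KSU11 \<eta>) (KSU12 az aw \<eta>) (KSU22 bz bw \<eta>)"
  have \<eta>0: "0 \<le> \<eta>" using \<eta> by simp
  obtain C where C: "0 < C" "\<And>i j s t. x < s \<Longrightarrow> x < t \<Longrightarrow> cmod (?\<kappa> i j s t) \<le> C * exp (- s) * exp (- t)"
    using KK_bound[of x] \<eta> by blast
  have \<kappa>m: "(\<lambda>p. ?\<kappa> i j (fst p) (snd p)) \<in> borel_measurable borel" for i j
    by (rule KK_measurable[OF \<eta>0 \<eta>(2) Ew_measurable])
  have Rm: "(\<lambda>p. R (fst p) (snd p)) \<in> borel_measurable borel"
    unfolding R_def using Rk_measurable by measurable
  define D where "D = (1 + 8 * \<eta>) / (2 * \<eta> * sqrt (8 * pi * \<eta>)) * exp (2 * \<eta> ^ 3 / 3)"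
  have D: "0 \<le> D" unfolding D_def using \<eta> by simp
  have RD: "cmod (R s t) \<le> D * exp (- \<eta> * s) * exp (- \<eta> * t)" for s t
    unfolding R_def D_def norm_of_real by (rule Rk_bound[OF \<eta>(1)])
  have S: "blk S xs u v = blk ?\<kappa> xs u v + oddR R xs u v" for xs u v
  proof -
    have 1: "KSU11 \<eta> s t = ?\<kappa> 1 1 s t" for s t
      unfolding KSU11_dbl[OF \<eta>0] by (simp add: KK_def kap_def row_fn_def)
    have 2: "KSU12 az aw \<eta> s t = ?\<kappa> 1 2 s t" for s t
      unfolding KSU12_dbl[OF \<eta>(1) a] by (simp add: KK_def kap_def row_fn_def)
    have 3: "- KSU12 az aw \<eta> t s = ?\<kappa> 2 1 s t" for s t
      unfolding 2 using KK_skew[of \<eta> "Ew \<eta> x" 2 1 s t] by simp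
    have 4: "KSU22 bz bw \<eta> s t = ?\<kappa> 2 2 s t + R s t" for s t
      unfolding KSU22_dbl[OF \<eta> b] by (simp add: KK_def kap_def row_fn_def R_def)
    have "u mod 2 + 1 = (if even u then 1 else 2)" "v mod 2 + 1 = (if even v then 1 else 2)"
      by (auto simp: mod_2_eq_odd)
    then show ?thesis
      unfolding blk_def oddR_def S_def skew_kernel_def using 1 2 3 4 by simp
  qed
  have term_eq: "cterm k x (blk S) = (\<Sum>m | 2 * m \<le> k. lterm ?\<kappa> x (k - m) m)" for k
  proof -
    \<comment> \<open>The available bound for R decays only at rate \<eta>, so the rate of the other
      entries is lowered from 1 to \<eta> at the price of powers of
      \<open>exp \<bar>x\<bar>\<close>.\<close>
    define G where "G = C * exp (2 * \<bar>x\<bar>) + D"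
    have G: "0 \<le> G" "D \<le> G" using C(1) D by (auto simp: G_def)
    have ee: "exp (- s) \<le> exp \<bar>x\<bar> * exp (- \<eta> * s)" if "x < s" for s
    proof -
      have "(1 - \<eta>) * x \<le> (1 - \<eta>) * s" using \<eta> that by (intro mult_left_mono) auto
      moreover have "- \<bar>x\<bar> \<le> (1 - \<eta>) * x"
      proof -
        have "\<bar>(1 - \<eta>) * x\<bar> \<le> 1 * \<bar>x\<bar>" unfolding abs_mult using \<eta> by (intro mult_right_mono) auto
        then show ?thesis by linarith
      qed
      ultimately show ?thesis unfolding exp_add[symmetric] by (simp add: algebra_simps)
    qed
    have Kb: "cmod (?\<kappa> i j s t) \<le> G * exp (- \<eta> * s) * exp (- \<eta> * t)" if "x < s" "x < t" for i j s t
    proof -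
      have "cmod (?\<kappa> i j s t) \<le> C * exp (- s) * exp (- t)" by (rule C(2)[OF that])
      also have "\<dots> \<le> C * (exp \<bar>x\<bar> * exp (- \<eta> * s)) * (exp \<bar>x\<bar> * exp (- \<eta> * t))"
        using C(1) by (intro mult_mono mult_left_mono ee that) auto
      also have "\<dots> = C * exp (2 * \<bar>x\<bar>) * exp (- \<eta> * s) * exp (- \<eta> * t)"
      proof -
        have "exp \<bar>x\<bar> * exp \<bar>x\<bar> = exp (2 * \<bar>x\<bar>)" unfolding exp_add[symmetric] by simp
        then show ?thesis by (simp only: mult_ac) (metis mult.assoc mult.commute mult.left_commute)
      qed
      also have "\<dots> \<le> G * exp (- \<eta> * s) * exp (- \<eta> * t)" using D by (intro mult_right_mono) (auto simp: G_def)
      finally show ?thesis .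
    qed
    have Rb: "cmod (R s t) \<le> G * exp (- \<eta> * s) * exp (- \<eta> * t)" for s t
      by (rule order.trans[OF RD]) (intro mult_right_mono G; simp)
    have "cterm k x (blk S) = (- 1) ^ k / fact k * integral_over_cube k x (\<lambda>xs. pf k (\<lambda>a b. blk ?\<kappa> xs a b + oddR R xs a b))"
      unfolding cterm_def by (simp only: S flip: S)
    also have "\<dots> = (\<Sum>m | 2 * m \<le> k. (- 1) ^ (k - m) / (fact m * fact (k - 2 * m)) *
      integral_over_cube k x (\<lambda>xs. (\<Prod>i<m. R (xs i) (xs (k - m + i)) / 2) *
        pf (k - m) (\<lambda>a b. blk ?\<kappa> xs (cross (k - m) m a) (cross (k - m) m b))))"
      by (rule cube_pf_expansion[OF \<kappa>m Rm \<eta>(1) G(1) Kb Rb])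
    also have "\<dots> = (\<Sum>m | 2 * m \<le> k. lterm ?\<kappa> x (k - m) m)"
    proof (rule sum.cong[OF refl])
      fix m assume "m \<in> {m. 2 * m \<le> k}"
      then have m: "m \<le> k - m" "k - m + m = k" "k - m - m = k - 2 * m" by auto
      have "integral_over_cube (k - m + m) x (\<lambda>xs. (\<Prod>i<m. R (xs i) (xs (k - m + i)) / 2) *
          pf (k - m) (\<lambda>a b. blk ?\<kappa> xs (cross (k - m) m a) (cross (k - m) m b)))
        = integral_over_cube (k - m) x (\<lambda>xs. pf (k - m) (lab ?\<kappa> m xs))"
      \<comment> \<open>R enters here through a constant bound to the right of \<open>x\<close>;
        decay in the integrated points is supplied by the rows of the kernel.\<close>
      proof (rule row_integration[where r = "\<lambda>s t. R s t / 2" and D = "D * exp (\<bar>x\<bar>) * exp (\<bar>x\<bar>)"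
            and d = "\<lambda>s. \<integral>y. indicator {x<..} y *\<^sub>R (R s y / 2) \<partial>lborel", OF KK_skew \<kappa>m _ C(1) _ C(2) _ _ m(1)])
        show "(\<lambda>p. R (fst p) (snd p) / 2) \<in> borel_measurable borel" using Rm by measurable
        show "0 \<le> D * exp \<bar>x\<bar> * exp \<bar>x\<bar>" using D by simp
        have ex: "exp (- \<eta> * s) \<le> exp \<bar>x\<bar>" if "x < s" for s
        proof -
          have "\<eta> * x \<le> \<eta> * s" using \<eta> that by (intro mult_left_mono) auto
          moreover have "\<bar>\<eta> * x\<bar> \<le> 1 * \<bar>x\<bar>" unfolding abs_mult using \<eta> by (intro mult_right_mono) auto
          ultimately have "- \<eta> * s \<le> \<bar>x\<bar>" by (simp add: abs_le_iff)
          then show ?thesis by simp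
        qed
        show "cmod (R s t / 2) \<le> D * exp \<bar>x\<bar> * exp \<bar>x\<bar>" if "x < s" "x < t" for s t
        proof -
          have "cmod (R s t / 2) \<le> cmod (R s t)" by (simp add: norm_divide)
          also have "\<dots> \<le> D * exp (- \<eta> * s) * exp (- \<eta> * t)" by (rule RD)
          also have "\<dots> \<le> D * exp \<bar>x\<bar> * exp \<bar>x\<bar>" using D by (intro mult_mono ex that mult_left_mono) auto
          finally show ?thesis .
        qed
        show "?\<kappa> 3 j s t = (\<integral>y. indicator {x<..} y *\<^sub>R (R s y / 2 * ?\<kappa> 1 j y t) \<partial>lborel)
            - (\<integral>y. indicator {x<..} y *\<^sub>R (R s y / 2) \<partial>lborel) * ?\<kappa> 1 j s t" if "x < s" "x < t" for j s t
          using KK_row[OF \<eta> that, of j] by (simp add: R_def)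
      qed
      then show "(- 1) ^ (k - m) / (fact m * fact (k - 2 * m)) *
          integral_over_cube k x (\<lambda>xs. (\<Prod>i<m. R (xs i) (xs (k - m + i)) / 2) *
            pf (k - m) (\<lambda>a b. blk ?\<kappa> xs (cross (k - m) m a) (cross (k - m) m b))) = lterm ?\<kappa> x (k - m) m"
        unfolding lterm_def m(2,3) by (simp only:)
    qed
    finally show ?thesis .
  qed
  have "summable (\<lambda>n. pf_const n * (C * exp (- 2 * x)) ^ n / fact n)"
    by (rule summable_pf_const) (use C(1) in simp)
  from sums_regroup[OF lterm_sum_bound[OF C(1) \<kappa>m C(2)] this]
  have s: "(\<lambda>k. cterm k x (blk S)) sums (\<Sum>n. \<Sum>m\<le>n. lterm ?\<kappa> x n m)" unfolding term_eq .
  have "F_SU az aw bz bw \<eta> x = (\<Sum>k. cterm k x (blk S))"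
    unfolding F_SU_def S_def[symmetric] by (rule fredholm_pf_eq[OF sums_summable[OF s]])
  then show ?thesis using s by (simp add: sums_iff)
qed

text \<open>By \<open>KK_0_row_3\<close> each of the \<open>m\<close> rows with label 3 is minus one
  half of the row 2 at its point, and these scalars leave the Pfaffian by
  \<open>pf_scale\<close>.\<close>

lemma lterm_0: "lterm (KK 0 E0) x n m = ((- (1 / 2)) ^ m / (fact m * fact (n - m))) * ((- 1) ^ n * integral_over_cube n x (\<lambda>xs. pf n (blk (KK 0 E0) xs)))"
  if "m \<le> n"
proof -
  define c where "c a = (if odd a \<and> a div 2 < m then - (1 / 2) else 1 :: complex)" for a :: nat
  have "pf n (lab (KK 0 E0) m xs) = (- (1 / 2)) ^ m * pf n (blk (KK 0 E0) xs)" for xs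
  proof -
    have "lab (KK 0 E0) m xs a b = c a * c b * blk (KK 0 E0) xs a b" for a b
    proof -
      let ?l = "\<lambda>a :: nat. if even a then 1 else if a div 2 < m then 3 else 2 :: nat"
      have c: "(if ?l a = 3 then - (1 / 2) else 1) = c a" "(if ?l a = 3 then 2 else ?l a) = a mod 2 + 1" for a
        by (auto simp: c_def mod_2_eq_odd)
      show ?thesis
        unfolding lab_def blk_def KK_0_row_3[of "?l a" "?l b"] c ..
    qed
    then have "pf n (lab (KK 0 E0) m xs) = (\<Prod>a<2 * n. c a) * pf n (blk (KK 0 E0) xs)"
      unfolding pf_scale[symmetric] by (intro pf_cong) simp
    also have "(\<Prod>a<2 * n. c a) = (\<Prod>i = 0..<n. if i < m then - (1 / 2) else 1)"
      unfolding prod_pairs by (rule prod.cong) (auto simp: c_def)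
    also have "\<dots> = (\<Prod>i = 0..<m. - (1 / 2))"
      using that by (intro prod.mono_neutral_cong_right) auto
    also have "\<dots> = (- (1 / 2)) ^ m" by simp
    finally show ?thesis .
  qed
  then show ?thesis unfolding lterm_def by (simp add: cube_mult)
qed

text \<open>The GSE kernel is the kernel at \<eta> = 0 with second row and column halved, which
  yields one factor 1 / 2 per point.\<close>

lemma cterm_GSE:
  assumes K: "K = skew_kernel
     (double_airy_integral 1 1 (\<lambda>z w. (z - w) / (4 * z * w * (z + w))))
     (double_airy_integral 1 1 (\<lambda>z w. (z - w) / (4 * z * (z + w))))
     (double_airy_integral 1 1 (\<lambda>z w. (z - w) / (4 * (z + w))))"
  shows "cterm n x (blk K) = (1 / 2) ^ n / fact n * ((- 1) ^ n * integral_over_cube n x (\<lambda>xs. pf n (blk (KK 0 E0) xs)))"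
proof -
  have cb: "cbound 2 (\<lambda>z w. c * \<kappa> z w)" if "cbound 2 \<kappa>" "cmod c \<le> 1" for c \<kappa>
    unfolding cbound_def
  proof (intro conjI allI)
    have [measurable]: "case_prod \<kappa> \<in> borel_measurable (borel \<Otimes>\<^sub>M borel)" using that by (simp add: cbound_def)
    have "(\<lambda>p. c * case_prod \<kappa> p) \<in> borel_measurable (borel \<Otimes>\<^sub>M borel)" by measurable
    then show "(\<lambda>(z, w). c * \<kappa> z w) \<in> borel_measurable (borel \<Otimes>\<^sub>M borel)" by (simp add: case_prod_unfold)
    fix t s
    have "cmod (c * \<kappa> (cpath t) (cpath s)) \<le> 1 * (2 * (1 + \<bar>t\<bar>) * (1 + \<bar>s\<bar>))"
      unfolding norm_mult using that by (intro mult_mono) (auto simp: cbound_def)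
    then show "cmod (c * \<kappa> (cpath t) (cpath s)) \<le> 2 * (1 + \<bar>t\<bar>) * (1 + \<bar>s\<bar>)" by simp
  qed simp
  have 11: "double_airy_integral 1 1 (\<lambda>z w. (z - w) / (4 * z * w * (z + w))) s t = KK 0 E0 1 1 s t" for s t
  proof -
    have "(\<lambda>z w. (z - w) / (4 * z * w * (z + w))) = k11 0" by (simp add: k11_def fun_eq_iff)
    then show ?thesis
      using double_airy_eq_dbl[OF cbound_k11[of 0], of s t] by (simp add: KK_def kap_def row_fn_def)
  qed
  have 12: "double_airy_integral 1 1 (\<lambda>z w. (z - w) / (4 * z * (z + w))) s t = 1 / 2 * KK 0 E0 1 2 s t" for s t
  proof -
    have "(\<lambda>z w. (z - w) / (4 * z * (z + w))) = (\<lambda>z w. 1 / 2 * k12 0 z w)" by (simp add: k12_def fun_eq_iff)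
    then show ?thesis
      using double_airy_eq_dbl[OF cb[OF cbound_k12[of 0], of "1 / 2"], of s t]
      by (simp only: dbl_mult) (simp add: KK_def kap_def row_fn_def)
  qed
  have 22: "double_airy_integral 1 1 (\<lambda>z w. (z - w) / (4 * (z + w))) s t = 1 / 4 * KK 0 E0 2 2 s t" for s t
  proof -
    have "(\<lambda>z w. (z - w) / (4 * (z + w))) = (\<lambda>z w. 1 / 4 * k22 0 z w)" by (simp add: k22_def fun_eq_iff)
    then show ?thesis
      using double_airy_eq_dbl[OF cb[OF cbound_k22[of 0], of "1 / 4"], of s t]
      by (simp only: dbl_mult) (simp add: KK_def kap_def row_fn_def)
  qed
  define d where "d a = (if odd a then 1 / 2 else 1 :: complex)" for a :: nat
  have "blk K xs a b = d a * d b * blk (KK 0 E0) xs a b" for xs a b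
  proof -
    have m: "a mod 2 + 1 = (if even a then 1 else 2)" for a :: nat by (auto simp: mod_2_eq_odd)
    show ?thesis
      unfolding blk_def K skew_kernel_def m 11 12 22 d_def
      using KK_skew[of 0 E0 2 1 "xs (a div 2)" "xs (b div 2)"] by simp
  qed
  then have "pf n (blk K xs) = (\<Prod>a<2 * n. d a) * pf n (blk (KK 0 E0) xs)" for xs
    unfolding pf_scale[symmetric] by (intro pf_cong) simp
  moreover have "(\<Prod>a<2 * n. d a) = (1 / 2) ^ n"
    unfolding prod_pairs by (simp add: d_def)
  ultimately have "pf n (blk K xs) = (1 / 2) ^ n * pf n (blk (KK 0 E0) xs)" for xs by simp
  then show ?thesis unfolding cterm_def by (simp add: cube_mult)
qed

lemma F_SU_at_right_0:
  fixes az aw bz bw :: "real \<Rightarrow> real" and x :: real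
  assumes a: "\<And>\<eta>. \<eta> > 0 \<Longrightarrow> az \<eta> > - \<eta>" "\<And>\<eta>. \<eta> > 0 \<Longrightarrow> az \<eta> + aw \<eta> > 0"
    and b: "\<And>\<eta>. \<eta> > 0 \<Longrightarrow> bz \<eta> > \<eta>" "\<And>\<eta>. \<eta> > 0 \<Longrightarrow> bw \<eta> > \<eta>"
  shows "((\<lambda>\<eta>. F_SU (az \<eta>) (aw \<eta>) (bz \<eta>) (bw \<eta>) \<eta> x) \<longlongrightarrow> F_GSE x) (at_right 0)"
proof (rule tendsto_at_right_sequentially[of 0 "1 / 4"])
  fix S :: "nat \<Rightarrow> real" assume S: "\<And>n. 0 < S n" "\<And>n. S n < 1 / 4" "S \<longlonglongrightarrow> 0"
  \<comment> \<open>The square root is the order of the width of R, hence the parameter in which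
    \<open>KK_tendsto\<close> is stated; starting below 1 / 4 gives
    \<open>q n \<le> 1 / 2\<close>.\<close>
  define q where "q n = sqrt (S n)" for n
  have q: "0 < q n" "q n \<le> 1 / 2" "(q n)\<^sup>2 = S n" for n
  proof -
    show "0 < q n" "(q n)\<^sup>2 = S n" using S(1)[of n] by (auto simp: q_def)
    have "sqrt (S n) \<le> sqrt ((1 / 2)\<^sup>2)" using S(2)[of n] by (intro real_sqrt_le_mono) (simp add: power2_eq_square)
    then show "q n \<le> 1 / 2" by (simp add: q_def real_sqrt_abs)
  qed
  have q0: "q \<longlonglongrightarrow> 0" unfolding q_def using tendsto_real_sqrt[OF S(3)] by simp
  have S2: "0 \<le> S n" "S n \<le> 1 / 2" for n using S(1,2)[of n] by auto
  define \<kappa> where "\<kappa> n = KK (S n) (Ew (S n) x)" for n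
  obtain C where C: "0 < C" "\<And>n i j s t. x < s \<Longrightarrow> x < t \<Longrightarrow> cmod (\<kappa> n i j s t) \<le> C * exp (- s) * exp (- t)"
    using KK_bound[of x] S(1) S2(2) unfolding \<kappa>_def by blast
  have \<kappa>m: "(\<lambda>p. \<kappa> n i j (fst p) (snd p)) \<in> borel_measurable borel" for n i j
    unfolding \<kappa>_def by (rule KK_measurable[OF S2 Ew_measurable])
  have \<kappa>0m: "(\<lambda>p. KK 0 E0 i j (fst p) (snd p)) \<in> borel_measurable borel" for i j
    by (rule KK_measurable[OF _ _ E0_measurable]) auto
  have lim: "(\<lambda>n. \<kappa> n i j s t) \<longlonglongrightarrow> KK 0 E0 i j s t" if "x < s" "x < t" for i j s t
    using KK_tendsto[OF q(1,2) q0 that] unfolding q(3) \<kappa>_def .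
  have lt: "(\<lambda>s. lterm (\<kappa> s) x n m) \<longlonglongrightarrow> lterm (KK 0 E0) x n m" for n m
    unfolding lterm_def
  proof (intro tendsto_mult tendsto_const pf_cube_tendsto[OF C(1)])
    show "(\<lambda>xs. lab (\<kappa> s) m xs a b) \<in> borel_measurable (cubeM n)" if "a < 2 * n" "b < 2 * n" for s a b
      by (rule lab_measurable[OF \<kappa>m that])
    show "(\<lambda>xs. lab (KK 0 E0) m xs a b) \<in> borel_measurable (cubeM n)" if "a < 2 * n" "b < 2 * n" for a b
      by (rule lab_measurable[OF \<kappa>0m that])
    show "cmod (lab (\<kappa> s) m xs a b) \<le> C * exp (- xs (a div 2)) * exp (- xs (b div 2))"
      if "xs \<in> cube n x" "a < 2 * n" "b < 2 * n" for s xs a b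
      unfolding lab_def using that by (intro C(2) cube_less) auto
    show "(\<lambda>s. lab (\<kappa> s) m xs a b) \<longlonglongrightarrow> lab (KK 0 E0) m xs a b"
      if "xs \<in> cube n x" "a < 2 * n" "b < 2 * n" for xs a b
      unfolding lab_def using that by (intro lim cube_less) auto
  qed
  have l: "(\<lambda>s. \<Sum>m\<le>n. lterm (\<kappa> s) x n m) \<longlonglongrightarrow> (\<Sum>m\<le>n. lterm (KK 0 E0) x n m)" for n
    by (intro tendsto_sum lt)
  have bd: "cmod (\<Sum>m\<le>n. lterm (\<kappa> s) x n m) \<le> pf_const n * (C * exp (- 2 * x)) ^ n / fact n" for n s
    by (rule order.trans[OF norm_sum lterm_sum_bound[OF C(1) \<kappa>m C(2)]])
  have "summable (\<lambda>n. pf_const n * (C * exp (- 2 * x)) ^ n / fact n)"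
    by (rule summable_pf_const) (use C(1) in simp)
  note T = suminf_tendsto[OF l bd this]
  have F: "F_SU (az (S s)) (aw (S s)) (bz (S s)) (bw (S s)) (S s) x = (\<Sum>n. \<Sum>m\<le>n. lterm (\<kappa> s) x n m)" for s
    unfolding \<kappa>_def by (intro F_SU_expansion a b S S2)
  define K where "K = skew_kernel
     (double_airy_integral 1 1 (\<lambda>z w. (z - w) / (4 * z * w * (z + w))))
     (double_airy_integral 1 1 (\<lambda>z w. (z - w) / (4 * z * (z + w))))
     (double_airy_integral 1 1 (\<lambda>z w. (z - w) / (4 * (z + w))))"
  \<comment> \<open>The binomial weights leave \<open>(1 / 2) ^ n / fact n\<close>, the same power
    of 1 / 2 that the halved rows produce in the GSE term.\<close>
  have t: "(\<Sum>m\<le>n. lterm (KK 0 E0) x n m) = cterm n x (blk K)" for n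
  proof -
    have "(\<Sum>m\<le>n. lterm (KK 0 E0) x n m) = (\<Sum>m\<le>n. (- (1 / 2)) ^ m / (fact m * fact (n - m))) * ((- 1) ^ n * integral_over_cube n x (\<lambda>xs. pf n (blk (KK 0 E0) xs)))"
      unfolding sum_distrib_right by (rule sum.cong) (auto simp: lterm_0)
    also have "\<dots> = cterm n x (blk K)"
      unfolding sum_inverse_fact cterm_GSE[OF K_def] by simp
    finally show ?thesis .
  qed
  have "F_GSE x = (\<Sum>n. cterm n x (blk K))"
    unfolding F_GSE_def K_def[symmetric] by (rule fredholm_pf_eq) (use T(1) in \<open>simp only: t\<close>)
  then show "(\<lambda>n. F_SU (az (S n)) (aw (S n)) (bz (S n)) (bw (S n)) (S n) x) \<longlonglongrightarrow> F_GSE x"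
    using T(2) unfolding F t by simp
qed simp

theorem proposition6p12:
  fixes az aw bz bw :: "real \<Rightarrow> real" and x :: real
  assumes "\<And>\<eta>. \<eta> > 0 \<Longrightarrow> az \<eta> > - \<eta>"
    and "\<And>\<eta>. \<eta> > 0 \<Longrightarrow> az \<eta> + aw \<eta> > 0"
    and "\<And>\<eta>. \<eta> > 0 \<Longrightarrow> bz \<eta> > \<eta>"
    and "\<And>\<eta>. \<eta> > 0 \<Longrightarrow> bw \<eta> > \<eta>"
  shows "((\<lambda>\<eta>. F_SU (az \<eta>) (aw \<eta>) (bz \<eta>) (bw \<eta>) \<eta> x) \<longlongrightarrow> F_GSE x) (at_right 0)
       \<and> ((\<lambda>\<eta>. F_SU (az \<eta>) (aw \<eta>) (bz \<eta>) (bw \<eta>) \<eta> x) \<longlongrightarrow> F_GUE x) at_top"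
  using F_SU_at_right_0[OF assms] F_SU_at_top[OF assms] by blast

end
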